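(* Let $\mathbb{G}$ be a locally compact quantum group. Consider the Hopf $*$-algebras $\mathcal{AP}(C_0(\mathbb{G}))\subseteq M(C_0(\mathbb{G}))$ and $\mathcal{AP}(C_0^u(\mathbb{G}))\subseteq M(C_0^u(\mathbb{G}))$. Then the strict extension of the reducing morphism $\Lambda:C_0^u(\mathbb{G})\to C_0(\mathbb{G})$ restricts to a bijection $\mathcal{AP}(C_0^u(\mathbb{G}))\to\mathcal{AP}(C_0(\mathbb{G}))$. In particular, $C(\mathbb{G}^{\mathrm{SAP}})$ is also the reduced version of the compact quantum group $\mathbb{AP}(C_0(\mathbb{G}))$.
   Context: Locally compact quantum groups are in the sense of Kustermans and Vaes. $C_0(\mathbb{G})$ and $C_0^u(\mathbb{G})$ are the reduced and universal (Kustermans) C$^*$-bialgebras of $\mathbb{G}$, and $\Lambda:C_0^u(\mathbb{G})\to C_0(\mathbb{G})$ is the canonical surjective $*$-homomorphism intertwining the coproducts (the reducing morphism). For a C$^*$-bialgebra $(A,\Delta)$ (a C$^*$-algebra with coassociative non-degenerate $*$-homomorphism $\Delta:A\to M(A\otimes A)$), a (finite-dimensional) invertible corepresentation is an invertible $T=(T_{ij})\in\mathbb{M}_n(M(A))$ with $\Delta(T_{ij})=\sum_k T_{ik}\otimes T_{kj}$. It is admissible if moreover $T^\top=(T_{ji})$ is invertible. The matrix elements of $T$ are the elements of the linear span of the $T_{ij}$. $\mathcal{AP}(A)\subseteq M(A)$ is the set of all matrix elements of admissible corepresentations of $A$, a unital $*$-subalgebra, and $\mathbb{AP}(A)$ is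 its norm closure. With the restriction of $\Delta$, $\mathbb{AP}(A)$ is a C$^*$-algebraic compact quantum group (Woronowicz, Sołtan) whose unique dense Hopf $*$-algebra is $\mathcal{AP}(A)$. The reduced version of a compact quantum group with dense Hopf $*$-algebra $\mathcal{A}$ is the completion of $\mathcal{A}$ acting on the GNS space of its Haar state. $\mathbb{G}^{\mathrm{SAP}}$ is the compact quantum group determined by $\mathbb{AP}(C_0^u(\mathbb{G}))$, so that $C(\mathbb{G}^{\mathrm{SAP}})$ is by definition the reduced version of $\mathbb{AP}(C_0^u(\mathbb{G}))$. *)

theory Defs
  imports "HOL-Analysis.Analysis"
begin

class complex_vector = real_vector +
  fixes scaleC :: "complex \<Rightarrow> 'a \<Rightarrow> 'a"  (infixr "*\<^sub>C" 75)
  assumes scaleC_add_right: "a *\<^sub>C (x + y) = a *\<^sub>C x + a *\<^sub>C y"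
    and scaleC_add_left: "(a + b) *\<^sub>C x = a *\<^sub>C x + b *\<^sub>C x"
    and scaleC_scaleC: "a *\<^sub>C (b *\<^sub>C x) = (a * b) *\<^sub>C x"
    and scaleC_one: "1 *\<^sub>C x = x"
    and scaleR_scaleC: "r *\<^sub>R x = complex_of_real r *\<^sub>C x"

definition complex_span :: "'a::complex_vector set \<Rightarrow> 'a set" where
  "complex_span S = {\<Sum>x\<in>F. c x *\<^sub>C x | F c. finite F \<and> F \<subseteq> S}"

typedef 'i ell2 = "{f :: 'i \<Rightarrow> complex. (\<lambda>i. (cmod (f i))\<^sup>2) summable_on UNIV}"
  morphisms coord Abs_ell2
  by (rule exI[of _ "\<lambda>_. 0"]) auto

setup_lifting type_definition_ell2

lemma square_summable_add:
  fixes f g :: "'i \<Rightarrow> complex"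
  assumes "(\<lambda>i. (cmod (f i))\<^sup>2) summable_on UNIV" "(\<lambda>i. (cmod (g i))\<^sup>2) summable_on UNIV"
  shows "(\<lambda>i. (cmod (f i + g i))\<^sup>2) summable_on UNIV"
proof (rule summable_on_comparison_test)
  show "(\<lambda>i. 2 * (cmod (f i))\<^sup>2 + 2 * (cmod (g i))\<^sup>2) summable_on UNIV"
    using assms by (intro summable_on_add summable_on_cmult_right)
  fix i
  have "(cmod (f i + g i))\<^sup>2 \<le> (cmod (f i) + cmod (g i))\<^sup>2"
    by (simp add: norm_triangle_ineq power_mono)
  also have "\<dots> \<le> 2 * (cmod (f i))\<^sup>2 + 2 * (cmod (g i))\<^sup>2"
    using zero_le_power2[of "cmod (f i) - cmod (g i)"] by (simp add: power2_eq_square algebra_simps)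
  finally show "(cmod (f i + g i))\<^sup>2 \<le> 2 * (cmod (f i))\<^sup>2 + 2 * (cmod (g i))\<^sup>2" .
qed auto

lemma square_summable_scale:
  fixes f :: "'i \<Rightarrow> complex"
  assumes "(\<lambda>i. (cmod (f i))\<^sup>2) summable_on UNIV"
  shows "(\<lambda>i. (cmod (c * f i))\<^sup>2) summable_on UNIV"
  using summable_on_cmult_right[OF assms, of "(cmod c)\<^sup>2"]
  by (simp add: norm_mult power_mult_distrib)

lemma square_summable_inner:
  fixes f g :: "'i \<Rightarrow> complex"
  assumes "(\<lambda>i. (cmod (f i))\<^sup>2) summable_on UNIV" "(\<lambda>i. (cmod (g i))\<^sup>2) summable_on UNIV"
  shows "(\<lambda>i. cnj (f i) * g i) summable_on UNIV"
proof (rule abs_summable_summable, rule summable_on_comparison_test)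
  show "(\<lambda>i. (cmod (f i))\<^sup>2 + (cmod (g i))\<^sup>2) summable_on UNIV"
    using assms by (intro summable_on_add)
  fix i
  have "0 \<le> (cmod (f i) - cmod (g i))\<^sup>2" "0 \<le> cmod (f i) * cmod (g i)" by simp_all
  moreover have "(cmod (f i) - cmod (g i))\<^sup>2 = (cmod (f i))\<^sup>2 + (cmod (g i))\<^sup>2 - 2 * (cmod (f i) * cmod (g i))"
    by (simp add: power2_diff)
  ultimately show "cmod (cnj (f i) * g i) \<le> (cmod (f i))\<^sup>2 + (cmod (g i))\<^sup>2"
    unfolding norm_mult complex_mod_cnj by linarith
qed auto

instantiation ell2 :: (type) complex_vector
begin
lift_definition zero_ell2 :: "'a ell2" is "\<lambda>_. 0" by simp
lift_definition plus_ell2 :: "'a ell2 \<Rightarrow> 'a ell2 \<Rightarrow> 'a ell2" is "\<lambda>f g i. f i + g i"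
  by (rule square_summable_add)
lift_definition uminus_ell2 :: "'a ell2 \<Rightarrow> 'a ell2" is "\<lambda>f i. - f i" by simp
lift_definition minus_ell2 :: "'a ell2 \<Rightarrow> 'a ell2 \<Rightarrow> 'a ell2" is "\<lambda>f g i. f i - g i"
  using square_summable_add[where g = "\<lambda>i. - g i" for g] by fastforce
lift_definition scaleC_ell2 :: "complex \<Rightarrow> 'a ell2 \<Rightarrow> 'a ell2" is "\<lambda>c f i. c * f i"
  by (rule square_summable_scale)
definition scaleR_ell2 :: "real \<Rightarrow> 'a ell2 \<Rightarrow> 'a ell2" where
  "scaleR_ell2 r x = scaleC (complex_of_real r) x"
instance
  by standard (unfold scaleR_ell2_def, (transfer, simp add: fun_eq_iff algebra_simps)+)
end

definition cinner :: "'i ell2 \<Rightarrow> 'i ell2 \<Rightarrow> complex" where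
  "cinner x y = (\<Sum>\<^sub>\<infinity>i. cnj (coord x i) * coord y i)"

lemma summable_cinner: "(\<lambda>i. cnj (coord x i) * coord y i) summable_on UNIV"
  using coord[of x] coord[of y] by (auto intro: square_summable_inner)

lemma cinner_self: "cinner x x = complex_of_real (\<Sum>\<^sub>\<infinity>i. (cmod (coord x i))\<^sup>2)"
proof -
  have "cinner x x = (\<Sum>\<^sub>\<infinity>i. complex_of_real ((cmod (coord x i))\<^sup>2))"
    unfolding cinner_def by (rule infsum_cong) (metis complex_norm_square mult.commute of_real_power)
  also have "\<dots> = complex_of_real (\<Sum>\<^sub>\<infinity>i. (cmod (coord x i))\<^sup>2)"
    using coord[of x] by (intro infsumI has_sum_of_real) auto
  finally show ?thesis .
qed

instantiation ell2 :: (type) real_inner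
begin
definition inner_ell2 :: "'a ell2 \<Rightarrow> 'a ell2 \<Rightarrow> real" where "inner_ell2 x y = Re (cinner x y)"
definition norm_ell2 :: "'a ell2 \<Rightarrow> real" where "norm_ell2 x = sqrt (inner x x)"
definition sgn_ell2 :: "'a ell2 \<Rightarrow> 'a ell2" where "sgn_ell2 x = inverse (norm x) *\<^sub>R x"
definition dist_ell2 :: "'a ell2 \<Rightarrow> 'a ell2 \<Rightarrow> real" where "dist_ell2 x y = norm (x - y)"
definition uniformity_ell2 :: "('a ell2 \<times> 'a ell2) filter" where
  "uniformity_ell2 = (INF e\<in>{0<..}. principal {(x, y). dist x y < e})"
definition open_ell2 :: "'a ell2 set \<Rightarrow> bool" where
  "open_ell2 U = (\<forall>x\<in>U. \<forall>\<^sub>F (x', y) in uniformity. x' = x \<longrightarrow> y \<in> U)"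
instance
proof
  fix x y z :: "'a ell2" and r :: real
  show "inner x y = inner y x"
  proof -
    have "cinner y x = cnj (cinner x y)"
      unfolding cinner_def infsum_cnj[symmetric] by (simp add: mult.commute)
    then show ?thesis by (simp add: inner_ell2_def)
  qed
  show "inner (x + y) z = inner x z + inner y z"
    unfolding inner_ell2_def cinner_def plus_complex.sel(1)[symmetric]
      infsum_add[OF summable_cinner summable_cinner, symmetric]
    by (simp add: plus_ell2.rep_eq algebra_simps)
  show "inner (r *\<^sub>R x) y = r * inner x y"
    unfolding inner_ell2_def cinner_def scaleR_ell2_def scaleC_ell2.rep_eq
    by (simp add: mult.assoc infsum_cmult_right')
  show "0 \<le> inner x x"
    by (simp add: inner_ell2_def cinner_self infsum_nonneg)
  show "inner x x = 0 \<longleftrightarrow> x = 0"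
  proof
    assume "inner x x = 0"
    then have *: "(\<Sum>\<^sub>\<infinity>i. (cmod (coord x i))\<^sup>2) = 0" by (simp add: inner_ell2_def cinner_self)
    have "(cmod (coord x i))\<^sup>2 = 0" for i
      by (rule nonneg_infsum_le_0D[of _ UNIV]) (use * coord[of x] in auto)
    then show "x = 0" by (simp add: coord_inject[symmetric] zero_ell2.rep_eq fun_eq_iff)
  qed (simp add: inner_ell2_def cinner_self zero_ell2.rep_eq)
qed (simp_all add: norm_ell2_def sgn_ell2_def dist_ell2_def uniformity_ell2_def open_ell2_def)
end

lemma norm_ell2_sq: "(norm x)\<^sup>2 = (\<Sum>\<^sub>\<infinity>i. (cmod (coord x i))\<^sup>2)"
  by (simp add: norm_ell2_def inner_ell2_def cinner_self infsum_nonneg)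

lemma sum_coord_le_norm: "finite F \<Longrightarrow> (\<Sum>i\<in>F. (cmod (coord x i))\<^sup>2) \<le> (norm x)\<^sup>2"
  unfolding norm_ell2_sq using coord[of x] by (intro finite_sum_le_infsum) auto

instance ell2 :: (type) banach
proof
  fix X :: "nat \<Rightarrow> 'a ell2" assume C: "Cauchy X"
  have coord_diff: "coord (x - y) i = coord x i - coord y i" for x y :: "'a ell2" and i
    by (simp add: minus_ell2.rep_eq)
  have coord_le: "cmod (coord x i) \<le> norm x" for x :: "'a ell2" and i
    by (rule power2_le_imp_le) (use sum_coord_le_norm[of "{i}" x] in auto)
  have "Cauchy (\<lambda>n. coord (X n) i)" for i
  proof (rule metric_CauchyI)
    fix e :: real assume "e > 0"
    then obtain M where "\<forall>m\<ge>M. \<forall>n\<ge>M. dist (X m) (X n) < e" using metric_CauchyD[OF C] by blast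
    moreover have "dist (coord (X m) i) (coord (X n) i) \<le> dist (X m) (X n)" for m n
      using coord_le[of "X m - X n" i] by (simp add: coord_diff dist_norm)
    ultimately show "\<exists>M. \<forall>m\<ge>M. \<forall>n\<ge>M. dist (coord (X m) i) (coord (X n) i) < e"
      by (meson le_less_trans)
  qed
  then have "\<forall>i. \<exists>l. (\<lambda>n. coord (X n) i) \<longlonglongrightarrow> l"
    by (simp add: Cauchy_convergent_iff convergent_def)
  from choice[OF this] obtain f where f: "(\<lambda>n. coord (X n) i) \<longlonglongrightarrow> f i" for i by blast
  have tail: "(\<Sum>i\<in>F. (cmod (coord (X n) i - f i))\<^sup>2) \<le> e\<^sup>2"
    if M: "\<forall>m\<ge>M. \<forall>n\<ge>M. dist (X m) (X n) < e" and "n \<ge> M" "finite F" for M n F e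
  proof (rule LIMSEQ_le_const2)
    show "(\<lambda>m. \<Sum>i\<in>F. (cmod (coord (X n) i - coord (X m) i))\<^sup>2) \<longlonglongrightarrow> (\<Sum>i\<in>F. (cmod (coord (X n) i - f i))\<^sup>2)"
      by (intro tendsto_intros f)
    have "(\<Sum>i\<in>F. (cmod (coord (X n) i - coord (X m) i))\<^sup>2) \<le> e\<^sup>2" if "m \<ge> M" for m
    proof -
      have "(\<Sum>i\<in>F. (cmod (coord (X n) i - coord (X m) i))\<^sup>2) \<le> (norm (X n - X m))\<^sup>2"
        using sum_coord_le_norm[OF \<open>finite F\<close>, of "X n - X m"] by (simp add: coord_diff)
      also have "\<dots> \<le> e\<^sup>2"
        using M \<open>n \<ge> M\<close> that by (intro power_mono) (auto simp: dist_norm intro: less_imp_le)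
      finally show ?thesis .
    qed
    then show "\<exists>N. \<forall>m\<ge>N. (\<Sum>i\<in>F. (cmod (coord (X n) i - coord (X m) i))\<^sup>2) \<le> e\<^sup>2" by blast
  qed
  have summ: "(\<lambda>i. (cmod (coord (X n) i - f i))\<^sup>2) summable_on UNIV"
    if M: "\<forall>m\<ge>M. \<forall>n\<ge>M. dist (X m) (X n) < e" and "n \<ge> M" for M n e
    by (rule nonneg_bdd_above_summable_on) (auto intro!: bdd_aboveI2[where M = "e\<^sup>2"] tail[OF that])
  obtain M1 where M1: "\<forall>m\<ge>M1. \<forall>n\<ge>M1. dist (X m) (X n) < 1" using metric_CauchyD[OF C, of 1] by auto
  have "(\<lambda>i. (cmod (coord (X M1) i + - (coord (X M1) i - f i)))\<^sup>2) summable_on UNIV"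
    using coord[of "X M1"] summ[OF M1 order_refl]
    by (intro square_summable_add) (simp_all only: norm_minus_cancel mem_Collect_eq)
  then have fs: "(\<lambda>i. (cmod (f i))\<^sup>2) summable_on UNIV" by simp
  define L where "L = Abs_ell2 f"
  have L: "coord L = f" by (simp add: L_def Abs_ell2_inverse fs)
  have "X \<longlonglongrightarrow> L"
  proof (rule metric_LIMSEQ_I)
    fix r :: real assume "r > 0"
    then obtain M where M: "\<forall>m\<ge>M. \<forall>n\<ge>M. dist (X m) (X n) < r/2" using metric_CauchyD[OF C, of "r/2"] by auto
    have "dist (X n) L < r" if "n \<ge> M" for n
    proof -
      have "(norm (X n - L))\<^sup>2 \<le> (r/2)\<^sup>2"
        unfolding norm_ell2_sq coord_diff L
        by (rule infsum_le_finite_sums[OF summ[OF M that]]) (use tail[OF M that] in auto)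
      then have "norm (X n - L) \<le> r/2" by (rule power2_le_imp_le) (use \<open>r > 0\<close> in simp)
      then show ?thesis using \<open>r > 0\<close> by (simp add: dist_norm)
    qed
    then show "\<exists>no. \<forall>n\<ge>no. dist (X n) L < r" by blast
  qed
  then show "convergent X" by (auto simp: convergent_def)
qed

lift_definition tensor_vec :: "'i ell2 \<Rightarrow> 'j ell2 \<Rightarrow> ('i \<times> 'j) ell2"  (infixr "\<otimes>\<^sub>v" 71)
  is "\<lambda>f g (i, j). f i * g j"
proof -
  fix f :: "'i \<Rightarrow> complex" and g :: "'j \<Rightarrow> complex"
  assume f: "(\<lambda>i. (cmod (f i))\<^sup>2) summable_on UNIV" and g: "(\<lambda>j. (cmod (g j))\<^sup>2) summable_on UNIV"
  have "(\<lambda>p. (cmod (f (fst p)))\<^sup>2 * (cmod (g (snd p)))\<^sup>2) summable_on UNIV \<times> UNIV"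
  proof (rule summable_on_SigmaI)
    show "((\<lambda>j. (cmod (f (fst (i, j))))\<^sup>2 * (cmod (g (snd (i, j))))\<^sup>2) has_sum
        (cmod (f i))\<^sup>2 * (\<Sum>\<^sub>\<infinity>j. (cmod (g j))\<^sup>2)) UNIV" for i
      using g by (auto intro: has_sum_cmult_right)
    show "(\<lambda>i. (cmod (f i))\<^sup>2 * (\<Sum>\<^sub>\<infinity>j. (cmod (g j))\<^sup>2)) summable_on UNIV"
      using f by (rule summable_on_cmult_left)
  qed auto
  then show "(\<lambda>p. (cmod (case p of (i, j) \<Rightarrow> f i * g j))\<^sup>2) summable_on UNIV"
    by (simp add: case_prod_beta norm_mult power_mult_distrib)
qed

lift_definition relabel :: "('k \<Rightarrow> 'i) \<Rightarrow> 'i ell2 \<Rightarrow> 'k ell2"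
  is "\<lambda>s f k. if inj s then f (s k) else 0"
proof -
  fix s :: "'k \<Rightarrow> 'i" and f :: "'i \<Rightarrow> complex"
  assume f: "(\<lambda>i. (cmod (f i))\<^sup>2) summable_on UNIV"
  show "(\<lambda>k. (cmod (if inj s then f (s k) else 0))\<^sup>2) summable_on UNIV"
  proof (cases "inj s")
    case True
    then show ?thesis
      using summable_on_reindex[of s UNIV "\<lambda>i. (cmod (f i))\<^sup>2"] summable_on_subset[OF f, of "range s"] 
      by (simp add: o_def)
  qed simp
qed

lemma scaleC_zero_right [simp]: "c *\<^sub>C (0 :: 'a :: complex_vector) = 0"
  using scaleC_add_right[of c 0 "0 :: 'a"] by simp

lemma scaleC_minus_right: "c *\<^sub>C (- x) = - (c *\<^sub>C (x :: 'a :: complex_vector))"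
  using scaleC_add_right[of c x "- x"] by (simp add: eq_neg_iff_add_eq_0 add.commute)

lemma scaleC_diff_right: "c *\<^sub>C (x - y) = c *\<^sub>C x - c *\<^sub>C (y :: 'a :: complex_vector)"
  using scaleC_add_right[of c "x - y" y] by simp

lemma norm_scaleC_ell2: "norm (c *\<^sub>C (x :: 'i ell2)) = cmod c * norm x"
proof -
  have "(norm (c *\<^sub>C x))\<^sup>2 = (cmod c * norm x)\<^sup>2"
    by (simp add: norm_ell2_sq power_mult_distrib scaleC_ell2.rep_eq norm_mult infsum_cmult_right')
  then show ?thesis by (simp add: power2_eq_iff_nonneg)
qed

lemma bounded_linear_scaleC_ell2: "bounded_linear (\<lambda>x :: 'i ell2. c *\<^sub>C x)"
  by (rule bounded_linear_intro[where K = "cmod c"])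
    (simp_all add: scaleC_add_right norm_scaleC_ell2 scaleR_scaleC scaleC_scaleC mult.commute)

typedef 'i op = "{T :: 'i ell2 \<Rightarrow>\<^sub>L 'i ell2. \<forall>c x. blinfun_apply T (c *\<^sub>C x) = c *\<^sub>C blinfun_apply T x}"
  morphisms blinfun_of_op Abs_op
  by (rule exI[of _ 0]) simp

setup_lifting type_definition_op

instantiation op :: (type) complex_vector
begin
lift_definition zero_op :: "'a op" is 0 by simp
lift_definition plus_op :: "'a op \<Rightarrow> 'a op \<Rightarrow> 'a op" is "(+)"
  by (simp add: blinfun.add_left scaleC_add_right)
lift_definition uminus_op :: "'a op \<Rightarrow> 'a op" is uminus
  by (simp add: blinfun.minus_left scaleC_minus_right)
lift_definition minus_op :: "'a op \<Rightarrow> 'a op \<Rightarrow> 'a op" is "(-)"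
  by (simp add: blinfun.diff_left scaleC_diff_right)
lift_definition scaleC_op :: "complex \<Rightarrow> 'a op \<Rightarrow> 'a op"
  is "\<lambda>c T. Blinfun (\<lambda>x. c *\<^sub>C x) o\<^sub>L T"
  by (simp add: bounded_linear_Blinfun_apply bounded_linear_scaleC_ell2 scaleC_scaleC mult.commute)
definition scaleR_op :: "real \<Rightarrow> 'a op \<Rightarrow> 'a op" where
  "scaleR_op r T = scaleC (complex_of_real r) T"
instance
proof
  fix a b :: complex and x y :: "'a op"
  show "a *\<^sub>C (x + y) = a *\<^sub>C x + a *\<^sub>C y"
    by transfer (intro blinfun_eqI, simp add: blinfun.add_left blinfun.add_right)
  show "(a + b) *\<^sub>C x = a *\<^sub>C x + b *\<^sub>C x"
    by transfer (intro blinfun_eqI, simp add: blinfun.add_left bounded_linear_Blinfun_apply bounded_linear_scaleC_ell2 scaleC_add_left)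
  show "a *\<^sub>C b *\<^sub>C x = (a * b) *\<^sub>C x"
    by transfer (intro blinfun_eqI, simp add: bounded_linear_Blinfun_apply bounded_linear_scaleC_ell2 scaleC_scaleC)
  show one: "1 *\<^sub>C x = x" for x :: "'a op"
    by transfer (intro blinfun_eqI, simp add: bounded_linear_Blinfun_apply bounded_linear_scaleC_ell2 scaleC_one)
  fix r s :: real
  show "r *\<^sub>R (x + y) = r *\<^sub>R x + r *\<^sub>R y" unfolding scaleR_op_def
    by transfer (intro blinfun_eqI, simp add: blinfun.add_left blinfun.add_right)
  show "(r + s) *\<^sub>R x = r *\<^sub>R x + s *\<^sub>R x" unfolding scaleR_op_def
    by transfer (intro blinfun_eqI, simp add: blinfun.add_left bounded_linear_Blinfun_apply bounded_linear_scaleC_ell2 scaleC_add_left)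
  show "r *\<^sub>R s *\<^sub>R x = (r * s) *\<^sub>R x" unfolding scaleR_op_def
    by transfer (intro blinfun_eqI, simp add: bounded_linear_Blinfun_apply bounded_linear_scaleC_ell2 scaleC_scaleC)
  show "1 *\<^sub>R x = x" unfolding scaleR_op_def by (simp add: one)
  show "r *\<^sub>R x = complex_of_real r *\<^sub>C x" by (rule scaleR_op_def)
qed (transfer, simp)+
end

lemma blinfun_of_op_scaleR: "blinfun_of_op (r *\<^sub>R T) = r *\<^sub>R blinfun_of_op T"
  by (intro blinfun_eqI)
    (simp add: scaleR_op_def scaleC_op.rep_eq bounded_linear_Blinfun_apply bounded_linear_scaleC_ell2
      blinfun.scaleR_left scaleR_scaleC)

lemma norm_id_blinfun_ell2: "norm (id_blinfun :: 'i ell2 \<Rightarrow>\<^sub>L 'i ell2) = 1"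
proof (rule antisym[OF norm_blinfun_id_le])
  obtain k :: 'i where True by simp
  have fin: "(\<lambda>i. (cmod (if i = k then 1 else (0 :: complex)))\<^sup>2) summable_on UNIV"
    by (rule finite_nonzero_values_imp_summable_on, rule finite_subset[of _ "{k}"]) auto
  define e where "e = Abs_ell2 (\<lambda>i. if i = k then 1 else 0)"
  have "coord e k = 1"
    using fin by (simp add: e_def Abs_ell2_inverse)
  then have "e \<noteq> 0" by (auto simp: zero_ell2.rep_eq)
  then show "1 \<le> norm (id_blinfun :: 'i ell2 \<Rightarrow>\<^sub>L 'i ell2)"
    using norm_blinfun[of id_blinfun e] by simp
qed

instantiation op :: (type) real_normed_algebra_1
begin
lift_definition one_op :: "'a op" is id_blinfun by simp
lift_definition times_op :: "'a op \<Rightarrow> 'a op \<Rightarrow> 'a op" is "(o\<^sub>L)" by simp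
lift_definition norm_op :: "'a op \<Rightarrow> real" is norm .
definition sgn_op :: "'a op \<Rightarrow> 'a op" where "sgn_op T = inverse (norm T) *\<^sub>R T"
definition dist_op :: "'a op \<Rightarrow> 'a op \<Rightarrow> real" where "dist_op S T = norm (S - T)"
definition uniformity_op :: "('a op \<times> 'a op) filter" where
  "uniformity_op = (INF e\<in>{0<..}. principal {(S, T). dist S T < e})"
definition open_op :: "'a op set \<Rightarrow> bool" where
  "open_op U = (\<forall>S\<in>U. \<forall>\<^sub>F (S', T) in uniformity. S' = S \<longrightarrow> T \<in> U)"
instance
proof
  fix x y z :: "'a op" and r :: real
  show "x * y * z = x * (y * z)" by transfer (intro blinfun_eqI, simp)
  show "(x + y) * z = x * z + y * z" by transfer (intro blinfun_eqI, simp add: blinfun.add_left)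
  show "x * (y + z) = x * y + x * z" by transfer (intro blinfun_eqI, simp add: blinfun.add_left blinfun.add_right)
  show "1 * x = x" "x * 1 = x" by (transfer, intro blinfun_eqI, simp)+
  show "r *\<^sub>R x * y = r *\<^sub>R (x * y)" "x * r *\<^sub>R y = r *\<^sub>R (x * y)"
    unfolding blinfun_of_op_inject[symmetric] blinfun_of_op_scaleR times_op.rep_eq
    by (intro blinfun_eqI, simp add: blinfun.scaleR_left blinfun.scaleR_right)+
  show "norm (r *\<^sub>R x) = \<bar>r\<bar> * norm x" by (simp add: norm_op.rep_eq blinfun_of_op_scaleR)
  show "norm x = 0 \<longleftrightarrow> x = 0" by transfer simp
  show "norm (x + y) \<le> norm x + norm y" by transfer (rule norm_triangle_ineq)
  show "norm (x * y) \<le> norm x * norm y" by transfer (rule norm_blinfun_compose)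
  show "norm (1 :: 'a op) = 1" by transfer (rule norm_id_blinfun_ell2)
  show "(0 :: 'a op) \<noteq> 1"
  proof
    assume "(0 :: 'a op) = 1"
    then have "norm (0 :: 'a ell2 \<Rightarrow>\<^sub>L 'a ell2) = norm (id_blinfun :: 'a ell2 \<Rightarrow>\<^sub>L 'a ell2)"
      by (metis one_op.rep_eq zero_op.rep_eq)
    then show False by (simp add: norm_id_blinfun_ell2)
  qed
  show "sgn x = inverse (norm x) *\<^sub>R x" "dist x y = norm (x - y)" by (rule sgn_op_def dist_op_def)+
  show "(uniformity :: ('a op \<times> 'a op) filter) = (INF e\<in>{0<..}. principal {(S, T). dist S T < e})"
    by (rule uniformity_op_def)
  show "open U \<longleftrightarrow> (\<forall>S\<in>U. \<forall>\<^sub>F (S', T) in uniformity. S' = S \<longrightarrow> T \<in> U)" for U :: "'a op set"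
    by (rule open_op_def)
qed
end

section \<open>Operators on a Hilbert space and its tensor powers\<close>

definition op_apply :: "'i op \<Rightarrow> 'i ell2 \<Rightarrow> 'i ell2"  (infixr "\<cdot>" 72) where
  "T \<cdot> x = blinfun_apply (blinfun_of_op T) x"

definition adj :: "'i op \<Rightarrow> 'i op" where
  "adj T = (THE S. \<forall>x y. cinner (S \<cdot> x) y = cinner x (T \<cdot> y))"

definition unitary_op :: "'i op \<Rightarrow> bool" where
  "unitary_op U \<longleftrightarrow> adj U * U = 1 \<and> U * adj U = 1"

definition positive_op :: "'i op \<Rightarrow> bool" where
  "positive_op T \<longleftrightarrow> (\<forall>x. Im (cinner x (T \<cdot> x)) = 0 \<and> 0 \<le> Re (cinner x (T \<cdot> x)))"

definition op_le :: "'i op \<Rightarrow> 'i op \<Rightarrow> bool" where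
  "op_le S T \<longleftrightarrow> positive_op (T - S)"

definition tensor_op :: "'i op \<Rightarrow> 'j op \<Rightarrow> ('i \<times> 'j) op"  (infixr "\<otimes>\<^sub>o" 71) where
  "S \<otimes>\<^sub>o T = (THE R. \<forall>x y. R \<cdot> (x \<otimes>\<^sub>v y) = (S \<cdot> x) \<otimes>\<^sub>v (T \<cdot> y))"

text \<open>Conjugation by the unitary \<^term>\<open>relabel s\<close>; used for bijections \<open>s\<close> only.\<close>
definition relabel_op :: "('k \<Rightarrow> 'i) \<Rightarrow> 'i op \<Rightarrow> 'k op" where
  "relabel_op s T = (THE S. \<forall>x. S \<cdot> relabel s x = relabel s (T \<cdot> x))"

definition flip_op :: "('i \<times> 'j) op \<Rightarrow> ('j \<times> 'i) op" where
  "flip_op = relabel_op prod.swap"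

definition assoc_op :: "(('i \<times> 'j) \<times> 'k) op \<Rightarrow> ('i \<times> 'j \<times> 'k) op" where
  "assoc_op = relabel_op (\<lambda>(i, j, k). ((i, j), k))"

text \<open>Leg numbering: \<open>V\<^sub>1\<^sub>2 = V \<otimes> 1\<close>, and \<open>V\<^sub>1\<^sub>3\<close> is obtained from it by flipping the last two legs.\<close>
definition leg12 :: "('i \<times> 'j) op \<Rightarrow> ('i \<times> 'j \<times> 'k) op" where
  "leg12 V = assoc_op (V \<otimes>\<^sub>o 1)"

definition leg13 :: "('i \<times> 'k) op \<Rightarrow> ('i \<times> 'j \<times> 'k) op" where
  "leg13 V = relabel_op (\<lambda>(i, j, k). (i, k, j)) (leg12 V)"


section \<open>Normal functionals and slice maps\<close>

definition normal_functional :: "('i op \<Rightarrow> complex) \<Rightarrow> bool" where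
  "normal_functional \<omega> \<longleftrightarrow> (\<exists>\<xi> \<eta>.
     summable (\<lambda>n::nat. (norm (\<xi> n))\<^sup>2) \<and> summable (\<lambda>n. (norm (\<eta> n))\<^sup>2) \<and>
     (\<forall>T. \<omega> T = (\<Sum>n. cinner (\<eta> n) (T \<cdot> \<xi> n))))"

text \<open>
  Normal functionals on \<open>M\<close>, as functions on all operators that vanish off \<open>M\<close>, so that equality of
  functionals on \<open>M\<close> is equality in HOL.
\<close>
definition predual :: "'i op set \<Rightarrow> ('i op \<Rightarrow> complex) set" where
  "predual M = {\<lambda>x. if x \<in> M then \<rho> x else 0 | \<rho>. normal_functional \<rho>}"

text \<open>The operator \<open>(\<iota> \<otimes> \<omega>)(T)\<close> for the vector functional \<open>\<omega> = \<langle>\<theta>, \<cdot> \<zeta>\<rangle>\<close>, and its mirror image.\<close>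
definition vec_slice_right :: "'j ell2 \<Rightarrow> 'j ell2 \<Rightarrow> ('i \<times> 'j) op \<Rightarrow> 'i op" where
  "vec_slice_right \<theta> \<zeta> T = (THE Q. \<forall>a b. cinner b (Q \<cdot> a) = cinner (b \<otimes>\<^sub>v \<theta>) (T \<cdot> (a \<otimes>\<^sub>v \<zeta>)))"

definition vec_slice_left :: "'i ell2 \<Rightarrow> 'i ell2 \<Rightarrow> ('i \<times> 'j) op \<Rightarrow> 'j op" where
  "vec_slice_left \<theta> \<zeta> T = (THE Q. \<forall>a b. cinner b (Q \<cdot> a) = cinner (\<theta> \<otimes>\<^sub>v b) (T \<cdot> (\<zeta> \<otimes>\<^sub>v a)))"

text \<open>
  \<open>slice_left \<omega> T = (\<omega> \<otimes> \<iota>)(T)\<close> and \<open>slice_right \<omega> T = (\<iota> \<otimes> \<omega>)(T)\<close>. When \<open>\<omega>\<close> is only given on a von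
  Neumann algebra \<open>M\<close>, these are used for \<open>T\<close> whose sliced leg lies in \<open>M\<close>.
\<close>
definition slice_left :: "('i op \<Rightarrow> complex) \<Rightarrow> ('i \<times> 'j) op \<Rightarrow> 'j op" where
  "slice_left \<omega> T = (THE R. \<forall>\<theta> \<zeta>. cinner \<theta> (R \<cdot> \<zeta>) = \<omega> (vec_slice_right \<theta> \<zeta> T))"

definition slice_right :: "('j op \<Rightarrow> complex) \<Rightarrow> ('i \<times> 'j) op \<Rightarrow> 'i op" where
  "slice_right \<omega> T = (THE R. \<forall>\<theta> \<zeta>. cinner \<theta> (R \<cdot> \<zeta>) = \<omega> (vec_slice_left \<theta> \<zeta> T))"

definition sigma_weak_closure :: "'i op set \<Rightarrow> 'i op set" where
  "sigma_weak_closure S = {x. \<forall>\<Omega> e. finite \<Omega> \<and> (\<forall>\<omega>\<in>\<Omega>. normal_functional \<omega>) \<and> e > 0 \<longrightarrow>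
     (\<exists>s\<in>S. \<forall>\<omega>\<in>\<Omega>. cmod (\<omega> x - \<omega> s) < e)}"


section \<open>C*-algebras and von Neumann algebras of operators\<close>

definition star_subalgebra :: "'i op set \<Rightarrow> bool" where
  "star_subalgebra A \<longleftrightarrow> 0 \<in> A \<and> (\<forall>a\<in>A. \<forall>b\<in>A. a + b \<in> A \<and> a * b \<in> A) \<and>
     (\<forall>a\<in>A. adj a \<in> A \<and> (\<forall>c. c *\<^sub>C a \<in> A))"

definition star_hom :: "'i op set \<Rightarrow> ('i op \<Rightarrow> 'j op) \<Rightarrow> bool" where
  "star_hom A f \<longleftrightarrow>
     (\<forall>a\<in>A. \<forall>b\<in>A. f (a + b) = f a + f b \<and> f (a * b) = f a * f b) \<and>
     (\<forall>a\<in>A. f (adj a) = adj (f a) \<and> (\<forall>c. f (c *\<^sub>C a) = c *\<^sub>C f a))"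

text \<open>Concrete C*-algebras, acting non-degenerately.\<close>
definition cstar_algebra :: "'i op set \<Rightarrow> bool" where
  "cstar_algebra A \<longleftrightarrow> star_subalgebra A \<and> closed A \<and>
     closure (complex_span {a \<cdot> x | a x. a \<in> A}) = UNIV"

text \<open>For \<open>A\<close> acting non-degenerately, the multiplier algebra is the idealizer of \<open>A\<close>.\<close>
definition multipliers :: "'i op set \<Rightarrow> 'i op set" where
  "multipliers A = {m. \<forall>a\<in>A. m * a \<in> A \<and> a * m \<in> A}"

text \<open>The minimal (spatial) tensor product.\<close>
definition cstar_tensor :: "'i op set \<Rightarrow> 'j op set \<Rightarrow> ('i \<times> 'j) op set"  (infixr "\<otimes>\<^sub>m" 71) where
  "A \<otimes>\<^sub>m B = closure (complex_span {a \<otimes>\<^sub>o b | a b. a \<in> A \<and> b \<in> B})"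

definition nondegenerate_hom :: "'i op set \<Rightarrow> 'j op set \<Rightarrow> ('i op \<Rightarrow> 'j op) \<Rightarrow> bool" where
  "nondegenerate_hom A B f \<longleftrightarrow> star_hom A f \<and> f ` A \<subseteq> multipliers B \<and>
     closure (complex_span {f a * b | a b. a \<in> A \<and> b \<in> B}) = B"

text \<open>The strict extension \<open>M(A) \<rightarrow> M(B)\<close> of a non-degenerate homomorphism \<open>f : A \<rightarrow> M(B)\<close>.\<close>
definition strict_ext :: "'i op set \<Rightarrow> 'j op set \<Rightarrow> ('i op \<Rightarrow> 'j op) \<Rightarrow> 'i op \<Rightarrow> 'j op" where
  "strict_ext A B f m = (THE y. y \<in> multipliers B \<and> (\<forall>a\<in>A. y * f a = f (m * a)))"

definition cstar_tensor_hom ::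
    "'i op set \<Rightarrow> 'j op set \<Rightarrow> ('i op \<Rightarrow> 'k op) \<Rightarrow> ('j op \<Rightarrow> 'l op) \<Rightarrow> ('i \<times> 'j) op \<Rightarrow> ('k \<times> 'l) op" where
  "cstar_tensor_hom A B f g = (THE F. star_hom (A \<otimes>\<^sub>m B) F \<and> (\<forall>x. x \<notin> A \<otimes>\<^sub>m B \<longrightarrow> F x = 0) \<and>
     (\<forall>a\<in>A. \<forall>b\<in>B. F (a \<otimes>\<^sub>o b) = f a \<otimes>\<^sub>o g b))"

definition commutant :: "'i op set \<Rightarrow> 'i op set" where
  "commutant S = {T. \<forall>s\<in>S. T * s = s * T}"

definition von_neumann_algebra :: "'i op set \<Rightarrow> bool" where
  "von_neumann_algebra M \<longleftrightarrow> adj ` M \<subseteq> M \<and> commutant (commutant M) = M"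

definition vn_tensor :: "'i op set \<Rightarrow> 'j op set \<Rightarrow> ('i \<times> 'j) op set"  (infixr "\<otimes>\<^sub>w" 71) where
  "M \<otimes>\<^sub>w N = commutant (commutant {a \<otimes>\<^sub>o b | a b. a \<in> M \<and> b \<in> N})"

definition normal_unital_hom :: "'i op set \<Rightarrow> 'j op set \<Rightarrow> ('i op \<Rightarrow> 'j op) \<Rightarrow> bool" where
  "normal_unital_hom M N f \<longleftrightarrow> star_hom M f \<and> f ` M \<subseteq> N \<and> f 1 = 1 \<and>
     (\<forall>\<omega>\<in>predual N. (\<lambda>x. if x \<in> M then \<omega> (f x) else 0) \<in> predual M)"

definition vn_tensor_hom ::
    "'i op set \<Rightarrow> 'j op set \<Rightarrow> 'k op set \<Rightarrow> 'l op set \<Rightarrow> ('i op \<Rightarrow> 'k op) \<Rightarrow> ('j op \<Rightarrow> 'l op)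
      \<Rightarrow> ('i \<times> 'j) op \<Rightarrow> ('k \<times> 'l) op" where
  "vn_tensor_hom M N M' N' f g =
     (THE F. normal_unital_hom (M \<otimes>\<^sub>w N) (M' \<otimes>\<^sub>w N') F \<and> (\<forall>x. x \<notin> M \<otimes>\<^sub>w N \<longrightarrow> F x = 0) \<and>
       (\<forall>a\<in>M. \<forall>b\<in>N. F (a \<otimes>\<^sub>o b) = f a \<otimes>\<^sub>o g b))"


section \<open>Weights\<close>

definition positive_part :: "'i op set \<Rightarrow> 'i op set" where
  "positive_part M = {x \<in> M. positive_op x}"

definition square_integrable :: "'i op set \<Rightarrow> ('i op \<Rightarrow> ennreal) \<Rightarrow> 'i op set" where
  "square_integrable M \<phi> = {x \<in> M. \<phi> (adj x * x) < \<infinity>}"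

text \<open>
  Normal semifinite faithful weights; only the values on the positive part of \<open>M\<close> matter. The third
  clause is normality (\<open>x\<close> is the supremum of the upward directed set \<open>D\<close>), the last one
  semifiniteness.
\<close>
definition nsf_weight :: "'i op set \<Rightarrow> ('i op \<Rightarrow> ennreal) \<Rightarrow> bool" where
  "nsf_weight M \<phi> \<longleftrightarrow>
     (\<forall>x\<in>positive_part M. \<forall>y\<in>positive_part M. \<phi> (x + y) = \<phi> x + \<phi> y) \<and>
     (\<forall>x\<in>positive_part M. \<forall>r\<ge>0. \<phi> (r *\<^sub>R x) = ennreal r * \<phi> x) \<and>
     (\<forall>D x. D \<subseteq> positive_part M \<and> D \<noteq> {} \<and> (\<forall>d\<in>D. \<forall>e\<in>D. \<exists>f\<in>D. op_le d f \<and> op_le e f) \<and>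
        x \<in> positive_part M \<and> (\<forall>d\<in>D. op_le d x) \<and>
        (\<forall>y\<in>positive_part M. (\<forall>d\<in>D. op_le d y) \<longrightarrow> op_le x y)
        \<longrightarrow> \<phi> x = (SUP d\<in>D. \<phi> d)) \<and>
     (\<forall>x\<in>positive_part M. \<phi> x = 0 \<longrightarrow> x = 0) \<and>
     M \<subseteq> sigma_weak_closure (square_integrable M \<phi>)"

text \<open>The GNS map of \<open>\<phi>\<close>, for \<open>M\<close> acting on the GNS space of \<open>\<phi>\<close> by the GNS representation.\<close>
definition gns_map :: "'i op set \<Rightarrow> ('i op \<Rightarrow> ennreal) \<Rightarrow> ('i op \<Rightarrow> 'i ell2) \<Rightarrow> bool" where
  "gns_map M \<phi> \<eta> \<longleftrightarrow>
     (\<forall>x\<in>square_integrable M \<phi>. \<forall>y\<in>square_integrable M \<phi>. \<eta> (x + y) = \<eta> x + \<eta> y) \<and>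
     (\<forall>x\<in>square_integrable M \<phi>. \<forall>c. \<eta> (c *\<^sub>C x) = c *\<^sub>C \<eta> x) \<and>
     (\<forall>x\<in>square_integrable M \<phi>. \<phi> (adj x * x) = ennreal ((norm (\<eta> x))\<^sup>2)) \<and>
     (\<forall>a\<in>M. \<forall>x\<in>square_integrable M \<phi>. a \<cdot> \<eta> x = \<eta> (a * x)) \<and>
     closure (\<eta> ` square_integrable M \<phi>) = UNIV"


section \<open>Locally compact quantum groups\<close>

definition positive_predual :: "'i op set \<Rightarrow> ('i op \<Rightarrow> complex) set" where
  "positive_predual M =
     {\<omega> \<in> predual M. \<forall>x\<in>positive_part M. Im (\<omega> x) = 0 \<and> 0 \<le> Re (\<omega> x)}"

definition left_invariant ::
    "'i op set \<Rightarrow> ('i op \<Rightarrow> ('i \<times> 'i) op) \<Rightarrow> ('i op \<Rightarrow> ennreal) \<Rightarrow> bool" where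
  "left_invariant M \<Delta> \<phi> \<longleftrightarrow> (\<forall>\<omega>\<in>positive_predual M. \<forall>x\<in>positive_part M. \<phi> x < \<infinity> \<longrightarrow>
     \<phi> (slice_left \<omega> (\<Delta> x)) = ennreal (Re (\<omega> 1)) * \<phi> x)"

definition right_invariant ::
    "'i op set \<Rightarrow> ('i op \<Rightarrow> ('i \<times> 'i) op) \<Rightarrow> ('i op \<Rightarrow> ennreal) \<Rightarrow> bool" where
  "right_invariant M \<Delta> \<psi> \<longleftrightarrow> (\<forall>\<omega>\<in>positive_predual M. \<forall>x\<in>positive_part M. \<psi> x < \<infinity> \<longrightarrow>
     \<psi> (slice_right \<omega> (\<Delta> x)) = ennreal (Re (\<omega> 1)) * \<psi> x)"

text \<open>
  The von Neumann algebraic picture of Kustermans and Vaes. The underlying von Neumann algebra acts on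
  the GNS space \<open>L\<^sup>2\<close> of the left Haar weight, which is identified with \<open>\<ell>\<^sup>2('i)\<close> by the choice of an
  orthonormal basis.
\<close>
record 'i lcqg =
  Linf :: "'i op set"
  comult :: "'i op \<Rightarrow> ('i \<times> 'i) op"
  haar :: "'i op \<Rightarrow> ennreal"
  gns :: "'i op \<Rightarrow> 'i ell2"

definition locally_compact_quantum_group :: "'i lcqg \<Rightarrow> bool" where
  "locally_compact_quantum_group G \<longleftrightarrow> (let M = Linf G; \<Delta> = comult G in
     von_neumann_algebra M \<and>
     normal_unital_hom M (M \<otimes>\<^sub>w M) \<Delta> \<and>
     (\<forall>x\<in>M. assoc_op (vn_tensor_hom M M (M \<otimes>\<^sub>w M) M \<Delta> (\<lambda>y. y) (\<Delta> x)) =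
            vn_tensor_hom M M M (M \<otimes>\<^sub>w M) (\<lambda>y. y) \<Delta> (\<Delta> x)) \<and>
     nsf_weight M (haar G) \<and> left_invariant M \<Delta> (haar G) \<and>
     gns_map M (haar G) (gns G) \<and>
     (\<exists>\<psi>. nsf_weight M \<psi> \<and> right_invariant M \<Delta> \<psi>))"

text \<open>
  The multiplicative unitary \<open>W\<close> of \<open>G\<close>, determined by
  \<open>(\<omega> \<otimes> \<iota>)(W\<^sup>*) \<eta>(b) = \<eta>((\<omega> \<otimes> \<iota>)\<Delta>(b))\<close>, where \<open>\<eta>\<close> is the GNS map of the left Haar weight.
\<close>
definition multiplicative_unitary :: "'i lcqg \<Rightarrow> ('i \<times> 'i) op \<Rightarrow> bool" where
  "multiplicative_unitary G W \<longleftrightarrow> unitary_op W \<and>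
     (\<forall>b\<in>square_integrable (Linf G) (haar G). \<forall>\<omega>. normal_functional \<omega> \<longrightarrow>
        slice_left \<omega> (comult G b) \<in> square_integrable (Linf G) (haar G) \<and>
        slice_left \<omega> (adj W) \<cdot> gns G b = gns G (slice_left \<omega> (comult G b)))"

text \<open>The reduced algebra \<open>C\<^sub>0(G)\<close>, with comultiplication the restriction of \<^term>\<open>comult G\<close>.\<close>
definition C0 :: "('i \<times> 'i) op \<Rightarrow> 'i op set" where
  "C0 W = closure {slice_right \<omega> W | \<omega>. normal_functional \<omega>}"


subsection \<open>The dual\<close>

definition dual_C0 :: "('i \<times> 'i) op \<Rightarrow> 'i op set" where
  "dual_C0 W = closure {slice_left \<omega> W | \<omega>. normal_functional \<omega>}"

definition dual_Linf :: "('i \<times> 'i) op \<Rightarrow> 'i op set" where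
  "dual_Linf W = sigma_weak_closure {slice_left \<omega> W | \<omega>. normal_functional \<omega>}"

definition dual_comult :: "('i \<times> 'i) op \<Rightarrow> 'i op \<Rightarrow> ('i \<times> 'i) op" where
  "dual_comult W x = flip_op (W * (x \<otimes>\<^sub>o 1) * adj W)"

definition dual_unitary :: "('i \<times> 'i) op \<Rightarrow> ('i \<times> 'i) op" where
  "dual_unitary W = flip_op (adj W)"

definition dual_L1 :: "('i \<times> 'i) op \<Rightarrow> ('i op \<Rightarrow> complex) set" where
  "dual_L1 W = predual (dual_Linf W)"

text \<open>The left regular representation of the dual, with values in \<open>C\<^sub>0(G)\<close>.\<close>
definition dual_lambda :: "('i \<times> 'i) op \<Rightarrow> ('i op \<Rightarrow> complex) \<Rightarrow> 'i op" where
  "dual_lambda W \<omega> = slice_left \<omega> (dual_unitary W)"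

text \<open>The convolution product \<open>(\<omega> \<otimes> \<theta>) \<circ> \<Delta>\<close> on \<open>L\<^sup>1\<close> of the dual.\<close>
definition dual_conv ::
    "('i \<times> 'i) op \<Rightarrow> ('i op \<Rightarrow> complex) \<Rightarrow> ('i op \<Rightarrow> complex) \<Rightarrow> 'i op \<Rightarrow> complex" where
  "dual_conv W \<omega> \<theta> = (\<lambda>x. if x \<in> dual_Linf W then \<omega> (slice_right \<theta> (dual_comult W x)) else 0)"

text \<open>
  \<open>dual_star W \<omega> \<theta>\<close> means that \<open>\<theta> = \<omega>\<^sup>*\<close>, that is, \<open>\<theta>(x)\<close> is the complex conjugate of \<open>\<omega>(S(x)\<^sup>*)\<close> for all
  \<open>x\<close> in the domain of the antipode \<open>S\<close> of the dual. As \<open>S\<close> is the closure of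
  \<open>(\<iota> \<otimes> \<rho>)(V) \<mapsto> (\<iota> \<otimes> \<rho>)(V\<^sup>*)\<close> for \<open>V = dual_unitary W\<close>, this unfolds to the equation below.
\<close>
definition dual_star ::
    "('i \<times> 'i) op \<Rightarrow> ('i op \<Rightarrow> complex) \<Rightarrow> ('i op \<Rightarrow> complex) \<Rightarrow> bool" where
  "dual_star W \<omega> \<theta> \<longleftrightarrow> \<omega> \<in> dual_L1 W \<and> \<theta> \<in> dual_L1 W \<and> dual_lambda W \<theta> = adj (dual_lambda W \<omega>)"

text \<open>The *-algebra \<open>L\<^sup>1\<^sub>*\<close> of the dual.\<close>
definition dual_L1_star :: "('i \<times> 'i) op \<Rightarrow> ('i op \<Rightarrow> complex) set" where
  "dual_L1_star W = {\<omega>. \<exists>\<theta>. dual_star W \<omega> \<theta>}"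

definition cstar_seminorm :: "('i \<times> 'i) op \<Rightarrow> (('i op \<Rightarrow> complex) \<Rightarrow> real) \<Rightarrow> bool" where
  "cstar_seminorm W p \<longleftrightarrow>
     (\<forall>\<omega>\<in>dual_L1_star W. 0 \<le> p \<omega> \<and> (\<forall>c. p (\<lambda>x. c * \<omega> x) = cmod c * p \<omega>)) \<and>
     (\<forall>\<omega>\<in>dual_L1_star W. \<forall>\<theta>\<in>dual_L1_star W.
        p (\<lambda>x. \<omega> x + \<theta> x) \<le> p \<omega> + p \<theta> \<and> p (dual_conv W \<omega> \<theta>) \<le> p \<omega> * p \<theta>) \<and>
     (\<forall>\<omega> \<theta>. dual_star W \<omega> \<theta> \<longrightarrow> p (dual_conv W \<theta> \<omega>) = (p \<omega>)\<^sup>2)"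


subsection \<open>The universal C*-bialgebra\<close>

text \<open>
  \<open>(A, l)\<close> is (a faithful non-degenerate representation of) the universal enveloping C*-algebra of
  \<open>L\<^sup>1\<^sub>*\<close> of the dual. Its norm is the supremum of \<open>\<parallel>\<pi>(\<omega>)\<parallel>\<close> over all *-representations \<open>\<pi>\<close>, i.e. the
  largest C*-seminorm. Stating it through seminorms avoids a quantification over all Hilbert spaces.
\<close>
definition universal_C0 ::
    "('i \<times> 'i) op \<Rightarrow> 'j op set \<Rightarrow> (('i op \<Rightarrow> complex) \<Rightarrow> 'j op) \<Rightarrow> bool" where
  "universal_C0 W A l \<longleftrightarrow> cstar_algebra A \<and>
     (\<forall>\<omega>\<in>dual_L1_star W. \<forall>c. l (\<lambda>x. c * \<omega> x) = c *\<^sub>C l \<omega>) \<and>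
     (\<forall>\<omega>\<in>dual_L1_star W. \<forall>\<theta>\<in>dual_L1_star W.
        l (\<lambda>x. \<omega> x + \<theta> x) = l \<omega> + l \<theta> \<and> l (dual_conv W \<omega> \<theta>) = l \<omega> * l \<theta>) \<and>
     (\<forall>\<omega> \<theta>. dual_star W \<omega> \<theta> \<longrightarrow> l \<theta> = adj (l \<omega>)) \<and>
     closure (l ` dual_L1_star W) = A \<and>
     (\<forall>p. cstar_seminorm W p \<longrightarrow> (\<forall>\<omega>\<in>dual_L1_star W. p \<omega> \<le> norm (l \<omega>)))"

text \<open>
  The comultiplication of the universal algebra is determined by \<open>(\<iota> \<otimes> \<Delta>)(V) = V\<^sub>1\<^sub>3 V\<^sub>1\<^sub>2\<close>, where the
  unitary \<open>V\<close> is the universal corepresentation: \<open>(\<omega> \<otimes> \<iota>)(V) = l(\<omega>)\<close>.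
\<close>
definition universal_comult ::
    "('i \<times> 'i) op \<Rightarrow> 'j op set \<Rightarrow> (('i op \<Rightarrow> complex) \<Rightarrow> 'j op) \<Rightarrow> ('j op \<Rightarrow> ('j \<times> 'j) op) \<Rightarrow> bool" where
  "universal_comult W A l \<Delta> \<longleftrightarrow> nondegenerate_hom A (A \<otimes>\<^sub>m A) \<Delta> \<and>
     (\<exists>V. unitary_op V \<and> V \<in> multipliers (dual_C0 W \<otimes>\<^sub>m A) \<and>
       (\<forall>\<omega>\<in>dual_L1_star W. slice_left \<omega> V = l \<omega> \<and> \<Delta> (l \<omega>) = slice_left \<omega> (leg13 V * leg12 V)))"

definition reducing_morphism ::
    "'i lcqg \<Rightarrow> ('i \<times> 'i) op \<Rightarrow> 'j op set \<Rightarrow> (('i op \<Rightarrow> complex) \<Rightarrow> 'j op) \<Rightarrow> ('j op \<Rightarrow> ('j \<times> 'j) op)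
      \<Rightarrow> ('j op \<Rightarrow> 'i op) \<Rightarrow> bool" where
  "reducing_morphism G W A l \<Delta> \<Lambda> \<longleftrightarrow>
     star_hom A \<Lambda> \<and> \<Lambda> ` A = C0 W \<and>
     (\<forall>\<omega>\<in>dual_L1_star W. \<Lambda> (l \<omega>) = dual_lambda W \<omega>) \<and>
     (\<forall>a\<in>A. comult G (\<Lambda> a) =
        strict_ext (A \<otimes>\<^sub>m A) (C0 W \<otimes>\<^sub>m C0 W) (cstar_tensor_hom A A \<Lambda> \<Lambda>) (\<Delta> a))"


section \<open>Admissible corepresentations\<close>

definition multiplier_comult :: "'i op set \<Rightarrow> ('i op \<Rightarrow> ('i \<times> 'i) op) \<Rightarrow> 'i op \<Rightarrow> ('i \<times> 'i) op" where
  "multiplier_comult A \<Delta> = strict_ext A (A \<otimes>\<^sub>m A) \<Delta>"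

text \<open>\<open>n \<times> n\<close> matrices are functions of two indices, of which only the values at indices below \<open>n\<close> matter.\<close>
definition invertible_matrix :: "'i op set \<Rightarrow> nat \<Rightarrow> (nat \<Rightarrow> nat \<Rightarrow> 'i op) \<Rightarrow> bool" where
  "invertible_matrix B n T \<longleftrightarrow> (\<forall>i<n. \<forall>j<n. T i j \<in> B) \<and>
     (\<exists>S. (\<forall>i<n. \<forall>j<n. S i j \<in> B) \<and>
       (\<forall>i<n. \<forall>j<n. (\<Sum>k<n. T i k * S k j) = (if i = j then 1 else 0) \<and>
                     (\<Sum>k<n. S i k * T k j) = (if i = j then 1 else 0)))"

definition invertible_corep ::
    "'i op set \<Rightarrow> ('i op \<Rightarrow> ('i \<times> 'i) op) \<Rightarrow> nat \<Rightarrow> (nat \<Rightarrow> nat \<Rightarrow> 'i op) \<Rightarrow> bool" where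
  "invertible_corep A \<Delta> n T \<longleftrightarrow> invertible_matrix (multipliers A) n T \<and>
     (\<forall>i<n. \<forall>j<n. multiplier_comult A \<Delta> (T i j) = (\<Sum>k<n. T i k \<otimes>\<^sub>o T k j))"

definition admissible_corep ::
    "'i op set \<Rightarrow> ('i op \<Rightarrow> ('i \<times> 'i) op) \<Rightarrow> nat \<Rightarrow> (nat \<Rightarrow> nat \<Rightarrow> 'i op) \<Rightarrow> bool" where
  "admissible_corep A \<Delta> n T \<longleftrightarrow>
     invertible_corep A \<Delta> n T \<and> invertible_matrix (multipliers A) n (\<lambda>i j. T j i)"

definition AP :: "'i op set \<Rightarrow> ('i op \<Rightarrow> ('i \<times> 'i) op) \<Rightarrow> 'i op set" where
  "AP A \<Delta> = {\<Sum>i<n. \<Sum>j<n. c i j *\<^sub>C T i j | n T c. admissible_corep A \<Delta> n T}"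

definition AP_closure :: "'i op set \<Rightarrow> ('i op \<Rightarrow> ('i \<times> 'i) op) \<Rightarrow> 'i op set" where
  "AP_closure A \<Delta> = closure (AP A \<Delta>)"


section \<open>Reduced versions of compact quantum groups\<close>

text \<open>\<open>\<Delta> a = \<Sum>k<n. b k \<otimes> c k\<close> is a decomposition in the algebraic tensor square of \<open>P\<close>.\<close>
definition comult_decomp ::
    "'i op set \<Rightarrow> ('i op \<Rightarrow> ('i \<times> 'i) op) \<Rightarrow> 'i op \<Rightarrow> nat \<Rightarrow> (nat \<Rightarrow> 'i op) \<Rightarrow> (nat \<Rightarrow> 'i op) \<Rightarrow> bool" where
  "comult_decomp P \<Delta> a n b c \<longleftrightarrow>
     (\<forall>k<n. b k \<in> P \<and> c k \<in> P) \<and> \<Delta> a = (\<Sum>k<n. b k \<otimes>\<^sub>o c k)"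

text \<open>The Haar state of the Hopf *-algebra \<open>P\<close>.\<close>
definition haar_state :: "'i op set \<Rightarrow> ('i op \<Rightarrow> ('i \<times> 'i) op) \<Rightarrow> ('i op \<Rightarrow> complex) \<Rightarrow> bool" where
  "haar_state P \<Delta> h \<longleftrightarrow>
     (\<forall>a\<in>P. \<forall>b\<in>P. h (a + b) = h a + h b) \<and> (\<forall>a\<in>P. \<forall>c. h (c *\<^sub>C a) = c * h a) \<and>
     h 1 = 1 \<and> (\<forall>a\<in>P. Im (h (adj a * a)) = 0 \<and> 0 \<le> Re (h (adj a * a))) \<and>
     (\<forall>a\<in>P. \<forall>n b c. comult_decomp P \<Delta> a n b c \<longrightarrow>
        (\<Sum>k<n. h (b k) *\<^sub>C c k) = h a *\<^sub>C 1 \<and> (\<Sum>k<n. h (c k) *\<^sub>C b k) = h a *\<^sub>C 1)"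

text \<open>
  \<open>(C, \<Delta>\<^sub>C)\<close>, with \<open>\<pi> : P \<rightarrow> C\<close>, is the reduced version of the compact quantum group \<open>(B, \<Delta>)\<close> with dense
  Hopf *-algebra \<open>P\<close>: \<open>\<pi>\<close> is the GNS representation of the Haar state of \<open>P\<close>, with cyclic vector \<open>\<xi>\<close>, and
  \<open>C\<close> is the completion of \<open>\<pi>(P)\<close>.
\<close>
definition reduced_version ::
    "'i op set \<Rightarrow> ('i op \<Rightarrow> ('i \<times> 'i) op) \<Rightarrow> 'i op set \<Rightarrow> ('i op \<Rightarrow> 'k op) \<Rightarrow> 'k op set
      \<Rightarrow> ('k op \<Rightarrow> ('k \<times> 'k) op) \<Rightarrow> bool" where
  "reduced_version B \<Delta> P \<pi> C \<Delta>\<^sub>C \<longleftrightarrow> closure P = B \<and>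
     (\<exists>h \<xi>. haar_state P \<Delta> h \<and> star_hom P \<pi> \<and> (\<forall>a\<in>P. cinner \<xi> (\<pi> a \<cdot> \<xi>) = h a) \<and>
        closure {\<pi> a \<cdot> \<xi> | a. a \<in> P} = UNIV) \<and>
     C = closure (\<pi> ` P) \<and> star_hom C \<Delta>\<^sub>C \<and> \<Delta>\<^sub>C ` C \<subseteq> C \<otimes>\<^sub>m C \<and>
     (\<forall>a\<in>P. \<forall>n b c. comult_decomp P \<Delta> a n b c \<longrightarrow> \<Delta>\<^sub>C (\<pi> a) = (\<Sum>k<n. \<pi> (b k) \<otimes>\<^sub>o \<pi> (c k)))"

end

theory Submission imports Defs begin

text \<open>
  Let \<open>S\<close> be the dual multiplicative unitary, whose left slices span \<open>C0 W\<close>, and \<open>V\<close> its universal lift, whose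
  left slices span the universal algebra \<open>A\<close>; let \<open>r\<close> be the support of the predual *-algebra on which these
  slices are determined. An invertible \<open>T\<close> over \<open>M(A)\<close> is a corepresentation with image \<open>U\<close> under \<open>\<Lambda>\<close> exactly if
  \<open>R (U\<^sub>i\<^sub>j \<otimes> 1) = \<Sum>\<^sub>k (U\<^sub>k\<^sub>j \<otimes> T\<^sub>i\<^sub>k) R\<close> for \<open>R = V (r \<otimes> 1)\<close>. Given an admissible \<open>U\<close> over \<open>C0 W\<close>, invertibility of
  its transpose allows this relation to be solved for \<open>T\<close>, and taking slices shows that the entries of the solution
  are multipliers of \<open>A\<close>. The pentagon equation makes \<open>T\<close> a corepresentation; as \<open>S\<close> satisfies the same relation
  with \<open>T = U\<close>, uniqueness gives \<open>\<Lambda> T = U\<close>. Linear relations between the entries of \<open>U\<close> pass to those of \<open>T\<close>, so \<open>\<Lambda>\<close>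
  is injective on matrix elements. The second claim is transport of structure along the bijection.\<close>

text \<open>The obstacle is that \<open>\<Lambda>\<close> and the comultiplication of
  \<open>A\<close> are known only on the elements \<open>L w\<close> with w in the predual
  *-algebra, whereas solving the relation for T leads to the functionals x |-> w(sum_j Z_mj x U_ij),
  with Z inverse to the transpose of U. These are normal but not known to lie in the *-algebra, and
  slices of V by them are at first only multipliers of \<open>A\<close>. Multiplying by elements of
  \<open>A\<close> and testing on the *-algebra, which separates points only under its support,
  extends the formulas for \<open>\<Lambda>\<close> and the comultiplication to them; this is why r
  enters the relation with V. Both inverses that admissibility provides act in one step: the inverse
  of the transpose solves for T, the inverse of U itself solves for the adjoints, and together they
  give left and right multipliers. A second obstacle is that functionals in the predual of N vanish
  off N by encoding, so that a slice has its intended meaning only once the sliced leg is known to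
  lie in N.\<close>

notation scaleC (infixr "*C" 75)
notation tensor_op (infixr "\<otimes>" 71)
notation tensor_vec (infixr "\<odot>" 71)
abbreviation "nfun \<equiv> normal_functional"
abbreviation "cspan \<equiv> complex_span"
abbreviation "vsl \<equiv> vec_slice_left"
abbreviation "vsr \<equiv> vec_slice_right"
abbreviation "swc \<equiv> sigma_weak_closure"

section \<open>Hilbert space\<close>

lemma coord_add [simp]: "coord (x + y) i = coord x i + coord y i"
  and coord_diff [simp]: "coord (x - y) i = coord x i - coord y i"
  and coord_uminus [simp]: "coord (- x) i = - coord x i"
  and coord_scaleC [simp]: "coord (c *C x) i = c * coord x i"
  and coord_scaleR [simp]: "coord (s *\<^sub>R x) i = complex_of_real s * coord x i"
  and coord_zero [simp]: "coord 0 i = 0" by (simp_all add: plus_ell2.rep_eq minus_ell2.rep_eq uminus_ell2.rep_eq scaleC_ell2.rep_eq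
      scaleR_scaleC zero_ell2.rep_eq)

lemma coord_sum [simp]: "coord (sum f F) i = (\<Sum>k\<in>F. coord (f k) i)" by (induction F rule: infinite_finite_induct) auto

lemma ell2_eqI: "(\<And>i. coord x i = coord y i) ==> x = y" by (simp add: coord_inject[symmetric] fun_eq_iff)

lemma scaleC_sum_right: "c *C sum f F = (\<Sum>k\<in>F. c *C (f k :: 'a :: complex_vector))"
  by (induction F rule: infinite_finite_induct) (auto simp: scaleC_add_right)

lemma scaleC_zero_left [simp]: "0 *C (x :: 'a :: complex_vector) = 0" by (metis add_cancel_right_right add_0 scaleC_add_left)

lemma scaleC_minus_left: "(- c) *C x = - (c *C (x :: 'a :: complex_vector))"
  using scaleC_add_left[of c "- c" x] by (simp add: eq_neg_iff_add_eq_0 add.commute)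

lemma scaleC_minus1 [simp]: "(- 1) *C x = - (x :: 'a :: complex_vector)" by (simp add: scaleC_minus_left scaleC_one)

declare scaleC_one [simp]

lemma cinner_add_left: "cinner (x + y) z = cinner x z + cinner y z"
  and cinner_add_right: "cinner z (x + y) = cinner z x + cinner z y" unfolding cinner_def infsum_add[OF summable_cinner summable_cinner, symmetric]
  by (simp_all add: algebra_simps)

lemma cinner_commute: "cinner y x = cnj (cinner x y)" unfolding cinner_def infsum_cnj[symmetric] by (simp add: mult.commute)

lemma cinner_scaleC_left: "cinner (c *C x) y = cnj c * cinner x y"
  and cinner_scaleC_right: "cinner x (c *C y) = c * cinner x y" unfolding cinner_def by (simp_all add: infsum_cmult_right'[symmetric] algebra_simps)

lemma cinner_zero [simp]: "cinner 0 x = 0" "cinner x 0 = 0" by (simp_all add: cinner_def)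

lemma cinner_minus_left: "cinner (- x) y = - cinner x y"
  and cinner_minus_right: "cinner x (- y) = - cinner x y" using cinner_scaleC_left[of "-1" x y] cinner_scaleC_right[of x "-1" y] by simp_all

lemma cinner_diff_left: "cinner (x - y) z = cinner x z - cinner y z"
  and cinner_diff_right: "cinner z (x - y) = cinner z x - cinner z y" using cinner_add_left[of x "- y" z] cinner_add_right[of z x "- y"]
  by (simp_all add: cinner_minus_left cinner_minus_right)

lemma cinner_sum_left: "cinner (sum f F) y = (\<Sum>k\<in>F. cinner (f k) y)"
  and cinner_sum_right: "cinner y (sum f F) = (\<Sum>k\<in>F. cinner y (f k))"
  by (induction F rule: infinite_finite_induct) (auto simp: cinner_add_left cinner_add_right)

lemmas cinner_simps = cinner_add_left cinner_add_right cinner_scaleC_left cinner_scaleC_right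
  cinner_minus_left cinner_minus_right cinner_diff_left cinner_diff_right
  cinner_sum_left cinner_sum_right

lemma cmod_sq: "(complex_of_real (cmod z))\<^sup>2 = z * cnj z" by (metis complex_norm_square of_real_power)

lemma cinner_norm: "cinner x x = complex_of_real ((norm x)\<^sup>2)" by (simp add: cinner_self norm_ell2_sq)

lemma cinner_eq_0 [simp]: "cinner x x = 0 \<longleftrightarrow> x = 0" by (simp add: cinner_norm)

lemma Cauchy_Schwarz: "cmod (cinner x y) \<le> norm x * norm y"
proof (cases "cinner x y = 0")
  case False
  \<comment> \<open>Multiplying \<open>y\<close> by the phase \<open>c\<close> makes the inner
    product real and equal to its modulus, so the inequality for the real inner product
    applies.\<close>
  define c where "c = cnj (cinner x y) / cmod (cinner x y)"
  have [simp]: "cmod c = 1" using False by (simp add: c_def norm_divide)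
  have "c * cinner x y = complex_of_real (cmod (cinner x y))"
    using False by (simp add: c_def mult.commute[of "cnj _"] complex_norm_square[symmetric] power2_eq_square)
  then have "cmod (cinner x y) = inner x (c *C y)" by (simp add: inner_ell2_def cinner_scaleC_right)
  also have "\<dots> \<le> norm x * norm (c *C y)" by (rule norm_cauchy_schwarz)
  finally show ?thesis by (simp add: norm_scaleC_ell2)
qed simp

lemma cinner_ext: "(\<And>z. cinner z x = cinner z y) ==> x = y"
proof -
  assume "\<And>z. cinner z x = cinner z y"
  then have "cinner (x - y) (x - y) = 0" by (simp add: cinner_diff_right)
  then show ?thesis by simp
qed

lemma cinner_ext_left: "(\<And>z. cinner x z = cinner y z) ==> x = y" by (rule cinner_ext) (metis cinner_commute)

lemma bounded_linear_cinner_right: "bounded_linear (cinner x)" by (rule bounded_linear_intro[where K = "norm x"])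
    (simp_all add: cinner_simps scaleR_scaleC scaleR_conv_of_real, metis Cauchy_Schwarz mult.commute)

lemma bounded_linear_cinner_left: "bounded_linear (\<lambda>x. cinner x y)" by (rule bounded_linear_intro[where K = "norm y"])
    (simp_all add: cinner_simps scaleR_scaleC scaleR_conv_of_real Cauchy_Schwarz)

lemma bounded_bilinear_cinner: "bounded_bilinear cinner" by (rule bounded_bilinear.intro)
    (auto simp: cinner_simps scaleR_scaleC scaleR_conv_of_real intro!: exI[of _ 1] Cauchy_Schwarz)

lemmas tendsto_cinner = bounded_bilinear.tendsto[OF bounded_bilinear_cinner]

lemma norm_le_cinnerI:
  assumes "\<And>y. norm y \<le> 1 ==> cmod (cinner y x) \<le> B" "0 \<le> B"
  shows "norm x \<le> B"
proof (cases "x = 0")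
  case False
  have "cinner ((1 / norm x) *\<^sub>R x) x = norm x" using False by (simp add: scaleR_scaleC cinner_simps cinner_norm power2_eq_square)
  then show ?thesis using assms(1)[of "(1 / norm x) *\<^sub>R x"] False by simp
qed (use assms in auto)

definition ket :: "'i => 'i ell2" where "ket k = Abs_ell2 (\<lambda>i. if i = k then 1 else 0)"

lemma coord_ket: "coord (ket k) i = (if i = k then 1 else 0)"
proof -
  have "(\<lambda>i. (cmod (if i = k then 1 else (0 :: complex)))\<^sup>2) summable_on UNIV"
    by (rule finite_nonzero_values_imp_summable_on, rule finite_subset[of _ "{k}"]) auto
  then show ?thesis by (simp add: ket_def Abs_ell2_inverse)
qed

lemma cinner_ket_left [simp]: "cinner (ket k) x = coord x k"
proof -
  have "cinner (ket k) x = (\<Sum>\<^sub>\<infinity>i\<in>{k}. cnj (coord (ket k) i) * coord x i)"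
    unfolding cinner_def by (rule infsum_cong_neutral) (auto simp: coord_ket)
  then show ?thesis by (simp add: coord_ket)
qed

lemma cinner_ket_right [simp]: "cinner x (ket k) = cnj (coord x k)" by (subst cinner_commute) simp

lemma norm_ket [simp]: "norm (ket k) = 1"
proof -
  have "cinner (ket k) (ket k) = 1" by (simp add: coord_ket)
  then have "complex_of_real ((norm (ket k))\<^sup>2) = complex_of_real 1" by (simp add: cinner_norm)
  then have "(norm (ket k))\<^sup>2 = 1" by (simp only: of_real_eq_iff)
  then show ?thesis by (simp add: power2_eq_1_iff) (metis norm_ge_zero not_one_le_zero neg_0_le_iff_le)
qed

definition trunc :: "'i set => 'i ell2 => 'i ell2" where
  "trunc F x = (\<Sum>k\<in>F. coord x k *C ket k)"

lemma coord_trunc: "finite F ==> coord (trunc F x) i = (if i \<in> F then coord x i else 0)"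
  by (simp add: trunc_def coord_ket if_distrib[of "(*) _"] cong: if_cong)

lemma norm_trunc_diff:
  assumes "finite F"
  shows "(norm (x - trunc F x))\<^sup>2 = (norm x)\<^sup>2 - (\<Sum>i\<in>F. (cmod (coord x i))\<^sup>2)"
proof -
  have "cinner (x - trunc F x) (x - trunc F x) = cinner x x - (\<Sum>i\<in>F. cnj (coord x i) * coord x i)"
    using assms by (simp add: trunc_def cinner_simps coord_ket if_distrib[of "(*) _"] cong: if_cong)
  also have "(\<Sum>i\<in>F. cnj (coord x i) * coord x i) = complex_of_real (\<Sum>i\<in>F. (cmod (coord x i))\<^sup>2)"
    by (simp add: cmod_sq mult.commute)
  finally have "complex_of_real ((norm (x - trunc F x))\<^sup>2) =
      complex_of_real ((norm x)\<^sup>2 - (\<Sum>i\<in>F. (cmod (coord x i))\<^sup>2))" by (simp only: cinner_norm of_real_diff)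
  then show ?thesis by (simp only: of_real_eq_iff)
qed

lemma trunc_tendsto: "((\<lambda>F. trunc F x) \<longlongrightarrow> x) (finite_subsets_at_top UNIV)"
proof -
  have "((\<lambda>i. (cmod (coord x i))\<^sup>2) has_sum (norm x)\<^sup>2) UNIV"
    unfolding norm_ell2_sq using coord[of x] by (intro has_sum_infsum) auto
  then have "((\<lambda>F. (norm x)\<^sup>2 - (\<Sum>i\<in>F. (cmod (coord x i))\<^sup>2)) \<longlongrightarrow> (norm x)\<^sup>2 - (norm x)\<^sup>2) (finite_subsets_at_top UNIV)"
    unfolding has_sum_def by (intro tendsto_intros)
  then have "((\<lambda>F. (norm (x - trunc F x))\<^sup>2) \<longlongrightarrow> 0) (finite_subsets_at_top UNIV)"
    by (rule Lim_transform_eventually[THEN tendsto_eq_rhs])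
      (auto simp: eventually_finite_subsets_at_top norm_trunc_diff intro!: exI[of _ "{}"])
  then have "((\<lambda>F. sqrt ((norm (x - trunc F x))\<^sup>2)) \<longlongrightarrow> sqrt 0) (finite_subsets_at_top UNIV)"
    by (rule tendsto_real_sqrt)
  then have "((\<lambda>F. norm (x - trunc F x)) \<longlongrightarrow> 0) (finite_subsets_at_top UNIV)" by simp
  then show ?thesis using tendsto_norm_zero_cancel tendsto_diff[OF tendsto_const[of x], of "\<lambda>F. x - trunc F x" 0] by force
qed

text \<open>Truncations are finite combinations of basis vectors and converge to \<open>x\<close>.
  Identities between bounded linear maps are reduced to basis vectors, and later to elementary
  tensors, in this way.\<close>

lemma ell2_induct [case_names closed add scaleC ket]:
  assumes "closed {x. P x}" "\<And>x y. P x ==> P y ==> P (x + y)" "\<And>c x. P x ==> P (c *C x)" "\<And>k. P (ket k)"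
  shows "P x"
proof -
  have "P 0" using assms(3)[OF assms(4), of 0] by simp
  then have "P (\<Sum>k\<in>F. coord x k *C ket k)" for F by (induction F rule: infinite_finite_induct) (auto intro: assms)
  then have "\<forall>F. trunc F x \<in> {x. P x}" by (simp add: trunc_def)
  then have "x \<in> {x. P x}" by (intro Lim_in_closed_set[OF assms(1) _ _ trunc_tendsto]) (auto simp: finite_subsets_at_top_neq_bot)
  then show ?thesis by simp
qed

section \<open>Bounded operators\<close>

lemma op_apply_add_left: "(S + T) \<cdot> x = S \<cdot> x + T \<cdot> x"
  and op_apply_diff_left: "(S - T) \<cdot> x = S \<cdot> x - T \<cdot> x"
  and op_apply_minus_left: "(- T) \<cdot> x = - (T \<cdot> x)"
  and op_apply_zero_left [simp]: "0 \<cdot> x = 0"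
  and op_apply_mult: "(S * T) \<cdot> x = S \<cdot> T \<cdot> x"
  and op_apply_one [simp]: "1 \<cdot> x = x"
  and op_apply_scaleC_left: "(c *C T) \<cdot> x = c *C (T \<cdot> x)"
  by (simp_all add: op_apply_def plus_op.rep_eq minus_op.rep_eq uminus_op.rep_eq zero_op.rep_eq
      times_op.rep_eq one_op.rep_eq scaleC_op.rep_eq blinfun.bilinear_simps
      bounded_linear_Blinfun_apply bounded_linear_scaleC_ell2)

lemma op_apply_add_right: "T \<cdot> (x + y) = T \<cdot> x + T \<cdot> y"
  and op_apply_diff_right: "T \<cdot> (x - y) = T \<cdot> x - T \<cdot> y"
  and op_apply_minus_right: "T \<cdot> (- x) = - (T \<cdot> x)"
  and op_apply_zero_right [simp]: "T \<cdot> 0 = 0"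
  and op_apply_sum_right: "T \<cdot> sum f F = (\<Sum>k\<in>F. T \<cdot> f k)"
  by (simp_all add: op_apply_def blinfun.bilinear_simps blinfun.sum_right)

lemma op_apply_scaleC_right: "T \<cdot> (c *C x) = c *C (T \<cdot> x)" using blinfun_of_op[of T] by (simp add: op_apply_def)

lemma op_apply_sum_left: "sum f F \<cdot> x = (\<Sum>k\<in>F. f k \<cdot> x)"
  by (induction F rule: infinite_finite_induct) (auto simp: op_apply_add_left)

lemmas op_simps = op_apply_add_left op_apply_diff_left op_apply_minus_left op_apply_mult
  op_apply_scaleC_left op_apply_add_right op_apply_diff_right op_apply_minus_right
  op_apply_sum_right op_apply_scaleC_right op_apply_sum_left

lemma op_eqI: "(\<And>x. S \<cdot> x = T \<cdot> x) ==> S = T" unfolding op_apply_def blinfun_of_op_inject[symmetric] by (rule blinfun_eqI)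

lemma op_eqI_cinner: "(\<And>x y. cinner x (S \<cdot> y) = cinner x (T \<cdot> y)) ==> S = T" by (intro op_eqI cinner_ext)

lemma norm_op_apply: "norm (T \<cdot> x) \<le> norm T * norm x" unfolding op_apply_def norm_op.rep_eq by (rule norm_blinfun)

lemma norm_op_leI: "0 \<le> B ==> (\<And>x. norm (T \<cdot> x) \<le> B * norm x) ==> norm T \<le> B"
  unfolding op_apply_def norm_op.rep_eq by (rule norm_blinfun_bound)

lemma norm_op_cinner_leI:
  assumes "0 \<le> B" "\<And>x y. cmod (cinner x (T \<cdot> y)) \<le> B * norm x * norm y"
  shows "norm T \<le> B"
proof (rule norm_op_leI[OF assms(1)])
  fix y
  have "cmod (cinner x (T \<cdot> y)) \<le> B * norm y" if "norm x \<le> 1" for x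
  proof -
    have "norm x * (B * norm y) \<le> 1 * (B * norm y)" using that assms(1) by (intro mult_right_mono) auto
    then show ?thesis using assms(2)[of x y] by (simp add: algebra_simps)
  qed
  then show "norm (T \<cdot> y) \<le> B * norm y" by (rule norm_le_cinnerI) (use assms(1) in auto)
qed

lemma cmod_cinner_op_le: "cmod (cinner x (T \<cdot> y)) \<le> norm T * norm x * norm y"
  using Cauchy_Schwarz[of x "T \<cdot> y"] mult_left_mono[OF norm_op_apply[of T y], of "norm x"] by (simp add: algebra_simps)

lemma linear_op_apply: "bounded_linear ((\<cdot>) T)" unfolding op_apply_def by (rule blinfun.bounded_linear_right)

lemma bounded_bilinear_op_apply: "bounded_bilinear (\<cdot>)"
proof (rule bounded_bilinear.intro)
  show "\<exists>K. \<forall>T (x :: 'a ell2). norm (T \<cdot> x) \<le> norm T * norm x * K" by (intro exI[of _ 1]) (simp add: norm_op_apply)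
qed (simp_all add: op_simps scaleR_scaleC)


lemma scaleC_mult_left: "(c *C S) * T = c *C (S * (T :: 'i op))"
  and scaleC_mult_right: "S * (c *C T) = c *C (S * (T :: 'i op))" by (rule op_eqI, simp add: op_simps)+

lemma norm_scaleC_op: "norm (c *C (T :: 'i op)) = cmod c * norm T"
proof (rule antisym)
  have le: "norm (c *C T) \<le> cmod c * norm T" for c and T :: "'i op"
  proof (rule norm_op_leI)
    fix x show "norm ((c *C T) \<cdot> x) \<le> cmod c * norm T * norm x" using mult_left_mono[OF norm_op_apply[of T x], of "cmod c"]
      by (simp add: op_simps norm_scaleC_ell2 algebra_simps)
  qed simp
  show "norm (c *C T) \<le> cmod c * norm T" by (rule le)
  show "cmod c * norm T \<le> norm (c *C T)"
  proof (cases "c = 0")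
    case False
    have "norm T = norm (inverse c *C c *C T)" using False by (simp add: scaleC_scaleC)
    also have "\<dots> \<le> inverse (cmod c) * norm (c *C T)" using le[of "inverse c" "c *C T"] by (simp add: norm_inverse)
    finally show ?thesis using False by (simp add: field_simps)
  qed simp
qed

lemma bounded_linear_scaleC_op: "bounded_linear (\<lambda>T :: 'i op. c *C T)" by (rule bounded_linear_intro[where K = "cmod c"])
    (simp_all add: scaleC_add_right norm_scaleC_op scaleR_scaleC scaleC_scaleC mult.commute)

instance op :: (type) banach
proof
  fix X :: "nat => 'a op" assume C: "Cauchy X"
  have d: "dist (blinfun_of_op S) (blinfun_of_op T) = dist S T" for S T :: "'a op" by (simp add: dist_norm norm_op.rep_eq minus_op.rep_eq)
  have "Cauchy (\<lambda>n. blinfun_of_op (X n))" using C by (simp add: Cauchy_def d)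
  then obtain L where L: "(\<lambda>n. blinfun_of_op (X n)) \<longlonglongrightarrow> L" using Cauchy_convergent_iff convergent_def by blast
  have "blinfun_apply L (c *C x) = c *C blinfun_apply L x" for c x
  proof (rule LIMSEQ_unique)
    show "(\<lambda>n. X n \<cdot> (c *C x)) \<longlonglongrightarrow> L (c *C x)" unfolding op_apply_def by (intro tendsto_intros L)
    have "(\<lambda>n. X n \<cdot> x) \<longlonglongrightarrow> L x" unfolding op_apply_def by (intro tendsto_intros L)
    from bounded_linear.tendsto[OF bounded_linear_scaleC_ell2 this, of c]
    show "(\<lambda>n. X n \<cdot> (c *C x)) \<longlonglongrightarrow> c *C L x" by (simp add: op_simps)
  qed
  then have "L = blinfun_of_op (Abs_op L)" by (simp add: Abs_op_inverse)
  then obtain T where T: "L = blinfun_of_op T" ..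
  have "X \<longlonglongrightarrow> T" using L by (subst tendsto_dist_iff) (simp add: T tendsto_dist_iff[of "\<lambda>n. blinfun_of_op (X n)"] d)
  then show "convergent X" by (auto simp: convergent_def)
qed

lemma ex_op:
  assumes "\<And>x y. f (x + y) = f x + f y" "\<And>c x. f (c *C x) = c *C f x"
    and "\<And>x. norm (f x) \<le> B * norm x"
  shows "\<exists>T :: 'i op. \<forall>x. T \<cdot> x = f x"
proof -
  have bl: "bounded_linear f" by (rule bounded_linear_intro[where K = B]) (simp_all add: assms scaleR_scaleC mult.commute)
  define L where "L = Blinfun f"
  have L: "blinfun_apply L = f" by (simp add: L_def bounded_linear_Blinfun_apply bl)
  then have "blinfun_of_op (Abs_op L) = L" by (intro Abs_op_inverse) (simp add: assms)
  then show ?thesis by (intro exI[of _ "Abs_op L"]) (simp add: op_apply_def L)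
qed

text \<open>Riesz representation in coordinates: the vector T y has k-th coordinate B (ket k) y, and
  boundedness of the form makes these coordinates square summable. Adjoints and vector slices are
  obtained from it.\<close>

lemma ex_op_form:
  fixes B :: "'i ell2 => 'i ell2 => complex"
  assumes addl: "\<And>x y z. B (x + y) z = B x z + B y z" and addr: "\<And>x y z. B z (x + y) = B z x + B z y"
    and scl: "\<And>c x y. B (c *C x) y = cnj c * B x y" and scr: "\<And>c x y. B x (c *C y) = c * B x y"
    and bd: "\<And>x y. cmod (B x y) \<le> C * norm x * norm y"
  shows "\<exists>T. \<forall>x y. cinner x (T \<cdot> y) = B x y"
proof -
  have zl: "B 0 y = 0" for y using scl[of 0 0 y] by simp
  have suml: "B (sum f F) y = (\<Sum>k\<in>F. B (f k) y)" for f :: "'i => 'i ell2" and F y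
    by (induction F rule: infinite_finite_induct) (auto simp: zl addl)
  have fin: "(\<Sum>k\<in>F. (cmod (B (ket k) y))\<^sup>2) \<le> (C * norm y)\<^sup>2" if "finite F" for F y
  proof -
    \<comment> \<open>Testing the form on ?v gives |?v|^2 = B ?v y <= C |?v| |y|, hence |?v| <= C
      |y|, uniformly in F.\<close>
    let ?v = "\<Sum>k\<in>F. B (ket k) y *C ket k" and ?s = "\<Sum>k\<in>F. (cmod (B (ket k) y))\<^sup>2"
    have "complex_of_real ((norm ?v)\<^sup>2) = of_real ?s" unfolding cinner_norm[symmetric] using that
      by (simp add: cinner_simps coord_ket if_distrib[of "(*) _"] cmod_sq mult.commute cong: if_cong)
    then have nv: "(norm ?v)\<^sup>2 = ?s" by (simp only: of_real_eq_iff)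
    have "B ?v y = of_real ?s" unfolding suml scl of_real_sum by (simp add: cmod_sq mult.commute)
    then have "cmod (of_real ?s) \<le> C * norm ?v * norm y" using bd[of ?v y] by simp
    then have le: "(norm ?v)\<^sup>2 \<le> C * norm ?v * norm y" unfolding nv[symmetric] norm_of_real by simp
    show ?thesis
    proof (cases "norm ?v = 0")
      case False
      then have "norm ?v \<le> C * norm y" using le by (simp add: power2_eq_square algebra_simps)
      then show ?thesis unfolding nv[symmetric] by (intro power_mono) auto
    qed (simp add: nv[symmetric])
  qed
  have summ: "(\<lambda>k. (cmod (B (ket k) y))\<^sup>2) summable_on UNIV" for y
    by (rule nonneg_bdd_above_summable_on) (auto intro!: bdd_aboveI2[where M = "(C * norm y)\<^sup>2"] fin)
  define f where "f y = Abs_ell2 (\<lambda>k. B (ket k) y)" for y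
  have cf: "coord (f y) k = B (ket k) y" for y k by (simp add: f_def Abs_ell2_inverse summ)
  have nf: "norm (f y) \<le> \<bar>C\<bar> * norm y" for y
  proof (rule power2_le_imp_le)
    have "(norm (f y))\<^sup>2 \<le> (C * norm y)\<^sup>2" unfolding norm_ell2_sq cf by (rule infsum_le_finite_sums[OF summ]) (use fin in auto)
    then show "(norm (f y))\<^sup>2 \<le> (\<bar>C\<bar> * norm y)\<^sup>2" by (simp add: power_mult_distrib)
  qed simp
  obtain T where T: "\<And>y. T \<cdot> y = f y"
    using ex_op[of f "\<bar>C\<bar>"] nf by (metis (no_types, lifting) cf ell2_eqI addr scr coord_add coord_scaleC)
  have "cinner x (T \<cdot> y) = B x y" for x y
  proof (induction x rule: ell2_induct)
    case closed
    have "bounded_linear (\<lambda>x. B x y)"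
      by (rule bounded_linear_intro[where K = "C * norm y"]) (simp_all add: addl scl scaleR_scaleC scaleR_conv_of_real,
        metis bd mult.assoc mult.commute)
    then show ?case by (intro closed_Collect_eq) (simp_all add: linear_continuous_on bounded_linear_cinner_left)
  qed (simp_all add: cinner_simps addl scl T cf)
  then show ?thesis by blast
qed

lemma adj_ex: "\<exists>!S. \<forall>x y. cinner (S \<cdot> x) y = cinner x (T \<cdot> y)"
proof -
  have "cmod (cinner (T \<cdot> x) y) \<le> norm T * norm x * norm y" for x y
    using cmod_cinner_op_le[of y T x] cinner_commute[of y "T \<cdot> x"] by (simp add: mult_ac)
  then have "\<exists>S. \<forall>x y. cinner x (S \<cdot> y) = cinner (T \<cdot> x) y" by (intro ex_op_form) (auto simp: cinner_simps op_simps)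
  then obtain S where "\<And>x y. cinner x (S \<cdot> y) = cinner (T \<cdot> x) y" by blast
  then have S: "\<forall>x y. cinner (S \<cdot> x) y = cinner x (T \<cdot> y)" by (metis cinner_commute)
  have "S' = S" if "\<forall>x y. cinner (S' \<cdot> x) y = cinner x (T \<cdot> y)" for S' by (rule op_eqI, rule cinner_ext_left) (use that S in simp)
  with S show ?thesis by blast
qed

lemma cinner_adj_left: "cinner (adj T \<cdot> x) y = cinner x (T \<cdot> y)" using theI'[OF adj_ex[of T]] unfolding adj_def by blast

lemma cinner_adj_right: "cinner x (adj T \<cdot> y) = cinner (T \<cdot> x) y" by (metis cinner_adj_left cinner_commute)

lemma adj_unique: "(\<And>x y. cinner (S \<cdot> x) y = cinner x (T \<cdot> y)) ==> adj T = S" using adj_ex[of T] cinner_adj_left by blast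

lemma adj_adj [simp]: "adj (adj T) = T" by (rule adj_unique) (simp add: cinner_adj_right)

lemma adj_add: "adj (S + T) = adj S + adj T"
  and adj_diff: "adj (S - T) = adj S - adj T"
  and adj_minus: "adj (- T) = - adj T"
  and adj_mult: "adj (S * T) = adj T * adj S"
  and adj_scaleC: "adj (c *C T) = cnj c *C adj T"
  and adj_one [simp]: "adj 1 = 1"
  and adj_zero [simp]: "adj 0 = 0" by (rule adj_unique, simp add: op_simps cinner_simps cinner_adj_left)+

lemma adj_sum: "adj (sum f F) = (\<Sum>k\<in>F. adj (f k))" by (induction F rule: infinite_finite_induct) (auto simp: adj_add)

lemma adj_power: "adj (T ^ n) = adj T ^ n" by (induction n) (auto simp: adj_mult power_commutes)

lemmas adj_simps = adj_add adj_diff adj_minus adj_mult adj_scaleC adj_sum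

lemma norm_adj [simp]: "norm (adj T) = norm T"
proof -
  have "norm (adj S) \<le> norm S" for S :: "'a op"
  proof (rule norm_op_cinner_leI)
    fix x y show "cmod (cinner x (adj S \<cdot> y)) \<le> norm S * norm x * norm y"
      using cmod_cinner_op_le[of y S x] cinner_commute[of y "S \<cdot> x"] by (simp add: cinner_adj_right mult_ac)
  qed simp
  from this[of T] this[of "adj T"] show ?thesis by simp
qed

lemma norm_cstar: "norm (adj T * T) = (norm T)\<^sup>2"
proof (rule antisym)
  show "norm (adj T * T) \<le> (norm T)\<^sup>2" using norm_mult_ineq[of "adj T" T] by (simp add: power2_eq_square)
  have "norm T \<le> sqrt (norm (adj T * T))"
  proof (rule norm_op_leI)
    fix x
    have "(norm (T \<cdot> x))\<^sup>2 = cmod (cinner x ((adj T * T) \<cdot> x))"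
      by (simp add: op_simps cinner_adj_right cinner_norm norm_mult power2_eq_square)
    also have "\<dots> \<le> norm (adj T * T) * norm x * norm x" by (rule cmod_cinner_op_le)
    also have "\<dots> = (sqrt (norm (adj T * T)) * norm x)\<^sup>2" by (simp add: power2_eq_square)
    finally show "norm (T \<cdot> x) \<le> sqrt (norm (adj T * T)) * norm x" by (rule power2_le_imp_le) simp
  qed simp
  then show "(norm T)\<^sup>2 \<le> norm (adj T * T)" by (metis norm_ge_zero power_mono real_sqrt_pow2)
qed

lemma bounded_linear_adj: "bounded_linear adj" by (rule bounded_linear_intro[where K = 1]) (simp_all add: adj_simps scaleR_scaleC)

section \<open>Tensor products\<close>

lemma coord_tensor [simp]: "coord (x \<odot> y) (i, j) = coord x i * coord y j" by (simp add: tensor_vec.rep_eq)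

lemma ket_tensor: "ket (i, j) = ket i \<odot> ket j"
proof (rule ell2_eqI)
  fix p show "coord (ket (i, j)) p = coord (ket i \<odot> ket j) p" by (cases p) (simp add: coord_ket)
qed

lemma tensor_add_left: "(x + y) \<odot> z = x \<odot> z + y \<odot> z"
  and tensor_add_right: "z \<odot> (x + y) = z \<odot> x + z \<odot> y"
  and tensor_scaleC_left: "(c *C x) \<odot> z = c *C (x \<odot> z)"
  and tensor_scaleC_right: "z \<odot> (c *C x) = c *C (z \<odot> x)"
  and tensor_diff_left: "(x - y) \<odot> z = x \<odot> z - y \<odot> z"
  and tensor_diff_right: "z \<odot> (x - y) = z \<odot> x - z \<odot> y"
  and tensor_zero_left [simp]: "0 \<odot> z = 0"
  and tensor_zero_right [simp]: "z \<odot> 0 = 0" by (rule ell2_eqI, rename_tac p, case_tac p, simp add: algebra_simps)+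

lemma tensor_sum_left: "sum f F \<odot> z = (\<Sum>k\<in>F. f k \<odot> z)"
  and tensor_sum_right: "z \<odot> sum f F = (\<Sum>k\<in>F. z \<odot> f k)"
  by (induction F rule: infinite_finite_induct) (auto simp: tensor_add_left tensor_add_right)

lemmas tensor_vec_simps = tensor_add_left tensor_add_right tensor_scaleC_left tensor_scaleC_right
  tensor_diff_left tensor_diff_right tensor_sum_left tensor_sum_right

lemma cinner_tensor [simp]: "cinner (x \<odot> y) (x' \<odot> y') = cinner x x' * cinner y y'"
proof -
  let ?f = "\<lambda>i j. (cnj (coord x i) * coord x' i) * (cnj (coord y j) * coord y' j)"
  have "(\<lambda>(i, j). ?f i j) summable_on UNIV \<times> UNIV"
  proof -
    have "(\<lambda>(i, j). ?f i j) = (\<lambda>p. cnj (coord (x \<odot> y) p) * coord (x' \<odot> y') p)" by (auto simp: fun_eq_iff mult_ac)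
    then show ?thesis using summable_cinner[of "x \<odot> y" "x' \<odot> y'"] by simp
  qed
  then have "infsum (\<lambda>(i, j). ?f i j) (UNIV \<times> UNIV) = (\<Sum>\<^sub>\<infinity>i. \<Sum>\<^sub>\<infinity>j. ?f i j)"
    by (rule infsum_Sigma'_banach[symmetric])
  also have "\<dots> = cinner x x' * cinner y y'" unfolding cinner_def by (simp add: infsum_cmult_right' infsum_cmult_left')
  also have "infsum (\<lambda>(i, j). ?f i j) (UNIV \<times> UNIV) = cinner (x \<odot> y) (x' \<odot> y')"
    unfolding cinner_def by (intro infsum_cong_neutral) (auto simp: mult_ac)
  finally show ?thesis .
qed

lemma norm_tensor [simp]: "norm (x \<odot> y) = norm x * norm y"
proof -
  have "complex_of_real ((norm (x \<odot> y))\<^sup>2) = of_real ((norm x * norm y)\<^sup>2)"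
    by (simp only: cinner_norm[symmetric] cinner_tensor) (simp add: cinner_norm power_mult_distrib)
  then show ?thesis by (simp only: of_real_eq_iff power2_eq_iff_nonneg norm_ge_zero mult_nonneg_nonneg)
qed

lemma bounded_bilinear_tensor: "bounded_bilinear (\<odot>)"
  by (rule bounded_bilinear.intro) (auto simp: tensor_vec_simps scaleR_scaleC intro!: exI[of _ 1])

lemmas bounded_linear_tensor_left = bounded_bilinear.bounded_linear_left[OF bounded_bilinear_tensor]
lemmas bounded_linear_tensor_right = bounded_bilinear.bounded_linear_right[OF bounded_bilinear_tensor]

lemma tensor_induct [case_names closed add scaleC tensor]:
  assumes "closed {x. P x}" "\<And>x y. P x ==> P y ==> P (x + y)" "\<And>c x. P x ==> P (c *C x)" "\<And>a b. P (a \<odot> b)"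
  shows "P u"
proof (induction u rule: ell2_induct)
  case (ket k) then show ?case using assms(4) by (cases k) (simp add: ket_tensor)
qed (use assms in auto)

lemma closed_linear_eq:
  "bounded_linear f ==> bounded_linear g ==> closed {x. f x = g x}" by (intro closed_Collect_eq) (simp_all add: linear_continuous_on)

lemma tensor_linear_eqI:
  assumes "bounded_linear f" "bounded_linear g" "\<And>c x. f (c *C x) = c *C f x" "\<And>c x. g (c *C x) = c *C g x"
    and "\<And>a b. f (a \<odot> b) = g (a \<odot> b)"
  shows "f u = (g u :: 'a :: {complex_vector, real_normed_vector})"
proof (induction u rule: tensor_induct)
  case closed show ?case by (rule closed_linear_eq) fact+
next
  case (add x y) then show ?case by (simp add: bounded_linear.linear[OF assms(1)] bounded_linear.linear[OF assms(2)] linear_add)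
qed (simp_all add: assms)

lemma tensor_cinner_eqI: "(\<And>a b. cinner (a \<odot> b) u = cinner (a \<odot> b) v) ==> u = v"
proof (rule cinner_ext)
  fix z assume *: "\<And>a b. cinner (a \<odot> b) u = cinner (a \<odot> b) v"
  show "cinner z u = cinner z v"
  proof (induction z rule: tensor_induct)
    case closed show ?case by (intro closed_linear_eq bounded_linear_cinner_left)
  qed (use * in \<open>auto simp: cinner_simps\<close>)
qed

lemma op_tensor_eqI: "(\<And>a b. S \<cdot> (a \<odot> b) = T \<cdot> (a \<odot> b)) ==> S = T"
  by (rule op_eqI, rule tensor_linear_eqI[where f = "(\<cdot>) S" and g = "(\<cdot>) T"]) (simp_all add: linear_op_apply op_simps)

lemma op_form_eqI:
  "(\<And>a b c d. cinner (a \<odot> b) (S \<cdot> (c \<odot> d)) = cinner (a \<odot> b) (T \<cdot> (c \<odot> d))) ==> S = T"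
  by (intro op_tensor_eqI tensor_cinner_eqI)

lemma op_form3_eqI:
  assumes "\<And>a b c a' b' c'. cinner (a \<odot> b \<odot> c) (S \<cdot> (a' \<odot> b' \<odot> c')) = cinner (a \<odot> b \<odot> c) (T \<cdot> (a' \<odot> b' \<odot> c'))"
  shows "S = T"
proof (rule op_form_eqI)
  fix a :: "'a ell2" and p :: "('b \<times> 'c) ell2" and a' p'
  have *: "cinner (a \<odot> b \<odot> c) (S \<cdot> (a' \<odot> p')) = cinner (a \<odot> b \<odot> c) (T \<cdot> (a' \<odot> p'))" for b c
  proof (induction p' rule: tensor_induct)
    case closed show ?case by (intro closed_linear_eq bounded_linear_compose[OF bounded_linear_cinner_right]
        bounded_linear_compose[OF linear_op_apply] bounded_linear_tensor_right)
  qed (use assms in \<open>auto simp: cinner_simps op_simps tensor_vec_simps\<close>)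
  show "cinner (a \<odot> p) (S \<cdot> (a' \<odot> p')) = cinner (a \<odot> p) (T \<cdot> (a' \<odot> p'))"
  proof (induction p rule: tensor_induct)
    case closed show ?case by (intro closed_linear_eq bounded_linear_compose[OF bounded_linear_cinner_left] bounded_linear_tensor_right)
  qed (auto simp: cinner_simps op_simps tensor_vec_simps *)
qed

text \<open>The Hilbert space over \<open>'k \<times> 'i\<close> is a direct sum of copies of the
  one over \<open>'i\<close>, indexed by \<open>'k\<close>; \<open>row k\<close> is the k-th
  component. Amplifications 1 \<otimes> T act on each component separately.\<close>

definition row :: "'k => ('k \<times> 'i) ell2 => 'i ell2" where
  "row k u = Abs_ell2 (\<lambda>i. coord u (k, i))"

lemma square_summable_row: "(\<lambda>i. (cmod (coord u (k, i)))\<^sup>2) summable_on UNIV"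
proof -
  have "(\<lambda>p. (cmod (coord u p))\<^sup>2) summable_on range (Pair k)" by (rule summable_on_subset_banach[of _ UNIV]) (use coord[of u] in auto)
  then show ?thesis by (subst (asm) summable_on_reindex) (auto simp: o_def inj_on_def)
qed

lemma coord_row [simp]: "coord (row k u) i = coord u (k, i)" by (simp add: row_def Abs_ell2_inverse square_summable_row)

lemma row_simps: "row k (u + v) = row k u + row k v" "row k (c *C u) = c *C row k u"
  "row k (u - v) = row k u - row k v" "row k (a \<odot> b) = coord a k *C b" by (rule ell2_eqI, simp)+

lemma cinner_row_has_sum: "((\<lambda>k. cinner (row k u) (row k v)) has_sum cinner u v) UNIV"
proof -
  have s: "(\<lambda>(k, i). cnj (coord u (k, i)) * coord v (k, i)) summable_on UNIV \<times> UNIV"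
    using summable_cinner[of u v] by (simp add: case_prod_beta')
  have "(\<lambda>k. cinner (row k u) (row k v)) summable_on UNIV" using summable_on_Sigma_banach[OF s] by (simp add: cinner_def)
  moreover have "(\<Sum>\<^sub>\<infinity>k. cinner (row k u) (row k v)) = cinner u v"
    using infsum_Sigma'_banach[OF s] by (simp add: cinner_def case_prod_beta')
  ultimately show ?thesis by (simp add: has_sum_iff)
qed

lemma norm_row_has_sum: "((\<lambda>k. (norm (row k u))\<^sup>2) has_sum (norm u)\<^sup>2) UNIV"
  using cinner_row_has_sum[of u u] unfolding cinner_norm has_sum_of_real_iff .

lemma norm_row_le: "norm (row k u) \<le> norm u"
proof (rule power2_le_imp_le)
  show "(norm (row k u))\<^sup>2 \<le> (norm u)\<^sup>2" using finite_sum_le_has_sum[OF norm_row_has_sum[of u], of "{k}"] by simp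
qed simp

lemma bounded_linear_row: "bounded_linear (row k)" by (rule bounded_linear_intro[where K = 1]) (simp_all add: row_simps scaleR_scaleC norm_row_le)

lemma ell2_row_eqI: "(\<And>k. row k u = row k v) ==> u = v" by (rule ell2_eqI) (metis coord_row surj_pair)

lemma ex_rows:
  assumes "(\<lambda>k. (norm (f k))\<^sup>2) summable_on UNIV"
  shows "\<exists>u. (\<forall>k. row k u = f k) \<and> (norm u)\<^sup>2 = (\<Sum>\<^sub>\<infinity>k. (norm (f k))\<^sup>2)"
proof -
  have s: "(\<lambda>p. (cmod (coord (f (fst p)) (snd p)))\<^sup>2) summable_on UNIV \<times> UNIV"
  proof (rule summable_on_SigmaI)
    show "((\<lambda>i. (cmod (coord (f (fst (k, i))) (snd (k, i))))\<^sup>2) has_sum (norm (f k))\<^sup>2) UNIV" for k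
      unfolding norm_ell2_sq fst_conv snd_conv using coord[of "f k"] by (intro has_sum_infsum) auto
  qed (use assms in auto)
  define u where "u = Abs_ell2 (\<lambda>p. coord (f (fst p)) (snd p))"
  have "coord u p = coord (f (fst p)) (snd p)" for p using s by (simp add: u_def Abs_ell2_inverse)
  then have "row k u = f k" for k by (intro ell2_eqI) simp
  moreover from this have "(norm u)\<^sup>2 = (\<Sum>\<^sub>\<infinity>k. (norm (f k))\<^sup>2)" using norm_row_has_sum[of u] by (simp add: infsumI)
  ultimately show ?thesis by blast
qed

text \<open>1 \<otimes> T is built row by row, and its norm bound is the sum over the rows of the
  bounds for T.\<close>

lemma ex_tensor_one: "\<exists>R :: ('k \<times> 'i) op. (\<forall>u k. row k (R \<cdot> u) = T \<cdot> row k u) \<and> norm R \<le> norm T"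
proof -
  have s: "(\<lambda>k. (norm (T \<cdot> row k u))\<^sup>2) summable_on UNIV"
    and le: "(\<Sum>\<^sub>\<infinity>k. (norm (T \<cdot> row k u))\<^sup>2) \<le> (norm T)\<^sup>2 * (norm u)\<^sup>2" for u :: "('k \<times> 'i) ell2"
  proof -
    have le1: "(norm (T \<cdot> row k u))\<^sup>2 \<le> (norm T)\<^sup>2 * (norm (row k u))\<^sup>2" for k
      using norm_op_apply[of T "row k u"] by (metis norm_ge_zero power_mono power_mult_distrib)
    have hs: "((\<lambda>k. (norm T)\<^sup>2 * (norm (row k u))\<^sup>2) has_sum (norm T)\<^sup>2 * (norm u)\<^sup>2) UNIV"
      by (intro has_sum_cmult_right norm_row_has_sum)
    then have s2: "(\<lambda>k. (norm T)\<^sup>2 * (norm (row k u))\<^sup>2) summable_on UNIV" by (auto simp: summable_on_def)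
    show s: "(\<lambda>k. (norm (T \<cdot> row k u))\<^sup>2) summable_on UNIV" by (rule summable_on_comparison_test[OF s2]) (use le1 in auto)
    show "(\<Sum>\<^sub>\<infinity>k. (norm (T \<cdot> row k u))\<^sup>2) \<le> (norm T)\<^sup>2 * (norm u)\<^sup>2"
      by (rule has_sum_mono[OF has_sum_infsum[OF s] hs le1])
  qed
  have "\<forall>u :: ('k \<times> 'i) ell2. \<exists>v. (\<forall>k. row k v = T \<cdot> row k u) \<and> (norm v)\<^sup>2 = (\<Sum>\<^sub>\<infinity>k. (norm (T \<cdot> row k u))\<^sup>2)"
    by (intro allI ex_rows s)
  then obtain f where f: "\<And>u :: ('k \<times> 'i) ell2. \<forall>k. row k (f u) = T \<cdot> row k u"
    and nf: "\<And>u. (norm (f u))\<^sup>2 = (\<Sum>\<^sub>\<infinity>k. (norm (T \<cdot> row k u))\<^sup>2)" by metis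
  have n: "norm (f u) \<le> norm T * norm u" for u by (rule power2_le_imp_le) (use nf le in \<open>simp_all add: power_mult_distrib\<close>)
  obtain R where R: "\<And>u. R \<cdot> u = f u"
    using ex_op[of f "norm T"] n f by (metis (no_types, lifting) ell2_row_eqI row_simps(1,2) op_apply_add_right op_apply_scaleC_right)
  show ?thesis using R f n by (intro exI[of _ R]) (auto intro: norm_op_leI)
qed

lemma tensor_op_right_ex: "\<exists>R :: ('k \<times> 'i) op. (\<forall>x y. R \<cdot> (x \<odot> y) = x \<odot> (T \<cdot> y)) \<and> (\<forall>u k. row k (R \<cdot> u) = T \<cdot> row k u) \<and> norm R \<le> norm T"
proof -
  obtain R :: "('k \<times> 'i) op" where R: "\<And>u k. row k (R \<cdot> u) = T \<cdot> row k u" "norm R \<le> norm T" using ex_tensor_one by blast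
  have "R \<cdot> (x \<odot> y) = x \<odot> (T \<cdot> y)" for x y by (rule ell2_row_eqI) (simp add: R row_simps op_simps)
  with R show ?thesis by blast
qed

subsection \<open>Relabelling\<close>

lemma coord_relabel: "inj s ==> coord (relabel s x) k = coord x (s k)" by (simp add: relabel.rep_eq)

lemma relabel_linear: "relabel s (x + y) = relabel s x + relabel s y" "relabel s (c *C x) = c *C relabel s x"
  "relabel s (x - y) = relabel s x - relabel s y" by (rule ell2_eqI, simp add: relabel.rep_eq)+

lemma relabel_zero [simp]: "relabel s 0 = 0" by (metis relabel_linear(2) scaleC_zero_left)

lemma cinner_relabel: "bij s ==> cinner (relabel s x) (relabel s y) = cinner x y"
  unfolding cinner_def using infsum_reindex_bij_betw[of s UNIV UNIV "\<lambda>i. cnj (coord x i) * coord y i"] by (simp add: coord_relabel bij_is_inj)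

lemma norm_relabel: "bij s ==> norm (relabel s x) = norm x" by (simp add: norm_ell2_def inner_ell2_def cinner_relabel)

lemma relabel_relabel: "bij s ==> bij t ==> relabel s (relabel t x) = relabel (t \<circ> s) x"
  by (rule ell2_eqI) (simp add: coord_relabel bij_is_inj bij_comp)

lemma relabel_id [simp]: "relabel id x = x" "relabel (\<lambda>i. i) x = x" by (rule ell2_eqI, simp add: coord_relabel inj_on_def)+

lemma relabel_inv: "bij s ==> relabel s (relabel (inv s) x) = x" "bij s ==> relabel (inv s) (relabel s y) = y"
  by (simp_all add: relabel_relabel bij_imp_bij_inv bij_is_inj bij_is_surj surj_iff[THEN iffD1] inv_o_cancel)

lemma bounded_linear_relabel: "bij s ==> bounded_linear (relabel s)"
  by (rule bounded_linear_intro[where K = 1]) (simp_all add: relabel_linear scaleR_scaleC norm_relabel)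

lemma relabel_op_ex: "bij s ==> \<exists>!S. \<forall>x. S \<cdot> relabel s x = relabel s (T \<cdot> x)"
proof -
  assume s: "bij s"
  obtain S where S: "\<And>y. S \<cdot> y = relabel s (T \<cdot> relabel (inv s) y)"
    using ex_op[of "\<lambda>y. relabel s (T \<cdot> relabel (inv s) y)" "norm T"] norm_op_apply[of T "relabel (inv s) _"]
    by (auto simp: relabel_linear op_simps norm_relabel s bij_imp_bij_inv)
  show ?thesis
  proof (rule ex1I[of _ S])
    fix R assume R: "\<forall>x. R \<cdot> relabel s x = relabel s (T \<cdot> x)"
    show "R = S"
    proof (rule op_eqI)
      fix y show "R \<cdot> y = S \<cdot> y" using R[rule_format, of "relabel (inv s) y"] by (simp add: S relabel_inv s)
    qed
  qed (simp add: S relabel_inv s)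
qed

lemma relabel_op_apply: "bij s ==> relabel_op s T \<cdot> relabel s x = relabel s (T \<cdot> x)"
  using theI'[OF relabel_op_ex[of s T]] unfolding relabel_op_def by blast

lemma relabel_op_eqI: "bij s ==> (\<And>x. S \<cdot> relabel s x = relabel s (T \<cdot> x)) ==> relabel_op s T = S"
  using relabel_op_ex[of s T] relabel_op_apply[of s T] by blast

lemma relabel_op_cinner: "bij s ==> cinner (relabel s x) (relabel_op s T \<cdot> relabel s y) = cinner x (T \<cdot> y)"
  by (simp add: relabel_op_apply cinner_relabel)

lemma relabel_algebra:
  assumes "bij s"
  shows "relabel_op s (S + T) = relabel_op s S + relabel_op s T"
    "relabel_op s (S - T) = relabel_op s S - relabel_op s T"
    "relabel_op s (S * T) = relabel_op s S * relabel_op s T"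
    "relabel_op s (c *C T) = c *C relabel_op s T" "relabel_op s 1 = 1" "relabel_op s 0 = 0"
  by (rule relabel_op_eqI[OF assms], simp add: op_simps relabel_linear relabel_op_apply assms)+

lemma relabel_op_adj: "bij s ==> relabel_op s (adj T) = adj (relabel_op s T)"
proof (rule relabel_op_eqI)
  fix x assume s: "bij s"
  show "adj (relabel_op s T) \<cdot> relabel s x = relabel s (adj T \<cdot> x)"
  proof (rule cinner_ext)
    fix z
    have "cinner (relabel s (relabel (inv s) z)) (adj (relabel_op s T) \<cdot> relabel s x) =
        cinner (relabel s (relabel (inv s) z)) (relabel s (adj T \<cdot> x))"
      by (simp only: cinner_adj_right relabel_op_apply[OF s] cinner_relabel[OF s])
    then show "cinner z (adj (relabel_op s T) \<cdot> relabel s x) = cinner z (relabel s (adj T \<cdot> x))" by (simp add: relabel_inv s)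
  qed
qed

lemma relabel_op_relabel_op:
  assumes "bij s" "bij t" shows "relabel_op s (relabel_op t T) = relabel_op (t \<circ> s) T"
proof (rule relabel_op_eqI[OF assms(1)])
  fix x
  have "relabel_op (t \<circ> s) T \<cdot> relabel s (relabel t (relabel (inv t) x)) = relabel s (relabel_op t T \<cdot> relabel t (relabel (inv t) x))"
    using assms by (simp only: relabel_relabel[OF assms] relabel_op_apply bij_comp)
  then show "relabel_op (t \<circ> s) T \<cdot> relabel s x = relabel s (relabel_op t T \<cdot> x)" by (simp add: relabel_inv assms)
qed

lemma relabel_op_id: "relabel_op id T = T" "relabel_op (\<lambda>i. i) T = T" using relabel_op_eqI[of id T T] bij_id by (simp_all add: id_def)

lemma norm_relabel_op: "bij s ==> norm (relabel_op s T) = norm T"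
proof -
  have le: "norm (relabel_op t S) \<le> norm S" if t: "bij t" for t :: "'c => 'd" and S
  proof (rule norm_op_leI)
    fix x
    have "norm (relabel_op t S \<cdot> relabel t (relabel (inv t) x)) \<le> norm S * norm (relabel (inv t) x)"
      by (simp only: relabel_op_apply[OF t] norm_relabel[OF t] norm_op_apply)
    then show "norm (relabel_op t S \<cdot> x) \<le> norm S * norm x" by (simp add: relabel_inv t norm_relabel bij_imp_bij_inv)
  qed simp
  assume s: "bij s"
  have "norm T = norm (relabel_op (inv s) (relabel_op s T))"
    by (simp add: relabel_op_relabel_op s bij_imp_bij_inv surj_iff[THEN iffD1] bij_is_surj relabel_op_id)
  then show ?thesis using le[OF s, of T] le[OF bij_imp_bij_inv[OF s], of "relabel_op s T"] by simp
qed

lemma bij_swap [simp]: "bij prod.swap" by (rule bijI') auto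

lemma relabel_swap [simp]: "relabel prod.swap (x \<odot> y) = y \<odot> x" by (rule ell2_eqI, rename_tac p, case_tac p) (simp add: coord_relabel)

lemma relabel_swap_swap [simp]: "relabel prod.swap (relabel prod.swap u) = u" by (simp add: relabel_relabel)

lemma flip_op_apply: "flip_op T \<cdot> relabel prod.swap x = relabel prod.swap (T \<cdot> x)" by (simp add: flip_op_def relabel_op_apply)

lemma flip_op_apply': "flip_op T \<cdot> x = relabel prod.swap (T \<cdot> relabel prod.swap x)" by (metis flip_op_apply relabel_swap_swap)

lemma flip_op_algebra: "flip_op (S + T) = flip_op S + flip_op T" "flip_op (S - T) = flip_op S - flip_op T"
  "flip_op (S * T) = flip_op S * flip_op T" "flip_op (c *C T) = c *C flip_op T" "flip_op 1 = 1" "flip_op 0 = 0"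
  "flip_op (adj T) = adj (flip_op T)" unfolding flip_op_def by (simp_all add: relabel_algebra relabel_op_adj)

lemma flip_flip [simp]: "flip_op (flip_op T) = T" by (simp add: flip_op_def relabel_op_relabel_op relabel_op_id)

lemma cinner_flip: "cinner (a \<odot> b) (flip_op T \<cdot> (c \<odot> d)) = cinner (b \<odot> a) (T \<cdot> (d \<odot> c))"
  using relabel_op_cinner[OF bij_swap, of "b \<odot> a" T "d \<odot> c"] by (simp add: flip_op_def)

lemma norm_flip [simp]: "norm (flip_op T) = norm T" by (simp add: flip_op_def norm_relabel_op)

subsection \<open>Tensor products of operators\<close>

text \<open>A product of two one-sided amplifications, the one by S conjugated with the flip;
  boundedness is inherited from the factors.\<close>

lemma tensor_op_ex:
  "\<exists>R :: ('i \<times> 'j) op. (\<forall>x y. R \<cdot> (x \<odot> y) = (S \<cdot> x) \<odot> (T \<cdot> y)) \<and> norm R \<le> norm S * norm T"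
proof -
  obtain R1 :: "('i \<times> 'j) op" where R1: "\<And>x y. R1 \<cdot> (x \<odot> y) = x \<odot> (T \<cdot> y)" "norm R1 \<le> norm T" using tensor_op_right_ex by blast
  obtain R2 :: "('j \<times> 'i) op" where R2: "\<And>x y. R2 \<cdot> (x \<odot> y) = x \<odot> (S \<cdot> y)" "norm R2 \<le> norm S" using tensor_op_right_ex by blast
  have "norm (flip_op R2 * R1) \<le> norm S * norm T" by (rule order_trans[OF norm_mult_ineq]) (simp add: mult_mono R1 R2)
  then show ?thesis by (intro exI[of _ "flip_op R2 * R1"]) (simp add: op_simps R1 R2 flip_op_apply')
qed

lemma tensor_op_apply [simp]: "(S \<otimes> T) \<cdot> (x \<odot> y) = (S \<cdot> x) \<odot> (T \<cdot> y)"
  and norm_tensor_op_le: "norm (S \<otimes> T) \<le> norm S * norm T"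
proof -
  obtain R where R: "\<And>x y. R \<cdot> (x \<odot> y) = (S \<cdot> x) \<odot> (T \<cdot> y)" "norm R \<le> norm S * norm T" using tensor_op_ex by blast
  have "S \<otimes> T = R" unfolding tensor_op_def
  proof (rule the_equality)
    fix Q assume "\<forall>x y. Q \<cdot> (x \<odot> y) = (S \<cdot> x) \<odot> (T \<cdot> y)"
    then show "Q = R" by (intro op_tensor_eqI) (simp add: R)
  qed (simp add: R)
  with R show "(S \<otimes> T) \<cdot> (x \<odot> y) = (S \<cdot> x) \<odot> (T \<cdot> y)" "norm (S \<otimes> T) \<le> norm S * norm T" by simp_all
qed

lemma tensor_op_add_left: "(S + S') \<otimes> T = S \<otimes> T + S' \<otimes> T"
  and tensor_op_add_right: "S \<otimes> (T + T') = S \<otimes> T + S \<otimes> T'"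
  and tensor_op_diff_left: "(S - S') \<otimes> T = S \<otimes> T - S' \<otimes> T"
  and tensor_op_diff_right: "S \<otimes> (T - T') = S \<otimes> T - S \<otimes> T'"
  and tensor_op_scaleC_left: "(c *C S) \<otimes> T = c *C (S \<otimes> T)"
  and tensor_op_scaleC_right: "S \<otimes> (c *C T) = c *C (S \<otimes> T)"
  and tensor_op_mult: "(S \<otimes> T) * (S' \<otimes> T') = (S * S') \<otimes> (T * T')"
  and tensor_op_one [simp]: "1 \<otimes> 1 = 1"
  and tensor_op_zero_left [simp]: "0 \<otimes> T = 0"
  and tensor_op_zero_right [simp]: "S \<otimes> 0 = 0" by (rule op_tensor_eqI, simp add: op_simps tensor_vec_simps)+

lemma tensor_op_sum_left: "sum f F \<otimes> T = (\<Sum>k\<in>F. f k \<otimes> T)"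
  and tensor_op_sum_right: "T \<otimes> sum f F = (\<Sum>k\<in>F. T \<otimes> f k)"
  by (induction F rule: infinite_finite_induct) (auto simp: tensor_op_add_left tensor_op_add_right)

lemma adj_tensor: "adj (S \<otimes> T) = adj S \<otimes> adj T" by (rule op_form_eqI) (simp add: cinner_adj_right)

lemma flip_tensor [simp]: "flip_op (S \<otimes> T) = T \<otimes> S" by (rule op_form_eqI) (simp add: cinner_flip)

lemma bilin_tensor: "bounded_bilinear (\<otimes>)" by (rule bounded_bilinear.intro)
    (auto simp: tensor_op_add_left tensor_op_add_right tensor_op_scaleC_left tensor_op_scaleC_right scaleR_scaleC
      intro!: exI[of _ 1] norm_tensor_op_le)

lemma row_one_tensor: "row k ((1 \<otimes> T) \<cdot> u) = T \<cdot> row k u"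
proof (rule tensor_linear_eqI[where f = "\<lambda>u. row k ((1 \<otimes> T) \<cdot> u)" and g = "\<lambda>u. T \<cdot> row k u"])
  show "bounded_linear (\<lambda>u. row k ((1 \<otimes> T) \<cdot> u))" "bounded_linear (\<lambda>u. T \<cdot> row k u)"
    by (intro bounded_linear_compose[OF bounded_linear_row] bounded_linear_compose[OF linear_op_apply]
      linear_op_apply bounded_linear_row)+
qed (simp_all add: row_simps op_simps)

subsection \<open>Leg numbering\<close>

text \<open>Vector counterparts of the relabellings in \<open>assoc_op\<close> and
  \<open>leg13\<close>. They make the action of \<open>leg12 V\<close> and \<open>leg13 V\<close> on
  elementary tensors explicit when V itself is not an elementary tensor.\<close>

definition assoc_vec :: "(('i \<times> 'j) \<times> 'k) ell2 => ('i \<times> 'j \<times> 'k) ell2" where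
  "assoc_vec = relabel (\<lambda>(i, j, k). ((i, j), k))"

definition swap23_vec :: "('i \<times> 'j \<times> 'k) ell2 => ('i \<times> 'k \<times> 'j) ell2" where
  "swap23_vec = relabel (\<lambda>(i, k, j). (i, j, k))"

lemma bij_assoc [simp]: "bij (\<lambda>(i, j, k). ((i, j), k))" by (rule bijI') auto
lemma bij_swap23 [simp]: "bij (\<lambda>(i, k, j). (i, j, k))" by (rule bijI') auto

lemma assoc_vec_tensor [simp]: "assoc_vec ((a \<odot> b) \<odot> c) = a \<odot> b \<odot> c"
  unfolding assoc_vec_def by (rule ell2_eqI, rename_tac p, case_tac p) (simp add: coord_relabel bij_is_inj)

lemma swap23_vec_tensor [simp]: "swap23_vec (a \<odot> b \<odot> c) = a \<odot> c \<odot> b"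
  unfolding swap23_vec_def by (rule ell2_eqI, rename_tac p, case_tac p) (simp add: coord_relabel bij_is_inj)

lemma bounded_linear_assoc_vec: "bounded_linear assoc_vec"
  and bounded_linear_swap23_vec: "bounded_linear swap23_vec" by (simp_all add: assoc_vec_def swap23_vec_def bounded_linear_relabel)

lemma assoc_vec_linear: "assoc_vec (x + y) = assoc_vec x + assoc_vec y" "assoc_vec (c *C x) = c *C assoc_vec x"
  and swap23_vec_linear: "swap23_vec (u + v) = swap23_vec u + swap23_vec v" "swap23_vec (c *C u) = c *C swap23_vec u"
  by (simp_all add: assoc_vec_def swap23_vec_def relabel_linear)

lemma leg12_apply: "leg12 V \<cdot> assoc_vec (p \<odot> c) = assoc_vec ((V \<cdot> p) \<odot> c)"
  by (simp add: leg12_def assoc_op_def assoc_vec_def relabel_op_apply)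

lemma leg13_apply: "leg13 V \<cdot> swap23_vec (assoc_vec (p \<odot> c)) = swap23_vec (assoc_vec ((V \<cdot> p) \<odot> c))"
  by (simp add: leg13_def swap23_vec_def relabel_op_apply leg12_apply[unfolded assoc_vec_def] assoc_vec_def)

lemma leg12_tensor: "leg12 V \<cdot> (a \<odot> b \<odot> c) = assoc_vec ((V \<cdot> (a \<odot> b)) \<odot> c)"
  using leg12_apply[of V "a \<odot> b" c] by simp

lemma leg13_tensor: "leg13 V \<cdot> (a \<odot> b \<odot> c) = swap23_vec (assoc_vec ((V \<cdot> (a \<odot> c)) \<odot> b))"
  using leg13_apply[of V "a \<odot> c" b] by simp

lemma leg12_algebra: "leg12 (S * T) = leg12 S * leg12 T" "leg12 (adj T) = adj (leg12 T)" "leg12 1 = 1" unfolding leg12_def assoc_op_def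
  by (simp_all add: relabel_algebra(3)[OF bij_assoc, symmetric] relabel_algebra(5)[OF bij_assoc] tensor_op_mult)
    (simp add: relabel_op_adj[OF bij_assoc, symmetric] adj_tensor)

lemma leg13_algebra: "leg13 (S * T) = leg13 S * leg13 T" "leg13 (adj T) = adj (leg13 T)" "leg13 1 = 1" unfolding leg13_def
  by (simp_all add: relabel_algebra(3,5)[OF bij_swap23] relabel_op_adj[OF bij_swap23] leg12_algebra)

lemma leg12_tensor_op: "leg12 (S \<otimes> T) = S \<otimes> T \<otimes> 1"
  and leg13_tensor_op: "leg13 (S \<otimes> T) = S \<otimes> 1 \<otimes> T" by (rule op_form3_eqI, simp add: leg12_tensor leg13_tensor)+

section \<open>Slices and normal functionals\<close>

lemma vsr_ex: "\<exists>!Q. \<forall>a b. cinner b (Q \<cdot> a) = cinner (b \<odot> p) (T \<cdot> (a \<odot> q))"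
proof -
  have "\<exists>Q. \<forall>b a. cinner b (Q \<cdot> a) = cinner (b \<odot> p) (T \<cdot> (a \<odot> q))"
  proof (rule ex_op_form[where C = "norm T * norm p * norm q"])
    fix a b show "cmod (cinner (b \<odot> p) (T \<cdot> (a \<odot> q))) \<le> norm T * norm p * norm q * norm b * norm a"
      using cmod_cinner_op_le[of "b \<odot> p" T "a \<odot> q"] by (simp add: mult_ac)
  qed (simp_all add: tensor_vec_simps cinner_simps op_simps)
  then obtain Q where Q: "\<forall>b a. cinner b (Q \<cdot> a) = cinner (b \<odot> p) (T \<cdot> (a \<odot> q))" ..
  then show ?thesis by (intro ex1I[of _ Q]) (auto intro: op_eqI_cinner)
qed

lemma cinner_vsr: "cinner b (vsr p q T \<cdot> a) = cinner (b \<odot> p) (T \<cdot> (a \<odot> q))"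
  using theI'[OF vsr_ex[of p T q]] unfolding vec_slice_right_def by blast

lemma vsl_ex: "\<exists>!Q. \<forall>a b. cinner b (Q \<cdot> a) = cinner (p \<odot> b) (T \<cdot> (q \<odot> a))"
  using vsr_ex[of p "flip_op T" q] by (simp add: cinner_flip)

lemma cinner_vsl: "cinner b (vsl p q T \<cdot> a) = cinner (p \<odot> b) (T \<cdot> (q \<odot> a))"
  using theI'[OF vsl_ex[of p T q]] unfolding vec_slice_left_def by blast

lemma vsr_flip: "vsr p q (flip_op T) = vsl p q T" by (rule op_eqI_cinner, simp add: cinner_vsr cinner_vsl cinner_flip)+

lemma vsl_flip: "vsl p q (flip_op T) = vsr p q T" using vsr_flip[of p q "flip_op T"] by simp

lemma cinner_tensor_op: "cinner (a \<odot> b) ((P \<otimes> Q) \<cdot> u) = cinner ((adj P \<cdot> a) \<odot> (adj Q \<cdot> b)) u"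
  by (simp only: cinner_adj_left[symmetric] adj_tensor tensor_op_apply)

lemma vsr_add: "vsr p q (S + T) = vsr p q S + vsr p q T"
  and vsr_diff: "vsr p q (S - T) = vsr p q S - vsr p q T"
  and vsr_scaleC: "vsr p q (c *C T) = c *C vsr p q T"
  and vsr_zero [simp]: "vsr p q 0 = 0"
  and vsr_tensor: "vsr p q (A \<otimes> B) = cinner p (B \<cdot> q) *C A" by (rule op_eqI_cinner, simp add: cinner_vsr cinner_simps op_simps)+

lemma vsl_add: "vsl p q (S + T) = vsl p q S + vsl p q T"
  and vsl_diff: "vsl p q (S - T) = vsl p q S - vsl p q T"
  and vsl_scaleC: "vsl p q (c *C T) = c *C vsl p q T"
  and vsl_zero [simp]: "vsl p q 0 = 0"
  and vsl_add_vec1: "vsl (p + p') q T = vsl p q T + vsl p' q T"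
  and vsl_add_vec2: "vsl p (q + q') T = vsl p q T + vsl p q' T"
  and vsl_scaleC_vec1: "vsl (c *C p) q T = cnj c *C vsl p q T"
  and vsl_scaleC_vec2: "vsl p (c *C q) T = c *C vsl p q T"
  and vsl_tensor: "vsl p q (A \<otimes> B) = cinner p (A \<cdot> q) *C B"
  by (rule op_eqI_cinner, simp add: cinner_vsl cinner_simps op_simps tensor_vec_simps)+

lemma adj_vsr: "adj (vsr p q T) = vsr q p (adj T)" by (rule adj_unique) (metis cinner_commute cinner_vsr cinner_adj_right)

lemma adj_vsl: "adj (vsl p q T) = vsl q p (adj T)" by (rule adj_unique) (metis cinner_commute cinner_vsl cinner_adj_right)

lemma vsr_sum: "vsr p q (sum f F) = (\<Sum>k\<in>F. vsr p q (f k))" by (induction F rule: infinite_finite_induct) (auto simp: vsr_add)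

lemma vsl_sum: "vsl p q (sum f F) = (\<Sum>k\<in>F. vsl p q (f k))" by (induction F rule: infinite_finite_induct) (auto simp: vsl_add)

lemma vsr_mult_in: "vsr p q ((1 \<otimes> A) * T) = vsr (adj A \<cdot> p) q T"
  "vsr p q (T * (1 \<otimes> A)) = vsr p (A \<cdot> q) T"
  and vsr_mult_out: "vsr p q ((B \<otimes> 1) * T) = B * vsr p q T"
  "vsr p q (T * (B \<otimes> 1)) = vsr p q T * B" by (rule op_eqI_cinner, simp add: cinner_vsr op_simps cinner_tensor_op,
      (simp only: cinner_vsr[symmetric] cinner_adj_left)?)+

lemma vsl_mult_in: "vsl p q ((B \<otimes> 1) * T) = vsl (adj B \<cdot> p) q T"
  "vsl p q (T * (B \<otimes> 1)) = vsl p (B \<cdot> q) T"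
  and vsl_mult_out: "vsl p q ((1 \<otimes> A) * T) = A * vsl p q T"
  "vsl p q (T * (1 \<otimes> A)) = vsl p q T * A" by (rule op_eqI_cinner, simp add: cinner_vsl op_simps cinner_tensor_op,
      (simp only: cinner_vsl[symmetric] cinner_adj_left)?)+

lemma norm_vsr_le: "norm (vsr p q T) \<le> norm p * norm q * norm T"
proof (rule norm_op_cinner_leI)
  fix x y show "cmod (cinner x (vsr p q T \<cdot> y)) \<le> norm p * norm q * norm T * norm x * norm y"
    using cmod_cinner_op_le[of "x \<odot> p" T "y \<odot> q"] by (simp add: cinner_vsr mult_ac)
qed simp

lemma norm_vsl_le: "norm (vsl p q T) \<le> norm p * norm q * norm T" using norm_vsr_le[of p q "flip_op T"] by (simp add: vsr_flip)

lemma bounded_linear_vsl: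
  fixes p q :: "'i ell2" shows "bounded_linear (vsl p q :: ('i \<times> 'j) op => 'j op)"
proof (rule bounded_linear_intro[where K = "norm p * norm q"])
  show "norm (vsl p q T) \<le> norm T * (norm p * norm q)" for T :: "('i \<times> 'j) op" using norm_vsl_le[of p q T] by (simp add: mult_ac)
qed (simp_all add: vsl_add scaleR_scaleC vsl_scaleC)

lemma bounded_linear_vsr:
  fixes p q :: "'j ell2" shows "bounded_linear (vsr p q :: ('i \<times> 'j) op => 'i op)"
proof (rule bounded_linear_intro[where K = "norm p * norm q"])
  show "norm (vsr p q T) \<le> norm T * (norm p * norm q)" for T :: "('i \<times> 'j) op" using norm_vsr_le[of p q T] by (simp add: mult_ac)
qed (simp_all add: vsr_add scaleR_scaleC vsr_scaleC)

lemma bounded_linear_vsl_vec2: "bounded_linear (\<lambda>q. vsl p q T)"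
proof (rule bounded_linear_intro[where K = "norm p * norm T"])
  show "norm (vsl p q T) \<le> norm q * (norm p * norm T)" for q using norm_vsl_le[of p q T] by (simp add: mult_ac)
qed (simp_all add: vsl_add_vec2 scaleR_scaleC vsl_scaleC_vec2)

lemma bounded_linear_vsr_vec2: "bounded_linear (\<lambda>q. vsr p q T)" using bounded_linear_vsl_vec2[of p "flip_op T"] by (simp add: vsl_flip)

lemma op_vsl_eqI: "(\<And>p q. vsl p q S = vsl p q T) ==> S = T" by (rule op_form_eqI) (metis cinner_vsl)

lemma op_vsr_eqI: "(\<And>p q. vsr p q S = vsr p q T) ==> S = T" by (rule op_form_eqI) (metis cinner_vsr)

text \<open>That a leg of T lies in a von Neumann algebra is expressed through this equivalence,
  with y running through the commutant.\<close>

lemma commutes_left_leg: "(\<forall>p q. vsr p q T * y = y * vsr p q T) \<longleftrightarrow> T * (y \<otimes> 1) = (y \<otimes> 1) * T"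
  by (metis op_vsr_eqI vsr_mult_out)

lemma commutes_right_leg: "(\<forall>p q. vsl p q T * y = y * vsl p q T) \<longleftrightarrow> T * (1 \<otimes> y) = (1 \<otimes> y) * T"
  by (metis op_vsl_eqI vsl_mult_out)

subsection \<open>Normal functionals\<close>

lemma normal_functionalD:
  assumes "nfun w"
  shows "\<exists>x \<eta>. summable (\<lambda>n::nat. (norm (x n))\<^sup>2) \<and> summable (\<lambda>n. (norm (\<eta> n))\<^sup>2) \<and>
    (\<forall>T. (\<lambda>n. cinner (\<eta> n) (T \<cdot> x n)) sums w T) \<and> summable (\<lambda>n. norm (\<eta> n) * norm (x n))"
proof -
  obtain x \<eta> where s: "summable (\<lambda>n::nat. (norm (x n))\<^sup>2)" "summable (\<lambda>n. (norm (\<eta> n))\<^sup>2)"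
    and w: "\<And>T. w T = (\<Sum>n. cinner (\<eta> n) (T \<cdot> x n))" using assms unfolding normal_functional_def by blast
  have p: "summable (\<lambda>n. norm (\<eta> n) * norm (x n))"
  proof (rule summable_comparison_test'[OF summable_add[OF s]])
    fix n :: nat
    have n0: "0 \<le> norm (\<eta> n) * norm (x n)" by simp
    moreover have "2 * (norm (\<eta> n) * norm (x n)) \<le> (norm (\<eta> n))\<^sup>2 + (norm (x n))\<^sup>2"
      using sum_squares_bound[of "norm (\<eta> n)" "norm (x n)"] by simp
    ultimately show "norm (norm (\<eta> n) * norm (x n)) \<le> (norm (x n))\<^sup>2 + (norm (\<eta> n))\<^sup>2"
      unfolding real_norm_def abs_of_nonneg[OF n0] by linarith
  qed
  have "summable (\<lambda>n. cinner (\<eta> n) (T \<cdot> x n))" for T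
  proof (rule summable_comparison_test'[OF summable_mult[OF p, of "norm T"]])
    fix n :: nat show "norm (cinner (\<eta> n) (T \<cdot> x n)) \<le> norm T * (norm (\<eta> n) * norm (x n))"
      using cmod_cinner_op_le[of "\<eta> n" T "x n"] by (simp add: mult_ac)
  qed
  then show ?thesis using s p w by - (rule exI[of _ x], rule exI[of _ \<eta>], auto simp: summable_sums)
qed

lemma normal_linear:
  assumes "nfun w"
  shows "w (S + T) = w S + w T" "w (c *C T) = c * w T" "w (S - T) = w S - w T" "w 0 = 0"
    "bounded_linear w" "w (sum f F) = (\<Sum>k\<in>F. w (f k))"
proof -
  obtain x \<eta> where w: "\<And>T. (\<lambda>n. cinner (\<eta> n) (T \<cdot> x n)) sums w T" "summable (\<lambda>n. norm (\<eta> n) * norm (x n))"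
    using normal_functionalD[OF assms] by blast
  show add: "w (S + T) = w S + w T" for S T
    using sums_unique2[OF w(1)[of "S + T"]] sums_add[OF w(1)[of S] w(1)[of T]] by (simp add: op_simps cinner_simps)
  show scale: "w (c *C T) = c * w T" for c T using sums_unique2[OF w(1)[of "c *C T"]] sums_mult[OF w(1)[of T]] by (simp add: op_simps cinner_simps)
  show "w (S - T) = w S - w T" using add[of S "(-1) *C T"] scale[of "-1" T] by simp
  show "w 0 = 0" using add[of 0 0] by simp
  show bl: "bounded_linear w"
  proof (rule bounded_linear_intro[where K = "\<Sum>n. norm (\<eta> n) * norm (x n)"])
    fix T :: "'a op"
    have s: "summable (\<lambda>n. norm (cinner (\<eta> n) (T \<cdot> x n)))"
      by (rule summable_comparison_test'[OF summable_mult[OF w(2), of "norm T"]])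
        (use cmod_cinner_op_le[of "\<eta> _" T "x _"] in \<open>auto simp: mult_ac\<close>)
    have "norm (w T) \<le> (\<Sum>n. norm (cinner (\<eta> n) (T \<cdot> x n)))" using summable_norm[OF s] w(1)[of T] by (simp add: sums_iff)
    also have "\<dots> \<le> (\<Sum>n. norm T * (norm (\<eta> n) * norm (x n)))"
      by (rule suminf_le[OF _ s summable_mult[OF w(2)]]) (use cmod_cinner_op_le[of "\<eta> _" T "x _"] in \<open>auto simp: mult_ac\<close>)
    also have "\<dots> = norm T * (\<Sum>n. norm (\<eta> n) * norm (x n))" by (rule suminf_mult[OF w(2)])
    finally show "norm (w T) \<le> norm T * (\<Sum>n. norm (\<eta> n) * norm (x n))" .
  qed (simp_all add: add scaleR_scaleC scale scaleR_conv_of_real)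
  show "w (sum f F) = (\<Sum>k\<in>F. w (f k))" by (rule linear_sum[OF bounded_linear.linear[OF bl]])
qed

text \<open>The index type \<open>'k\<close> may be uncountable, but a vector has only countably
  many nonzero rows; enumerating them gives the two square-summable sequences demanded by
  \<open>normal_functional\<close>.\<close>

lemma normal_packed:
  fixes u v :: "('k \<times> 'i) ell2"
  shows "nfun (\<lambda>T. cinner v ((1 \<otimes> T) \<cdot> u))"
proof -
  define K where "K = {k. row k u \<noteq> 0 \<or> row k v \<noteq> 0}"
  have "countable {k \<in> UNIV. (norm (row k w))\<^sup>2 \<noteq> 0}" for w :: "('k \<times> 'i) ell2"
    by (rule abs_summable_countable) (use norm_row_has_sum[of w] in \<open>auto simp: summable_on_def\<close>)
  from this[of u] this[of v] have K: "countable K" unfolding K_def Collect_disj_eq by simp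
  define e where "e = to_nat_on K"
  have e: "inj_on e K" unfolding e_def by (rule inj_on_to_nat_on[OF K])
  define f where "f w n = (if n \<in> e ` K then row (the_inv_into K e n) w else 0)" for w :: "('k \<times> 'i) ell2" and n
  have fe: "f w (e k) = row k w" if "k \<in> K" for w k using that by (simp add: f_def the_inv_into_f_f[OF e])
  have reindex: "(g has_sum S) UNIV" if h: "(h has_sum S) UNIV" and gh: "\<And>k. k \<in> K ==> g (e k) = h k"
      and "\<And>k. k \<notin> K ==> h k = 0" "\<And>n. n \<notin> e ` K ==> g n = 0"
    for g :: "nat => 'z :: real_normed_vector" and h S
  proof -
    have "(h has_sum S) K" using h by (rule has_sum_cong_neutral[THEN iffD1, rotated -1]) (use that in auto)
    then have "(g \<circ> e has_sum S) K" by (rule has_sum_cong[THEN iffD1, rotated]) (use gh in auto)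
    then have "(g has_sum S) (e ` K)" by (simp add: has_sum_reindex[OF e])
    then show ?thesis by (rule has_sum_cong_neutral[THEN iffD1, rotated -1]) (use that in auto)
  qed
  have "((\<lambda>n. (norm (f w n))\<^sup>2) has_sum (norm w)\<^sup>2) UNIV" if "w = u \<or> w = v" for w
  proof (rule reindex[OF norm_row_has_sum])
    show "(norm (row k w))\<^sup>2 = 0" if "k \<notin> K" for k using that \<open>w = u \<or> w = v\<close> by (auto simp: K_def)
    show "(norm (f w n))\<^sup>2 = 0" if "n \<notin> e ` K" for n using that by (simp add: f_def)
  qed (simp add: fe)
  then have "summable (\<lambda>n. (norm (f w n))\<^sup>2)" if "w = u \<or> w = v" for w using that has_sum_imp_sums sums_summable by blast
  moreover have "(\<lambda>n. cinner (f v n) (T \<cdot> f u n)) sums cinner v ((1 \<otimes> T) \<cdot> u)" for T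
  proof (rule has_sum_imp_sums, rule reindex[OF cinner_row_has_sum])
    show "cinner (row k v) (row k ((1 \<otimes> T) \<cdot> u)) = 0" if "k \<notin> K" for k using that by (auto simp: K_def)
    show "cinner (f v n) (T \<cdot> f u n) = 0" if "n \<notin> e ` K" for n using that by (simp add: f_def)
  qed (simp add: fe row_one_tensor)
  ultimately show ?thesis unfolding normal_functional_def by (intro exI[of _ "f u"] exI[of _ "f v"]) (simp add: sums_iff)
qed

text \<open>The two sequences become the rows of single vectors over nat. A normal functional is
  thus a vector functional of an amplification, and stability under the operations below is a
  computation with vectors.\<close>

lemma normal_unpack:
  assumes "nfun w"
  obtains u v :: "(nat \<times> 'i) ell2" where "\<And>T :: 'i op. w T = cinner v ((1 \<otimes> T) \<cdot> u)"
proof -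
  obtain x \<eta> where w: "summable (\<lambda>n::nat. (norm (x n))\<^sup>2)" "summable (\<lambda>n. (norm (\<eta> n))\<^sup>2)"
    "\<And>T. (\<lambda>n. cinner (\<eta> n) (T \<cdot> x n)) sums w T" using normal_functionalD[OF assms] by blast
  obtain u where u: "\<And>k. row k u = x k" using ex_rows[of x] w(1) by (auto simp: summable_on_UNIV_nonneg_real_iff)
  obtain v where v: "\<And>k. row k v = \<eta> k" using ex_rows[of \<eta>] w(2) by (auto simp: summable_on_UNIV_nonneg_real_iff)
  have "w T = cinner v ((1 \<otimes> T) \<cdot> u)" for T using has_sum_imp_sums[OF cinner_row_has_sum[of v "(1 \<otimes> T) \<cdot> u"]] w(3)[of T]
    by (simp add: row_one_tensor u v sums_unique2)
  then show thesis by (rule that)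
qed

lemma normal_vec: "nfun (\<lambda>T. cinner a (T \<cdot> b))" using normal_packed[of "ket () \<odot> a" "ket () \<odot> b"] by (simp add: coord_ket)

lemma assoc_one_tensor: "(1 \<otimes> 1 \<otimes> T) \<cdot> assoc_vec u = assoc_vec ((1 \<otimes> T) \<cdot> u)"
  and assoc_cinner: "cinner (assoc_vec u') (assoc_vec v') = cinner u' v'"
proof -
  have "relabel_op (\<lambda>(i, j, k). ((i, j), k)) (1 \<otimes> T) = 1 \<otimes> 1 \<otimes> T" by (rule op_form3_eqI)
       (metis assoc_vec_def assoc_vec_tensor op_apply_one relabel_op_apply bij_assoc tensor_op_apply)
  then show "(1 \<otimes> 1 \<otimes> T) \<cdot> assoc_vec u = assoc_vec ((1 \<otimes> T) \<cdot> u)"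
    by (metis assoc_vec_def bij_assoc relabel_op_apply)
  show "cinner (assoc_vec u') (assoc_vec v') = cinner u' v'" by (simp add: assoc_vec_def cinner_relabel)
qed

text \<open>Reassociation merges the auxiliary leg with \<open>'k\<close>: the composite is again a
  vector functional of an amplification, with auxiliary index in \<open>nat \<times> 'k\<close>, and
  \<open>normal_packed\<close> turns it back into sequences.\<close>

lemma normal_comp:
  fixes g :: "('k \<times> 'i) op => complex"
  assumes "nfun g"
  shows "nfun (\<lambda>x. g (A * (1 \<otimes> x) * B))"
proof -
  obtain u v :: "(nat \<times> 'k \<times> 'i) ell2" where g: "\<And>T. g T = cinner v ((1 \<otimes> T) \<cdot> u)"
    using normal_unpack[OF assms] by blast
  have *: "\<exists>w. z = assoc_vec w" for z :: "(nat \<times> 'k \<times> 'i) ell2"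
    unfolding assoc_vec_def using relabel_inv(1)[OF bij_assoc, of z] by metis
  obtain u' v' where uv: "(1 \<otimes> B) \<cdot> u = assoc_vec u'" "(1 \<otimes> adj A) \<cdot> v = assoc_vec v'" using * by blast
  have "g (A * (1 \<otimes> x) * B) = cinner v' ((1 \<otimes> x) \<cdot> u')" for x
  proof -
    have "g (A * (1 \<otimes> x) * B) = cinner v ((1 \<otimes> A) \<cdot> (1 \<otimes> 1 \<otimes> x) \<cdot> (1 \<otimes> B) \<cdot> u)"
      by (simp add: g op_apply_mult[symmetric] tensor_op_mult mult.assoc)
    also have "\<dots> = cinner ((1 \<otimes> adj A) \<cdot> v) ((1 \<otimes> 1 \<otimes> x) \<cdot> (1 \<otimes> B) \<cdot> u)"
      by (simp add: cinner_adj_right[symmetric] adj_tensor)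
    also have "\<dots> = cinner v' ((1 \<otimes> x) \<cdot> u')" unfolding uv using assoc_one_tensor[of x u'] by (simp add: assoc_cinner)
    finally show ?thesis .
  qed
  then show ?thesis by (simp add: normal_packed)
qed

lemma cinner_relabel_op:
  assumes "bij s"
  shows "cinner a (relabel_op s T \<cdot> b) = cinner (relabel (inv s) a) (T \<cdot> relabel (inv s) b)"
  using relabel_op_cinner[OF assms, of "relabel (inv s) a" T "relabel (inv s) b"] by (simp add: relabel_inv assms)

lemma relabel_normal:
  assumes "nfun w" "bij s"
  shows "nfun (\<lambda>T. w (relabel_op s T))"
proof -
  obtain x \<eta> where w: "summable (\<lambda>n::nat. (norm (x n))\<^sup>2)" "summable (\<lambda>n. (norm (\<eta> n))\<^sup>2)"
    "\<And>T. (\<lambda>n. cinner (\<eta> n) (T \<cdot> x n)) sums w T" using normal_functionalD[OF assms(1)] by blast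
  have "w (relabel_op s T) = (\<Sum>n. cinner (relabel (inv s) (\<eta> n)) (T \<cdot> relabel (inv s) (x n)))" for T
    using sums_unique[OF w(3)[of "relabel_op s T"]] by (simp add: cinner_relabel_op assms)
  then show ?thesis unfolding normal_functional_def using w(1,2)
    by (intro exI[of _ "\<lambda>n. relabel (inv s) (x n)"] exI[of _ "\<lambda>n. relabel (inv s) (\<eta> n)"])
      (simp add: norm_relabel bij_imp_bij_inv assms)
qed

lemma flip_normal: "nfun w ==> nfun (\<lambda>T. w (flip_op T))" unfolding flip_op_def by (rule relabel_normal) simp_all

lemma normal_comp_left:
  fixes w :: "('i \<times> 'k) op => complex"
  assumes "nfun w"
  shows "nfun (\<lambda>x. w (A * (x \<otimes> 1) * B))"
proof -
  have "nfun (\<lambda>x. w (flip_op (flip_op A * (1 \<otimes> x) * flip_op B)))" by (rule normal_comp[OF flip_normal[OF assms]])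
  then show ?thesis by (simp add: flip_op_algebra)
qed

lemma normal_mult:
  assumes "nfun w"
  shows "nfun (\<lambda>x. w (A * x * B))"
proof -
  obtain u v :: "(nat \<times> 'a) ell2" where w: "\<And>T. w T = cinner v ((1 \<otimes> T) \<cdot> u)" using normal_unpack[OF assms] by blast
  have "w (A * x * B) = cinner ((1 \<otimes> adj A) \<cdot> v) ((1 \<otimes> x) \<cdot> (1 \<otimes> B) \<cdot> u)" for x
    by (simp add: w cinner_adj_right[symmetric] adj_tensor op_apply_mult[symmetric] tensor_op_mult mult.assoc)
  then show ?thesis by (simp add: normal_packed)
qed

lemma normal_mult_left: "nfun w ==> nfun (\<lambda>x. w (A * x))"
  and normal_mult_right: "nfun w ==> nfun (\<lambda>x. w (x * A))" using normal_mult[of w A 1] normal_mult[of w 1 A] by simp_all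

lemma normal_scaleC: "nfun w ==> nfun (\<lambda>x. c * w x)" using normal_mult_left[of w "c *C 1"] by (simp add: scaleC_mult_left normal_linear)

lemma normal_zero: "nfun (\<lambda>x. 0)" using normal_vec[of 0 0] by simp

lemma normal_add:
  assumes "nfun w" "nfun p"
  shows "nfun (\<lambda>x. w x + p x)"
proof -
  obtain u v :: "(nat \<times> 'a) ell2" where w: "\<And>T. w T = cinner v ((1 \<otimes> T) \<cdot> u)" using normal_unpack[OF assms(1)] by blast
  obtain u' v' :: "(nat \<times> 'a) ell2" where p: "\<And>T. p T = cinner v' ((1 \<otimes> T) \<cdot> u')" using normal_unpack[OF assms(2)] by blast
  \<comment> \<open>A leg over bool carries both pairs of representing vectors; orthogonality of
    \<open>ket True\<close> and \<open>ket False\<close> removes the cross terms.\<close>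
  have "nfun (\<lambda>T. cinner (ket True \<odot> v + ket False \<odot> v') (T \<cdot> (ket True \<odot> u + ket False \<odot> u')))"
    by (rule normal_vec)
  from normal_comp[OF this, of 1 1]
  have "nfun (\<lambda>T :: (nat \<times> 'a) op. cinner v (T \<cdot> u) + cinner v' (T \<cdot> u'))" by (simp add: cinner_simps op_simps coord_ket)
  from normal_comp[OF this, of 1 1] show ?thesis by (simp add: w p)
qed

lemma normal_sum: "(\<And>k. k \<in> F ==> nfun (w k)) ==> nfun (\<lambda>x. \<Sum>k\<in>F. w k x)"
  by (induction F rule: infinite_finite_induct) (auto intro: normal_zero normal_add)

lemma normal_diff:
  assumes "nfun w" "nfun p"
  shows "nfun (\<lambda>x. w x - p x)" using normal_add[OF assms(1) normal_scaleC[OF assms(2), of "-1"]] by simp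

lemma normal_cnj: "nfun w ==> nfun (\<lambda>x. cnj (w (adj x)))"
proof -
  assume "nfun w"
  then obtain u v :: "(nat \<times> 'a) ell2" where w: "\<And>T. w T = cinner v ((1 \<otimes> T) \<cdot> u)" using normal_unpack by blast
  have "cnj (w (adj x)) = cinner u ((1 \<otimes> x) \<cdot> v)" for x
    unfolding w cinner_commute[symmetric] by (simp add: cinner_adj_left[symmetric] adj_tensor)
  then show ?thesis by (simp add: normal_packed)
qed

text \<open>The slice by a general normal functional is a norm-convergent series of vector slices.
  Membership of slices in norm-closed subspaces thus reduces to vector slices.\<close>

lemma normal_slice_sums:
  assumes "nfun w"
  shows "\<exists>x \<eta> R. (\<lambda>n. vsl (\<eta> n) (x n) T) sums R \<and>
    (\<forall>T. (\<lambda>n :: nat. cinner (\<eta> n) (T \<cdot> x n)) sums w T) \<and>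
    (\<forall>p q. cinner p (R \<cdot> q) = w (vsr p q T))"
proof -
  obtain x \<eta> where w: "\<And>T. (\<lambda>n. cinner (\<eta> n) (T \<cdot> x n)) sums w T" "summable (\<lambda>n. norm (\<eta> n) * norm (x n))"
    using normal_functionalD[OF assms] by blast
  have "summable (\<lambda>n. norm (vsl (\<eta> n) (x n) T))" by (rule summable_comparison_test'[OF summable_mult[OF w(2), of "norm T"]])
      (use norm_vsl_le[of "\<eta> _" "x _" T] in \<open>auto simp: mult_ac\<close>)
  then obtain R where R: "(\<lambda>n. vsl (\<eta> n) (x n) T) sums R" using summable_sums[OF summable_norm_cancel] by metis
  have "cinner p (R \<cdot> q) = w (vsr p q T)" for p q
  proof (rule sums_unique2[OF _ w(1)])
    have "bounded_linear (\<lambda>R. cinner p (R \<cdot> q))"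
      by (intro bounded_linear_compose[OF bounded_linear_cinner_right] bounded_bilinear.bounded_linear_left[OF bounded_bilinear_op_apply])
    from bounded_linear.sums[OF this R]
    show "(\<lambda>n. cinner (\<eta> n) (vsr p q T \<cdot> x n)) sums cinner p (R \<cdot> q)" by (simp add: cinner_vsl cinner_vsr)
  qed
  with R w(1) show ?thesis by (intro exI[of _ x] exI[of _ \<eta>] exI[of _ R] conjI allI)
qed

lemma cinner_slice_left:
  assumes "nfun w"
  shows "cinner p (slice_left w T \<cdot> q) = w (vsr p q T)"
proof -
  obtain x \<eta> R where "(\<lambda>n. vsl (\<eta> n) (x n) T) sums R"
    "\<And>T. (\<lambda>n :: nat. cinner (\<eta> n) (T \<cdot> x n)) sums w T"
    and R: "\<And>p q. cinner p (R \<cdot> q) = w (vsr p q T)" using normal_slice_sums[OF assms, of T] by blast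
  have "slice_left w T = R" unfolding slice_left_def by (rule the_equality) (auto simp: R intro: op_eqI_cinner)
  then show ?thesis by (simp add: R)
qed

lemma slice_left_eqI: "nfun w ==> (\<And>p q. cinner p (R \<cdot> q) = w (vsr p q T)) ==> slice_left w T = R"
  by (rule op_eqI_cinner) (simp add: cinner_slice_left)

lemma slice_left_sums:
  assumes "nfun w"
  shows "\<exists>x \<eta>. (\<lambda>n. vsl (\<eta> n) (x n) T) sums slice_left w T \<and>
    (\<forall>T. (\<lambda>n :: nat. cinner (\<eta> n) (T \<cdot> x n)) sums w T)"
proof -
  obtain x \<eta> R where *: "(\<lambda>n. vsl (\<eta> n) (x n) T) sums R"
    "\<And>T. (\<lambda>n :: nat. cinner (\<eta> n) (T \<cdot> x n)) sums w T"
    and R: "\<And>p q. cinner p (R \<cdot> q) = w (vsr p q T)" using normal_slice_sums[OF assms, of T] by blast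
  from R have "slice_left w T = R" by (rule slice_left_eqI[OF assms])
  with * show ?thesis by (intro exI[of _ x] exI[of _ \<eta>] conjI allI) simp_all
qed

lemma slice_right_flip: "slice_right w T = slice_left w (flip_op T)" unfolding slice_right_def slice_left_def vsr_flip ..

lemma cinner_slice_right:
  "nfun w ==> cinner p (slice_right w T \<cdot> q) = w (vsl p q T)" by (simp add: slice_right_flip cinner_slice_left vsr_flip)

lemma slice_left_vec: "slice_left (\<lambda>T. cinner a (T \<cdot> b)) X = vsl a b X"
  and slice_right_vec: "slice_right (\<lambda>T. cinner a (T \<cdot> b)) X' = vsr a b X'"
  by (rule op_eqI_cinner, simp add: cinner_slice_left cinner_slice_right normal_vec cinner_vsl cinner_vsr)+

lemma slice_left_algebra:
  assumes "nfun w"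
  shows "slice_left w (S + T) = slice_left w S + slice_left w T"
    "slice_left w (S - T) = slice_left w S - slice_left w T"
    "slice_left w (c *C T) = c *C slice_left w T"
    "slice_left w (A \<otimes> B) = w A *C B"
    "slice_left w ((1 \<otimes> Q) * T) = Q * slice_left w T"
    "slice_left w (T * (1 \<otimes> Q)) = slice_left w T * Q"
    "slice_left w ((P \<otimes> 1) * T * (P' \<otimes> 1)) = slice_left (\<lambda>x. w (P * x * P')) T"
    "adj (slice_left w T) = slice_left (\<lambda>x. cnj (w (adj x))) (adj T)"
proof -
  note lin = normal_linear[OF assms] and sl = cinner_slice_left[OF assms] and eqI = slice_left_eqI[OF assms]
  show "slice_left w (S + T) = slice_left w S + slice_left w T" by (rule eqI) (simp add: op_simps cinner_simps sl lin vsr_add)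
  show "slice_left w (S - T) = slice_left w S - slice_left w T" by (rule eqI) (simp add: op_simps cinner_simps sl lin vsr_diff)
  show "slice_left w (c *C T) = c *C slice_left w T" by (rule eqI) (simp add: op_simps cinner_simps sl lin vsr_scaleC)
  show "slice_left w (A \<otimes> B) = w A *C B" by (rule eqI) (simp add: op_simps cinner_simps lin vsr_tensor)
  show "slice_left w ((1 \<otimes> Q) * T) = Q * slice_left w T" by (rule eqI) (simp add: op_simps vsr_mult_in sl[symmetric] cinner_adj_left)
  show "slice_left w (T * (1 \<otimes> Q)) = slice_left w T * Q" by (rule eqI) (simp add: op_simps vsr_mult_in sl)
  show "slice_left w ((P \<otimes> 1) * T * (P' \<otimes> 1)) = slice_left (\<lambda>x. w (P * x * P')) T"
    by (rule eqI) (simp add: cinner_slice_left[OF normal_mult[OF assms]] vsr_mult_out)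
  show "adj (slice_left w T) = slice_left (\<lambda>x. cnj (w (adj x))) (adj T)"
  proof (rule slice_left_eqI[OF normal_cnj[OF assms], symmetric])
    fix p q
    have "cinner p (adj (slice_left w T) \<cdot> q) = cnj (cinner q (slice_left w T \<cdot> p))" unfolding cinner_adj_right by (rule cinner_commute)
    then show "cinner p (adj (slice_left w T) \<cdot> q) = cnj (w (adj (vsr p q (adj T))))" by (simp add: sl adj_vsr)
  qed
qed

text \<open>The left slice is a norm-convergent series of vector slices, on which the bounded
  functional \<open>p\<close> acts term by term; the result is the series of \<open>w\<close> at the
  right slice.\<close>

lemma fubini_slices:
  assumes "nfun w" "nfun p"
  shows "w (slice_right p X) = p (slice_left w X)"
proof -
  obtain x \<eta> where s: "(\<lambda>n. vsl (\<eta> n) (x n) X) sums slice_left w X"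
    "\<And>T. (\<lambda>n :: nat. cinner (\<eta> n) (T \<cdot> x n)) sums w T" using slice_left_sums[OF assms(1), of X] by blast
  have "(\<lambda>n. p (vsl (\<eta> n) (x n) X)) sums p (slice_left w X)" by (rule bounded_linear.sums[OF normal_linear(5)[OF assms(2)] s(1)])
  then show ?thesis using s(2)[of "slice_right p X"] by (simp add: cinner_slice_right assms sums_unique2)
qed

section \<open>Projections and the bicommutant theorem\<close>

lemma complex_spanI: "x \<in> S ==> x \<in> cspan S" unfolding complex_span_def by (auto intro!: exI[of _ "{x}"] exI[of _ "\<lambda>_. 1"])

lemma complex_span_zero: "0 \<in> cspan S" unfolding complex_span_def by (auto intro!: exI[of _ "{}"])

lemma complex_span_scaleC: "x \<in> cspan S ==> c *C x \<in> cspan S" unfolding complex_span_def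
proof safe
  fix F b assume F: "finite F" "F \<subseteq> S"
  show "\<exists>F' b'. c *C (\<Sum>x\<in>F. b x *C x) = (\<Sum>x\<in>F'. b' x *C x) \<and> finite F' \<and> F' \<subseteq> S"
    by (rule exI[of _ F], rule exI[of _ "\<lambda>x. c * b x"]) (use F in \<open>simp add: scaleC_sum_right scaleC_scaleC\<close>)
qed

lemma complex_span_add: "x \<in> cspan S ==> y \<in> cspan S ==> x + y \<in> cspan S" unfolding complex_span_def
proof safe
  fix F G b c assume F: "finite F" "F \<subseteq> S" and G: "finite G" "G \<subseteq> S"
  have "(\<Sum>x\<in>F. b x *C x) = (\<Sum>x\<in>F \<union> G. (if x \<in> F then b x else 0) *C x)"
    using F G by (intro sum.mono_neutral_cong_left) auto
  moreover have "(\<Sum>x\<in>G. c x *C x) = (\<Sum>x\<in>F \<union> G. (if x \<in> G then c x else 0) *C x)"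
    using F G by (intro sum.mono_neutral_cong_left) auto
  ultimately have "(\<Sum>x\<in>F. b x *C x) + (\<Sum>x\<in>G. c x *C x) =
      (\<Sum>x\<in>F \<union> G. ((if x \<in> F then b x else 0) + (if x \<in> G then c x else 0)) *C x)"
    by (simp add: sum.distrib[symmetric] scaleC_add_left)
  then show "\<exists>F' b'. (\<Sum>x\<in>F. b x *C x) + (\<Sum>x\<in>G. c x *C x) = (\<Sum>x\<in>F'. b' x *C x) \<and> finite F' \<and> F' \<subseteq> S"
    by (rule_tac exI[of _ "F \<union> G"], rule_tac exI) (use F G in auto)
qed

lemma complex_span_induct [consumes 1, case_names zero add base]:
  assumes "x \<in> cspan S" "P 0" "\<And>x y. P x ==> P y ==> P (x + y)" "\<And>c x. x \<in> S ==> P (c *C x)"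
  shows "P x"
proof -
  obtain F c where F: "finite F" "F \<subseteq> S" and x: "x = (\<Sum>x\<in>F. c x *C x)" using assms(1) unfolding complex_span_def by blast
  show ?thesis unfolding x using F by (induction F rule: finite_induct) (auto intro: assms)
qed

lemma closure_cspan_induct [consumes 1, case_names closed zero add base]:
  fixes S :: "'a :: {complex_vector, metric_space} set"
  assumes x: "x \<in> closure (cspan S)" and "closed {x. P x}" "P 0" "\<And>x y. P x ==> P y ==> P (x + y)" "\<And>c x. x \<in> S ==> P (c *C x)"
  shows "P x"
proof -
  have "cspan S \<subseteq> {x. P x}" using complex_span_induct[of _ S P] assms by blast
  then have "closure (cspan S) \<subseteq> {x. P x}" by (rule closure_minimal) fact
  then show ?thesis using x by auto
qed

lemma closure_add: "(\<And>x y. x \<in> S ==> y \<in> S ==> x + y \<in> S) ==> x \<in> closure S ==> y \<in> closure S ==> x + y \<in> closure (S :: 'a :: real_normed_vector set)"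
proof -
  assume S: "\<And>x y. x \<in> S ==> y \<in> S ==> x + y \<in> S" and "x \<in> closure S" "y \<in> closure S"
  then obtain f g where "\<And>n. f n \<in> S" "f \<longlonglongrightarrow> x" "\<And>n. g n \<in> S" "g \<longlonglongrightarrow> y"
    unfolding closure_sequential by blast
  then show ?thesis unfolding closure_sequential by (intro exI[of _ "\<lambda>n. f n + g n"]) (simp add: S tendsto_add)
qed

lemma closure_linear_image: "bounded_linear f ==> (\<And>x. x \<in> S ==> f x \<in> T) ==> x \<in> closure S ==> f x \<in> closure T"
  using image_closure_subset[of S f "closure T"] closure_subset[of T] by (auto simp: linear_continuous_on image_subset_iff subset_iff)

definition csubspace :: "'i ell2 set => bool" where
  "csubspace K \<longleftrightarrow> 0 \<in> K \<and> (\<forall>x\<in>K. \<forall>y\<in>K. x + y \<in> K) \<and> (\<forall>c. \<forall>x\<in>K. c *C x \<in> K)"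

lemma csubspace_complex_span: "csubspace (cspan S)" by (simp add: csubspace_def complex_span_zero complex_span_add complex_span_scaleC)

lemma csubspace_closure: "csubspace K ==> csubspace (closure K)" unfolding csubspace_def using closure_subset[of K]
  by (auto intro: closure_add closure_linear_image[OF bounded_linear_scaleC_ell2, where S = K])

text \<open>A minimizing sequence for the distance d to K is Cauchy by the parallelogram identity,
  because midpoints stay in K and hence at distance at least d from x.\<close>

lemma nearest_point:
  assumes "csubspace K" "closed K"
  shows "\<exists>k\<in>K. \<forall>y\<in>K. cinner y (x - k) = 0"
proof -
  define d where "d = infdist x K"
  have ne: "K \<noteq> {}" using assms by (auto simp: csubspace_def)
  have d0: "0 \<le> d" by (simp add: d_def infdist_nonneg)
  have dle: "d \<le> norm (x - y)" if "y \<in> K" for y using infdist_le[OF that, of x] by (simp add: d_def dist_norm)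
  have "\<exists>y\<in>K. norm (x - y) < d + e" if "e > 0" for e
  proof (rule ccontr)
    assume "\<not> ?thesis"
    then have "d + e \<le> infdist x K" unfolding infdist_notempty[OF ne] by (intro cINF_greatest ne) (auto simp: dist_norm not_less)
    then show False using that by (simp add: d_def)
  qed
  then have "\<forall>n. \<exists>y\<in>K. norm (x - y) < d + inverse (real (Suc n))" by simp
  then obtain k where k: "\<And>n. k n \<in> K" "\<And>n. norm (x - k n) < d + inverse (real (Suc n))" by metis
  \<comment> \<open>Both squared distances are at most d^2 + (2d+1)e with e = 1/(N+1); twice their
    sum minus 4 d^2 is 4(2d+1)e = (8d+4)e.\<close>
  have par: "(norm (k m - k n))\<^sup>2 \<le> (8 * d + 4) * inverse (real (Suc N))" if "N \<le> m" "N \<le> n" for N m n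
  proof -
    let ?e = "inverse (real (Suc N))"
    have e: "0 < ?e" "?e \<le> 1" by (simp_all add: field_simps)
    have b: "(norm (x - k m))\<^sup>2 \<le> d\<^sup>2 + (2 * d + 1) * ?e" if "N \<le> m" for m
    proof -
      have "norm (x - k m) \<le> d + ?e" using k(2)[of m] that by (smt (verit) inverse_le_iff_le of_nat_0_less_iff of_nat_mono Suc_le_mono zero_less_Suc)
      then have "(norm (x - k m))\<^sup>2 \<le> (d + ?e)\<^sup>2" by (intro power_mono) auto
      also have "\<dots> = d\<^sup>2 + 2 * d * ?e + ?e * ?e" by (simp add: power2_eq_square algebra_simps)
      also have "?e * ?e \<le> 1 * ?e" using e by (intro mult_right_mono) auto
      finally show ?thesis by (simp add: algebra_simps)
    qed
    have "(1 / 2) *\<^sub>R (k m + k n) \<in> K" using k assms(1) by (simp add: csubspace_def scaleR_scaleC)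
    from dle[OF this] have "d\<^sup>2 \<le> (norm (x - (1 / 2) *\<^sub>R (k m + k n)))\<^sup>2" using d0 by (intro power_mono) auto
    moreover have "(norm (k m - k n))\<^sup>2 + 4 * (norm (x - (1 / 2) *\<^sub>R (k m + k n)))\<^sup>2 = 2 * (norm (x - k m))\<^sup>2 + 2 * (norm (x - k n))\<^sup>2"
      by (simp add: power2_norm_eq_inner inner_simps inner_commute algebra_simps)
    ultimately show ?thesis using b[OF that(1)] b[OF that(2)] by (simp add: algebra_simps)
  qed
  have "Cauchy k"
  proof (rule metric_CauchyI)
    fix e :: real assume "e > 0"
    then obtain N where N: "inverse (real (Suc N)) < e\<^sup>2 / (8 * d + 4)"
      using d0 reals_Archimedean[of "e\<^sup>2 / (8 * d + 4)"] by (auto simp: field_simps)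
    have "dist (k m) (k n) < e" if "N \<le> m" "N \<le> n" for m n
    proof -
      have "(norm (k m - k n))\<^sup>2 < e\<^sup>2" using par[OF that] N d0 by (smt (verit, best) divide_less_eq pos_less_divide_eq mult.commute)
      then have "norm (k m - k n) < e" by (rule power_less_imp_less_base) (use \<open>e > 0\<close> in simp)
      then show ?thesis by (simp add: dist_norm)
    qed
    then show "\<exists>M. \<forall>m\<ge>M. \<forall>n\<ge>M. dist (k m) (k n) < e" by blast
  qed
  then obtain l where l: "k \<longlonglongrightarrow> l" using Cauchy_convergent_iff convergent_def by blast
  have lK: "l \<in> K" using assms(2) k(1) l closed_sequentially by blast
  have nl: "norm (x - l) \<le> d"
  proof (rule LIMSEQ_le)
    show "(\<lambda>n. norm (x - k n)) \<longlonglongrightarrow> norm (x - l)" by (intro tendsto_intros l)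
    show "(\<lambda>n. d + inverse (real (Suc n))) \<longlonglongrightarrow> d"
      using tendsto_add[OF tendsto_const LIMSEQ_inverse_real_of_nat, of d] by simp
  qed (use k(2) less_imp_le in blast)
  have "cinner y (x - l) = 0" if y: "y \<in> K" for y
  proof (cases "y = 0")
    case False
    \<comment> \<open>c y is the component of x - l along y. Subtracting it would push the distance
      below d unless the inner product vanishes.\<close>
    define c where "c = cinner y (x - l) / complex_of_real ((norm y)\<^sup>2)"
    have "l + c *C y \<in> K" using lK y assms(1) by (simp add: csubspace_def)
    then have "(norm (x - l))\<^sup>2 \<le> (norm (x - l - c *C y))\<^sup>2"
      using nl dle[of "l + c *C y"] by (intro power_mono) (auto simp: algebra_simps)
    moreover have "cinner (x - l - c *C y) (x - l - c *C y) =
        cinner (x - l) (x - l) - cnj (cinner y (x - l)) * cinner y (x - l) / complex_of_real ((norm y)\<^sup>2)"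
    proof -
      have "cinner (u - c *C y) (u - c *C y) = cinner u u - c * cnj (cinner y u) - cnj c * cinner y u + cnj c * (c * complex_of_real ((norm y)\<^sup>2))" for u
        using cinner_commute[of u y] cinner_norm[of y] by (simp add: cinner_simps algebra_simps)
      moreover have "c * complex_of_real ((norm y)\<^sup>2) = cinner y (x - l)" using False by (simp add: c_def)
      ultimately show ?thesis by (simp only:) (simp add: c_def mult.commute)
    qed
    then have "complex_of_real ((norm (x - l - c *C y))\<^sup>2) = complex_of_real ((norm (x - l))\<^sup>2 - (cmod (cinner y (x - l)))\<^sup>2 / (norm y)\<^sup>2)"
      by (simp only: cinner_norm of_real_diff of_real_divide of_real_power cmod_sq) (simp add: mult.commute)
    then have "(norm (x - l - c *C y))\<^sup>2 = (norm (x - l))\<^sup>2 - (cmod (cinner y (x - l)))\<^sup>2 / (norm y)\<^sup>2"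
      by (simp only: of_real_eq_iff)
    ultimately have "(cmod (cinner y (x - l)))\<^sup>2 / (norm y)\<^sup>2 \<le> 0" by linarith
    then show ?thesis using False by (simp add: divide_le_0_iff)
  qed simp
  with lK show ?thesis by blast
qed

lemma ex_projection:
  assumes "csubspace K" "closed K"
  shows "\<exists>P. P * P = P \<and> adj P = P \<and> (\<forall>x. P \<cdot> x \<in> K) \<and> (\<forall>x\<in>K. P \<cdot> x = x)"
proof -
  obtain f where f: "\<And>x. f x \<in> K" "\<And>x y. y \<in> K ==> cinner y (x - f x) = 0" using nearest_point[OF assms] by metis
  have K: "0 \<in> K" "\<And>x y. x \<in> K ==> y \<in> K ==> x + y \<in> K" "\<And>c x. x \<in> K ==> c *C x \<in> K"
    using assms(1) by (auto simp: csubspace_def)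
  have K2: "x - y \<in> K" if "x \<in> K" "y \<in> K" for x y using K(2)[OF that(1) K(3)[OF that(2), of "-1"]] by simp
  have uniq: "f x = k" if "k \<in> K" "\<And>y. y \<in> K ==> cinner y (x - k) = 0" for x k
  proof -
    have "cinner (f x - k) ((x - k) - (x - f x)) = 0" unfolding cinner_diff_right[of _ "x - k"] using K2[OF f(1) that(1)] that(2) f(2) by simp
    then show ?thesis by simp
  qed
  have fx: "f x = x" if "x \<in> K" for x by (rule uniq) (use that in auto)
  have nf: "norm (f x) \<le> norm x" for x
  proof -
    have "cinner (f x) x = cinner (f x) (f x)" using f(2)[OF f(1), of x x] by (simp add: cinner_simps)
    then have "(norm (f x))\<^sup>2 = cmod (cinner (f x) x)" by (simp add: cinner_norm norm_mult power2_eq_square)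
    also have "\<dots> \<le> norm (f x) * norm x" by (rule Cauchy_Schwarz)
    finally show ?thesis by (cases "f x = 0") (auto simp: power2_eq_square)
  qed
  obtain P where P: "\<And>x. P \<cdot> x = f x"
  proof -
    have "\<exists>P. \<forall>x. P \<cdot> x = f x"
    proof (rule ex_op[where B = 1])
      fix x y c
      show "f (x + y) = f x + f y"
      proof (rule uniq)
        fix z assume "z \<in> K"
        then have "cinner z ((x - f x) + (y - f y)) = 0" by (simp only: cinner_add_right f(2)) simp
        then show "cinner z (x + y - (f x + f y)) = 0" by (simp add: algebra_simps)
      qed (use f K in auto)
      show "f (c *C x) = c *C f x"
      proof (rule uniq)
        fix y assume "y \<in> K"
        then have "cinner y (c *C (x - f x)) = 0" by (simp only: cinner_scaleC_right f(2)) simp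
        then show "cinner y (c *C x - c *C f x) = 0" by (simp add: scaleC_diff_right)
      qed (use f K in auto)
      show "norm (f x) \<le> 1 * norm x" using nf by simp
    qed
    then show thesis using that by blast
  qed
  have "cinner (f x) y = cinner x (f y)" for x y
  proof -
    have *: "cinner (f x) y = cinner (f x) (f y)" for x y using f(2)[OF f(1)[of x], of y] by (simp add: cinner_simps)
    have "cinner (f x) y = cinner (f x) (f y)" by (rule *)
    also have "\<dots> = cinner x (f y)" using *[of y x] cinner_commute[of "f y"] by simp
    finally show ?thesis .
  qed
  then have "adj P = P" by (intro adj_unique) (simp add: P)
  moreover have "P * P = P" by (rule op_eqI) (simp add: op_simps P fx f)
  ultimately show ?thesis by (intro exI[of _ P]) (simp add: P f fx)
qed

section \<open>Commutants and the double commutant theorem\<close>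

lemma commutantI: "(\<And>s. s \<in> S ==> T * s = s * T) ==> T \<in> commutant S"
  and commutantD: "T \<in> commutant S ==> s \<in> S ==> T * s = s * T" by (auto simp: commutant_def)

lemma commutant_adj: "(\<And>s. s \<in> S ==> adj s \<in> S) ==> T \<in> commutant S ==> adj T \<in> commutant S"
proof (rule commutantI)
  fix s assume "\<And>s. s \<in> S ==> adj s \<in> S" "T \<in> commutant S" "s \<in> S"
  then have "adj (T * adj s) = adj (adj s * T)" by (metis commutantD)
  then show "adj T * s = s * adj T" by (simp add: adj_mult)
qed

lemma subalgD:
  assumes "star_subalgebra A"
  shows "0 \<in> A" "a \<in> A ==> b \<in> A ==> a + b \<in> A" "a \<in> A ==> b \<in> A ==> a * b \<in> A" "a \<in> A ==> adj a \<in> A"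
    "a \<in> A ==> c *C a \<in> A" "a \<in> A ==> b \<in> A ==> a - b \<in> A" "a \<in> A ==> - a \<in> A"
proof -
  have m: "- a \<in> A" if "a \<in> A" for a using assms that scaleC_minus1[of a] by (metis star_subalgebra_def)
  then show "a \<in> A ==> b \<in> A ==> a - b \<in> A" "a \<in> A ==> - a \<in> A" using assms by (metis add_uminus_conv_diff star_subalgebra_def)+
qed (use assms in \<open>auto simp: star_subalgebra_def\<close>)

lemma subalg_sum: "star_subalgebra A ==> (\<And>k. k \<in> F ==> f k \<in> A) ==> sum f F \<in> A"
  by (induction F rule: infinite_finite_induct) (auto simp: subalgD)

lemma star_subalgebra_commutant:
  assumes "\<And>s. s \<in> S ==> adj s \<in> S" shows "star_subalgebra (commutant S)" unfolding star_subalgebra_def using commutant_adj[OF assms]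
  by (auto simp: commutant_def scaleC_mult_left scaleC_mult_right algebra_simps) (metis mult.assoc)

text \<open>The amplification step of the double commutant theorem, for a *-algebra that may act degenerately.\<close>
lemma amplified_density:
  fixes X :: "'i op set" and u :: "('k \<times> 'i) ell2"
  assumes X: "star_subalgebra X" and T: "T \<in> commutant (commutant X)"
    and ker: "\<And>\<xi>. (\<And>x. x \<in> X ==> x \<cdot> \<xi> = 0) ==> T \<cdot> \<xi> = 0"
  shows "(1 \<otimes> T) \<cdot> u \<in> closure {(1 \<otimes> x) \<cdot> u | x. x \<in> X}"
proof -
  define K where "K = closure {(1 \<otimes> x) \<cdot> u | x. x \<in> X}"
  have "csubspace {(1 \<otimes> x) \<cdot> u | x. x \<in> X}" unfolding csubspace_def
  proof (safe)
    show "\<exists>x. 0 = (1 \<otimes> x) \<cdot> u \<and> x \<in> X" using subalgD(1)[OF X] by (intro exI[of _ 0]) simp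
    fix x y and c assume "x \<in> X" "y \<in> X"
    then show "\<exists>z. (1 \<otimes> x) \<cdot> u + (1 \<otimes> y) \<cdot> u = (1 \<otimes> z) \<cdot> u \<and> z \<in> X"
      using subalgD(2)[OF X] by (intro exI[of _ "x + y"]) (simp add: tensor_op_add_right op_simps)
    show "\<exists>z. c *C ((1 \<otimes> x) \<cdot> u) = (1 \<otimes> z) \<cdot> u \<and> z \<in> X"
      using subalgD(5)[OF X \<open>x \<in> X\<close>] by (intro exI[of _ "c *C x"]) (simp add: tensor_op_scaleC_right op_simps)
  qed
  then have "csubspace K" "closed K" by (simp_all add: K_def csubspace_closure)
  then obtain P where P: "P * P = P" "adj P = P" "\<And>x. P \<cdot> x \<in> K" "\<And>x. x \<in> K ==> P \<cdot> x = x" using ex_projection by blast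
  have inv: "(1 \<otimes> x) \<cdot> v \<in> K" if "x \<in> X" "v \<in> K" for x v unfolding K_def
  proof (rule closure_linear_image[OF linear_op_apply])
    show "v \<in> closure {(1 \<otimes> x) \<cdot> u | x. x \<in> X}" using that by (simp add: K_def)
    fix w assume "w \<in> {(1 \<otimes> x) \<cdot> u | x. x \<in> X}"
    then obtain y where "w = (1 \<otimes> y) \<cdot> u" "y \<in> X" by blast
    then show "(1 \<otimes> x) \<cdot> w \<in> {(1 \<otimes> x) \<cdot> u | x. x \<in> X}"
      using subalgD(3)[OF X \<open>x \<in> X\<close>] by (auto simp: op_apply_mult[symmetric] tensor_op_mult)
  qed
  have PxP: "(1 \<otimes> x) * P = P * (1 \<otimes> x) * P" if "x \<in> X" for x by (rule op_eqI) (simp add: op_simps P inv that)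
  have comm: "P * (1 \<otimes> x) = (1 \<otimes> x) * P" if "x \<in> X" for x
  proof -
    have "adj ((1 \<otimes> adj x) * P) = adj (P * (1 \<otimes> adj x) * P)" using PxP[OF subalgD(4)[OF X that]] by simp
    then have "P * (1 \<otimes> x) = P * (1 \<otimes> x) * P" by (simp add: adj_mult adj_tensor P mult.assoc)
    then show ?thesis using PxP[OF that] by simp
  qed
  \<comment> \<open>Slicing off the first leg of P leads from operators commuting with the
    amplification to the commutant of X, with whose elements T commutes.\<close>
  have "vsl p q P \<in> commutant X" for p q using comm by (auto simp: commutant_def commutes_right_leg[symmetric])
  then have PT: "P * (1 \<otimes> T) = (1 \<otimes> T) * P" using T by (auto simp: commutes_right_leg[symmetric] commutant_def)
  \<comment> \<open>v is killed by all 1 \<otimes> x: it is the part of u on which X acts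
    degenerately. By \<open>ker\<close> also T vanishes on its rows.\<close>
  define v where "v = u - P \<cdot> u"
  have "(1 \<otimes> x) \<cdot> v = 0" if "x \<in> X" for x
  proof -
    have "(1 \<otimes> x) \<cdot> u \<in> K" unfolding K_def by (rule subsetD[OF closure_subset]) (use that in auto)
    moreover have "(1 \<otimes> x) \<cdot> P \<cdot> u = P \<cdot> (1 \<otimes> x) \<cdot> u" using comm[OF that] by (metis op_apply_mult)
    ultimately show ?thesis by (simp add: v_def op_simps P)
  qed
  moreover have row0: "row k 0 = 0" for k using row_simps(2)[of k 0 0] by simp
  ultimately have "x \<cdot> row k v = 0" if "x \<in> X" for x k using that row_one_tensor[of k x v] by metis
  then have "T \<cdot> row k v = 0" for k by (intro ker)
  then have "(1 \<otimes> T) \<cdot> v = 0" by (intro ell2_row_eqI) (simp add: row_one_tensor row0)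
  then have "(1 \<otimes> T) \<cdot> u = P \<cdot> (1 \<otimes> T) \<cdot> u"
    using op_apply_mult[of P "1 \<otimes> T" u] by (simp add: v_def op_apply_diff_right PT op_apply_mult)
  from this[symmetric] have "(1 \<otimes> T) \<cdot> u \<in> K" by (rule subst[where P = "\<lambda>z. z \<in> K"]) (rule P(3))
  then show ?thesis by (simp only: K_def)
qed

lemma bicommutant_density:
  assumes X: "star_subalgebra X" and T: "T \<in> commutant (commutant X)"
    and ker: "\<And>y. (\<And>x. x \<in> X ==> x \<cdot> y = 0) ==> T \<cdot> y = 0"
  shows "T \<in> sigma_weak_closure X" unfolding sigma_weak_closure_def
proof safe
  fix \<Omega> :: "('a op => complex) set" and e :: real
  assume fin: "finite \<Omega>" and nrm: "\<forall>g\<in>\<Omega>. nfun g" and e: "e > 0"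
  have "\<forall>g\<in>\<Omega>. \<exists>u v :: (nat \<times> 'a) ell2. \<forall>T. g T = cinner v ((1 \<otimes> T) \<cdot> u)"
  proof
    fix g assume "g \<in> \<Omega>"
    then obtain u v :: "(nat \<times> 'a) ell2" where "\<And>T. g T = cinner v ((1 \<otimes> T) \<cdot> u)" using normal_unpack[of g] nrm by metis
    then show "\<exists>u v :: (nat \<times> 'a) ell2. \<forall>T. g T = cinner v ((1 \<otimes> T) \<cdot> u)" by blast
  qed
  then obtain u v :: "('a op => complex) => (nat \<times> 'a) ell2"
    where uv: "\<And>g T. g \<in> \<Omega> ==> g T = cinner (v g) ((1 \<otimes> T) \<cdot> u g)" by metis
  \<comment> \<open>The functionals in \<Omega> themselves index the summands, so that a single
    vector represents all of them; after reassociation the auxiliary index is a pair of a functional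
    and a number.\<close>
  define U0 where "U0 = (\<Sum>g\<in>\<Omega>. ket g \<odot> u g)"
  obtain U where U: "assoc_vec U = U0" unfolding assoc_vec_def using relabel_inv(1)[OF bij_assoc, of U0] by metis
  define C where "C = 1 + (\<Sum>g\<in>\<Omega>. norm (v g))"
  have C: "C > 0" "\<And>g. g \<in> \<Omega> ==> norm (v g) \<le> C"
    using fin member_le_sum[of _ \<Omega> "\<lambda>g. norm (v g)"] by (force simp: C_def add_pos_nonneg sum_nonneg)+
  obtain x where x: "x \<in> X" "norm ((1 \<otimes> x) \<cdot> U - (1 \<otimes> T) \<cdot> U) < e / C"
  proof -
    have "(1 \<otimes> T) \<cdot> U \<in> closure {(1 \<otimes> x) \<cdot> U | x. x \<in> X}" by (rule amplified_density[OF X T]) (rule ker)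
    moreover have "e / C > 0" using e C by simp
    ultimately show thesis using that unfolding closure_approachable dist_norm by blast
  qed
  have "cmod (g T - g x) < e" if w: "g \<in> \<Omega>" for g
  proof -
    have "row g (assoc_vec ((1 \<otimes> S) \<cdot> U)) = (1 \<otimes> S) \<cdot> u g" for S
    proof -
      have "row g U0 = (\<Sum>g'\<in>\<Omega>. coord (ket g') g *C u g')" unfolding U0_def by (rule ell2_eqI) simp
      also have "\<dots> = u g" using fin w by (simp add: coord_ket if_distrib[of "\<lambda>c. c *C _"] cong: if_cong)
      finally show ?thesis by (simp add: assoc_one_tensor[symmetric] U row_one_tensor)
    qed
    then have "norm ((1 \<otimes> (x - T)) \<cdot> u g) \<le> norm (assoc_vec ((1 \<otimes> (x - T)) \<cdot> U))" by (metis norm_row_le)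
    also have "\<dots> = norm ((1 \<otimes> x) \<cdot> U - (1 \<otimes> T) \<cdot> U)"
      by (simp add: assoc_vec_def norm_relabel tensor_op_diff_right op_simps)
    also have "\<dots> < e / C" by (rule x)
    finally have *: "norm ((1 \<otimes> (x - T)) \<cdot> u g) < e / C" .
    have "cmod (g T - g x) = cmod (cinner (v g) ((1 \<otimes> (x - T)) \<cdot> u g))"
      by (simp add: uv w tensor_op_diff_right op_simps cinner_simps norm_minus_commute)
    also have "\<dots> \<le> C * norm ((1 \<otimes> (x - T)) \<cdot> u g)" by (rule order_trans[OF Cauchy_Schwarz]) (simp add: C w mult_right_mono)
    also have "\<dots> < C * (e / C)" using * C(1) by (rule mult_strict_left_mono)
    finally show ?thesis using C by simp
  qed
  with x show "\<exists>s\<in>X. \<forall>g\<in>\<Omega>. cmod (g T - g s) < e" by blast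
qed

lemma normal_vanish_closure:
  assumes "x \<in> sigma_weak_closure S" "nfun w" "\<And>s. s \<in> S ==> w s = 0"
  shows "w x = 0"
proof (rule ccontr)
  assume "w x \<noteq> 0"
  then obtain s where "s \<in> S" "cmod (w x - w s) < cmod (w x)"
    using assms(1)[unfolded sigma_weak_closure_def, simplified, rule_format, of "{w}" "cmod (w x)"] assms(2) by auto
  then show False using assms(3) by simp
qed

lemma normal_vanish_bicommutant:
  assumes "star_subalgebra X" "T \<in> commutant (commutant X)" "nfun w" "\<And>s. s \<in> X ==> w s = 0"
    and "\<And>y. (\<And>x. x \<in> X ==> x \<cdot> y = 0) ==> T \<cdot> y = 0"
  shows "w T = 0" by (rule normal_vanish_closure[OF bicommutant_density[OF assms(1,2,5)] assms(3,4)])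

section \<open>C*-algebras\<close>

text \<open>Polarization: for self-adjoint T the real part of <x, T y> is a multiple of a difference
  of two quadratic values, which the parallelogram identity bounds; a phase then recovers the
  modulus.\<close>

lemma norm_selfadj_le:
  assumes "adj T = T" "\<And>x. cmod (cinner x (T \<cdot> x)) \<le> c * (norm x)\<^sup>2" "0 \<le> c"
  shows "norm T \<le> c"
proof -
  have re: "Re (cinner x (T \<cdot> y)) \<le> c * ((norm x)\<^sup>2 + (norm y)\<^sup>2) / 2" for x y
  proof -
    have s: "cinner y (T \<cdot> x) = cnj (cinner x (T \<cdot> y))"
      using cinner_adj_right[of y T x] assms(1) cinner_commute[of "T \<cdot> y" x] by simp
    have "cinner (x + y) (T \<cdot> (x + y)) - cinner (x - y) (T \<cdot> (x - y)) = 2 * (cinner x (T \<cdot> y) + cnj (cinner x (T \<cdot> y)))"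
      by (simp add: cinner_simps op_simps s)
    then have "4 * Re (cinner x (T \<cdot> y)) = Re (cinner (x + y) (T \<cdot> (x + y))) - Re (cinner (x - y) (T \<cdot> (x - y)))"
      by (metis (no_types, lifting) complex_add_cnj minus_complex.sel(1) mult_2 of_real_mult Re_complex_of_real mult.assoc numeral_Bit0 plus_complex.sel(1) mult.commute distrib_right)
    also have "\<dots> \<le> c * (norm (x + y))\<^sup>2 + c * (norm (x - y))\<^sup>2"
      using assms(2)[of "x + y"] assms(2)[of "x - y"] abs_Re_le_cmod[of "cinner (x + y) (T \<cdot> (x + y))"]
        abs_Re_le_cmod[of "cinner (x - y) (T \<cdot> (x - y))"] by linarith
    also have "\<dots> = 2 * (c * ((norm x)\<^sup>2 + (norm y)\<^sup>2))" by (simp add: power2_norm_eq_inner inner_simps inner_commute algebra_simps)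
    finally show ?thesis by simp
  qed
  show ?thesis
  proof (rule norm_op_leI[OF assms(3)], rule norm_le_cinnerI)
    fix x y :: "'a ell2" assume y: "norm y \<le> 1"
    show "cmod (cinner y (T \<cdot> x)) \<le> c * norm x"
    proof (cases "x = 0 \<or> cinner y (T \<cdot> x) = 0")
      case False
      \<comment> \<open>The phase d makes the value of the form real, and rescaling y by |x|
        balances the two squares in \<open>re\<close>, so that their mean is |x| times the required
        bound.\<close>
      define d where "d = cinner y (T \<cdot> x) / cmod (cinner y (T \<cdot> x))"
      have [simp]: "cmod d = 1" using False by (simp add: d_def norm_divide)
      have "cinner (d *C norm x *\<^sub>R y) (T \<cdot> x) = complex_of_real (norm x * cmod (cinner y (T \<cdot> x)))"
        using False by (simp add: d_def scaleR_scaleC cinner_simps cmod_sq[symmetric] power2_eq_square field_simps)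
      then have "norm x * cmod (cinner y (T \<cdot> x)) = Re (cinner (d *C norm x *\<^sub>R y) (T \<cdot> x))" by simp
      also have "\<dots> \<le> c * ((norm x * norm y)\<^sup>2 + (norm x)\<^sup>2) / 2" using re[of "d *C norm x *\<^sub>R y" x] by (simp add: norm_scaleC_ell2)
      also have "\<dots> \<le> c * ((norm x)\<^sup>2 + (norm x)\<^sup>2) / 2"
        using y assms(3) mult_left_mono[of "(norm y)\<^sup>2" 1 "(norm x)\<^sup>2"] by (intro divide_right_mono mult_left_mono add_right_mono) (auto simp: power_mult_distrib power_le_one)
      also have "\<dots> = norm x * (c * norm x)" by (simp add: power2_eq_square)
      finally show ?thesis using False by simp
    qed (use assms(3) in auto)
  qed (use assms(3) in auto)
qed

text \<open>y is 1 - sqrt(1 - x), found as the fixed point of y |-> (x + y y)/2, a contraction with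
  constant |x| < 1 on the self-adjoint elements of B of norm at most |x|. In this form the root lies
  in B also when B has no unit.\<close>

lemma ex_quadratic_root:
  assumes B: "closed B" "0 \<in> B" "\<And>a b. a \<in> B ==> b \<in> B ==> a + b \<in> B \<and> a * b \<in> B" "\<And>a c. a \<in> B ==> c *C a \<in> B"
    and x: "x \<in> B" "adj x = x" "norm x < 1"
  shows "\<exists>y\<in>B. adj y = y \<and> 2 *C y - y * y = (x :: 'i op)"
proof -
  define q where "q = norm x"
  have q: "0 \<le> q" "q < 1" using x by (auto simp: q_def)
  define s where "s = B \<inter> {y. adj y = y} \<inter> cball 0 q"
  define f where "f y = (1 / 2) *C (x + y * y)" for y
  have "closed {y :: 'i op. adj y = y}" by (rule closed_linear_eq) (auto intro: bounded_linear_adj bounded_linear_ident)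
  then have "complete s" unfolding s_def by (intro complete_eq_closed[THEN iffD2] closed_Int B(1) closed_cball)
  moreover have "s \<noteq> {}" using B(2) q by (auto simp: s_def)
  moreover have "f ` s \<subseteq> s"
  proof safe
    fix y assume y: "y \<in> s"
    have "norm (y * y) \<le> q * q" using y q by (intro order_trans[OF norm_mult_ineq] mult_mono) (auto simp: s_def)
    also have "\<dots> \<le> 1 * q" using q by (intro mult_right_mono) auto
    finally have "norm (x + y * y) \<le> 2 * q" using norm_triangle_ineq[of x "y * y"] by (simp add: q_def)
    then have "norm (f y) \<le> q" by (simp add: f_def norm_scaleC_op norm_divide)
    then show "f y \<in> s" using y B x by (simp add: s_def f_def adj_simps)
  qed
  moreover have "\<forall>y\<in>s. \<forall>z\<in>s. dist (f y) (f z) \<le> q * dist y z"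
  proof safe
    fix y z assume yz: "y \<in> s" "z \<in> s"
    have "f y - f z = (1 / 2) *C (y * (y - z) + (y - z) * z)" by (simp add: f_def scaleC_diff_right[symmetric] algebra_simps)
    moreover have "norm (y * (y - z) + (y - z) * z) \<le> q * norm (y - z) + norm (y - z) * q"
      using yz by (intro order_trans[OF norm_triangle_ineq] add_mono order_trans[OF norm_mult_ineq] mult_mono) (auto simp: s_def q)
    ultimately show "dist (f y) (f z) \<le> q * dist y z" by (simp add: dist_norm norm_scaleC_op norm_divide)
  qed
  ultimately obtain y where y: "y \<in> s" "f y = y" using Banach_fix[of s q f] q by metis
  have "2 *C y = 2 *C f y" by (simp add: y)
  then have "2 *C y = x + y * y" by (simp add: f_def scaleC_scaleC)
  then show ?thesis using y by (intro bexI[of _ y]) (auto simp: s_def)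
qed

lemma star_hom_zero: "star_subalgebra A ==> star_hom A f ==> f 0 = 0" using subalgD(1)[of A] by (metis add_cancel_right_right star_hom_def add_0)

lemma homD:
  assumes "star_hom A f"
  shows "a \<in> A ==> b \<in> A ==> f (a + b) = f a + f b" "a \<in> A ==> b \<in> A ==> f (a * b) = f a * f b"
    "a \<in> A ==> f (adj a) = adj (f a)" "a \<in> A ==> f (c *C a) = c *C f a" using assms by (auto simp: star_hom_def)

lemma star_hom_diff: "star_subalgebra A ==> star_hom A f ==> a \<in> A ==> b \<in> A ==> f (a - b) = f a - f b"
  using homD(1)[of A f a "(-1) *C b"] homD(4)[of A f b "-1"] subalgD(5)[of A b "-1"] by simp

lemma star_hom_sum: "star_subalgebra A ==> star_hom A f ==> (\<And>k. k \<in> F ==> g k \<in> A) ==> f (sum g F) = (\<Sum>k\<in>F. f (g k))"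
  by (induction F rule: infinite_finite_induct) (auto simp: star_hom_zero homD subalg_sum)

text \<open>For |b| < 1 write adj b * b = 2 y - y y with y self-adjoint in A. Applying f gives |f(b)
  v|^2 = |v|^2 - |v - f(y) v|^2, which is at most |v|^2.\<close>

lemma star_hom_contractive:
  assumes A: "star_subalgebra A" "closed A" and f: "star_hom A f" and a: "a \<in> A"
  shows "norm (f a) \<le> norm a"
proof -
  have unit: "norm (f b) \<le> 1" if b: "b \<in> A" "norm b < 1" for b
  proof -
    let ?x = "adj b * b"
    have "norm ?x < 1" using b by (simp add: norm_cstar power_less_one_iff)
    then obtain y where y: "y \<in> A" "adj y = y" "2 *C y - y * y = ?x" using ex_quadratic_root[of A ?x] A b by (auto simp: subalgD adj_mult)
    have fy: "adj (f y) = f y" using homD(3)[OF f y(1)] y by simp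
    have "f ?x = 2 *C f y - f y * f y" unfolding y(3)[symmetric] using y(1) A f by (simp add: star_hom_diff homD subalgD)
    then have eq: "adj (f b) * f b = 2 *C f y - f y * f y" using b A f by (simp add: homD subalgD)
    have "norm (f b \<cdot> v) \<le> norm v" for v
    proof (rule power2_le_imp_le)
      have "cinner (f b \<cdot> v) (f b \<cdot> v) = cinner v ((adj (f b) * f b) \<cdot> v)" by (simp add: op_simps cinner_adj_right)
      also have "\<dots> = cinner v v - cinner (v - f y \<cdot> v) (v - f y \<cdot> v)"
      proof -
        have "cinner (f y \<cdot> v) w = cinner v (f y \<cdot> w)" for w using cinner_adj_left[of "f y" v w] fy by simp
        then show ?thesis unfolding eq by (simp add: op_simps cinner_simps)
      qed
      finally have "complex_of_real ((norm (f b \<cdot> v))\<^sup>2) = complex_of_real ((norm v)\<^sup>2 - (norm (v - f y \<cdot> v))\<^sup>2)"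
        by (simp only: cinner_norm of_real_diff)
      then have "(norm (f b \<cdot> v))\<^sup>2 = (norm v)\<^sup>2 - (norm (v - f y \<cdot> v))\<^sup>2" by (simp only: of_real_eq_iff)
      then show "(norm (f b \<cdot> v))\<^sup>2 \<le> (norm v)\<^sup>2" by simp
    qed simp
    then show ?thesis by (intro norm_op_leI) auto
  qed
  show ?thesis
  proof (rule dense_le)
    fix t assume "t < norm (f a)"
    show "t \<le> norm a"
    proof (rule ccontr)
      assume "\<not> t \<le> norm a"
      then have t: "norm a < t" by simp
      then have "0 < t" by (rule le_less_trans[OF norm_ge_zero])
      note t = this t
      have "norm (f ((1 / t) *C a)) \<le> 1" by (rule unit) (use t a A in \<open>auto simp: subalgD norm_scaleC_op norm_divide\<close>)
      then have "norm (f a) \<le> t" using t a f by (simp add: homD norm_scaleC_op norm_divide)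
      then show False using \<open>t < norm (f a)\<close> by simp
    qed
  qed
qed

section \<open>Density of products and inverses of multipliers\<close>

lemma power_selfadj_form:
  assumes "adj k = k" "\<And>v. 0 \<le> Re (cinner v (k \<cdot> v))"
  shows "0 \<le> Re (cinner v ((k ^ n) \<cdot> v))"
proof -
  have e: "cinner v ((k ^ (m + l + m)) \<cdot> v) = cinner ((k ^ m) \<cdot> v) ((k ^ l) \<cdot> (k ^ m) \<cdot> v)" for m l
    using cinner_adj_left[of "k ^ m" v "(k ^ l) \<cdot> (k ^ m) \<cdot> v"] by (simp add: power_add op_apply_mult adj_power assms)
  show ?thesis
  proof (cases "even n")
    case True
    then obtain m where "n = m + 0 + m" by (metis add_0_right evenE mult_2)
    then show ?thesis by (simp only: e) (simp add: cinner_norm)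
  next
    case False
    then obtain m where "n = m + 1 + m" by (metis oddE mult_2 add.assoc add.commute)
    then show ?thesis using assms(2) by (simp only: e power_one_right)
  qed
qed

text \<open>With \<open>h = a\<^sup>*a\<close> scaled to a positive contraction, \<open>a (1 - h)\<^sup>n\<close> tends to zero.\<close>
lemma cstar_mult_dense:
  assumes A: "star_subalgebra A" and a: "a \<in> A"
  shows "a \<in> closure (cspan {x * y | x y. x \<in> A \<and> y \<in> A})" (is "_ \<in> closure ?S")
proof (cases "a = 0")
  case True then show ?thesis using complex_span_zero closure_subset by blast
next
  case False
  define c where "c = (norm a)\<^sup>2"
  have c: "0 < c" using False by (simp add: c_def)
  define h where "h = (1 / c) *C (adj a * a)"
  define k where "k = 1 - h"
  have hA: "h \<in> A" using A a by (simp add: h_def subalgD)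
  have adj: "adj h = h" "adj k = k" by (simp_all add: h_def k_def adj_simps)
  have hform: "cinner v (h \<cdot> v) = complex_of_real ((norm (a \<cdot> v))\<^sup>2 / c)" for v
    by (simp add: h_def op_simps cinner_simps cinner_adj_right cinner_norm)
  have h0: "0 \<le> Re (cinner v (h \<cdot> v))" for v using c by (simp add: hform)
  have k0: "0 \<le> Re (cinner v (k \<cdot> v))" for v
  proof -
    have "(norm (a \<cdot> v))\<^sup>2 \<le> c * (norm v)\<^sup>2" unfolding c_def power_mult_distrib[symmetric] by (intro power_mono norm_op_apply) auto
    then have "(norm (a \<cdot> v))\<^sup>2 / c \<le> (norm v)\<^sup>2" using c by (simp add: field_simps)
    then show ?thesis by (simp add: k_def op_simps cinner_simps hform cinner_norm)
  qed
  have hk: "h * k ^ n = k ^ n * h" for n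
  proof -
    have "h * k = k * h" by (simp add: k_def algebra_simps)
    then show ?thesis by (induction n) (auto simp: mult.assoc, metis mult.assoc)
  qed
  have ak: "(norm (a * k ^ n))\<^sup>2 \<le> c / (2 * n + 1)" for n
  proof -
    define t where "t j v = Re (cinner v ((h * k ^ j) \<cdot> v))" for j v
    have dec: "t (Suc j) v \<le> t j v" for j v
    proof -
      have "t j v - t (Suc j) v = Re (cinner v ((h * k ^ j * (1 - k)) \<cdot> v))"
        by (simp add: t_def algebra_simps power_commutes op_simps cinner_simps)
      also have "h * k ^ j * (1 - k) = h * k ^ j * h" by (simp add: k_def)
      also have "Re (cinner v ((h * k ^ j * h) \<cdot> v)) = Re (cinner (h \<cdot> v) ((k ^ j) \<cdot> h \<cdot> v))"
        using cinner_adj_left[of h v] by (simp add: op_apply_mult adj)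
      also have "\<dots> \<ge> 0" by (rule power_selfadj_form[OF adj(2) k0])
      finally show ?thesis by simp
    qed
    have dec': "t m v \<le> t j v" if "j \<le> m" for j m v using that by (induction m rule: dec_induct) (auto intro: order_trans[OF dec])
    \<comment> \<open>For m = 2n the 2n+1 terms of this sum decrease in form value and add up to at
      most 1, so the last one is at most 1/(2n+1).\<close>
    have geo: "(\<Sum>j\<le>m. h * k ^ j) = 1 - k ^ Suc m" for m by (induction m) (auto simp: k_def algebra_simps)
    have "norm (h * k ^ (2 * n)) \<le> 1 / (2 * n + 1)"
    proof (rule norm_selfadj_le)
      show "adj (h * k ^ (2 * n)) = h * k ^ (2 * n)" by (simp add: adj_mult adj_power adj hk)
      fix v
      have "(2 * n + 1) * t (2 * n) v \<le> (\<Sum>j\<le>2 * n. t j v)"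
        using sum_mono[of "{..2 * n}" "\<lambda>_. t (2 * n) v" "\<lambda>j. t j v"] dec' by simp
      also have "\<dots> = Re (cinner v ((1 - k ^ Suc (2 * n)) \<cdot> v))"
        unfolding geo[symmetric] by (simp add: t_def op_apply_sum_left cinner_sum_right)
      also have "\<dots> \<le> (norm v)\<^sup>2"
        using power_selfadj_form[OF adj(2) k0, of v "Suc (2 * n)"] by (simp only: op_simps cinner_simps op_apply_one cinner_norm) simp
      finally have le: "t (2 * n) v \<le> 1 / (2 * n + 1) * (norm v)\<^sup>2" by (simp add: field_simps)
      have "h * k ^ (2 * n) = k ^ n * h * k ^ n" by (simp add: mult_2 power_add mult.assoc[symmetric] hk)
      then have "cinner v ((h * k ^ (2 * n)) \<cdot> v) = cinner ((k ^ n) \<cdot> v) (h \<cdot> (k ^ n) \<cdot> v)"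
        using cinner_adj_left[of "k ^ n" v] by (simp add: op_apply_mult adj_power adj)
      then have r: "cinner v ((h * k ^ (2 * n)) \<cdot> v) = complex_of_real ((norm (a \<cdot> (k ^ n) \<cdot> v))\<^sup>2 / c)" by (simp add: hform)
      have "cmod (cinner v ((h * k ^ (2 * n)) \<cdot> v)) = t (2 * n) v" unfolding t_def r using c by (simp add: norm_divide norm_power)
      then show "cmod (cinner v ((h * k ^ (2 * n)) \<cdot> v)) \<le> 1 / (2 * n + 1) * (norm v)\<^sup>2" using le by simp
    qed simp
    moreover have "(norm (a * k ^ n))\<^sup>2 = norm (c *C (h * k ^ (2 * n)))"
    proof -
      have "adj (a * k ^ n) * (a * k ^ n) = k ^ n * (c *C h) * k ^ n" using c by (simp add: adj_mult adj_power adj h_def scaleC_scaleC mult.assoc)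
      also have "\<dots> = c *C (h * k ^ (2 * n))" by (simp add: scaleC_mult_left scaleC_mult_right mult_2 power_add mult.assoc[symmetric] hk)
      finally show ?thesis by (metis norm_cstar)
    qed
    moreover have "c * norm (h * k ^ (2 * n)) \<le> c * (1 / (2 * n + 1))" if "norm (h * k ^ (2 * n)) \<le> 1 / (2 * n + 1)"
      using that c by (intro mult_left_mono) auto
    ultimately show ?thesis using c by (simp add: norm_scaleC_op)
  qed
  have mem: "a * k ^ n \<in> A \<and> a - a * k ^ n \<in> ?S" for n
  proof (induction n)
    case (Suc n)
    have e: "a * k ^ Suc n = a * k ^ n - (a * k ^ n) * h" by (simp add: k_def algebra_simps power_commutes[symmetric])
    have e': "a - a * k ^ Suc n = (a - a * k ^ n) + (a * k ^ n) * h" unfolding e by simp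
    have IH: "a * k ^ n \<in> A" "a - a * k ^ n \<in> ?S" using Suc by auto
    have "(a * k ^ n) * h \<in> ?S" by (rule complex_spanI) (use IH hA in blast)
    then have "a - a * k ^ Suc n \<in> ?S" unfolding e' by (rule complex_span_add[OF IH(2)])
    moreover have "a * k ^ Suc n \<in> A" unfolding e by (rule subalgD(6)[OF A IH(1) subalgD(3)[OF A IH(1) hA]])
    ultimately show ?case by blast
  qed (simp add: a complex_span_zero)
  have lim: "(\<lambda>n. a - a * k ^ n) \<longlonglongrightarrow> a"
  proof -
    have "(norm (a * k ^ n))\<^sup>2 \<le> c * inverse (real (Suc n))" for n
      using order_trans[OF ak[of n], of "c * inverse (real (Suc n))"] c by (simp add: field_simps)
    moreover have "(\<lambda>n. c * inverse (real (Suc n))) \<longlonglongrightarrow> 0"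
      using tendsto_mult_right_zero[OF LIMSEQ_inverse_real_of_nat] .
    ultimately have "(\<lambda>n. (norm (a * k ^ n))\<^sup>2) \<longlonglongrightarrow> 0"
      by - (rule Lim_null_comparison[where g = "\<lambda>n. c * inverse (real (Suc n))"], auto)
    from tendsto_real_sqrt[OF this] have "(\<lambda>n. a * k ^ n) \<longlonglongrightarrow> 0" by (simp add: tendsto_norm_zero_iff)
    from tendsto_diff[OF tendsto_const this, of a] show ?thesis by simp
  qed
  show ?thesis unfolding closure_sequential by (rule exI[of _ "\<lambda>n. a - a * k ^ n"], rule conjI[OF allI[OF conjunct2[OF mem]] lim])
qed

lemma multipliersD: "m \<in> multipliers A ==> a \<in> A ==> m * a \<in> A" "m \<in> multipliers A ==> a \<in> A ==> a * m \<in> A"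
  by (auto simp: multipliers_def)

lemma star_subalgebra_multipliers:
  assumes A: "star_subalgebra A" shows "star_subalgebra (multipliers A)" "1 \<in> multipliers A"
proof -
  have "adj m \<in> multipliers A" if m: "m \<in> multipliers A" for m unfolding multipliers_def
  proof safe
    fix a assume "a \<in> A"
    then have "adj (adj a * m) \<in> A" "adj (m * adj a) \<in> A" using A m by (simp_all only: subalgD multipliersD)
    then show "adj m * a \<in> A" "a * adj m \<in> A" by (simp_all add: adj_mult)
  qed
  then show "star_subalgebra (multipliers A)" unfolding star_subalgebra_def
    using A by (auto simp: multipliers_def subalgD algebra_simps scaleC_mult_left scaleC_mult_right) (metis mult.assoc)+
qed (simp add: multipliers_def)

lemma multipliers_superset: "star_subalgebra A ==> A \<subseteq> multipliers A" by (auto simp: multipliers_def subalgD)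

lemma closed_multipliers: "closed A ==> closed (multipliers A)"
proof -
  assume A: "closed A"
  have "multipliers A = (\<Inter>a\<in>A. ((\<lambda>m. m * a) -` A) \<inter> ((\<lambda>m. a * m) -` A))" by (auto simp: multipliers_def)
  moreover have "closed (((\<lambda>m. m * a) -` A) \<inter> ((\<lambda>m. a * m) -` A))" for a
    by (intro closed_Int continuous_closed_vimage A) (auto intro: continuous_intros)
  ultimately show ?thesis by auto
qed

text \<open>Spectral permanence, through the Neumann series of \<open>m\<^sup>*m\<close>.\<close>
lemma multipliers_inverse:
  assumes A: "star_subalgebra A" "closed A" and m: "m \<in> multipliers A" "m * n = 1" "n * m = 1"
  shows "n \<in> multipliers A"
proof -
  note M = star_subalgebra_multipliers[OF A(1)] closed_multipliers[OF A(2)]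
  have nz: "norm m > 0" "norm n > 0" using m by auto
  define c where "c = (norm m)\<^sup>2"
  define h where "h = (1 / c) *C (adj m * m)"
  define T where "T = 1 - h"
  \<comment> \<open>d bounds h from below, because |v| <= |n| |m v|; hence |1 - h| <= 1 - d < 1 and
    the Neumann series converges.\<close>
  define d where "d = 1 / (c * (norm n)\<^sup>2)"
  have c: "0 < c" "0 < d" using nz by (simp_all add: c_def d_def)
  have "norm T \<le> 1 - d"
  proof (rule norm_selfadj_le)
    show "adj T = T" by (simp add: T_def h_def adj_simps)
    have form: "cinner v (T \<cdot> v) = complex_of_real ((norm v)\<^sup>2 - (norm (m \<cdot> v))\<^sup>2 / c)" for v
      by (simp add: T_def h_def op_simps cinner_simps cinner_adj_right cinner_norm)
    have up: "(norm (m \<cdot> v))\<^sup>2 / c \<le> (norm v)\<^sup>2" for v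
    proof -
      have "(norm (m \<cdot> v))\<^sup>2 \<le> c * (norm v)\<^sup>2" unfolding c_def power_mult_distrib[symmetric] by (intro power_mono norm_op_apply) auto
      then show ?thesis using c by (simp add: field_simps)
    qed
    have low: "d * (norm v)\<^sup>2 \<le> (norm (m \<cdot> v))\<^sup>2 / c" for v
    proof -
      have "norm v \<le> norm n * norm (m \<cdot> v)" using norm_op_apply[of n "m \<cdot> v"] m(3) by (simp add: op_apply_mult[symmetric])
      then have "(norm v)\<^sup>2 \<le> (norm n)\<^sup>2 * (norm (m \<cdot> v))\<^sup>2" unfolding power_mult_distrib[symmetric] by (intro power_mono) auto
      then show ?thesis using c nz by (simp add: d_def field_simps)
    qed
    show "cmod (cinner v (T \<cdot> v)) \<le> (1 - d) * (norm v)\<^sup>2" for v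
      unfolding form norm_of_real using up[of v] low[of v] by (simp add: algebra_simps)
    obtain v :: "'a ell2" where "norm v = 1" using norm_ket[of undefined] ..
    then show "0 \<le> 1 - d" using up[of v] low[of v] by simp
  qed
  then have "norm T < 1" using c by simp
  have TM: "T \<in> multipliers A" "adj m \<in> multipliers A" "h \<in> multipliers A" using m M by (simp_all add: T_def h_def subalgD)
  have pow: "T ^ k \<in> multipliers A" for k by (induction k) (auto simp: M TM subalgD)
  define g where "g N = (\<Sum>k<N. T ^ k)" for N
  have gM: "g N \<in> multipliers A" for N unfolding g_def by (intro subalg_sum M pow)
  have gh: "g N * h = 1 - T ^ N" for N
  proof (induction N)
    case (Suc N)
    have "g (Suc N) * h = 1 - T ^ N + T ^ N * (1 - T)" using Suc by (simp add: g_def distrib_right T_def)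
    then show ?case by (simp add: right_diff_distrib power_commutes)
  qed (simp add: g_def)
  \<comment> \<open>Since h n is a multiple of adj m, the partial sums of the series applied to h n
    stay among the multipliers, and they converge to n.\<close>
  have hn: "h * n = (1 / c) *C adj m" by (simp add: h_def scaleC_mult_left mult.assoc m)
  have lim: "(\<lambda>N. (1 - T ^ N) * n) \<longlonglongrightarrow> (1 - 0) * n"
    using \<open>norm T < 1\<close> by (intro tendsto_intros LIMSEQ_power_zero)
  have mem: "(1 - T ^ N) * n \<in> multipliers A" for N
  proof -
    have "(1 - T ^ N) * n = g N * ((1 / c) *C adj m)" by (simp only: gh[symmetric] mult.assoc hn)
    then show ?thesis using subalgD(3)[OF M(1) gM subalgD(5)[OF M(1) TM(2)]] by simp
  qed
  have "(1 - 0) * n \<in> multipliers A" by (rule closed_sequentially[OF M(3) mem lim])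
  then show ?thesis by simp
qed

section \<open>Strict extensions\<close>

text \<open>Differences of related pairs are related, so the norm bound makes the relation
  single-valued and lets it extend by continuity. Operators can thus be defined by formulas whose
  well-definedness is not visible beforehand.\<close>

lemma ex_op_rel:
  assumes add: "\<And>u z u' z'. R u z ==> R u' z' ==> R (u + u') (z + z')"
    and scale: "\<And>u z c. R u z ==> R (c *C u) (c *C z)"
    and bd: "\<And>u z. R u z ==> norm z \<le> B * norm u"
    and dense: "closure {u. \<exists>z. R u z} = UNIV"
  shows "\<exists>T :: 'i op. \<forall>u z. R u z --> T \<cdot> u = z"
proof -
  have diff: "R (u - u') (z - z')" if "R u z" "R u' z'" for u z u' z' using add[OF that(1) scale[OF that(2), of "-1"]] by simp
  have "\<exists>s z. (\<forall>n::nat. R (s n) (z n)) \<and> s \<longlonglongrightarrow> x" for x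
  proof -
    have "x \<in> closure {u. \<exists>z. R u z}" using dense by simp
    then obtain s where s: "\<forall>n. s n \<in> {u. \<exists>z. R u z}" "s \<longlonglongrightarrow> x" unfolding closure_sequential by blast
    then have "\<forall>n. \<exists>z. R (s n) z" by simp
    then obtain z where "\<forall>n. R (s n) (z n)" by metis
    with s show ?thesis by blast
  qed
  then obtain s z where sz: "\<And>x n. R (s x n) (z x n)" "\<And>x. s x \<longlonglongrightarrow> x" by metis
  have conv: "\<exists>l. w \<longlonglongrightarrow> l" if w: "\<And>n. R (u n) (w n)" and u: "u \<longlonglongrightarrow> x" for u w x
  proof -
    have "Cauchy u" using u LIMSEQ_imp_Cauchy by blast
    have "Cauchy w"
    proof (rule metric_CauchyI)
      fix e :: real assume e: "e > 0"
      then obtain M where M: "\<forall>m\<ge>M. \<forall>n\<ge>M. dist (u m) (u n) < e / (\<bar>B\<bar> + 1)"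
        using metric_CauchyD[OF \<open>Cauchy u\<close>, of "e / (\<bar>B\<bar> + 1)"] by auto
      have "dist (w m) (w n) < e" if "m \<ge> M" "n \<ge> M" for m n
      proof -
        have "dist (w m) (w n) \<le> B * norm (u m - u n)" using bd[OF diff[OF w w]] by (simp add: dist_norm)
        also have "\<dots> \<le> (\<bar>B\<bar> + 1) * norm (u m - u n)" by (intro mult_right_mono) auto
        also have "\<dots> < (\<bar>B\<bar> + 1) * (e / (\<bar>B\<bar> + 1))" using M that by (intro mult_strict_left_mono) (auto simp: dist_norm)
        finally show ?thesis by simp
      qed
      then show "\<exists>M. \<forall>m\<ge>M. \<forall>n\<ge>M. dist (w m) (w n) < e" by blast
    qed
    then show ?thesis by (simp add: Cauchy_convergent_iff convergent_def)
  qed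
  have "\<exists>l. z x \<longlonglongrightarrow> l" for x by (rule conv[OF sz(1) sz(2)])
  then obtain f where f: "\<And>x. z x \<longlonglongrightarrow> f x" by metis
  have lim: "w \<longlonglongrightarrow> f x" if w: "\<And>n. R (u n) (w n)" and u: "u \<longlonglongrightarrow> x" for u w x
  proof -
    have "(\<lambda>n. u n - s x n) \<longlonglongrightarrow> 0" using tendsto_diff[OF u sz(2)[of x]] by simp
    then have t: "(\<lambda>n. B * norm (u n - s x n)) \<longlonglongrightarrow> 0" using tendsto_mult_right_zero tendsto_norm_zero by blast
    have "(\<lambda>n. w n - z x n) \<longlonglongrightarrow> 0" by (rule Lim_null_comparison[OF _ t]) (use bd[OF diff[OF w sz(1)]] in auto)
    from tendsto_add[OF this f[of x]] show ?thesis by simp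
  qed
  have "\<exists>T. \<forall>x. T \<cdot> x = f x"
  proof (rule ex_op)
    show "f (x + y) = f x + f y" for x y
      by (rule LIMSEQ_unique[OF lim tendsto_add[OF f[of x] f[of y]]]) (rule add[OF sz(1) sz(1)], rule tendsto_add[OF sz(2) sz(2)])
    show "f (c *C x) = c *C f x" for c x by (rule LIMSEQ_unique[OF lim bounded_linear.tendsto[OF bounded_linear_scaleC_ell2 f[of x]]])
        (rule scale[OF sz(1)], rule bounded_linear.tendsto[OF bounded_linear_scaleC_ell2 sz(2)])
    show "norm (f x) \<le> B * norm x" for x
      by (rule LIMSEQ_le[OF tendsto_norm[OF f] tendsto_mult[OF tendsto_const tendsto_norm[OF sz(2)]]]) (use bd[OF sz(1)] in blast)
  qed
  then obtain T where T: "\<And>x. T \<cdot> x = f x" by blast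
  have "T \<cdot> u = w" if "R u w" for u w
    unfolding T by (rule LIMSEQ_unique[OF lim[of "\<lambda>_. u" "\<lambda>_. w"] tendsto_const]) (use that in auto)
  then show ?thesis by blast
qed

lemma closure_complex_span_UNIV_I:
  assumes "closure (cspan S) = UNIV" "\<And>x. x \<in> S ==> x \<in> closure (cspan T)"
  shows "closure (cspan T) = (UNIV :: 'i ell2 set)"
proof -
  have K: "csubspace (closure (cspan T))" by (intro csubspace_closure csubspace_complex_span)
  have "x \<in> closure (cspan T)" for x
  proof -
    have "x \<in> closure (cspan S)" using assms by simp
    then show ?thesis by (induction rule: closure_cspan_induct) (use K assms(2) in \<open>auto simp: csubspace_def\<close>)
  qed
  then show ?thesis by blast
qed

lemma op_eq_on_dense:
  assumes "closure (cspan S) = UNIV" "\<And>x. x \<in> S ==> T \<cdot> x = T' \<cdot> x" shows "T = T'"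
proof (rule op_eqI)
  fix x
  have "x \<in> closure (cspan S)" using assms by simp
  then show "T \<cdot> x = T' \<cdot> x"
  proof (induction rule: closure_cspan_induct)
    case closed show ?case by (rule closed_linear_eq; rule linear_op_apply)
  qed (use assms(2) in \<open>auto simp: op_simps\<close>)
qed

lemma cstar_algebraD: "cstar_algebra A ==> star_subalgebra A" "cstar_algebra A ==> closed A"
  "cstar_algebra A ==> closure (cspan {a \<cdot> x | a x. a \<in> A}) = UNIV" by (auto simp: cstar_algebra_def)

lemma cstar_cancel_right: "cstar_algebra A ==> (\<And>a. a \<in> A ==> T * a = T' * a) ==> T = T'"
  by (rule op_eq_on_dense[OF cstar_algebraD(3)]) (auto simp: op_apply_mult[symmetric])

locale strict_hom =
  fixes A :: "'i op set" and B :: "'j op set" and f :: "'i op => 'j op"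
  assumes A: "cstar_algebra A" and B: "cstar_algebra B" and nd: "nondegenerate_hom A B f"
begin

lemmas As = cstar_algebraD(1)[OF A] and Ac = cstar_algebraD(2)[OF A]
  and Bs = cstar_algebraD(1)[OF B] and Bc = cstar_algebraD(2)[OF B]
lemmas MA = star_subalgebra_multipliers[OF As] and MB = star_subalgebra_multipliers[OF Bs]

lemma hom: "star_hom A f" and f_mem: "a \<in> A ==> f a \<in> multipliers B"
  and dense: "closure (cspan {f a * b | a b. a \<in> A \<and> b \<in> B}) = B" using nd by (auto simp: nondegenerate_hom_def)

lemma dense_vec: "closure (cspan {f a \<cdot> x | a x. a \<in> A}) = UNIV"
proof (rule closure_complex_span_UNIV_I[OF cstar_algebraD(3)[OF B]])
  fix x assume "x \<in> {b \<cdot> x | b x. b \<in> B}"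
  then obtain b y where b: "b \<in> closure (cspan {f a * b | a b. a \<in> A \<and> b \<in> B})" "x = b \<cdot> y" using dense by blast
  have "b \<cdot> y \<in> closure (cspan {f a \<cdot> x | a x. a \<in> A})"
  proof (rule closure_linear_image[OF bounded_bilinear.bounded_linear_left[OF bounded_bilinear_op_apply] _ b(1)])
    fix c assume "c \<in> cspan {f a * b | a b. a \<in> A \<and> b \<in> B}"
    then show "c \<cdot> y \<in> cspan {f a \<cdot> x | a x. a \<in> A}"
    proof (induction rule: complex_span_induct)
      case (base c x)
      then obtain a b where "x = f a * b" "a \<in> A" by blast
      then have "x \<cdot> y \<in> {f a \<cdot> x | a x. a \<in> A}" by (auto simp: op_apply_mult)
      then show ?case unfolding op_apply_scaleC_left by (intro complex_span_scaleC complex_spanI)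
    qed (auto simp: complex_span_zero op_apply_add_left intro: complex_span_add)
  qed
  then show "x \<in> closure (cspan {f a \<cdot> x | a x. a \<in> A})" by (simp add: b)
qed

lemma f_cancel: "(\<And>a. a \<in> A ==> y * f a = z * f a) ==> y = z" by (rule op_eq_on_dense[OF dense_vec]) (auto simp: op_apply_mult[symmetric])

lemma f_cancel_left: "(\<And>a. a \<in> A ==> f a * y = f a * z) ==> y = z"
proof -
  assume *: "\<And>a. a \<in> A ==> f a * y = f a * z"
  have "adj y * f a = adj z * f a" if "a \<in> A" for a
    using arg_cong[OF *[OF subalgD(4)[OF As that]], of adj] that by (simp add: adj_mult homD(3)[OF hom])
  then have "adj y = adj z" by (rule f_cancel)
  then show "y = z" by (metis adj_adj)
qed

text \<open>The operator has to send a sum of vectors f(a) v to the sum of the f(m a) v. Let Z p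
  denote the sum of the f(p a) v and let k be the square root of c^2 - adj m * m with c > |m|, a
  multiplier by \<open>ex_quadratic_root\<close>. Then |Z k|^2 + |Z m|^2 = c^2 |Z 1|^2, which bounds
  Z m by Z 1.\<close>

lemma ext_ex_op:
  assumes m: "m \<in> multipliers A"
  shows "\<exists>y. \<forall>a\<in>A. y * f a = f (m * a)"
proof -
  define Z where "Z p xs = (\<Sum>(a, \<xi>)\<leftarrow>xs. f (p * a) \<cdot> \<xi>)" for p xs
  define ok where "ok xs \<longleftrightarrow> (\<forall>(a, \<xi>)\<in>set xs. a \<in> A)" for xs :: "('i op \<times> 'j ell2) list"
  have Z_nil: "Z p [] = 0" and Z_Cons: "Z p ((a, \<xi>) # xs) = f (p * a) \<cdot> \<xi> + Z p xs" for p a \<xi> xs by (simp_all add: Z_def)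
  have one: "cinner (f (p * a) \<cdot> \<xi>) (f (q * b) \<cdot> v) = cinner (f a \<cdot> \<xi>) (f (adj p * q * b) \<cdot> v)"
    if "a \<in> A" "b \<in> A" "p \<in> multipliers A" "q \<in> multipliers A" for a b p q \<xi> v
  proof -
    have mem: "p * a \<in> A" "q * b \<in> A" "adj p * q * b \<in> A" using that MA by (auto simp: multipliersD subalgD)
    have "cinner (f (p * a) \<cdot> \<xi>) (f (q * b) \<cdot> v) = cinner \<xi> ((adj (f (p * a)) * f (q * b)) \<cdot> v)"
      by (simp add: op_apply_mult cinner_adj_right)
    also have "adj (f (p * a)) * f (q * b) = f (adj (p * a) * (q * b))" using mem As hom by (simp add: homD subalgD)
    also have "adj (p * a) * (q * b) = adj a * (adj p * q * b)" by (simp add: adj_mult mult.assoc)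
    also have "f (adj a * (adj p * q * b)) = adj (f a) * f (adj p * q * b)" using mem that As hom by (simp add: homD subalgD)
    finally show ?thesis by (simp add: op_apply_mult cinner_adj_right)
  qed
  have two: "cinner (f (p * a) \<cdot> \<xi>) (Z q ys) = cinner (f a \<cdot> \<xi>) (Z (adj p * q) ys)"
    if "a \<in> A" "ok ys" "p \<in> multipliers A" "q \<in> multipliers A" for a p q \<xi> ys
    using that(2) by (induction ys) (auto simp: Z_nil Z_Cons ok_def cinner_simps one that)
  have form: "cinner (Z p xs) (Z q ys) = cinner (Z 1 xs) (Z (adj p * q) ys)"
    if "ok xs" "ok ys" "p \<in> multipliers A" "q \<in> multipliers A" for p q xs ys
    using that(1) by (induction xs) (auto simp: Z_nil Z_Cons ok_def[of "_ # _"] ok_def[of xs for xs, symmetric] cinner_simps two[OF _ that(2-4)])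
  have Z_diff: "Z (p - q) xs = Z p xs - Z q xs" if "ok xs" "p \<in> multipliers A" "q \<in> multipliers A" for p q xs using that(1) by (induction xs)
      (auto simp: Z_nil Z_Cons ok_def left_diff_distrib star_hom_diff[OF As hom] multipliersD that op_simps)
  have Z_scale: "Z (c *C p) xs = c *C Z p xs" if "ok xs" "p \<in> multipliers A" for p c xs using that(1) by (induction xs)
      (auto simp: Z_nil Z_Cons ok_def scaleC_mult_left homD(4)[OF hom] multipliersD that op_simps scaleC_add_right)
  define c where "c = norm m + 1"
  have c: "c > 0" "norm m < c" by (simp_all add: c_def add_nonneg_pos)
  define x where "x = complex_of_real (1 / c\<^sup>2) *C (adj m * m)"
  have xM: "x \<in> multipliers A" using m MA by (simp add: x_def subalgD)
  have "(norm m)\<^sup>2 < c\<^sup>2" using c by (intro power_strict_mono) auto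
  then have nx: "norm x < 1" using c by (simp add: x_def norm_scaleC_op norm_cstar norm_divide norm_power)
  have ax: "adj x = x" by (simp add: x_def adj_simps)
  obtain y where y: "y \<in> multipliers A" "adj y = y" "2 *C y - y * y = x"
    using ex_quadratic_root[OF closed_multipliers[OF Ac] _ _ _ xM ax nx] MA by (auto simp: subalgD)
  define k where "k = complex_of_real c *C (1 - y)"
  have kM: "k \<in> multipliers A" and ak: "adj k = k" using y MA by (simp_all add: k_def subalgD adj_simps)
  have kk: "k * k = complex_of_real (c\<^sup>2) *C 1 - adj m * m"
  proof -
    have "(1 - y) * (1 - y) = 1 - x" unfolding y(3)[symmetric] by (simp add: algebra_simps scaleC_add_left[of 1 1, simplified])
    then have "k * k = complex_of_real (c\<^sup>2) *C (1 - x)" by (simp add: k_def scaleC_mult_left scaleC_mult_right scaleC_scaleC power2_eq_square)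
    also have "complex_of_real (c\<^sup>2) *C x = adj m * m" using c by (simp add: x_def scaleC_scaleC)
    then have "complex_of_real (c\<^sup>2) *C (1 - x) = complex_of_real (c\<^sup>2) *C 1 - adj m * m" by (simp add: scaleC_diff_right)
    finally show ?thesis .
  qed
  have bound: "norm (Z m xs) \<le> c * norm (Z 1 xs)" if xs: "ok xs" for xs
  proof (rule power2_le_imp_le)
    have mm: "adj m * m \<in> multipliers A" "c *C 1 \<in> multipliers A" for c using m MA by (simp_all add: subalgD)
    have "cinner (Z k xs) (Z k xs) = cinner (Z 1 xs) (Z (complex_of_real (c\<^sup>2) *C 1 - adj m * m) xs)"
      using form[OF xs xs kM kM] by (simp only: ak kk)
    also have "\<dots> = complex_of_real (c\<^sup>2) * cinner (Z 1 xs) (Z 1 xs) - cinner (Z m xs) (Z m xs)"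
      by (simp only: Z_diff[OF xs mm(2) mm(1)] Z_scale[OF xs MA(2)] cinner_simps form[OF xs xs m m])
    finally have "complex_of_real ((norm (Z k xs))\<^sup>2) = complex_of_real (c\<^sup>2 * (norm (Z 1 xs))\<^sup>2 - (norm (Z m xs))\<^sup>2)"
      by (simp only: cinner_norm of_real_diff of_real_mult)
    then have "(norm (Z k xs))\<^sup>2 = c\<^sup>2 * (norm (Z 1 xs))\<^sup>2 - (norm (Z m xs))\<^sup>2" by (simp only: of_real_eq_iff)
    then show "(norm (Z m xs))\<^sup>2 \<le> (c * norm (Z 1 xs))\<^sup>2"
      using zero_le_power2[of "norm (Z k xs)"] unfolding power_mult_distrib by linarith
  qed (use c in simp)
  define R where "R u z \<longleftrightarrow> (\<exists>xs. ok xs \<and> u = Z 1 xs \<and> z = Z m xs)" for u z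
  have "\<exists>T. \<forall>u z. R u z --> T \<cdot> u = z"
  proof (rule ex_op_rel[where B = c])
    have app: "Z p (xs @ ys) = Z p xs + Z p ys" for p xs ys by (simp add: Z_def)
    show add: "R (u + u') (z + z')" if "R u z" "R u' z'" for u z u' z'
    proof -
      obtain xs ys where "ok xs" "u = Z 1 xs" "z = Z m xs" "ok ys" "u' = Z 1 ys" "z' = Z m ys"
        using \<open>R u z\<close> \<open>R u' z'\<close> unfolding R_def by blast
      then show ?thesis unfolding R_def by (intro exI[of _ "xs @ ys"]) (auto simp: ok_def app)
    qed
    have zmap: "Z p (map (\<lambda>(a, \<xi>). (a, c *C \<xi>)) xs) = c *C Z p xs" for p c xs
      by (induction xs) (auto simp: Z_nil Z_Cons scaleC_add_right op_simps)
    show scale: "R (c *C u) (c *C z)" if "R u z" for u z c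
    proof -
      obtain xs where "ok xs" "u = Z 1 xs" "z = Z m xs" using \<open>R u z\<close> unfolding R_def by blast
      then show ?thesis unfolding R_def by (intro exI[of _ "map (\<lambda>(a, \<xi>). (a, c *C \<xi>)) xs"]) (auto simp: ok_def zmap)
    qed
    show "norm z \<le> c * norm u" if "R u z" for u z using that bound by (auto simp: R_def)
    have R0: "R 0 0" unfolding R_def by (intro exI[of _ "[]"]) (simp add: ok_def Z_nil)
    have "cspan {f a \<cdot> x | a x. a \<in> A} \<subseteq> {u. \<exists>z. R u z}"
    proof
      fix u assume "u \<in> cspan {f a \<cdot> x | a x. a \<in> A}"
      then show "u \<in> {u. \<exists>z. R u z}"
      proof (induction rule: complex_span_induct)
        case (base b x)
        then obtain a \<xi> where "x = f a \<cdot> \<xi>" "a \<in> A" by blast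
        then have "R x (f (m * a) \<cdot> \<xi>)" unfolding R_def by (intro exI[of _ "[(a, \<xi>)]"]) (auto simp: ok_def Z_nil Z_Cons)
        then show ?case using scale by blast
      qed (use add R0 in blast)+
    qed
    then show "closure {u. \<exists>z. R u z} = UNIV" using closure_mono dense_vec by blast
  qed
  then obtain T where T: "\<And>u z. R u z ==> T \<cdot> u = z" by blast
  have "T * f a = f (m * a)" if "a \<in> A" for a
  proof (rule op_eqI)
    fix \<xi>
    have "R (f a \<cdot> \<xi>) (f (m * a) \<cdot> \<xi>)" unfolding R_def
      by (intro exI[of _ "[(a, \<xi>)]"]) (use that in \<open>auto simp: ok_def Z_nil Z_Cons\<close>)
    then show "(T * f a) \<cdot> \<xi> = f (m * a) \<cdot> \<xi>" using T by (simp add: op_apply_mult)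
  qed
  then show ?thesis by blast
qed

lemma ext_left: "(\<And>a. a \<in> A ==> y * f a = f (m * a)) ==> m \<in> multipliers A ==> b \<in> B ==> y * b \<in> B"
proof -
  assume y: "\<And>a. a \<in> A ==> y * f a = f (m * a)" and m: "m \<in> multipliers A" and "b \<in> B"
  then have "b \<in> closure (cspan {f a * b | a b. a \<in> A \<and> b \<in> B})" using dense by simp
  then show "y * b \<in> B"
  proof (induction rule: closure_cspan_induct)
    case closed show ?case using continuous_closed_vimage[OF Bc, of "\<lambda>b. y * b"] by (auto simp: vimage_def intro: continuous_intros)
  next
    case (base c x)
    then obtain a b where "x = f a * b" "a \<in> A" "b \<in> B" by blast
    then have "y * (c *C x) = c *C (f (m * a) * b)" "m * a \<in> A" using y m by (simp_all add: scaleC_mult_right mult.assoc[symmetric] multipliersD)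
    then show ?case using f_mem \<open>b \<in> B\<close> Bs by (simp add: subalgD multipliersD)
  qed (use Bs in \<open>auto simp: subalgD distrib_left\<close>)
qed

lemma ext_ex:
  assumes m: "m \<in> multipliers A"
  shows "\<exists>!y. y \<in> multipliers B \<and> (\<forall>a\<in>A. y * f a = f (m * a))"
proof -
  obtain y where y: "\<And>a. a \<in> A ==> y * f a = f (m * a)" using ext_ex_op[OF m] by blast
  have m': "adj m \<in> multipliers A" using m MA by (simp add: subalgD)
  obtain y' where y': "\<And>a. a \<in> A ==> y' * f a = f (adj m * a)" using ext_ex_op[OF m'] by blast
  \<comment> \<open>The adjoint of y extends adj m, so left multiplication by it preserves B as
    well; this makes y a two-sided multiplier.\<close>
  have "adj y = y'"
  proof (rule f_cancel, rule f_cancel_left)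
    fix a c assume ac: "a \<in> A" "c \<in> A"
    have mem: "m * adj c \<in> A" "adj m * a \<in> A" using ac m m' As by (simp_all add: multipliersD subalgD)
    have "f c * (adj y * f a) = adj (y * f (adj c)) * f a" using ac by (simp add: adj_mult homD(3)[OF hom] mult.assoc)
    also have "\<dots> = f (adj (m * adj c)) * f a" unfolding y[OF subalgD(4)[OF As ac(2)]] homD(3)[OF hom mem(1)] ..
    also have "\<dots> = f (adj (m * adj c) * a)" using ac As mem by (simp add: homD(2)[OF hom] subalgD)
    also have "adj (m * adj c) * a = c * (adj m * a)" by (simp add: adj_mult mult.assoc)
    also have "f \<dots> = f c * (y' * f a)" using ac mem by (simp add: y' homD(2)[OF hom])
    finally show "f c * (adj y * f a) = f c * (y' * f a)" .
  qed
  have "y \<in> multipliers B" unfolding multipliers_def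
  proof safe
    fix b assume b: "b \<in> B"
    show "y * b \<in> B" by (rule ext_left[OF y m b])
    have "y' * adj b \<in> B" by (rule ext_left[OF y' m']) (use b Bs in \<open>simp_all add: subalgD\<close>)
    then have "adj (y' * adj b) \<in> B" using Bs subalgD(4) by blast
    then show "b * y \<in> B" by (simp add: adj_mult \<open>adj y = y'\<close>[symmetric])
  qed
  then show ?thesis using y f_cancel by (intro ex1I[of _ y]) auto
qed

abbreviation ext :: "'i op => 'j op" where "ext \<equiv> strict_ext A B f"

lemma ext_mem: "m \<in> multipliers A ==> ext m \<in> multipliers B"
  and ext_apply: "m \<in> multipliers A ==> a \<in> A ==> ext m * f a = f (m * a)" using theI'[OF ext_ex[of m]] unfolding strict_ext_def by blast+

lemma ext_eqI: "m \<in> multipliers A ==> (\<And>a. a \<in> A ==> y * f a = f (m * a)) ==> ext m = y" by (rule f_cancel) (simp add: ext_apply)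

lemma ext_one: "ext 1 = 1" by (rule ext_eqI) (simp_all add: MA)

lemma ext_add: "m \<in> multipliers A ==> n \<in> multipliers A ==> ext (m + n) = ext m + ext n"
  by (rule ext_eqI) (simp_all add: MA subalgD distrib_right ext_apply homD(1)[OF hom] multipliersD)

lemma ext_mult: "m \<in> multipliers A ==> n \<in> multipliers A ==> ext (m * n) = ext m * ext n"
  by (rule ext_eqI) (simp_all add: MA subalgD mult.assoc ext_apply multipliersD)

lemma ext_scaleC: "m \<in> multipliers A ==> ext (c *C m) = c *C ext m"
  by (rule ext_eqI) (simp_all add: MA subalgD scaleC_mult_left ext_apply homD(4)[OF hom] multipliersD)

lemma ext_adj:
  assumes m: "m \<in> multipliers A" shows "ext (adj m) = adj (ext m)"
proof (rule ext_eqI)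
  show m': "adj m \<in> multipliers A" using m MA by (simp add: subalgD)
  fix a assume a: "a \<in> A"
  show "adj (ext m) * f a = f (adj m * a)"
  proof (rule f_cancel_left)
    fix c assume c: "c \<in> A"
    have mem: "m * adj c \<in> A" "adj m * a \<in> A" "adj c \<in> A" using a c m m' As by (simp_all add: multipliersD subalgD)
    have "f c * (adj (ext m) * f a) = adj (ext m * f (adj c)) * f a" using c by (simp add: adj_mult homD(3)[OF hom] mult.assoc)
    also have "\<dots> = f (adj (m * adj c) * a)" using a As mem m by (simp add: ext_apply homD(2,3)[OF hom] subalgD)
    also have "adj (m * adj c) * a = c * (adj m * a)" by (simp add: adj_mult mult.assoc)
    also have "f \<dots> = f c * f (adj m * a)" using c mem by (simp add: homD(2)[OF hom])
    finally show "f c * (adj (ext m) * f a) = f c * f (adj m * a)" .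
  qed
qed

lemma ext_hom: "star_hom (multipliers A) ext" by (simp add: star_hom_def ext_add ext_mult ext_adj ext_scaleC)

lemma ext_zero: "ext 0 = 0" by (rule star_hom_zero[OF MA(1) ext_hom])

lemma ext_sum: "(\<And>k. k \<in> F ==> g k \<in> multipliers A) ==> ext (sum g F) = (\<Sum>k\<in>F. ext (g k))"
  by (rule star_hom_sum[OF MA(1) ext_hom])

end

section \<open>Tensor products of C*-algebras\<close>

lemma tensor_memI: "a \<in> A ==> b \<in> B ==> a \<otimes> b \<in> A \<otimes>\<^sub>m B"
  unfolding cstar_tensor_def by (rule subsetD[OF closure_subset], rule complex_spanI) blast

lemma closed_tensor: "closed (A \<otimes>\<^sub>m B)" by (simp add: cstar_tensor_def)

lemma tensor_zero_mem: "0 \<in> A \<otimes>\<^sub>m B" unfolding cstar_tensor_def by (rule subsetD[OF closure_subset], rule complex_span_zero)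

lemma tensor_add_mem: "s \<in> A \<otimes>\<^sub>m B ==> t \<in> A \<otimes>\<^sub>m B ==> s + t \<in> A \<otimes>\<^sub>m B"
  unfolding cstar_tensor_def by (rule closure_add) (auto intro: complex_span_add)

lemma tensor_scaleC_mem: "t \<in> A \<otimes>\<^sub>m B ==> c *C t \<in> A \<otimes>\<^sub>m B" unfolding cstar_tensor_def
  by (rule closure_linear_image[OF bounded_linear_scaleC_op]) (auto intro: complex_span_scaleC)

lemma tensor_mem_induct [consumes 1, case_names closed add tensor]:
  assumes t: "t \<in> A \<otimes>\<^sub>m B" and "closed {t. P t}" "\<And>s t. P s ==> P t ==> P (s + t)"
    and el: "\<And>a b c. a \<in> A ==> b \<in> B ==> P (c *C (a \<otimes> b))" and ne: "A \<noteq> {} \<and> B \<noteq> {}"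
  shows "P t"
proof -
  obtain a b where "a \<in> A" "b \<in> B" using ne by blast
  from el[OF this, of 0] have P0: "P 0" by simp
  from t[unfolded cstar_tensor_def] show ?thesis
  proof (induction rule: closure_cspan_induct)
    case (base c x) then show ?case using el by blast
  qed (use assms P0 in auto)
qed

lemma linear_mult_op: "bounded_linear (\<lambda>x :: 'i op. y * x)" "bounded_linear (\<lambda>x :: 'i op. x * y)"
  by (rule bounded_linear_mult_right bounded_linear_mult_left)+

lemma closed_vimage: "bounded_linear f ==> closed C ==> closed {x. f x \<in> C}"
  using continuous_closed_vimage[of C f] linear_continuous_at[of f] by (auto simp: vimage_def)

lemma star_subalgebra_ne: "star_subalgebra A ==> A \<noteq> {}" by (auto simp: star_subalgebra_def)

lemma tensor_multiplier_mem:
  assumes "star_subalgebra A" "star_subalgebra B" "m \<in> multipliers A" "n \<in> multipliers B" "t \<in> A \<otimes>\<^sub>m B"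
  shows "(m \<otimes> n) * t \<in> A \<otimes>\<^sub>m B" "t * (m \<otimes> n) \<in> A \<otimes>\<^sub>m B"
proof -
  note ne = star_subalgebra_ne[OF assms(1)] star_subalgebra_ne[OF assms(2)]
  show "(m \<otimes> n) * t \<in> A \<otimes>\<^sub>m B" using assms(5) by (induction rule: tensor_mem_induct)
      (use assms ne in \<open>auto intro!: closed_vimage linear_mult_op closed_tensor tensor_add_mem tensor_scaleC_mem tensor_memI
        simp: distrib_left scaleC_mult_right tensor_op_mult multipliersD\<close>)
  show "t * (m \<otimes> n) \<in> A \<otimes>\<^sub>m B" using assms(5) by (induction rule: tensor_mem_induct)
      (use assms ne in \<open>auto intro!: closed_vimage linear_mult_op closed_tensor tensor_add_mem tensor_scaleC_mem tensor_memI
        simp: distrib_right scaleC_mult_left tensor_op_mult multipliersD\<close>)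
qed

lemma tensor_multiplier: "star_subalgebra A ==> star_subalgebra B ==> m \<in> multipliers A ==> n \<in> multipliers B ==>
    m \<otimes> n \<in> multipliers (A \<otimes>\<^sub>m B)" by (auto simp: multipliers_def[of "A \<otimes>\<^sub>m B"] tensor_multiplier_mem)

lemma star_subalgebra_tensor:
  assumes A: "star_subalgebra A" and B: "star_subalgebra B"
  shows "star_subalgebra (A \<otimes>\<^sub>m B)"
proof -
  note ne = star_subalgebra_ne[OF A] star_subalgebra_ne[OF B]
  have mult: "s * t \<in> A \<otimes>\<^sub>m B" if "s \<in> A \<otimes>\<^sub>m B" "t \<in> A \<otimes>\<^sub>m B" for s t using that(1)
  proof (induction rule: tensor_mem_induct)
    case (tensor a b c)
    then have "(a \<otimes> b) * t \<in> A \<otimes>\<^sub>m B"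
      using tensor_multiplier_mem(1)[OF A B _ _ that(2)] multipliers_superset[OF A] multipliers_superset[OF B] by blast
    then show ?case by (simp add: scaleC_mult_left tensor_scaleC_mem)
  qed (use ne in \<open>auto intro!: closed_vimage linear_mult_op closed_tensor tensor_add_mem simp: distrib_right\<close>)
  have adj: "adj t \<in> A \<otimes>\<^sub>m B" if "t \<in> A \<otimes>\<^sub>m B" for t using that by (induction rule: tensor_mem_induct)
      (use ne A B in \<open>auto intro!: closed_vimage bounded_linear_adj closed_tensor tensor_add_mem tensor_scaleC_mem tensor_memI
         simp: adj_simps adj_tensor subalgD\<close>)
  show ?thesis unfolding star_subalgebra_def using mult adj by (auto simp: tensor_zero_mem tensor_add_mem tensor_scaleC_mem)
qed

lemma cstar_algebra_tensor:
  assumes A: "cstar_algebra A" and B: "cstar_algebra B"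
  shows "cstar_algebra (A \<otimes>\<^sub>m B)"
proof -
  define K where "K = closure (cspan {t \<cdot> x | t x. t \<in> A \<otimes>\<^sub>m B})"
  have K: "csubspace K" "closed K" unfolding K_def by (intro csubspace_closure csubspace_complex_span) simp
  have 1: "(a \<cdot> x) \<odot> (b \<cdot> y) \<in> K" if "a \<in> A" "b \<in> B" for a b x y
  proof -
    have "(a \<otimes> b) \<cdot> (x \<odot> y) \<in> {t \<cdot> x | t x. t \<in> A \<otimes>\<^sub>m B}" using tensor_memI[OF that] by blast
    then show ?thesis unfolding K_def by (simp add: complex_spanI closure_subset[THEN subsetD])
  qed
  have 2: "u \<odot> (b \<cdot> y) \<in> K" if "b \<in> B" for u b y
  proof -
    have "u \<in> closure (cspan {a \<cdot> x | a x. a \<in> A})" using cstar_algebraD(3)[OF A] by simp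
    then show ?thesis by (induction rule: closure_cspan_induct)
        (use K 1[OF _ that] in \<open>auto simp: csubspace_def tensor_vec_simps intro!: closed_vimage bounded_linear_tensor_left\<close>)
  qed
  have 3: "u \<odot> v \<in> K" for u v
  proof -
    have "v \<in> closure (cspan {b \<cdot> x | b x. b \<in> B})" using cstar_algebraD(3)[OF B] by simp
    then show ?thesis by (induction rule: closure_cspan_induct)
        (use K 2 in \<open>auto simp: csubspace_def tensor_vec_simps intro!: closed_vimage bounded_linear_tensor_right\<close>)
  qed
  have "w \<in> K" for w by (induction w rule: tensor_induct) (use K 3 in \<open>auto simp: csubspace_def\<close>)
  then show ?thesis unfolding cstar_algebra_def K_def[symmetric]
    using star_subalgebra_tensor[OF A[THEN cstar_algebraD(1)] B[THEN cstar_algebraD(1)]] closed_tensor by auto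
qed

lemma vsr_tensor_mem:
  assumes "star_subalgebra A" "closed A" "B \<noteq> {}" "t \<in> A \<otimes>\<^sub>m B"
  shows "vsr p q t \<in> A" using assms(4) by (induction rule: tensor_mem_induct)
    (use assms star_subalgebra_ne[OF assms(1)] in \<open>auto intro!: closed_vimage bounded_linear_vsr simp: vsr_add vsr_scaleC vsr_tensor subalgD\<close>)

lemma bounded_linear_flip: "bounded_linear flip_op" by (rule bounded_linear_intro[where K = 1]) (simp_all add: flip_op_algebra scaleR_scaleC)

lemma flip_tensor_mem:
  assumes "A \<noteq> {}" "B \<noteq> {}" "t \<in> A \<otimes>\<^sub>m B"
  shows "flip_op t \<in> B \<otimes>\<^sub>m A" using assms(3)
proof (induction rule: tensor_mem_induct)
  case closed
  show ?case by (rule closed_vimage[OF bounded_linear_flip closed_tensor])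
qed (use assms in \<open>auto simp: flip_op_algebra intro: tensor_add_mem tensor_scaleC_mem tensor_memI\<close>)

lemma vsl_tensor_mem:
  assumes "star_subalgebra B" "closed B" "A \<noteq> {}" "t \<in> A \<otimes>\<^sub>m B"
  shows "vsl p q t \<in> B"
  using vsr_tensor_mem[OF assms(1-3) flip_tensor_mem[OF assms(3) star_subalgebra_ne[OF assms(1)] assms(4)]] by (simp add: vsr_flip)

section \<open>Compression to finitely many coordinates\<close>

lemma matrix_unit_ex: "\<exists>E :: 'j op. \<forall>x. E \<cdot> x = coord x t *C ket s"
proof (rule ex_op[where B = 1])
  fix x :: "'j ell2"
  have "cmod (coord x t) \<le> norm x" using Cauchy_Schwarz[of "ket t" x] by simp
  then show "norm (coord x t *C ket s) \<le> 1 * norm x" by (simp add: norm_scaleC_ell2)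
qed (simp_all add: scaleC_add_left scaleC_scaleC)

definition matrix_unit :: "'j => 'j => 'j op" where
  "matrix_unit s t = (SOME E. \<forall>x. E \<cdot> x = coord x t *C ket s)"

lemma matrix_unit_apply [simp]: "matrix_unit s t \<cdot> x = coord x t *C ket s"
  using someI_ex[OF matrix_unit_ex[of t s]] unfolding matrix_unit_def by blast

lemma adj_matrix_unit: "adj (matrix_unit s t) = matrix_unit t s" by (rule adj_unique) (simp add: cinner_simps)

lemma matrix_unit_mult: "matrix_unit s t * matrix_unit u v = (if t = u then matrix_unit s v else 0)" by (rule op_eqI) (simp add: op_simps coord_ket)

definition coord_proj :: "'j set => 'j op" where "coord_proj F = (\<Sum>s\<in>F. matrix_unit s s)"

lemma coord_proj_trunc: "coord_proj F \<cdot> x = trunc F x" by (simp add: coord_proj_def trunc_def op_apply_sum_left)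

lemma coord_proj_idem: "finite F ==> coord_proj F * coord_proj F = coord_proj F"
  and adj_coord_proj: "adj (coord_proj F') = coord_proj F'"
  by (simp_all add: coord_proj_def sum_product matrix_unit_mult adj_sum adj_matrix_unit cong: if_cong)

lemma norm_coord_proj_le: "finite F ==> norm (coord_proj F) \<le> 1"
proof -
  assume F: "finite F"
  have "(norm (coord_proj F))\<^sup>2 = norm (coord_proj F)" using norm_cstar[of "coord_proj F"] by (simp add: adj_coord_proj coord_proj_idem F)
  then show ?thesis by (metis norm_ge_zero power2_eq_square mult_cancel_right1 order_refl zero_le_one)
qed

text \<open>With the rank-one projection onto \<open>ket s\<close> between S and T the slice
  factorizes; summed over F, slices multiply like matrices.\<close>

lemma vsr_mult_proj:
  assumes "finite F"
  shows "vsr p q (S * (1 \<otimes> coord_proj F) * T) = (\<Sum>s\<in>F. vsr p (ket s) S * vsr (ket s) q T)"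
proof -
  have "vsr p q (S * (1 \<otimes> matrix_unit s s) * T) = vsr p (ket s) S * vsr (ket s) q T" for s
  proof (rule op_eqI_cinner)
    fix x y
    have t: "(1 \<otimes> matrix_unit s s) \<cdot> u = (vsr (ket s) q T \<cdot> y) \<odot> ket s" if "u = T \<cdot> (y \<odot> q)" for u
    proof (rule tensor_cinner_eqI)
      fix a b
      have "cinner (a \<odot> b) ((1 \<otimes> matrix_unit s s) \<cdot> u) = cinner (a \<odot> (coord b s *C ket s)) u"
        by (simp add: cinner_tensor_op adj_matrix_unit)
      also have "\<dots> = cinner (a \<odot> b) ((vsr (ket s) q T \<cdot> y) \<odot> ket s)"
        by (simp add: tensor_vec_simps cinner_simps cinner_vsr that)
      finally show "cinner (a \<odot> b) ((1 \<otimes> matrix_unit s s) \<cdot> u) = cinner (a \<odot> b) ((vsr (ket s) q T \<cdot> y) \<odot> ket s)" .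
    qed
    show "cinner x (vsr p q (S * (1 \<otimes> matrix_unit s s) * T) \<cdot> y) =
      cinner x ((vsr p (ket s) S * vsr (ket s) q T) \<cdot> y)" by (simp add: cinner_vsr op_apply_mult t)
  qed
  then show ?thesis by (simp add: coord_proj_def tensor_op_sum_right sum_distrib_left sum_distrib_right vsr_sum)
qed

text \<open>Slicing the second leg by \<open>f\<close>: compression to finitely many coordinates reduces the estimate to a
  \<open>*\<close>-homomorphism between matrix algebras.\<close>
lemma slicewise_hom_contractive:
  fixes t :: "('i \<times> 'j) op" and Q :: "('k \<times> 'j) op"
  assumes A: "star_subalgebra A" "closed A" and f: "star_hom A f"
    and tA: "\<And>v q. vsr v q t \<in> A" and Q: "\<And>v q. vsr v q Q = f (vsr v q t)"
  shows "norm Q \<le> norm t"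
proof -
  have compress: "norm ((1 \<otimes> coord_proj F) * Q * (1 \<otimes> coord_proj F)) \<le> norm t" if F: "finite F" for F
  proof -
    let ?P = "coord_proj F"
    \<comment> \<open>M plays the role of the F-by-F matrices over A, realized as operators
      supported on the coordinates in F; g applies f to every entry.\<close>
    define M where "M = {T :: ('i \<times> 'j) op. (\<forall>v q. vsr v q T \<in> A) \<and> (1 \<otimes> ?P) * T * (1 \<otimes> ?P) = T}"
    define g where "g T = (\<Sum>s\<in>F. \<Sum>u\<in>F. f (vsr (ket s) (ket u) T) \<otimes> matrix_unit s u)" for T :: "('i \<times> 'j) op"
    have PP: "(1 \<otimes> ?P) * (1 \<otimes> ?P) = (1 \<otimes> ?P :: ('i \<times> 'j) op)" by (simp add: tensor_op_mult coord_proj_idem F)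
    have PT: "T * (1 \<otimes> ?P) = T" "(1 \<otimes> ?P) * T = T" if "T \<in> M" for T
    proof -
      have e: "T = (1 \<otimes> ?P) * T * (1 \<otimes> ?P)" using that by (simp add: M_def)
      show "T * (1 \<otimes> ?P) = T" by (subst e, subst (2) e) (simp add: mult.assoc PP)
      show "(1 \<otimes> ?P) * T = T" by (subst e, subst (2) e) (simp add: mult.assoc[symmetric] PP)
    qed
    have vsr_prod: "vsr v q (S * T) = (\<Sum>s\<in>F. vsr v (ket s) S * vsr (ket s) q T)" if "S \<in> M" for S T v q
      using vsr_mult_proj[OF F, of v q S T] PT(1)[OF that] by simp
    have Ms: "star_subalgebra M" unfolding star_subalgebra_def
    proof (intro conjI ballI allI)
      fix S T c assume S: "S \<in> M" and T: "T \<in> M"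
      show "S + T \<in> M" using S T A by (simp add: M_def vsr_add subalgD distrib_left distrib_right)
      show "c *C S \<in> M" using S A by (simp add: M_def vsr_scaleC subalgD scaleC_mult_left scaleC_mult_right)
      have "(1 \<otimes> ?P) * (S * T) * (1 \<otimes> ?P) = ((1 \<otimes> ?P) * S) * (T * (1 \<otimes> ?P))" by (simp add: mult.assoc)
      also have "\<dots> = S * T" using PT[OF S] PT[OF T] by simp
      finally have e: "(1 \<otimes> ?P) * (S * T) * (1 \<otimes> ?P) = S * T" .
      have "\<forall>v q. vsr v q (S * T) \<in> A" unfolding vsr_prod[OF S] using S T A by (auto simp: M_def intro!: subalg_sum subalgD(3))
      then show "S * T \<in> M" using e by (simp add: M_def)
      have "adj ((1 \<otimes> ?P) * S * (1 \<otimes> ?P)) = adj S" using S by (simp add: M_def)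
      then have "(1 \<otimes> ?P) * adj S * (1 \<otimes> ?P) = adj S" by (simp add: adj_mult adj_tensor adj_coord_proj mult.assoc)
      moreover have "vsr v q (adj S) \<in> A" for v q unfolding adj_vsr[symmetric] using S A by (simp add: M_def subalgD)
      ultimately show "adj S \<in> M" by (simp add: M_def)
    next
      show "0 \<in> M" using A by (simp add: M_def subalgD)
    qed
    have Mc: "closed M"
    proof -
      have "M = (\<Inter>v. \<Inter>q. {T. vsr v q T \<in> A}) \<inter> {T. (1 \<otimes> ?P) * T * (1 \<otimes> ?P) = T}" by (auto simp: M_def)
      moreover have "closed {T. vsr v q T \<in> A}" for v q by (rule closed_vimage[OF bounded_linear_vsr A(2)])
      moreover have "closed {T :: ('i \<times> 'j) op. (1 \<otimes> ?P) * T * (1 \<otimes> ?P) = T}"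
        by (rule closed_linear_eq[OF bounded_linear_compose[OF linear_mult_op(2) linear_mult_op(1)] bounded_linear_ident])
      ultimately show ?thesis by (auto intro!: closed_Int closed_INT)
    qed
    have mem: "vsr v q T \<in> A" if "T \<in> M" for T v q using that by (simp add: M_def)
    have gh: "star_hom M g" unfolding star_hom_def
    proof (intro conjI ballI allI)
      fix S T c assume S: "S \<in> M" and T: "T \<in> M"
      show "g (S + T) = g S + g T" by (simp add: g_def vsr_add homD(1)[OF f mem[OF S] mem[OF T]] tensor_op_add_left sum.distrib)
      show "g (c *C S) = c *C g S" by (simp add: g_def vsr_scaleC homD(4)[OF f mem[OF S]] tensor_op_scaleC_left scaleC_sum_right)
      have "adj (g S) = (\<Sum>s\<in>F. \<Sum>u\<in>F. f (vsr (ket u) (ket s) (adj S)) \<otimes> matrix_unit u s)"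
        by (simp add: g_def adj_sum adj_tensor adj_matrix_unit homD(3)[OF f mem[OF S], symmetric] adj_vsr)
      also have "\<dots> = g (adj S)" unfolding g_def by (rule sum.swap)
      finally show "g (adj S) = adj (g S)" by simp
      have "g S * g T = (\<Sum>s\<in>F. \<Sum>u\<in>F. \<Sum>s'\<in>F. \<Sum>u'\<in>F.
          (f (vsr (ket s) (ket u) S) * f (vsr (ket s') (ket u') T)) \<otimes> (matrix_unit s u * matrix_unit s' u'))"
        unfolding g_def sum_distrib_right by (simp only: sum_distrib_left tensor_op_mult)
      also have "\<dots> = (\<Sum>s\<in>F. \<Sum>u\<in>F. \<Sum>u'\<in>F. (f (vsr (ket s) (ket u) S) * f (vsr (ket u) (ket u') T)) \<otimes> matrix_unit s u')"
      proof (rule sum.cong[OF refl], rule sum.cong[OF refl])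
        fix s u assume "s \<in> F" "u \<in> F"
        show "(\<Sum>s'\<in>F. \<Sum>u'\<in>F. (f (vsr (ket s) (ket u) S) * f (vsr (ket s') (ket u') T)) \<otimes> (matrix_unit s u * matrix_unit s' u'))
          = (\<Sum>u'\<in>F. (f (vsr (ket s) (ket u) S) * f (vsr (ket u) (ket u') T)) \<otimes> matrix_unit s u')"
          by (subst sum.swap) (simp add: matrix_unit_mult if_distrib[of "\<lambda>x. _ \<otimes> x"] F \<open>u \<in> F\<close> cong: if_cong)
      qed
      also have "\<dots> = (\<Sum>s\<in>F. \<Sum>u'\<in>F. (\<Sum>u\<in>F. f (vsr (ket s) (ket u) S) * f (vsr (ket u) (ket u') T)) \<otimes> matrix_unit s u')"
        unfolding tensor_op_sum_left by (rule sum.cong[OF refl]) (rule sum.swap)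
      also have "\<dots> = g (S * T)" unfolding g_def vsr_prod[OF S] using A
        by (simp add: star_hom_sum[OF A(1) f] subalgD mem S T homD(2)[OF f mem[OF S] mem[OF T]])
      finally show "g (S * T) = g S * g T" by simp
    qed
    let ?t = "(1 \<otimes> ?P) * t * (1 \<otimes> ?P)"
    have tM: "?t \<in> M" unfolding M_def using tA PP by (auto simp: vsr_mult_in mult.assoc) (simp add: mult.assoc[symmetric] PP)
    have Pket: "coord_proj F \<cdot> ket s = ket s" if "s \<in> F" for s
      using that F by (intro ell2_eqI) (simp add: coord_proj_trunc coord_trunc coord_ket)
    have E: "(1 \<otimes> matrix_unit s s) * Q * (1 \<otimes> matrix_unit u u) = vsr (ket s) (ket u) Q \<otimes> matrix_unit s u" for s u
      by (rule op_vsr_eqI) (simp add: mult.assoc vsr_mult_in vsr_tensor adj_matrix_unit,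
          rule op_eqI_cinner, simp add: cinner_vsr tensor_vec_simps cinner_simps op_simps)
    have "(1 \<otimes> ?P) * Q * (1 \<otimes> ?P) = (\<Sum>s\<in>F. \<Sum>u\<in>F. (1 \<otimes> matrix_unit s s) * Q * (1 \<otimes> matrix_unit u u))"
      by (simp add: coord_proj_def tensor_op_sum_right sum_distrib_left sum_distrib_right) (rule sum.swap)
    also have "\<dots> = g ?t" unfolding E Q g_def by (intro sum.cong refl) (simp add: mult.assoc vsr_mult_in adj_coord_proj Pket)
    finally have "norm ((1 \<otimes> ?P) * Q * (1 \<otimes> ?P)) \<le> norm ?t" using star_hom_contractive[OF Ms Mc gh tM] by simp
    also have "\<dots> \<le> norm (1 \<otimes> ?P :: ('i \<times> 'j) op) * norm t * norm (1 \<otimes> ?P :: ('i \<times> 'j) op)"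
      using norm_mult_ineq[of "(1 \<otimes> ?P) * t" "1 \<otimes> ?P"] mult_right_mono[OF norm_mult_ineq[of "1 \<otimes> ?P" t]]
      by (meson norm_ge_zero order_trans)
    also have "\<dots> \<le> 1 * norm t * 1" using norm_tensor_op_le[of "1 :: 'i op" ?P] norm_coord_proj_le[OF F] by (intro mult_mono) auto
    finally show ?thesis by simp
  qed
  \<comment> \<open>The second coordinates of the pairs in G determine a compression that fixes both
    truncated vectors, so the bound for compressions holds on finitely supported vectors.\<close>
  have fin: "cmod (cinner (trunc G x) (Q \<cdot> trunc G y)) \<le> norm t * norm (trunc G x) * norm (trunc G y)" if G: "finite G" for G x y
  proof -
    let ?P = "coord_proj (snd ` G)"
    have P: "(1 \<otimes> ?P) \<cdot> trunc G z = trunc G z" for z :: "('k \<times> 'j) ell2"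
    proof -
      have "(1 \<otimes> ?P) \<cdot> ket p = ket p" if "p \<in> G" for p :: "'k \<times> 'j"
      proof (cases p)
        case (Pair k j)
        then have "j \<in> snd ` G" using that by force
        then have "?P \<cdot> ket j = ket j" using G by (intro ell2_eqI) (simp add: coord_proj_trunc coord_trunc coord_ket)
        then show ?thesis by (simp add: Pair ket_tensor)
      qed
      then show ?thesis by (simp add: trunc_def op_simps)
    qed
    have "cinner (trunc G x) (Q \<cdot> trunc G y) = cinner ((1 \<otimes> ?P) \<cdot> trunc G x) (Q \<cdot> (1 \<otimes> ?P) \<cdot> trunc G y)" by (simp add: P)
    also have "\<dots> = cinner (trunc G x) (((1 \<otimes> ?P) * Q * (1 \<otimes> ?P)) \<cdot> trunc G y)"
      by (simp only: cinner_adj_right[symmetric] adj_tensor adj_coord_proj adj_one op_apply_mult)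
    finally show ?thesis using cmod_cinner_op_le[of "trunc G x" "(1 \<otimes> ?P) * Q * (1 \<otimes> ?P)" "trunc G y"]
        mult_right_mono[OF mult_right_mono[OF compress[of "snd ` G"], of "norm (trunc G x)"], of "norm (trunc G y)"] G by simp
  qed
  show ?thesis
  proof (rule norm_op_cinner_leI)
    fix x y :: "('k \<times> 'j) ell2"
    show "cmod (cinner x (Q \<cdot> y)) \<le> norm t * norm x * norm y"
    proof (rule tendsto_le)
      show "((\<lambda>G. norm t * norm (trunc G x) * norm (trunc G y)) \<longlongrightarrow> norm t * norm x * norm y) (finite_subsets_at_top UNIV)"
        by (intro tendsto_intros trunc_tendsto)
      show "((\<lambda>G. cmod (cinner (trunc G x) (Q \<cdot> trunc G y))) \<longlongrightarrow> cmod (cinner x (Q \<cdot> y))) (finite_subsets_at_top UNIV)"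
        by (intro tendsto_norm tendsto_cinner bounded_linear.tendsto[OF linear_op_apply] trunc_tendsto)
      show "\<forall>\<^sub>F G in finite_subsets_at_top UNIV. cmod (cinner (trunc G x) (Q \<cdot> trunc G y)) \<le> norm t * norm (trunc G x) * norm (trunc G y)"
        using fin by (auto simp: eventually_finite_subsets_at_top)
    qed simp
  qed simp
qed

text \<open>On finite sums of elementary tensors Q is explicit. The contraction estimate makes the
  images of an approximating sequence Cauchy, and their limit still has the prescribed
  slices.\<close>

lemma tensor_hom_slices_ex:
  fixes B :: "'j op set" and A :: "'i op set" and f :: "'i op => 'k op"
  assumes A: "star_subalgebra A" "closed A" and f: "star_hom A f" and B: "B \<noteq> {}" and t: "t \<in> A \<otimes>\<^sub>m B"
  shows "\<exists>Q. \<forall>p q. vsr p q Q = f (vsr p q t)"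
proof -
  define Rel where "Rel s Q \<longleftrightarrow> (\<forall>p q. vsr p q s \<in> A) \<and> (\<forall>p q. vsr p q Q = f (vsr p q s))"
    for s :: "('i \<times> 'j) op" and Q :: "('k \<times> 'j) op"
  have add: "Rel (s + s') (Q + Q')" if "Rel s Q" "Rel s' Q'" for s s' Q Q' using that A f by (simp add: Rel_def vsr_add homD subalgD)
  have scale: "Rel (c *C s) (c *C Q)" if "Rel s Q" for s Q c using that A f by (simp add: Rel_def vsr_scaleC homD subalgD)
  have bd: "norm Q \<le> norm s" if "Rel s Q" for s Q using slicewise_hom_contractive[OF A f, of s Q] that by (simp add: Rel_def)
  have diff: "Rel (s - s') (Q - Q')" if "Rel s Q" "Rel s' Q'" for s s' Q Q' using add[OF that(1) scale[OF that(2), of "-1"]] by simp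
  have base: "\<exists>Q. Rel s Q" if "s \<in> cspan {a \<otimes> b | a b. a \<in> A \<and> b \<in> B}" for s using that
  proof (induction rule: complex_span_induct)
    case zero
    have "Rel 0 0" using A f by (simp add: Rel_def subalgD star_hom_zero)
    then show ?case ..
  next
    case (add x y) then show ?case using \<open>\<And>s s' Q Q'. Rel s Q ==> Rel s' Q' ==> Rel (s + s') (Q + Q')\<close> by blast
  next
    case (base c x)
    then obtain a b where x: "x = a \<otimes> b" "a \<in> A" by blast
    then have "Rel x (f a \<otimes> b)" using A f by (simp add: Rel_def vsr_tensor subalgD homD)
    then show ?case using scale by blast
  qed
  have "t \<in> closure (cspan {a \<otimes> b | a b. a \<in> A \<and> b \<in> B})" using t by (simp add: cstar_tensor_def)
  then obtain s where s: "\<forall>n. s n \<in> cspan {a \<otimes> b | a b. a \<in> A \<and> b \<in> B}" "s \<longlonglongrightarrow> t" unfolding closure_sequential by blast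
  then have "\<forall>n. \<exists>Q. Rel (s n) Q" using base by blast
  then obtain Q where Q: "\<And>n. Rel (s n) (Q n)" by metis
  have "Cauchy s" using s LIMSEQ_imp_Cauchy by blast
  have "Cauchy Q"
  proof (rule metric_CauchyI)
    fix e :: real assume "e > 0"
    then obtain M where "\<forall>m\<ge>M. \<forall>n\<ge>M. dist (s m) (s n) < e" using metric_CauchyD[OF \<open>Cauchy s\<close>] by blast
    then show "\<exists>M. \<forall>m\<ge>M. \<forall>n\<ge>M. dist (Q m) (Q n) < e"
      using bd[OF diff[OF Q Q]] unfolding dist_norm by (meson le_less_trans)
  qed
  then obtain Q0 where Q0: "Q \<longlonglongrightarrow> Q0" using Cauchy_convergent_iff convergent_def by blast
  have tA: "vsr p q t \<in> A" for p q by (rule vsr_tensor_mem[OF A B t])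
  have "vsr p q Q0 = f (vsr p q t)" for p q
  proof (rule LIMSEQ_unique)
    show "(\<lambda>n. vsr p q (Q n)) \<longlonglongrightarrow> vsr p q Q0" by (rule bounded_linear.tendsto[OF bounded_linear_vsr Q0])
    have l: "(\<lambda>n. norm (vsr p q (s n) - vsr p q t)) \<longlonglongrightarrow> 0"
      using bounded_linear.tendsto[OF bounded_linear_vsr s(2)] by (simp add: LIM_zero tendsto_norm_zero)
    have "norm (vsr p q (Q n) - f (vsr p q t)) \<le> norm (vsr p q (s n) - vsr p q t)" for n
    proof -
      have m: "vsr p q (s n) \<in> A" "vsr p q (Q n) = f (vsr p q (s n))" using Q by (auto simp: Rel_def)
      show ?thesis unfolding m(2) star_hom_diff[OF A(1) f m(1) tA, symmetric] by (rule star_hom_contractive[OF A f subalgD(6)[OF A(1) m(1) tA]])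
    qed
    then have "(\<lambda>n. vsr p q (Q n) - f (vsr p q t)) \<longlonglongrightarrow> 0" by - (rule Lim_null_comparison[OF _ l], simp)
    then show "(\<lambda>n. vsr p q (Q n)) \<longlonglongrightarrow> f (vsr p q t)" by (simp add: LIM_zero_iff)
  qed
  then show ?thesis by blast
qed

lemma star_hom_continuous:
  assumes A: "star_subalgebra A" "closed A" and f: "star_hom A f"
  shows "continuous_on A f"
proof (rule continuous_onI)
  fix x e assume "x \<in> A" "(e :: real) > 0"
  have "dist (f y) (f x) \<le> dist y x" if "y \<in> A" for y
    using star_hom_contractive[OF A f subalgD(6)[OF A(1) that \<open>x \<in> A\<close>]] star_hom_diff[OF A(1) f that \<open>x \<in> A\<close>] by (simp add: dist_norm)
  then show "\<exists>d>0. \<forall>y\<in>A. dist y x < d --> dist (f y) (f x) \<le> e" using \<open>e > 0\<close> by (meson less_imp_le order_trans)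
qed

text \<open>F is given by its slices, so linearity and adjoints are read off slicewise;
  multiplicativity is checked against elementary tensors and extended by continuity.\<close>

lemma tensor_hom_left_ex:
  fixes B :: "'j op set" and A :: "'i op set" and f :: "'i op => 'k op"
  assumes A: "star_subalgebra A" "closed A" and f: "star_hom A f" and B: "star_subalgebra B"
  shows "\<exists>F. star_hom (A \<otimes>\<^sub>m B) F \<and> (\<forall>a\<in>A. \<forall>b\<in>B. F (a \<otimes> b) = f a \<otimes> b)"
proof -
  note Bne = star_subalgebra_ne[OF B]
  obtain F where F: "\<And>t p q. t \<in> A \<otimes>\<^sub>m B ==> vsr p q (F t) = f (vsr p q t)" using tensor_hom_slices_ex[OF A f Bne] by metis
  note TA = vsr_tensor_mem[OF A Bne]
  note S = star_subalgebra_tensor[OF A(1) B]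
  have add: "F (s + t) = F s + F t" if "s \<in> A \<otimes>\<^sub>m B" "t \<in> A \<otimes>\<^sub>m B" for s t
    by (rule op_vsr_eqI) (simp add: F that vsr_add subalgD[OF S] homD[OF f] TA)
  have scale: "F (c *C t) = c *C F t" if "t \<in> A \<otimes>\<^sub>m B" for c t
    by (rule op_vsr_eqI) (simp add: F that vsr_scaleC subalgD[OF S] homD[OF f] TA)
  have adj: "F (adj t) = adj (F t)" if "t \<in> A \<otimes>\<^sub>m B" for t
    by (rule op_vsr_eqI) (simp add: F that subalgD[OF S] homD[OF f] TA adj_vsr[symmetric])
  have el: "F (a \<otimes> b) = f a \<otimes> b" if "a \<in> A" "b \<in> B" for a b
    by (rule op_vsr_eqI) (simp add: F that tensor_memI vsr_tensor homD[OF f])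
  have bd: "norm (F t) \<le> norm t" if "t \<in> A \<otimes>\<^sub>m B" for t by (rule slicewise_hom_contractive[OF A f]) (simp_all add: F that TA)
  have mult_el: "F (t * (a \<otimes> b)) = F t * (f a \<otimes> b)" if "t \<in> A \<otimes>\<^sub>m B" "a \<in> A" "b \<in> B" for t a b
  proof (rule op_vsr_eqI)
    have e: "vsr p q (X * (c \<otimes> b)) = vsr p (b \<cdot> q) X * c" for X p q and c :: "'z op"
    proof -
      have "X * (c \<otimes> b) = X * (1 \<otimes> b) * (c \<otimes> 1)" by (simp add: mult.assoc tensor_op_mult)
      then show ?thesis by (simp only: vsr_mult_out vsr_mult_in)
    qed
    show "vsr p q (F (t * (a \<otimes> b))) = vsr p q (F t * (f a \<otimes> b))" for p q
      using that by (simp add: F subalgD[OF S] tensor_memI e homD[OF f] TA)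
  qed
  have mult: "F (s * t) = F s * F t" if s: "s \<in> A \<otimes>\<^sub>m B" and t: "t \<in> A \<otimes>\<^sub>m B" for s t
  proof -
    \<comment> \<open>Membership is part of the induction predicate because F is continuous only on
      the tensor product, so that closedness is available only inside it.\<close>
    have "t \<in> A \<otimes>\<^sub>m B \<and> F (s * t) = F s * F t" using t
    proof (induction rule: tensor_mem_induct)
      case closed
      have cF: "continuous_on (A \<otimes>\<^sub>m B) F"
      proof (rule continuous_onI)
        fix x e assume x: "x \<in> A \<otimes>\<^sub>m B" and "(e :: real) > 0"
        have "dist (F y) (F x) \<le> dist y x" if y: "y \<in> A \<otimes>\<^sub>m B" for y
        proof -
          have "F (y - x) = F y - F x" using add[OF y subalgD(5)[OF S x], of "-1"] scale[OF x, of "-1"] by simp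
          then show ?thesis using bd[OF subalgD(6)[OF S y x]] by (simp add: dist_norm)
        qed
        then show "\<exists>d>0. \<forall>y\<in>A \<otimes>\<^sub>m B. dist y x < d --> dist (F y) (F x) \<le> e" using \<open>e > 0\<close> by (meson less_imp_le order_trans)
      qed
      have "continuous_on (A \<otimes>\<^sub>m B) (\<lambda>t. F (s * t) - F s * F t)"
        by (intro continuous_on_diff continuous_on_compose2[OF cF] continuous_on_mult cF continuous_on_const continuous_on_id)
          (auto simp: subalgD[OF S] s)
      from continuous_closed_preimage[OF this closed_tensor closed_singleton[of 0]]
      show ?case by (simp add: vimage_def Int_def)
    next
      case (tensor a b c)
      then show ?case using s by (simp add: tensor_memI tensor_scaleC_mem scale scaleC_mult_right mult_el el subalgD[OF S])
    qed (use star_subalgebra_ne[OF A(1)] Bne s in \<open>auto simp: subalgD[OF S] distrib_left add\<close>)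
    then show ?thesis ..
  qed
  have "star_hom (A \<otimes>\<^sub>m B) F" unfolding star_hom_def using add mult adj scale by blast
  with el show ?thesis by blast
qed

lemma star_hom_tensor_unique:
  assumes "star_subalgebra A" "star_subalgebra B" "star_hom (A \<otimes>\<^sub>m B) F" "star_hom (A \<otimes>\<^sub>m B) G"
    and "\<And>a b. a \<in> A ==> b \<in> B ==> F (a \<otimes> b) = G (a \<otimes> b)" and "t \<in> A \<otimes>\<^sub>m B"
  shows "F t = G t"
proof -
  note S = star_subalgebra_tensor[OF assms(1,2)]
  have "t \<in> A \<otimes>\<^sub>m B \<and> F t = G t" using assms(6)
  proof (induction rule: tensor_mem_induct)
    case closed
    have "continuous_on (A \<otimes>\<^sub>m B) (\<lambda>t. F t - G t)" by (intro continuous_on_diff star_hom_continuous[OF S closed_tensor] assms)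
    from continuous_closed_preimage[OF this closed_tensor closed_singleton[of 0]]
    show ?case by (simp add: vimage_def Int_def)
  next
    case (tensor a b c)
    then show ?case using assms(5) by (simp add: tensor_memI tensor_scaleC_mem homD(4)[OF assms(3)] homD(4)[OF assms(4)])
  qed (use star_subalgebra_ne[OF assms(1)] star_subalgebra_ne[OF assms(2)] assms(3,4) in \<open>auto simp: subalgD[OF S] homD(1)\<close>)
  then show ?thesis ..
qed

lemma star_hom_image: 
  assumes "star_subalgebra A" "star_hom A f" shows "star_subalgebra (f ` A)" unfolding star_subalgebra_def using assms
  by (auto simp: homD[symmetric] subalgD intro: image_eqI[where x = 0] star_hom_zero[symmetric])

text \<open>f \<otimes> g is (f \<otimes> id) after (id \<otimes> g), where the second map is the
  one-sided construction conjugated with the flip. The value 0 off the tensor product makes the map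
  unique as a function, as the description in \<open>cstar_tensor_hom\<close> demands.\<close>

lemma tensor_hom_ex:
  fixes A :: "'i op set" and B :: "'j op set" and f :: "'i op => 'k op" and g :: "'j op => 'l op"
  assumes A: "star_subalgebra A" "closed A" and f: "star_hom A f" and B: "star_subalgebra B" "closed B" and g: "star_hom B g"
  shows "\<exists>!F. star_hom (A \<otimes>\<^sub>m B) F \<and> (\<forall>x. x \<notin> A \<otimes>\<^sub>m B --> F x = 0) \<and> (\<forall>a\<in>A. \<forall>b\<in>B. F (a \<otimes> b) = f a \<otimes> g b)"
proof -
  obtain F1 where F1: "star_hom (B \<otimes>\<^sub>m A) F1" "\<And>a b. a \<in> A ==> b \<in> B ==> F1 (b \<otimes> a) = g b \<otimes> a"
    using tensor_hom_left_ex[OF B g A(1)] by blast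
  define C where "C = closure (g ` B)"
  note Ane = star_subalgebra_ne[OF A(1)] and Bne = star_subalgebra_ne[OF B(1)]
  have gs: "star_subalgebra (g ` B)" by (rule star_hom_image[OF B(1) g])
  obtain F2 where F2: "star_hom (A \<otimes>\<^sub>m (g ` B)) F2" "\<And>a b. a \<in> A ==> b \<in> g ` B ==> F2 (a \<otimes> b) = f a \<otimes> b"
    using tensor_hom_left_ex[OF A f gs] by blast
  define G where "G t = flip_op (F1 (flip_op t))" for t
  have fl: "flip_op t \<in> B \<otimes>\<^sub>m A" if "t \<in> A \<otimes>\<^sub>m B" for t by (rule flip_tensor_mem[OF Ane Bne that])
  have G: "star_hom (A \<otimes>\<^sub>m B) G" unfolding star_hom_def G_def using fl by (auto simp: flip_op_algebra homD[OF F1(1)])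
  have Gm: "G t \<in> A \<otimes>\<^sub>m (g ` B)" if "t \<in> A \<otimes>\<^sub>m B" for t
  proof -
    note S = star_subalgebra_tensor[OF A(1) B(1)]
    have c: "continuous_on (A \<otimes>\<^sub>m B) G" by (rule star_hom_continuous[OF S closed_tensor G])
    have "t \<in> A \<otimes>\<^sub>m B \<and> G t \<in> A \<otimes>\<^sub>m (g ` B)" using that
    proof (induction rule: tensor_mem_induct)
      case closed
      from continuous_closed_preimage[OF c closed_tensor closed_tensor] show ?case by (simp add: vimage_def Int_def)
    next
      case (tensor a b c)
      then show ?case by (simp add: tensor_memI tensor_scaleC_mem homD(4)[OF G]) (simp add: G_def F1 tensor_memI tensor_scaleC_mem)
    qed (use Ane Bne in \<open>auto simp: homD(1)[OF G] tensor_add_mem\<close>)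
    then show ?thesis ..
  qed
  define F where "F t = (if t \<in> A \<otimes>\<^sub>m B then F2 (G t) else 0)" for t
  have F: "star_hom (A \<otimes>\<^sub>m B) F" unfolding star_hom_def F_def
    by (auto simp: subalgD[OF star_subalgebra_tensor[OF A(1) B(1)]] homD[OF G] homD[OF F2(1)] Gm)
  have el: "\<forall>a\<in>A. \<forall>b\<in>B. F (a \<otimes> b) = f a \<otimes> g b" by (simp add: F_def tensor_memI G_def F1 F2)
  show ?thesis
  proof (rule ex1I[of _ F])
    show "star_hom (A \<otimes>\<^sub>m B) F \<and> (\<forall>x. x \<notin> A \<otimes>\<^sub>m B --> F x = 0) \<and> (\<forall>a\<in>A. \<forall>b\<in>B. F (a \<otimes> b) = f a \<otimes> g b)"
      using F el by (simp add: F_def)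
    fix F' assume F': "star_hom (A \<otimes>\<^sub>m B) F' \<and> (\<forall>x. x \<notin> A \<otimes>\<^sub>m B --> F' x = 0) \<and> (\<forall>a\<in>A. \<forall>b\<in>B. F' (a \<otimes> b) = f a \<otimes> g b)"
    show "F' = F"
    proof
      fix t show "F' t = F t"
        using star_hom_tensor_unique[OF A(1) B(1), of F' F t] F F' el by (cases "t \<in> A \<otimes>\<^sub>m B") (auto simp: F_def)
    qed
  qed
qed

lemma cstar_tensor_hom:
  assumes "star_subalgebra A" "closed A" "star_hom A f" "star_subalgebra B" "closed B" "star_hom B g"
  shows "star_hom (A \<otimes>\<^sub>m B) (cstar_tensor_hom A B f g)"
    "a \<in> A ==> b \<in> B ==> cstar_tensor_hom A B f g (a \<otimes> b) = f a \<otimes> g b"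
  using theI'[OF tensor_hom_ex[OF assms]] unfolding cstar_tensor_hom_def by blast+

section \<open>Tensor products of von Neumann algebras\<close>

lemma vn_tensorI: "a \<in> M ==> b \<in> N ==> a \<otimes> b \<in> M \<otimes>\<^sub>w N" unfolding vn_tensor_def commutant_def by fastforce

lemma vn_tensor_subset: "star_subalgebra M ==> M \<otimes>\<^sub>w N \<subseteq> commutant (commutant (M \<otimes>\<^sub>m N))"
  unfolding vn_tensor_def commutant_def by (clarsimp, metis tensor_memI)

lemma predualE: "w \<in> predual M ==> \<exists>\<rho>. nfun \<rho> \<and> w = (\<lambda>x. if x \<in> M then \<rho> x else 0)"
  and predualI: "nfun \<rho> ==> (\<lambda>x. if x \<in> M then \<rho> x else 0) \<in> predual M" by (auto simp: predual_def)

lemma normal_hom_pullback: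
  assumes "normal_unital_hom M P F" "nfun \<rho>"
  shows "\<exists>\<nu>. nfun \<nu> \<and> (\<forall>t\<in>M. \<nu> t = \<rho> (F t))"
proof -
  have "(\<lambda>x. if x \<in> M then (if F x \<in> P then \<rho> (F x) else 0) else 0) \<in> predual M"
    using assms(1)[unfolded normal_unital_hom_def, THEN conjunct2, THEN conjunct2, THEN conjunct2, rule_format, OF predualI[OF assms(2), of P]] .
  then obtain \<nu> where \<nu>: "nfun \<nu>" "(\<lambda>x. if x \<in> M then (if F x \<in> P then \<rho> (F x) else 0) else 0) = (\<lambda>x. if x \<in> M then \<nu> x else 0)"
    by (auto dest!: predualE)
  have "\<nu> t = \<rho> (F t)" if "t \<in> M" for t using fun_cong[OF \<nu>(2), of t] that assms(1) by (auto simp: normal_unital_hom_def)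
  with \<nu>(1) show ?thesis by blast
qed

text \<open>Pulling a vector functional back along F and along G gives two normal functionals that
  agree on the C*-tensor product and hence, by the density theorem, on its bicommutant.\<close>

lemma vn_tensor_hom_unique:
  fixes F G :: "('i \<times> 'j) op => 'k op"
  assumes M: "star_subalgebra M" "1 \<in> M" and N: "star_subalgebra N" "1 \<in> N"
    and F: "normal_unital_hom (M \<otimes>\<^sub>w N) P F" and G: "normal_unital_hom (M \<otimes>\<^sub>w N) P G"
    and eq: "\<And>a b. a \<in> M ==> b \<in> N ==> F (a \<otimes> b) = G (a \<otimes> b)" and T: "T \<in> M \<otimes>\<^sub>w N"
  shows "F T = G T"
proof (rule op_eqI_cinner)
  fix x y :: "'k ell2"
  let ?\<rho> = "\<lambda>z. cinner x (z \<cdot> y)"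
  obtain \<nu> \<nu>' where \<nu>: "nfun \<nu>" "\<And>t. t \<in> M \<otimes>\<^sub>w N ==> \<nu> t = ?\<rho> (F t)"
    "nfun \<nu>'" "\<And>t. t \<in> M \<otimes>\<^sub>w N ==> \<nu>' t = ?\<rho> (G t)"
    using normal_hom_pullback[OF F normal_vec[of x y]] normal_hom_pullback[OF G normal_vec[of x y]] by metis
  define g where "g t = \<nu> t - \<nu>' t" for t
  have g: "nfun g" unfolding g_def by (rule normal_diff[OF \<nu>(1,3)])
  have "g s = 0" if "s \<in> M \<otimes>\<^sub>m N" for s using that
  proof (induction rule: tensor_mem_induct)
    case closed
    show ?case using closed_vimage[OF normal_linear(5)[OF g] closed_singleton[of 0]] by simp
  next
    case (tensor a b c)
    then have "g (a \<otimes> b) = 0" using vn_tensorI[of a M b N] by (simp add: g_def \<nu> eq)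
    then show ?case by (simp add: normal_linear(2)[OF g])
  qed (use M N in \<open>auto simp: normal_linear(1)[OF g]\<close>)
  moreover have "T \<in> commutant (commutant (M \<otimes>\<^sub>m N))" using T vn_tensor_subset[OF M(1)] by blast
  moreover have "T \<cdot> u = 0" if "\<And>x. x \<in> M \<otimes>\<^sub>m N ==> x \<cdot> u = 0" for u
    using that[OF tensor_memI[OF M(2) N(2)]] by simp
  ultimately have "g T = 0" using normal_vanish_bicommutant[OF star_subalgebra_tensor[OF M(1) N(1)] _ g] by blast
  then show "cinner x (F T \<cdot> y) = cinner x (G T \<cdot> y)" using \<nu> T by (simp add: g_def)
qed

text \<open>\<open>vn_tensor_hom\<close> is given by a description, so it is computed by exhibiting
  a map with the describing properties. Here that map is spatial: an amplification, a permutation s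
  of the legs, and conjugation by a unitary.\<close>

lemma vn_tensor_hom_spatial:
  fixes U :: "('k \<times> 'l) op" and s :: "'k \<times> 'l => ('i \<times> 'j) \<times> 'c"
  assumes M: "star_subalgebra M" "1 \<in> M" and N: "star_subalgebra N" "1 \<in> N"
    and U: "unitary_op U" and s: "bij s"
    and f: "\<And>a. a \<in> M ==> f a \<in> M'" and g: "\<And>b. b \<in> N ==> g b \<in> N'"
    and el: "\<And>a b. a \<in> M ==> b \<in> N ==> adj U * relabel_op s ((a \<otimes> b) \<otimes> 1) * U = f a \<otimes> g b"
    and T: "T \<in> M \<otimes>\<^sub>w N"
  shows "vn_tensor_hom M N M' N' f g T = adj U * relabel_op s (T \<otimes> 1) * U"
proof -
  define F0 where "F0 T = adj U * relabel_op s (T \<otimes> 1) * U" for T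
  define F where "F T = (if T \<in> M \<otimes>\<^sub>w N then F0 T else 0)" for T
  have UU: "adj U * U = 1" "U * adj U = 1" using U by (auto simp: unitary_op_def)
  have UU': "adj U * (U * X) = X" "U * (adj U * X) = X" for X by (simp_all add: mult.assoc[symmetric] UU)
  note rel = relabel_algebra[OF s]
  have F0: "F0 (S + T) = F0 S + F0 T" "F0 (c *C T) = c *C F0 T" "F0 (adj T) = adj (F0 T)" "F0 1 = 1" for S T c
    by (simp_all add: F0_def tensor_op_add_left tensor_op_scaleC_left rel distrib_left distrib_right scaleC_mult_left
        scaleC_mult_right adj_mult mult.assoc UU relabel_op_adj[OF s, symmetric] adj_tensor)
  have F0m: "F0 (S * T) = F0 S * F0 T" for S T
  proof -
    have "(S * T) \<otimes> (1 :: 'c op) = (S \<otimes> 1) * (T \<otimes> 1)" by (simp add: tensor_op_mult)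
    then show ?thesis unfolding F0_def by (simp only: rel(3) mult.assoc UU')
  qed
  have F0_mem: "F0 T \<in> M' \<otimes>\<^sub>w N'" if T: "T \<in> M \<otimes>\<^sub>w N" for T unfolding vn_tensor_def
  proof (rule commutantI)
    fix Y assume Y: "Y \<in> commutant {a \<otimes> b | a b. a \<in> M' \<and> b \<in> N'}"
    \<comment> \<open>Z is Y carried back through the unitary and the permutation: F0 t commutes
      with Y exactly if t \<otimes> 1 commutes with Z, and that is decided by the slices of
      Z.\<close>
    define Z where "Z = relabel_op (inv s) (U * Y * adj U)"
    have sZ: "relabel_op s Z = U * Y * adj U" unfolding Z_def using relabel_op_relabel_op[OF s bij_imp_bij_inv[OF s]]
      by (simp add: inv_o_cancel bij_is_inj s relabel_op_id)
    have tr: "F0 t * Y = Y * F0 t \<longleftrightarrow> Z * (t \<otimes> 1) = (t \<otimes> 1) * Z" for t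
    proof
      assume "F0 t * Y = Y * F0 t"
      then have "U * (F0 t * Y) * adj U = U * (Y * F0 t) * adj U" by simp
      then have "relabel_op s (t \<otimes> 1) * (U * Y * adj U) = (U * Y * adj U) * relabel_op s (t \<otimes> 1)"
        by (simp add: F0_def mult.assoc UU' UU)
      then have "relabel_op s ((t \<otimes> 1) * Z) = relabel_op s (Z * (t \<otimes> 1))" by (simp add: rel sZ)
      then have "relabel_op (inv s) (relabel_op s ((t \<otimes> 1) * Z)) = relabel_op (inv s) (relabel_op s (Z * (t \<otimes> 1)))" by simp
      then show "Z * (t \<otimes> 1) = (t \<otimes> 1) * Z"
        by (simp add: relabel_op_relabel_op s bij_imp_bij_inv surj_iff[THEN iffD1] bij_is_surj relabel_op_id)
    next
      assume "Z * (t \<otimes> 1) = (t \<otimes> 1) * Z"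
      then have "relabel_op s ((t \<otimes> 1) * Z) = relabel_op s (Z * (t \<otimes> 1))" by simp
      then have "relabel_op s (t \<otimes> 1) * (U * Y * adj U) = (U * Y * adj U) * relabel_op s (t \<otimes> 1)" by (simp add: rel sZ)
      then have "adj U * (relabel_op s (t \<otimes> 1) * (U * Y * adj U)) * U = adj U * ((U * Y * adj U) * relabel_op s (t \<otimes> 1)) * U" by simp
      then show "F0 t * Y = Y * F0 t" by (simp add: F0_def mult.assoc UU' UU)
    qed
    have "F0 t * Y = Y * F0 t" if t: "t \<in> {a \<otimes> b | a b. a \<in> M \<and> b \<in> N}" for t
    proof -
      obtain a b where ab: "t = a \<otimes> b" "a \<in> M" "b \<in> N" using t by blast
      then have "F0 t = f a \<otimes> g b" using el by (simp add: F0_def)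
      moreover have "f a \<otimes> g b \<in> {a \<otimes> b | a b. a \<in> M' \<and> b \<in> N'}" by (rule CollectI, rule exI[of _ "f a"], rule exI[of _ "g b"]) (simp add: ab f g)
      ultimately show ?thesis using commutantD[OF Y] by simp
    qed
    then have comm: "vsr p q Z \<in> commutant {a \<otimes> b | a b. a \<in> M \<and> b \<in> N}" for p q
      using commutes_left_leg[of Z] unfolding tr by (intro commutantI) blast
    have "vsr p q Z * T = T * vsr p q Z" for p q using commutantD[OF T[unfolded vn_tensor_def] comm] by simp
    then have "Z * (T \<otimes> 1) = (T \<otimes> 1) * Z" using commutes_left_leg[of Z T] by blast
    then show "F0 T * Y = Y * F0 T" by (simp add: tr)
  qed
  have sub: "star_subalgebra (M \<otimes>\<^sub>w N)"
  proof -
    have "adj t \<in> {a \<otimes> b | a b. a \<in> M \<and> b \<in> N}" if "t \<in> {a \<otimes> b | a b. a \<in> M \<and> b \<in> N}" for t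
    proof -
      obtain a b where "t = a \<otimes> b" "a \<in> M" "b \<in> N" using \<open>t \<in> _\<close> by blast
      then show ?thesis
        by (intro CollectI) (rule exI[of _ "adj a"], rule exI[of _ "adj b"], simp add: adj_tensor subalgD(4)[OF M(1)] subalgD(4)[OF N(1)])
    qed
    then show ?thesis unfolding vn_tensor_def by (intro star_subalgebra_commutant commutant_adj) auto
  qed
  have one: "1 \<in> M \<otimes>\<^sub>w N" using vn_tensorI[OF M(2) N(2)] by simp
  have hom: "normal_unital_hom (M \<otimes>\<^sub>w N) (M' \<otimes>\<^sub>w N') F" unfolding normal_unital_hom_def
  proof (intro conjI ballI)
    show "star_hom (M \<otimes>\<^sub>w N) F" unfolding star_hom_def using sub by (auto simp: F_def F0 F0m subalgD)
    show "F ` (M \<otimes>\<^sub>w N) \<subseteq> M' \<otimes>\<^sub>w N'" by (auto simp: F_def F0_mem)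
    show "F 1 = 1" using one by (simp add: F_def F0)
    fix v assume "v \<in> predual (M' \<otimes>\<^sub>w N')"
    then obtain \<rho> where \<rho>: "nfun \<rho>" "v = (\<lambda>x. if x \<in> M' \<otimes>\<^sub>w N' then \<rho> x else 0)" by (auto dest!: predualE)
    have "nfun (\<lambda>x. \<rho> (adj U * x * U))" by (rule normal_mult[OF \<rho>(1)])
    from normal_comp_left[OF relabel_normal[OF this s], of 1 1]
    have "nfun (\<lambda>x. \<rho> (F0 x))" by (simp add: F0_def)
    from predualI[OF this, of "M \<otimes>\<^sub>w N"]
    show "(\<lambda>x. if x \<in> M \<otimes>\<^sub>w N then v (F x) else 0) \<in> predual (M \<otimes>\<^sub>w N)"
      by (simp add: \<rho> F_def F0_mem cong: if_cong)
  qed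
  have "vn_tensor_hom M N M' N' f g = F" unfolding vn_tensor_hom_def
  proof (rule the_equality)
    show "normal_unital_hom (M \<otimes>\<^sub>w N) (M' \<otimes>\<^sub>w N') F \<and> (\<forall>x. x \<notin> M \<otimes>\<^sub>w N --> F x = 0) \<and>
       (\<forall>a\<in>M. \<forall>b\<in>N. F (a \<otimes> b) = f a \<otimes> g b)" using hom by (auto simp: F_def vn_tensorI F0_def el)
    fix G assume G: "normal_unital_hom (M \<otimes>\<^sub>w N) (M' \<otimes>\<^sub>w N') G \<and> (\<forall>x. x \<notin> M \<otimes>\<^sub>w N --> G x = 0) \<and>
       (\<forall>a\<in>M. \<forall>b\<in>N. G (a \<otimes> b) = f a \<otimes> g b)"
    show "G = F"
    proof
      fix t show "G t = F t"
      proof (cases "t \<in> M \<otimes>\<^sub>w N")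
        case True
        show ?thesis by (rule vn_tensor_hom_unique[OF M N _ hom _ True]) (use G in \<open>auto simp: F_def vn_tensorI F0_def el\<close>)
      qed (use G in \<open>simp add: F_def\<close>)
    qed
  qed
  then show ?thesis using T by (simp add: F_def F0_def)
qed

section \<open>The multiplicative unitary\<close>

lemma positive_op_cstar: "positive_op (adj T * T)" by (simp add: positive_op_def op_apply_mult cinner_adj_right cinner_norm)

lemma cinner_row: "cinner x (row k u) = cinner (ket k \<odot> x) u"
proof (rule has_sum_unique)
  show "((\<lambda>j. cinner (row j (ket k \<odot> x)) (row j u)) has_sum cinner (ket k \<odot> x) u) UNIV" by (rule cinner_row_has_sum)
  have "(\<lambda>j. cinner (row j (ket k \<odot> x)) (row j u)) = (\<lambda>j. if j \<in> {k} then cinner x (row k u) else 0)"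
    by (auto simp: row_simps cinner_simps coord_ket)
  then show "((\<lambda>j. cinner (row j (ket k \<odot> x)) (row j u)) has_sum cinner x (row k u)) UNIV"
    using has_sum_finite_neutralI[of "{k}" UNIV "\<lambda>j. if j \<in> {k} then cinner x (row k u) else 0" "cinner x (row k u)"] by simp
qed

lemma row_apply: "row k (T \<cdot> (q \<odot> v)) = vsl (ket k) q T \<cdot> v" by (rule cinner_ext) (simp add: cinner_row cinner_vsl)

lemma norm_row_trunc:
  fixes w :: "('a \<times> 'b) ell2"
  assumes "finite F"
  shows "(norm (w - (\<Sum>k\<in>F. ket k \<odot> row k w)))\<^sup>2 = (norm w)\<^sup>2 - (\<Sum>k\<in>F. (norm (row k w))\<^sup>2)"
proof -
  let ?s = "\<Sum>k\<in>F. ket k \<odot> row k w"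
  have "cinner ?s ?s = (\<Sum>k\<in>F. cinner (row k w) (row k w))"
  proof -
    have "cnj (if k = j then 1 else 0) * c = (if k = j then c else 0)" for k j :: 'a and c :: complex by simp
    then show ?thesis using assms by (simp add: cinner_simps coord_ket)
  qed
  moreover have "cinner ?s w = (\<Sum>k\<in>F. cinner (row k w) (row k w))" by (simp add: cinner_simps cinner_row)
  moreover from this have "cinner w ?s = (\<Sum>k\<in>F. cinner (row k w) (row k w))"
    by (subst cinner_commute) (simp add: cinner_norm del: of_real_power)
  ultimately have "cinner (w - ?s) (w - ?s) = cinner w w - (\<Sum>k\<in>F. cinner (row k w) (row k w))"
    by (simp only: cinner_diff_left cinner_diff_right diff_self diff_zero)
  then have "complex_of_real ((norm (w - ?s))\<^sup>2) = complex_of_real ((norm w)\<^sup>2 - (\<Sum>k\<in>F. (norm (row k w))\<^sup>2))"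
    by (simp only: cinner_norm of_real_diff of_real_sum)
  then show ?thesis by (simp only: of_real_eq_iff)
qed

locale lcqg_pair =
  fixes G :: "'i lcqg" and W :: "('i \<times> 'i) op"
  assumes lc: "locally_compact_quantum_group G" and mu: "multiplicative_unitary G W"
begin

abbreviation "M \<equiv> Linf G"
abbreviation "\<Delta> \<equiv> comult G"
abbreviation "\<phi> \<equiv> haar G"
abbreviation "\<eta> \<equiv> gns G"
abbreviation "nphi \<equiv> square_integrable M \<phi>"

lemma vN: "adj ` M \<subseteq> M" "commutant (commutant M) = M" and D: "normal_unital_hom M (M \<otimes>\<^sub>w M) \<Delta>"
  and coassoc: "x \<in> M ==> assoc_op (vn_tensor_hom M M (M \<otimes>\<^sub>w M) M \<Delta> (\<lambda>y. y) (\<Delta> x)) =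
            vn_tensor_hom M M M (M \<otimes>\<^sub>w M) (\<lambda>y. y) \<Delta> (\<Delta> x)"
  and wt: "nsf_weight M \<phi>" and gm: "gns_map M \<phi> \<eta>"
  using lc by (auto simp: locally_compact_quantum_group_def Let_def von_neumann_algebra_def)

lemma Ms: "star_subalgebra M"
proof -
  have "star_subalgebra (commutant (commutant M))" by (rule star_subalgebra_commutant, rule commutant_adj) (use vN in auto)
  then show ?thesis by (simp add: vN)
qed

lemma M1: "1 \<in> M" using vN(2) by (metis commutantI mult_1 mult_1_right)

lemma memM: "(\<And>y. y \<in> commutant M ==> x * y = y * x) ==> x \<in> M" using vN(2) commutantI[of "commutant M" x] by auto

lemma D_mem: "x \<in> M ==> \<Delta> x \<in> M \<otimes>\<^sub>w M" and D_hom: "star_hom M \<Delta>" and D_one: "\<Delta> 1 = 1"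
  using D by (auto simp: normal_unital_hom_def)

lemma D_legs:
  assumes "x \<in> M" "y \<in> commutant M"
  shows "\<Delta> x * (y \<otimes> 1) = (y \<otimes> 1) * \<Delta> x" "\<Delta> x * (1 \<otimes> y) = (1 \<otimes> y) * \<Delta> x"
proof -
  have "y \<otimes> 1 \<in> commutant {a \<otimes> b | a b. a \<in> M \<and> b \<in> M}" "1 \<otimes> y \<in> commutant {a \<otimes> b | a b. a \<in> M \<and> b \<in> M}"
    using assms(2) by (auto intro!: commutantI simp: tensor_op_mult commutantD)
  then show "\<Delta> x * (y \<otimes> 1) = (y \<otimes> 1) * \<Delta> x" "\<Delta> x * (1 \<otimes> y) = (1 \<otimes> y) * \<Delta> x"
    using D_mem[OF assms(1)] unfolding vn_tensor_def by (auto simp: commutant_def)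
qed

lemma vsl_D_mem: "x \<in> M ==> vsl p q (\<Delta> x) \<in> M" using D_legs(2) commutes_right_leg[of "\<Delta> x"] by (intro memM) blast

section \<open>Calculus with the left Haar weight and its GNS map\<close>

lemma pos_M: "x \<in> M ==> adj x * x \<in> positive_part M" by (simp add: positive_part_def positive_op_cstar subalgD[OF Ms])

lemma weight_add: "x \<in> positive_part M ==> y \<in> positive_part M ==> \<phi> (x + y) = \<phi> x + \<phi> y"
  and weight_scale: "x \<in> positive_part M ==> r \<ge> 0 ==> \<phi> (r *\<^sub>R x) = ennreal r * \<phi> x" using wt by (auto simp: nsf_weight_def)

lemma weight_normal:
  "D \<subseteq> positive_part M ==> D \<noteq> {} ==> (\<And>d e. d \<in> D ==> e \<in> D ==> \<exists>f\<in>D. op_le d f \<and> op_le e f) ==>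
   x \<in> positive_part M ==> (\<And>d. d \<in> D ==> op_le d x) ==>
   (\<And>y. y \<in> positive_part M ==> (\<And>d. d \<in> D ==> op_le d y) ==> op_le x y) ==> \<phi> x = (SUP d\<in>D. \<phi> d)"
  by (rule wt[unfolded nsf_weight_def, THEN conjunct2, THEN conjunct2, THEN conjunct1, rule_format]) (intro conjI ballI allI impI; simp)

lemma positive_part_add: "x \<in> positive_part M ==> y \<in> positive_part M ==> x + y \<in> positive_part M"
  by (auto simp: positive_part_def positive_op_def subalgD[OF Ms] op_simps cinner_simps)

lemma positive_part_scale: "x \<in> positive_part M ==> r \<ge> 0 ==> r *\<^sub>R x \<in> positive_part M"
  by (auto simp: positive_part_def positive_op_def scaleR_scaleC subalgD[OF Ms] op_simps cinner_simps)

lemma weight_mono: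
  assumes "x \<in> positive_part M" "y \<in> positive_part M" "positive_op (y - x)"
  shows "\<phi> x \<le> \<phi> y"
proof -
  have "y - x \<in> positive_part M" using assms by (simp add: positive_part_def subalgD[OF Ms])
  then show ?thesis using weight_add[OF assms(1), of "y - x"] by simp
qed

text \<open>The pointwise bound says adj x * x <= C z as operators. It converts norm estimates on
  vectors into estimates of the weight.\<close>

lemma weight_norm_bound:
  assumes "x \<in> M" "z \<in> positive_part M" "0 \<le> C" "\<And>v. (norm (x \<cdot> v))\<^sup>2 \<le> C * Re (cinner v (z \<cdot> v))"
  shows "\<phi> (adj x * x) \<le> ennreal C * \<phi> z"
proof -
  have "positive_op (C *\<^sub>R z - adj x * x)" unfolding positive_op_def using assms(2,4)
    by (auto simp: positive_part_def positive_op_def op_simps cinner_simps scaleR_scaleC cinner_adj_right cinner_norm)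
  then show ?thesis using weight_mono[OF pos_M[OF assms(1)] positive_part_scale[OF assms(2,3)]] weight_scale[OF assms(2,3)] by simp
qed

lemma nphi_left_ideal: assumes "c \<in> M" "b \<in> nphi" shows "c * b \<in> nphi"
proof -
  have b: "b \<in> M" "\<phi> (adj b * b) < \<infinity>" using assms(2) by (auto simp: square_integrable_def)
  have cb: "c * b \<in> M" using assms(1) b by (simp add: subalgD[OF Ms])
  have "\<phi> (adj (c * b) * (c * b)) \<le> ennreal ((norm c)\<^sup>2) * \<phi> (adj b * b)"
  proof (rule weight_norm_bound[OF cb pos_M[OF b(1)]])
    fix v
    have "(norm (c \<cdot> b \<cdot> v))\<^sup>2 \<le> (norm c * norm (b \<cdot> v))\<^sup>2" by (intro power_mono norm_op_apply) simp
    then show "(norm ((c * b) \<cdot> v))\<^sup>2 \<le> (norm c)\<^sup>2 * Re (cinner v ((adj b * b) \<cdot> v))"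
      by (simp add: op_apply_mult cinner_adj_right cinner_norm power_mult_distrib)
  qed simp
  also have "\<dots> < \<infinity>" using b(2) by (simp add: ennreal_mult_less_top)
  finally show ?thesis using cb by (simp add: square_integrable_def)
qed

lemma nphi_add: assumes "a \<in> nphi" "b \<in> nphi" shows "a + b \<in> nphi"
proof -
  have a: "a \<in> M" "\<phi> (adj a * a) < \<infinity>" and b: "b \<in> M" "\<phi> (adj b * b) < \<infinity>" using assms by (auto simp: square_integrable_def)
  have ab: "a + b \<in> M" using a b by (simp add: subalgD[OF Ms])
  have "\<phi> (adj (a + b) * (a + b)) \<le> ennreal 2 * \<phi> (adj a * a + adj b * b)"
  proof (rule weight_norm_bound[OF ab positive_part_add[OF pos_M[OF a(1)] pos_M[OF b(1)]]])
    fix v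
    have "(norm (a \<cdot> v + b \<cdot> v))\<^sup>2 \<le> (norm (a \<cdot> v) + norm (b \<cdot> v))\<^sup>2" by (intro power_mono norm_triangle_ineq) simp
    also have "\<dots> \<le> 2 * ((norm (a \<cdot> v))\<^sup>2 + (norm (b \<cdot> v))\<^sup>2)"
      using sum_squares_bound[of "norm (a \<cdot> v)" "norm (b \<cdot> v)"] by (simp add: power2_sum)
    finally show "(norm ((a + b) \<cdot> v))\<^sup>2 \<le> 2 * Re (cinner v ((adj a * a + adj b * b) \<cdot> v))"
      by (simp add: op_simps cinner_simps cinner_adj_right cinner_norm)
  qed simp
  also have "\<dots> < \<infinity>" using a b weight_add[OF pos_M[OF a(1)] pos_M[OF b(1)]] by (simp add: ennreal_mult_less_top)
  finally show ?thesis using ab by (simp add: square_integrable_def)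
qed

lemma nphi_scale: assumes "b \<in> nphi" shows "c *C b \<in> nphi"
  using nphi_left_ideal[OF subalgD(5)[OF Ms M1, of c] assms] by (simp add: scaleC_mult_left)

lemma gns: "a \<in> nphi ==> b \<in> nphi ==> \<eta> (a + b) = \<eta> a + \<eta> b" "a \<in> nphi ==> \<eta> (c *C a) = c *C \<eta> a"
  "a \<in> nphi ==> \<phi> (adj a * a) = ennreal ((norm (\<eta> a))\<^sup>2)" "m \<in> M ==> a \<in> nphi ==> m \<cdot> \<eta> a = \<eta> (m * a)"
  "closure (\<eta> ` nphi) = UNIV" using gm by (auto simp: gns_map_def)

lemma gns_zero: "0 \<in> nphi" "\<eta> 0 = 0"
proof -
  obtain b where b: "b \<in> nphi" using gns(5) by (metis UNIV_not_empty closure_empty equals0I image_is_empty)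
  show "0 \<in> nphi" "\<eta> 0 = 0" using nphi_scale[OF b, of 0] gns(2)[OF b, of 0] by simp_all
qed

lemma nphi_sum: "(\<And>k. k \<in> F ==> g k \<in> nphi) ==> sum g F \<in> nphi \<and> \<eta> (sum g F) = (\<Sum>k\<in>F. \<eta> (g k))"
proof (induction F rule: infinite_finite_induct)
  case (insert k F) then show ?case by (simp add: nphi_add gns(1))
qed (use gns_zero in simp_all)

lemma gns_diff: "a \<in> nphi ==> b \<in> nphi ==> a - b \<in> nphi \<and> \<eta> (a - b) = \<eta> a - \<eta> b"
  using nphi_add[of a "(-1) *C b"] nphi_scale[of b "-1"] gns(1)[of a "(-1) *C b"] gns(2)[of b "-1"] by simp

lemma eta_eqI: "(\<And>b. b \<in> nphi ==> S \<cdot> \<eta> b = T \<cdot> \<eta> b) ==> S = T"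
proof (rule op_eqI)
  fix x assume eq: "\<And>b. b \<in> nphi ==> S \<cdot> \<eta> b = T \<cdot> \<eta> b"
  have "closed {x. S \<cdot> x = T \<cdot> x}" by (rule closed_linear_eq; rule linear_op_apply)
  then have "closure (\<eta> ` nphi) \<subseteq> {x. S \<cdot> x = T \<cdot> x}" by (intro closure_minimal) (auto simp: eq)
  then show "S \<cdot> x = T \<cdot> x" using gns(5) by blast
qed

lemma W_unitary: "adj W * W = 1" "W * adj W = 1" using mu by (auto simp: multiplicative_unitary_def unitary_op_def)

lemma W_eta:
  assumes "b \<in> nphi" "nfun w"
  shows "slice_left w (\<Delta> b) \<in> nphi" "slice_left w (adj W) \<cdot> \<eta> b = \<eta> (slice_left w (\<Delta> b))"
  using mu assms by (auto simp: multiplicative_unitary_def)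

lemma W_eta_vec:
  assumes "b \<in> nphi"
  shows "vsl p q (\<Delta> b) \<in> nphi" "vsl p q (adj W) \<cdot> \<eta> b = \<eta> (vsl p q (\<Delta> b))"
  using W_eta[OF assms normal_vec[of p q]] by (simp_all add: slice_left_vec)

text \<open>On GNS vectors the slices of adj W act as slices of \<Delta> b, whose first leg commutes
  with y.\<close>

lemma W_left_leg:
  assumes y: "y \<in> commutant M"
  shows "adj W * (y \<otimes> 1) = (y \<otimes> 1) * adj W"
proof (rule op_vsl_eqI, rule eta_eqI)
  fix p q b assume b: "b \<in> nphi"
  then have "b \<in> M" by (simp add: square_integrable_def)
  have "vsl p (y \<cdot> q) (\<Delta> b) = vsl (adj y \<cdot> p) q (\<Delta> b)" using D_legs(1)[OF \<open>b \<in> M\<close> y] by (metis vsl_mult_in)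
  then show "vsl p q (adj W * (y \<otimes> 1)) \<cdot> \<eta> b = vsl p q ((y \<otimes> 1) * adj W) \<cdot> \<eta> b"
    by (simp add: vsl_mult_in W_eta_vec b)
qed

text \<open>With \<open>b\<^sub>k\<close> the slices of \<open>\<Delta> b\<close> along an orthonormal basis, normality makes the tails of
  \<open>\<Sum> \<phi>(b\<^sub>k\<^sup>* b\<^sub>k)\<close> small, and these dominate the error made by cutting off \<open>\<Delta> x \<Delta> b\<close>.\<close>
lemma D_W:
  assumes x: "x \<in> M"
  shows "\<Delta> x * adj W = adj W * (1 \<otimes> x)"
proof (rule op_vsl_eqI, rule eta_eqI)
  fix p q b assume b: "b \<in> nphi"
  then have bM: "b \<in> M" by (simp add: square_integrable_def)
  have xb: "x * b \<in> nphi" by (rule nphi_left_ideal[OF x b])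
  define bk where "bk k = vsl (ket k) q (\<Delta> b)" for k
  define xk where "xk k = vsl p (ket k) (\<Delta> x)" for k
  have bk: "bk k \<in> nphi" "bk k \<in> M" for k using W_eta_vec(1)[OF b] by (auto simp: bk_def vsl_D_mem bM)
  have xk: "xk k \<in> M" for k by (simp add: xk_def vsl_D_mem x)
  define y where "y = vsl p q (\<Delta> x * \<Delta> b)"
  have y: "y \<in> nphi" and eta_y: "\<eta> y = vsl p q (adj W * (1 \<otimes> x)) \<cdot> \<eta> b"
    using W_eta_vec[OF xb, of p q] by (simp_all add: y_def homD(2)[OF D_hom x bM, symmetric] vsl_mult_out op_apply_mult gns(4) x b)
  define w where "w = adj W \<cdot> (q \<odot> \<eta> b)"
  have eta_bk: "\<eta> (bk k) = row k w" for k by (simp add: w_def bk_def row_apply W_eta_vec b)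
  define yF where "yF F = (\<Sum>k\<in>F. xk k * bk k)" for F
  have yF: "yF F \<in> nphi" "\<eta> (yF F) = (\<Sum>k\<in>F. xk k \<cdot> row k w)" for F
    using nphi_sum[of F "\<lambda>k. xk k * bk k"] nphi_left_ideal[OF xk bk(1)] by (simp_all add: yF_def gns(4)[symmetric] xk bk eta_bk)
  define target where "target = vsl p q (\<Delta> x * adj W) \<cdot> \<eta> b"
  define C where "C = (norm p * norm (\<Delta> x))\<^sup>2"
  \<comment> \<open>z is the slice of \<Delta>(adj b * b) by the vector functional of q, and the zF
    below are its partial sums over an orthonormal basis of the first leg.\<close>
  define z where "z = vsl q q (\<Delta> (adj b * b))"
  define zF where "zF F = (\<Sum>k\<in>F. adj (bk k) * bk k)" for F
  have zM: "z \<in> M" unfolding z_def by (rule vsl_D_mem) (simp add: subalgD[OF Ms] bM)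
  have zv: "cinner v (z \<cdot> v) = complex_of_real ((norm (\<Delta> b \<cdot> (q \<odot> v)))\<^sup>2)" for v
    using bM by (simp add: z_def cinner_vsl homD[OF D_hom] subalgD[OF Ms] op_apply_mult cinner_adj_right cinner_norm)
  have zFv: "cinner v (zF F \<cdot> v) = complex_of_real (\<Sum>k\<in>F. (norm (bk k \<cdot> v))\<^sup>2)" for F v
    by (simp add: zF_def op_apply_sum_left cinner_sum_right op_apply_mult cinner_adj_right cinner_norm)
  have bkv: "bk k \<cdot> v = row k (\<Delta> b \<cdot> (q \<odot> v))" for k v by (simp add: bk_def row_apply)
  have zP: "z \<in> positive_part M" using zM by (simp add: positive_part_def positive_op_def zv)
  have zFP: "zF F \<in> positive_part M" for F
  proof -
    have "zF F \<in> M" unfolding zF_def by (rule subalg_sum[OF Ms]) (simp add: subalgD[OF Ms] bk)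
    then show ?thesis by (simp add: positive_part_def positive_op_def zFv sum_nonneg)
  qed
  have zle: "(\<Sum>k\<in>F. (norm (bk k \<cdot> v))\<^sup>2) \<le> (norm (\<Delta> b \<cdot> (q \<odot> v)))\<^sup>2" if "finite F" for F v
    unfolding bkv by (rule finite_sum_le_has_sum[OF norm_row_has_sum]) (use that in auto)
  have dP: "z - zF F \<in> positive_part M" if "finite F" for F
    using zM zFP[of F] zle[OF that] by (simp add: positive_part_def positive_op_def subalgD[OF Ms] op_apply_diff_left cinner_diff_right zv zFv)
  have phi_zF: "\<phi> (zF F) = ennreal (\<Sum>k\<in>F. (norm (row k w))\<^sup>2)" if "finite F" for F using that
  proof (induction F rule: finite_induct)
    case empty
    have "\<phi> (0 *\<^sub>R z) = 0" using weight_scale[OF zP, of 0] by simp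
    then show ?case by (simp add: zF_def)
  next
    case (insert k F)
    have "\<phi> (zF (insert k F)) = \<phi> (adj (bk k) * bk k) + \<phi> (zF F)" using insert weight_add[OF pos_M[OF bk(2)] zFP] by (simp add: zF_def)
    then show ?case using insert by (simp add: gns(3) bk eta_bk sum_nonneg)
  qed
  have phi_z: "\<phi> z = (SUP d\<in>zF ` {F. finite F}. \<phi> d)"
  proof (rule weight_normal)
    have mono: "op_le (zF F) (zF F')" if "finite F'" "F \<subseteq> F'" for F F'
      unfolding op_le_def positive_op_def op_apply_diff_left cinner_diff_right zFv
      using sum_mono2[OF that(1,2), of "\<lambda>k. (norm (bk k \<cdot> _))\<^sup>2"] by simp
    fix d e assume "d \<in> zF ` {F. finite F}" "e \<in> zF ` {F. finite F}"
    then obtain F F' where "finite F" "finite F'" "d = zF F" "e = zF F'" by blast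
    then show "\<exists>f\<in>zF ` {F. finite F}. op_le d f \<and> op_le e f"
      using mono[of "F \<union> F'" F] mono[of "F \<union> F'" F'] by (intro bexI[of _ "zF (F \<union> F')"]) auto
  next
    fix u assume u: "u \<in> positive_part M" "\<And>d. d \<in> zF ` {F. finite F} ==> op_le d u"
    have "Im (cinner v (u \<cdot> v)) = 0" for v using u(1) by (simp add: positive_part_def positive_op_def)
    moreover have "(norm (\<Delta> b \<cdot> (q \<odot> v)))\<^sup>2 \<le> Re (cinner v (u \<cdot> v))" for v
    proof (rule has_sum_le_finite_sums[OF norm_row_has_sum])
      fix F :: "'i set" assume "finite F"
      then have "0 \<le> Re (cinner v ((u - zF F) \<cdot> v))" using u(2) by (simp add: op_le_def positive_op_def)
      then show "(\<Sum>k\<in>F. (norm (row k (\<Delta> b \<cdot> (q \<odot> v))))\<^sup>2) \<le> Re (cinner v (u \<cdot> v))"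
        by (simp add: op_apply_diff_left cinner_diff_right zFv bkv)
    qed
    ultimately show "op_le z u" by (simp add: op_le_def positive_op_def op_apply_diff_left cinner_diff_right zv)
  qed (use zP zFP dP in \<open>auto simp: op_le_def positive_part_def\<close>)
  define R where "R F = sqrt ((norm w)\<^sup>2 - (\<Sum>k\<in>F. (norm (row k w))\<^sup>2))" for F
  have R: "R F = norm (w - (\<Sum>k\<in>F. ket k \<odot> row k w))" if "finite F" for F unfolding R_def norm_row_trunc[OF that, symmetric] by simp
  \<comment> \<open>Normality, through \<open>phi_z\<close>, gives \<phi>(z) <= |w|^2, and
    \<open>phi_zF\<close> evaluates the partial sums exactly; by additivity the remainder has at
    most the weight of the tail of w.\<close>
  have rest: "\<phi> (z - zF F) \<le> ennreal ((R F)\<^sup>2)" if F: "finite F" for F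
  proof -
    let ?s = "\<Sum>k\<in>F. (norm (row k w))\<^sup>2"
    have s: "0 \<le> ?s" "?s \<le> (norm w)\<^sup>2" by (auto intro: sum_nonneg finite_sum_le_has_sum[OF norm_row_has_sum F])
    have "\<phi> z \<le> ennreal ((norm w)\<^sup>2)" unfolding phi_z
      by (rule SUP_least) (auto simp: phi_zF intro!: ennreal_leI finite_sum_le_has_sum[OF norm_row_has_sum])
    then have "ennreal ?s + \<phi> (z - zF F) \<le> ennreal ((norm w)\<^sup>2)" using weight_add[OF zFP[of F] dP[OF F]] by (simp add: phi_zF[OF F])
    then show ?thesis using s by (cases "\<phi> (z - zF F)")
      (auto simp: R_def top_unique simp flip: ennreal_plus)
  qed
  have lim: "((\<lambda>F. norm p * norm (\<Delta> x) * R F) \<longlongrightarrow> 0) (finite_subsets_at_top UNIV)"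
  proof -
    have "((\<lambda>F. norm p * norm (\<Delta> x) * R F) \<longlongrightarrow> norm p * norm (\<Delta> x) * sqrt ((norm w)\<^sup>2 - (norm w)\<^sup>2)) (finite_subsets_at_top UNIV)"
      unfolding R_def using norm_row_has_sum[of w] unfolding has_sum_def by (intro tendsto_intros)
    then show ?thesis by simp
  qed
  have conv: "((\<lambda>F. \<eta> (yF F)) \<longlongrightarrow> v) (finite_subsets_at_top UNIV)"
    if "\<And>F. finite F ==> norm (v - \<eta> (yF F)) \<le> norm p * norm (\<Delta> x) * R F" for v
  proof -
    have "((\<lambda>F. v - \<eta> (yF F)) \<longlongrightarrow> 0) (finite_subsets_at_top UNIV)" by (rule Lim_null_comparison[OF _ lim])
        (unfold eventually_finite_subsets_at_top, use that in \<open>intro exI[of _ "{}"], auto\<close>)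
    from tendsto_diff[OF tendsto_const this, of v] show ?thesis by simp
  qed
  \<comment> \<open>The same net \<eta>(yF F) converges to both vectors: to target because \<Delta>
    x is bounded, and to \<eta> y because the weight controls the GNS norm of the remainder.\<close>
  have "\<eta> y = target"
  proof (rule tendsto_unique[OF finite_subsets_at_top_neq_bot])
    show "((\<lambda>F. \<eta> (yF F)) \<longlongrightarrow> target) (finite_subsets_at_top UNIV)"
    proof (rule conv)
      fix F :: "'i set" assume F: "finite F"
      show "norm (target - \<eta> (yF F)) \<le> norm p * norm (\<Delta> x) * R F" unfolding R[OF F]
      proof (rule norm_le_cinnerI)
        fix u :: "'i ell2" assume "norm u \<le> 1"
        let ?t = "w - (\<Sum>k\<in>F. ket k \<odot> row k w)"
        have "cinner u (target - \<eta> (yF F)) = cinner (p \<odot> u) (\<Delta> x \<cdot> ?t)"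
          by (simp add: target_def yF xk_def w_def op_apply_diff_right op_apply_sum_right op_apply_mult cinner_simps cinner_vsl)
        also have "cmod \<dots> \<le> norm (\<Delta> x) * norm (p \<odot> u) * norm ?t" by (rule cmod_cinner_op_le)
        also have "\<dots> \<le> norm p * norm (\<Delta> x) * norm ?t"
          using \<open>norm u \<le> 1\<close> mult_left_mono[of "norm u" 1 "norm p * norm (\<Delta> x) * norm ?t"] by (simp add: norm_tensor mult_ac)
        finally show "cmod (cinner u (target - \<eta> (yF F))) \<le> norm p * norm (\<Delta> x) * norm ?t" .
      qed simp
    qed
    show "((\<lambda>F. \<eta> (yF F)) \<longlongrightarrow> \<eta> y) (finite_subsets_at_top UNIV)"
    proof (rule conv)
      fix F :: "'i set" assume F: "finite F"
      have d: "y - yF F \<in> nphi" "\<eta> (y - yF F) = \<eta> y - \<eta> (yF F)" using gns_diff[OF y yF(1)] by auto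
      have "\<phi> (adj (y - yF F) * (y - yF F)) \<le> ennreal C * \<phi> (z - zF F)"
      proof (rule weight_norm_bound)
        show "y - yF F \<in> M" using d by (simp add: square_integrable_def)
        show "z - zF F \<in> positive_part M" by (rule dP[OF F])
        fix v
        let ?w = "\<Delta> b \<cdot> (q \<odot> v)"
        let ?t = "?w - (\<Sum>k\<in>F. ket k \<odot> row k ?w)"
        have "norm ((y - yF F) \<cdot> v) \<le> norm p * norm (\<Delta> x) * norm ?t"
        proof (rule norm_le_cinnerI)
          fix u :: "'i ell2" assume "norm u \<le> 1"
          have "cinner u ((y - yF F) \<cdot> v) = cinner (p \<odot> u) (\<Delta> x \<cdot> ?t)"
            by (simp add: y_def yF_def xk_def op_apply_diff_left op_apply_diff_right op_apply_sum_left op_apply_sum_right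
              op_apply_mult cinner_simps cinner_vsl bkv)
          also have "cmod \<dots> \<le> norm (\<Delta> x) * norm (p \<odot> u) * norm ?t" by (rule cmod_cinner_op_le)
          also have "\<dots> \<le> norm p * norm (\<Delta> x) * norm ?t"
            using \<open>norm u \<le> 1\<close> mult_left_mono[of "norm u" 1 "norm p * norm (\<Delta> x) * norm ?t"] by (simp add: mult_ac)
          finally show "cmod (cinner u ((y - yF F) \<cdot> v)) \<le> norm p * norm (\<Delta> x) * norm ?t" .
        qed simp
        then have "(norm ((y - yF F) \<cdot> v))\<^sup>2 \<le> (norm p * norm (\<Delta> x) * norm ?t)\<^sup>2" by (intro power_mono) auto
        also have "\<dots> = C * ((norm ?w)\<^sup>2 - (\<Sum>k\<in>F. (norm (row k ?w))\<^sup>2))"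
          using norm_row_trunc[OF F, of ?w] by (simp only: power_mult_distrib C_def)
        finally show "(norm ((y - yF F) \<cdot> v))\<^sup>2 \<le> C * Re (cinner v ((z - zF F) \<cdot> v))"
          by (simp add: op_apply_diff_left cinner_diff_right zv zFv bkv)
      qed (simp add: C_def)
      also have "\<dots> \<le> ennreal C * ennreal ((R F)\<^sup>2)" by (rule mult_left_mono[OF rest[OF F]]) simp
      finally have "(norm (\<eta> y - \<eta> (yF F)))\<^sup>2 \<le> (norm p * norm (\<Delta> x) * R F)\<^sup>2"
        by (simp add: gns(3)[OF d(1)] d(2) ennreal_mult[symmetric] C_def power_mult_distrib)
      then show "norm (\<eta> y - \<eta> (yF F)) \<le> norm p * norm (\<Delta> x) * R F" by (rule power2_le_imp_le) (simp add: R[OF F])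
    qed
  qed
  then show "vsl p q (\<Delta> x * adj W) \<cdot> \<eta> b = vsl p q (adj W * (1 \<otimes> x)) \<cdot> \<eta> b" by (simp add: target_def eta_y)
qed

end

section \<open>Leg calculus and the pentagon equation\<close>

lemma cinner_swap23_vec: "cinner (swap23_vec u') v' = cinner u' (swap23_vec v')"
proof -
  have "swap23_vec (swap23_vec v') = v'" by (rule ell2_eqI, rename_tac p, case_tac p) (simp add: swap23_vec_def coord_relabel bij_is_inj)
  moreover have "cinner (swap23_vec x) (swap23_vec y) = cinner x y" for x y by (simp add: swap23_vec_def cinner_relabel)
  ultimately show ?thesis by metis
qed

lemma cinner_tensor_left_eqI:
  assumes L: "bounded_linear L" "\<And>c x. L (c *C x) = c *C L x"
    and eq: "\<And>a b. cinner (L (a \<odot> b)) u = cinner (a \<odot> b) v"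
  shows "cinner (L p) u = cinner p v"
proof (induction p rule: tensor_induct)
  case closed
  show ?case by (intro closed_linear_eq bounded_linear_compose[OF bounded_linear_cinner_left L(1)] bounded_linear_cinner_left)
qed (simp_all add: eq L(2) linear_add[OF bounded_linear.linear[OF L(1)]] cinner_simps)

lemma bounded_linear_assoc_tensor: "bounded_linear (\<lambda>x. assoc_vec (x \<odot> y))"
  by (intro bounded_linear_compose[OF bounded_linear_assoc_vec bounded_linear_tensor_left])

lemma cinner_leg_right:
  "cinner (assoc_vec (p \<odot> c)) ((1 \<otimes> A) \<cdot> assoc_vec (q \<odot> d)) = cinner p ((1 \<otimes> vsr c d A) \<cdot> q)"
proof -
  have *: "cinner (assoc_vec (p \<odot> c)) (a \<odot> (A \<cdot> (b \<odot> d))) = cinner p (a \<odot> (vsr c d A \<cdot> b))" for a b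
    by (rule cinner_tensor_left_eqI[OF bounded_linear_assoc_tensor])
      (simp_all add: tensor_vec_simps assoc_vec_linear cinner_vsr)
  show ?thesis
  proof (induction q rule: tensor_induct)
    case closed
    show ?case by (intro closed_linear_eq bounded_linear_compose[OF bounded_linear_cinner_right]
          bounded_linear_compose[OF linear_op_apply] bounded_linear_assoc_tensor linear_op_apply)
  qed (simp_all add: * tensor_vec_simps assoc_vec_linear cinner_simps op_simps)
qed

text \<open>Two operators on three legs that share one leg multiply along it, and matrix elements in
  the other legs give products of slices. Equations between leg-numbered products thus become
  equations between slices.\<close>

lemma cinner_leg13_leg23:
  "cinner (a \<odot> t \<odot> c) ((leg13 A * (1 \<otimes> B)) \<cdot> (b \<odot> z \<odot> d)) = cinner c ((vsl a b A * vsl t z B) \<cdot> d)"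
proof -
  define p where "p = adj A \<cdot> (a \<odot> c)"
  define q where "q = B \<cdot> (z \<odot> d)"
  define r where "r = vsl t z B \<cdot> d"
  have r: "cinner y r = cinner (t \<odot> y) q" for y by (simp add: r_def q_def cinner_vsl)
  have "cinner (a \<odot> t \<odot> c) ((leg13 A * (1 \<otimes> B)) \<cdot> (b \<odot> z \<odot> d)) = cinner (swap23_vec (assoc_vec (p \<odot> t))) (b \<odot> q)"
    by (simp add: op_apply_mult q_def p_def cinner_adj_left[symmetric] leg13_algebra(2)[symmetric] leg13_tensor)
  also have "\<dots> = cinner p (b \<odot> r)"
  proof (rule cinner_tensor_left_eqI[OF bounded_linear_compose[OF bounded_linear_swap23_vec bounded_linear_assoc_tensor]])
    fix x y
    have "cinner (t \<odot> y) q = cinner y r" by (simp add: r)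
    then show "cinner (swap23_vec (assoc_vec ((x \<odot> y) \<odot> t))) (b \<odot> q) = cinner (x \<odot> y) (b \<odot> r)" by simp
  qed (simp_all add: tensor_vec_simps assoc_vec_linear swap23_vec_linear)
  also have "\<dots> = cinner c ((vsl a b A * vsl t z B) \<cdot> d)" by (simp add: p_def r_def cinner_adj_left op_apply_mult cinner_vsl)
  finally show ?thesis .
qed

lemma cinner_leg12_leg13:
  "cinner (a \<odot> t \<odot> c) ((leg12 A * leg13 B) \<cdot> (b \<odot> z \<odot> d)) = cinner a ((vsr t z A * vsr c d B) \<cdot> b)"
proof -
  define q where "q = adj A \<cdot> (a \<odot> t)"
  define p where "p = B \<cdot> (b \<odot> d)"
  define r where "r = vsr c d B \<cdot> b"
  have r: "cinner y r = cinner (y \<odot> c) p" for y by (simp add: r_def p_def cinner_vsr)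
  have "cinner (a \<odot> t \<odot> c) ((leg12 A * leg13 B) \<cdot> (b \<odot> z \<odot> d)) = cinner (assoc_vec (q \<odot> c)) (swap23_vec (assoc_vec (p \<odot> z)))"
    by (simp add: op_apply_mult q_def p_def cinner_adj_left[symmetric] leg12_algebra(2)[symmetric] leg12_tensor leg13_tensor)
  also have "\<dots> = cinner q (r \<odot> z)"
  proof (rule cinner_tensor_left_eqI[OF bounded_linear_assoc_tensor])
    fix x y
    have "cinner (assoc_vec ((x \<odot> c) \<odot> y)) (assoc_vec (p \<odot> z)) = cinner x r * cinner y z" by (simp only: assoc_cinner cinner_tensor r)
    then show "cinner (assoc_vec ((x \<odot> y) \<odot> c)) (swap23_vec (assoc_vec (p \<odot> z))) = cinner (x \<odot> y) (r \<odot> z)"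
      by (simp add: cinner_swap23_vec[symmetric])
  qed (simp_all add: tensor_vec_simps assoc_vec_linear)
  also have "\<dots> = cinner a ((vsr t z A * vsr c d B) \<cdot> b)" by (simp add: q_def r_def cinner_adj_left op_apply_mult cinner_vsr)
  finally show ?thesis .
qed

lemma vsl_leg12: "vsl x y (leg12 A) = vsl x y A \<otimes> 1"
proof (rule op_form_eqI)
  fix a b c d
  have "cinner (assoc_vec ((x \<odot> a) \<odot> b)) (assoc_vec ((A \<cdot> (y \<odot> c)) \<odot> d)) = cinner (x \<odot> a) (A \<cdot> (y \<odot> c)) * cinner b d"
    by (simp only: assoc_cinner cinner_tensor)
  then show "cinner (a \<odot> b) (vsl x y (leg12 A) \<cdot> (c \<odot> d)) = cinner (a \<odot> b) ((vsl x y A \<otimes> 1) \<cdot> (c \<odot> d))"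
    by (simp add: cinner_vsl leg12_tensor)
qed

lemma vsl_leg13: "vsl x y (leg13 A) = 1 \<otimes> vsl x y A"
proof (rule op_form_eqI)
  fix a b c d
  show "cinner (a \<odot> b) (vsl x y (leg13 A) \<cdot> (c \<odot> d)) = cinner (a \<odot> b) ((1 \<otimes> vsl x y A) \<cdot> (c \<odot> d))"
  proof -
    have "vsl a c 1 \<cdot> d = cinner a c *C d" by (rule cinner_ext) (simp add: cinner_vsl cinner_simps)
    then show ?thesis using cinner_leg13_leg23[of x a b A 1 y c d] by (simp add: cinner_vsl op_simps cinner_simps tensor_vec_simps)
  qed
qed

context lcqg_pair
begin

text \<open>The first leg of S belongs to the dual and the second to G: \<open>slice_left\<close> of
  S gives elements of \<open>C0 W\<close>, and \<open>vsr\<close> of S gives elements of the dual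
  von Neumann algebra.\<close>

abbreviation "S \<equiv> dual_unitary W"

lemma S_unitary: "adj S * S = 1" "S * adj S = 1" by (simp_all add: dual_unitary_def flip_op_algebra(3,7)[symmetric] W_unitary flip_op_algebra(5))

text \<open>As \<Delta> x = adj W * (1 \<otimes> x) * W, both tensor extensions in the
  coassociativity axiom are spatial, and the axiom turns into an equation between operators on three
  legs.\<close>

lemma coassoc_legs:
  assumes x: "x \<in> M"
  shows "leg12 (adj W) * (1 \<otimes> \<Delta> x) * leg12 W = (1 \<otimes> adj W) * leg13 (\<Delta> x) * (1 \<otimes> W)"
proof -
  \<comment> \<open>s1 puts the operator on legs two and three, s2 on legs one and three, each with
    the bracketing of the triples that its side of the axiom has.\<close>
  define s1 :: "('i \<times> 'i) \<times> 'i => ('i \<times> 'i) \<times> 'i" where "s1 = (\<lambda>((i, j), k). ((j, k), i))"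
  define s2 :: "'i \<times> 'i \<times> 'i => ('i \<times> 'i) \<times> 'i" where "s2 = (\<lambda>(i, j, k). ((i, k), j))"
  have s: "bij s1" "bij s2" unfolding s1_def s2_def by (rule bijI', auto)+
  have D': "adj W * (1 \<otimes> a) * W = \<Delta> a" if "a \<in> M" for a by (simp add: D_W[OF that, symmetric] mult.assoc W_unitary)
  have "s1 \<circ> (\<lambda>(i, j, k). ((i, j), k)) = prod.swap" by (auto simp: s1_def)
  then have r1: "assoc_op (relabel_op s1 (T \<otimes> 1)) = 1 \<otimes> T" for T
    by (simp add: assoc_op_def relabel_op_relabel_op s flip_op_def[symmetric] flip_tensor)
  have "(\<lambda>(i, j, k). ((i, j), k)) \<circ> (\<lambda>(i, j, k). (i, k, j)) = s2" by (auto simp: s2_def)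
  then have r2: "relabel_op s2 (T \<otimes> 1) = leg13 T" for T by (simp add: leg13_def leg12_def assoc_op_def relabel_op_relabel_op)
  have r1': "relabel_op s1 ((a \<otimes> b) \<otimes> 1) = (1 \<otimes> a) \<otimes> b" for a b
  proof -
    have "assoc_op (relabel_op s1 ((a \<otimes> b) \<otimes> 1)) = assoc_op ((1 \<otimes> a) \<otimes> b)" unfolding r1 by (rule op_form3_eqI)
        (metis assoc_op_def assoc_vec_def assoc_vec_tensor bij_assoc relabel_op_apply tensor_op_apply)
    from arg_cong[OF this, of "relabel_op (inv (\<lambda>(i, j, k). ((i, j), k)))"] show ?thesis
      by (simp add: assoc_op_def relabel_op_relabel_op bij_imp_bij_inv relabel_op_id surj_iff[THEN iffD1] bij_is_surj)
  qed
  have u1: "unitary_op (W \<otimes> 1)" and u2: "unitary_op (1 \<otimes> W)" by (simp_all add: unitary_op_def adj_tensor tensor_op_mult W_unitary)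
  have "vn_tensor_hom M M (M \<otimes>\<^sub>w M) M \<Delta> (\<lambda>y. y) (\<Delta> x) = adj (W \<otimes> 1) * relabel_op s1 (\<Delta> x \<otimes> 1) * (W \<otimes> 1)"
    by (rule vn_tensor_hom_spatial[OF Ms M1 Ms M1 u1 s(1) _ _ _ D_mem[OF x]])
      (simp_all add: D_mem r1' adj_tensor tensor_op_mult D')
  moreover have "vn_tensor_hom M M M (M \<otimes>\<^sub>w M) (\<lambda>y. y) \<Delta> (\<Delta> x) = adj (1 \<otimes> W) * relabel_op s2 (\<Delta> x \<otimes> 1) * (1 \<otimes> W)"
    by (rule vn_tensor_hom_spatial[OF Ms M1 Ms M1 u2 s(2) _ _ _ D_mem[OF x]])
      (simp_all add: D_mem r2 leg13_tensor_op adj_tensor tensor_op_mult D')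
  ultimately show ?thesis using coassoc[OF x] r1[of "\<Delta> x"] by (simp add: assoc_op_def relabel_algebra(3)[OF bij_assoc] r2 leg12_def adj_tensor)
qed

text \<open>A slice of S acts on GNS vectors by slicing \<Delta>. Acting twice iterates the
  comultiplication, and coassociativity rewrites the iterated slice as a single slice of \<Delta> q
  by the normal functional \<nu>.\<close>

lemma pentagon_slice:
  "vsr c d S * vsr a b S = slice_right (\<lambda>x. cinner (c \<odot> a) ((S * (x \<otimes> 1) * adj S) \<cdot> (d \<odot> b))) S"
proof (rule eta_eqI)
  fix q assume q: "q \<in> nphi"
  then have qM: "q \<in> M" by (simp add: square_integrable_def)
  define \<nu> where "\<nu> x = cinner (a \<odot> c) ((adj W * (1 \<otimes> x) * W) \<cdot> (b \<odot> d))" for x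
  have \<nu>: "nfun \<nu>" unfolding \<nu>_def by (rule normal_comp[OF normal_vec])
  have vS: "vsr t z S = vsl t z (adj W)" for t z by (simp add: dual_unitary_def vsr_flip)
  have "cinner (c \<odot> a) ((S * (x \<otimes> 1) * adj S) \<cdot> (d \<odot> b)) = \<nu> x" for x
  proof -
    have "S * (x \<otimes> 1) * adj S = flip_op (adj W * (1 \<otimes> x) * W)"
      by (simp add: dual_unitary_def flip_op_algebra(3) flip_op_algebra(7)[symmetric])
    then show ?thesis by (simp only: cinner_flip \<nu>_def)
  qed
  then have "slice_right (\<lambda>x. cinner (c \<odot> a) ((S * (x \<otimes> 1) * adj S) \<cdot> (d \<odot> b))) S \<cdot> \<eta> q = \<eta> (slice_left \<nu> (\<Delta> q))"
    using W_eta(2)[OF q \<nu>] by (simp add: slice_right_flip dual_unitary_def)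
  also have "slice_left \<nu> (\<Delta> q) = vsl c d (\<Delta> (vsl a b (\<Delta> q)))"
  proof (rule slice_left_eqI[OF \<nu>])
    fix e f
    have "cinner (assoc_vec ((a \<odot> c) \<odot> e)) ((leg12 (adj W) * (1 \<otimes> \<Delta> q) * leg12 W) \<cdot> assoc_vec ((b \<odot> d) \<odot> f)) = \<nu> (vsr e f (\<Delta> q))"
    proof -
      have "cinner (assoc_vec ((a \<odot> c) \<odot> e)) ((leg12 (adj W) * (1 \<otimes> \<Delta> q) * leg12 W) \<cdot> assoc_vec ((b \<odot> d) \<odot> f)) =
        cinner (leg12 W \<cdot> assoc_vec ((a \<odot> c) \<odot> e)) ((1 \<otimes> \<Delta> q) \<cdot> leg12 W \<cdot> assoc_vec ((b \<odot> d) \<odot> f))"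
        by (simp only: op_apply_mult leg12_algebra cinner_adj_right)
      also have "\<dots> = \<nu> (vsr e f (\<Delta> q))" by (simp only: leg12_apply cinner_leg_right \<nu>_def op_apply_mult cinner_adj_right)
      finally show ?thesis .
    qed
    moreover have "cinner (assoc_vec ((a \<odot> c) \<odot> e)) (((1 \<otimes> adj W) * leg13 (\<Delta> q) * (1 \<otimes> W)) \<cdot> assoc_vec ((b \<odot> d) \<odot> f)) =
       cinner e (vsl c d (\<Delta> (vsl a b (\<Delta> q))) \<cdot> f)"
    proof -
      let ?z = "vsl a b (\<Delta> q)"
      have z: "\<Delta> ?z = adj W * (1 \<otimes> ?z) * W" by (simp add: D_W[OF vsl_D_mem[OF qM], symmetric] mult.assoc W_unitary)
      have "vsl a b ((1 \<otimes> adj W) * leg13 (\<Delta> q) * (1 \<otimes> W)) = \<Delta> ?z" by (simp add: vsl_mult_out vsl_leg13 z)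
      then show ?thesis by (simp add: cinner_vsl[symmetric])
    qed
    ultimately show "cinner e (vsl c d (\<Delta> (vsl a b (\<Delta> q))) \<cdot> f) = \<nu> (vsr e f (\<Delta> q))"
      by (simp only: coassoc_legs[OF qM])
  qed
  finally show "(vsr c d S * vsr a b S) \<cdot> \<eta> q =
      slice_right (\<lambda>x. cinner (c \<odot> a) ((S * (x \<otimes> 1) * adj S) \<cdot> (d \<odot> b))) S \<cdot> \<eta> q"
    using W_eta_vec[OF q, of a b] W_eta_vec(2)[OF W_eta_vec(1)[OF q, of a b], of c d] by (simp add: vS op_apply_mult)
qed

text \<open>\<open>pentagon_slice\<close> is this equation in terms of matrix elements, with the
  last factor moved to the other side.\<close>

lemma pentagon: "leg12 S * leg13 S * (1 \<otimes> S) = (1 \<otimes> S) * leg12 S"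
proof -
  have "leg12 S * leg13 S = (1 \<otimes> S) * leg12 S * (1 \<otimes> adj S)"
  proof (rule op_form3_eqI)
    fix a c e b d f
    have n: "nfun (\<lambda>x. cinner (c \<odot> e) ((S * (x \<otimes> 1) * adj S) \<cdot> (d \<odot> f)))" by (rule normal_comp_left[OF normal_vec])
    have "vsl a b ((1 \<otimes> S) * leg12 S * (1 \<otimes> adj S)) = S * (vsl a b S \<otimes> 1) * adj S" by (simp add: vsl_mult_out vsl_leg12)
    then have "cinner a (slice_right (\<lambda>x. cinner (c \<odot> e) ((S * (x \<otimes> 1) * adj S) \<cdot> (d \<odot> f))) S \<cdot> b) =
        cinner (a \<odot> c \<odot> e) (((1 \<otimes> S) * leg12 S * (1 \<otimes> adj S)) \<cdot> (b \<odot> d \<odot> f))"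
      unfolding cinner_slice_right[OF n] by (simp only: cinner_vsl[of "c \<odot> e" a b _ "d \<odot> f", symmetric])
    then show "cinner (a \<odot> c \<odot> e) ((leg12 S * leg13 S) \<cdot> (b \<odot> d \<odot> f)) =
       cinner (a \<odot> c \<odot> e) (((1 \<otimes> S) * leg12 S * (1 \<otimes> adj S)) \<cdot> (b \<odot> d \<odot> f))"
      by (simp only: cinner_leg12_leg13 pentagon_slice)
  qed
  then show ?thesis by (simp add: mult.assoc tensor_op_mult S_unitary)
qed

text \<open>In the form adj S_12 S_23 S_12 = S_13 S_23 the pentagon equation evaluates the dual
  comultiplication x |-> adj S * (1 \<otimes> x) * S on slices of S. For functionals it follows that
  slicing S turns convolution into multiplication.\<close>

lemma vsl_dual_comult:
  "vsl a b (adj S * (1 \<otimes> vsr c d S) * S) = vsr (adj (vsl a b S) \<cdot> c) d S"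
proof (rule op_eqI_cinner)
  fix t z
  have "leg12 (adj S) * (1 \<otimes> S) * leg12 S = leg13 S * (1 \<otimes> S)"
    by (simp add: mult.assoc pentagon[symmetric]) (simp add: mult.assoc[symmetric] leg12_algebra(1)[symmetric] S_unitary leg12_algebra(3))
  then have *: "adj (leg12 S) * ((1 \<otimes> S) * leg12 S) = leg13 S * (1 \<otimes> S)" by (simp add: leg12_algebra mult.assoc)
  have "cinner (a \<odot> t) ((adj S * (1 \<otimes> vsr c d S) * S) \<cdot> (b \<odot> z)) =
      cinner (assoc_vec ((S \<cdot> (a \<odot> t)) \<odot> c)) ((1 \<otimes> S) \<cdot> assoc_vec ((S \<cdot> (b \<odot> z)) \<odot> d))"
    by (simp only: op_apply_mult cinner_adj_right cinner_leg_right)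
  also have "\<dots> = cinner (a \<odot> t \<odot> c) ((leg13 S * (1 \<otimes> S)) \<cdot> (b \<odot> z \<odot> d))"
    unfolding *[symmetric] by (simp only: op_apply_mult cinner_adj_right leg12_tensor)
  also have "\<dots> = cinner t (vsr (adj (vsl a b S) \<cdot> c) d S \<cdot> z)" unfolding cinner_leg13_leg23
    by (simp only: op_apply_mult cinner_adj_left[of "vsl a b S", symmetric] cinner_vsl[of "adj (vsl a b S) \<cdot> c" t z] cinner_vsr)
  finally show "cinner t (vsl a b (adj S * (1 \<otimes> vsr c d S) * S) \<cdot> z) =
     cinner t (vsr (adj (vsl a b S) \<cdot> c) d S \<cdot> z)" by (simp add: cinner_vsl)
qed

lemma dual_conv_slice:
  assumes q: "nfun q"
  shows "slice_right q (adj S * (1 \<otimes> vsr c d S) * S) = vsr c (slice_left q S \<cdot> d) S"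
proof (rule op_eqI_cinner)
  fix a b
  show "cinner a (slice_right q (adj S * (1 \<otimes> vsr c d S) * S) \<cdot> b) = cinner a (vsr c (slice_left q S \<cdot> d) S \<cdot> b)"
    by (simp add: vsl_dual_comult cinner_slice_right[OF q] cinner_slice_left[OF q, symmetric] cinner_adj_left cinner_vsl cinner_vsr)
qed

lemma slice_S_commutant: "y \<in> commutant M ==> S * (1 \<otimes> y) = (1 \<otimes> y) * S"
  using arg_cong[OF W_left_leg, of y flip_op] by (simp add: flip_op_algebra flip_tensor dual_unitary_def)

lemma D_S: "x \<in> M ==> flip_op (\<Delta> x) = S * (x \<otimes> 1) * adj S"
proof -
  assume x: "x \<in> M"
  have "\<Delta> x = adj W * (1 \<otimes> x) * W" by (simp add: D_W[OF x, symmetric] mult.assoc W_unitary)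
  then show ?thesis by (simp add: flip_op_algebra(3) flip_tensor dual_unitary_def) (simp add: flip_op_algebra(7)[symmetric])
qed

end

section \<open>The von Neumann algebra of the dual\<close>

lemma swc_superset: "x \<in> X ==> x \<in> swc X" unfolding sigma_weak_closure_def by (auto intro!: bexI[of _ x])

lemma swcD:
  "x \<in> swc X ==> finite \<Omega> ==> (\<And>w. w \<in> \<Omega> ==> nfun w) ==> e > 0 ==> \<exists>s\<in>X. \<forall>w\<in>\<Omega>. cmod (w x - w s) < e"
  unfolding sigma_weak_closure_def by simp

text \<open>Only moduli of differences of values are compared, so the criterion covers translations
  and the conjugate-linear adjoint along with linear maps.\<close>

lemma swc_map:
  assumes x: "x \<in> swc X" and f: "\<And>w. nfun w ==> \<exists>\<nu>. nfun \<nu> \<and> (\<forall>s. cmod (w (f x) - w (f s)) = cmod (\<nu> x - \<nu> s))"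
    and Y: "\<And>s. s \<in> X ==> f s \<in> swc Y"
  shows "f x \<in> swc Y" unfolding sigma_weak_closure_def
proof (intro CollectI allI impI)
  fix \<Omega> :: "('b op => complex) set" and e :: real
  assume *: "finite \<Omega> \<and> (\<forall>w\<in>\<Omega>. nfun w) \<and> e > 0"
  then have "\<forall>w\<in>\<Omega>. \<exists>\<nu>. nfun \<nu> \<and> (\<forall>s. cmod (w (f x) - w (f s)) = cmod (\<nu> x - \<nu> s))" using f by simp
  then obtain g where g: "\<And>w. w \<in> \<Omega> ==> nfun (g w)"
    "\<And>w s. w \<in> \<Omega> ==> cmod (w (f x) - w (f s)) = cmod (g w x - g w s)" by (auto dest!: bchoice)
  obtain s where s: "s \<in> X" "\<And>w. w \<in> \<Omega> ==> cmod (g w x - g w s) < e / 2"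
  proof -
    have "\<exists>s\<in>X. \<forall>w\<in>g ` \<Omega>. cmod (w x - w s) < e / 2" by (rule swcD[OF x]) (use * g(1) in auto)
    then show thesis using that by blast
  qed
  obtain t where t: "t \<in> Y" "\<And>w. w \<in> \<Omega> ==> cmod (w (f s) - w t) < e / 2" using swcD[OF Y[OF s(1)], of \<Omega> "e / 2"] * by auto
  have "cmod (w (f x) - w t) < e" if w: "w \<in> \<Omega>" for w
    using norm_triangle_ineq[of "w (f x) - w (f s)" "w (f s) - w t"] s(2)[OF w] t(2)[OF w] g(2)[OF w, of s] by simp
  with t(1) show "\<exists>s\<in>Y. \<forall>w\<in>\<Omega>. cmod (w (f x) - w s) < e" by blast
qed

lemma closed_swc: "closed (swc X)"
proof -
  have "x \<in> swc X" if x: "x \<in> closure (swc X)" for x unfolding sigma_weak_closure_def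
  proof (intro CollectI allI impI)
    fix \<Omega> :: "('a op => complex) set" and e :: real
    assume *: "finite \<Omega> \<and> (\<forall>w\<in>\<Omega>. nfun w) \<and> e > 0"
    let ?U = "\<Inter>w\<in>\<Omega>. {y. cmod (w x - w y) < e / 2}"
    have "open ?U"
    proof (rule open_INT)
      show "\<forall>w\<in>\<Omega>. open {y. cmod (w x - w y) < e / 2}"
      proof
        fix w assume "w \<in> \<Omega>"
        then have "continuous_on UNIV w" using * by (intro linear_continuous_on normal_linear(5)) simp
        then show "open {y. cmod (w x - w y) < e / 2}"
          using open_Collect_less[OF continuous_on_norm[OF continuous_on_diff[OF continuous_on_const]] continuous_on_const, of w "w x" "e / 2"] by simp
      qed
    qed (use * in simp)
    moreover have "x \<in> ?U" using * by simp
    ultimately have "?U \<inter> swc X \<noteq> {}" using x open_Int_closure_eq_empty[of ?U "swc X"] by blast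
    then obtain y where y: "\<And>w. w \<in> \<Omega> ==> cmod (w x - w y) < e / 2" "y \<in> swc X" by auto
    obtain t where t: "t \<in> X" "\<And>w. w \<in> \<Omega> ==> cmod (w y - w t) < e / 2" using swcD[OF y(2), of \<Omega> "e / 2"] * by auto
    have "cmod (w x - w t) < e" if w: "w \<in> \<Omega>" for w using norm_triangle_ineq[of "w x - w y" "w y - w t"] y(1)[OF w] t(2)[OF w] by simp
    with t(1) show "\<exists>s\<in>X. \<forall>w\<in>\<Omega>. cmod (w x - w s) < e" by blast
  qed
  then show ?thesis by (simp add: closure_subset_eq[symmetric] subsetI)
qed

lemma swc_linear:
  assumes X: "0 \<in> X" "\<And>x y. x \<in> X ==> y \<in> X ==> x + y \<in> X" "\<And>c x. x \<in> X ==> c *C x \<in> X"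
  shows "0 \<in> swc X" "x \<in> swc X ==> y \<in> swc X ==> x + y \<in> swc X" "x \<in> swc X ==> c *C x \<in> swc X"
proof -
  have add: "\<exists>\<nu>. nfun \<nu> \<and> (\<forall>s. cmod (w (x + y) - w (s + y)) = cmod (\<nu> x - \<nu> s))" if "nfun w" for w x y
    using that by (intro exI[of _ w]) (simp add: normal_linear)
  have XX: "x + y \<in> swc X" if "x \<in> swc X" "y \<in> X" for x y
    by (rule swc_map[OF that(1), of "\<lambda>s. s + y"]) (simp_all add: add X(2) swc_superset that(2))
  show "x + y \<in> swc X" if "x \<in> swc X" "y \<in> swc X"
  proof (rule swc_map[OF that(1), of "\<lambda>s. s + y"])
    show "s + y \<in> swc X" if "s \<in> X" for s using XX[OF \<open>y \<in> swc X\<close> that] by (simp add: add.commute)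
  qed (rule add)
  have "\<exists>\<nu>. nfun \<nu> \<and> (\<forall>s. cmod (w (c *C x) - w (c *C s)) = cmod (\<nu> x - \<nu> s))" if "nfun w" for w x
    by (rule exI[of _ "\<lambda>x. c * w x"]) (simp add: normal_scaleC normal_linear that)
  then show "c *C x \<in> swc X" if "x \<in> swc X"
    by (rule swc_map[OF that, of "\<lambda>s. c *C s"]) (assumption, rule swc_superset[OF X(3)], assumption)
qed (use swc_superset X in blast)

text \<open>Multiplication is separately sigma-weakly continuous, so products are extended to the
  closure one factor at a time: the left factor while the right one stays in X, then the right
  factor.\<close>

lemma star_subalgebra_swc:
  assumes X: "0 \<in> X" "\<And>x y. x \<in> X ==> y \<in> X ==> x + y \<in> X" "\<And>c x. x \<in> X ==> c *C x \<in> X"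
    and mult: "\<And>x y. x \<in> X ==> y \<in> X ==> x * y \<in> swc X" and adjX: "\<And>x. x \<in> X ==> adj x \<in> swc X"
  shows "star_subalgebra (swc X)"
proof -
  have mr: "\<exists>\<nu>. nfun \<nu> \<and> (\<forall>s. cmod (w (x * y) - w (s * y)) = cmod (\<nu> x - \<nu> s))" if "nfun w" for w x y
    by (rule exI[of _ "\<lambda>x. w (x * y)"]) (simp add: normal_mult_right that)
  have ml: "\<exists>\<nu>. nfun \<nu> \<and> (\<forall>s. cmod (w (y * x) - w (y * s)) = cmod (\<nu> x - \<nu> s))" if "nfun w" for w x y
    by (rule exI[of _ "\<lambda>x. w (y * x)"]) (simp add: normal_mult_left that)
  have m: "x * y \<in> swc X" if "x \<in> swc X" "y \<in> X" for x y by (rule swc_map[OF that(1) mr]) (auto simp: mult that(2))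
  have "x * y \<in> swc X" if "x \<in> swc X" "y \<in> swc X" for x y by (rule swc_map[OF that(2) ml]) (auto simp: m that(1))
  moreover have "adj x \<in> swc X" if "x \<in> swc X" for x
  proof (rule swc_map[OF that, of adj])
    fix w :: "'a op => complex" assume "nfun w"
    then show "\<exists>\<nu>. nfun \<nu> \<and> (\<forall>s. cmod (w (adj x) - w (adj s)) = cmod (\<nu> x - \<nu> s))"
      using complex_mod_cnj[of "w (adj x) - w (adj _)"] by (intro exI[of _ "\<lambda>x. cnj (w (adj x))"]) (simp add: normal_cnj)
  qed (rule adjX)
  moreover have "0 \<in> swc X" "\<And>x y. x \<in> swc X ==> y \<in> swc X ==> x + y \<in> swc X" "\<And>c x. x \<in> swc X ==> c *C x \<in> swc X"
    by (rule swc_linear[OF X]; assumption)+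
  ultimately show ?thesis by (simp add: star_subalgebra_def)
qed

lemma swc_idem: "x \<in> swc (swc X) ==> x \<in> swc X" by (rule swc_map[of x "swc X" "\<lambda>s. s"]) auto

lemma slice_left_add_fun:
  "nfun w ==> nfun p ==> slice_left (\<lambda>x. w x + p x) X = slice_left w X + slice_left p X"
  by (rule slice_left_eqI[OF normal_add]) (simp_all add: op_simps cinner_simps cinner_slice_left)

lemma slice_left_scaleC_fun: "nfun w ==> slice_left (\<lambda>x. c * w x) X = c *C slice_left w X"
  by (rule slice_left_eqI[OF normal_scaleC]) (simp_all add: op_simps cinner_simps cinner_slice_left)

lemma slice_left_in_closed:
  assumes "nfun w" "closed C" "0 \<in> C" "\<And>x y. x \<in> C ==> y \<in> C ==> x + y \<in> C" "\<And>a b. vsl a b X \<in> C"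
  shows "slice_left w X \<in> C"
proof -
  obtain u \<eta> where s: "(\<lambda>n. vsl (\<eta> n) (u n) X) sums slice_left w X" using slice_left_sums[OF assms(1), of X] by blast
  have "(\<Sum>k<n. vsl (\<eta> k) (u k) X) \<in> C" for n by (induction n) (simp_all add: assms)
  then show ?thesis using closed_sequentially[OF assms(2) _ s[unfolded sums_def]] by simp
qed

text \<open>Functionals in \<^term>\<open>predual N\<close> vanish off \<open>N\<close>. If the slices of \<open>X\<close> do not lie in \<open>N\<close>, then
  the form that defines \<^term>\<open>slice_left w X\<close> is not bounded, or vanishes.\<close>
lemma slice_left_junk:
  assumes N: "\<And>x y. x \<in> N ==> y \<in> N ==> x - y \<in> N" "\<And>x y. x \<in> N ==> y \<in> N ==> x + y \<in> N"
    and ab: "vsr a b X \<notin> N" and w: "\<And>x. x \<notin> N ==> w x = 0"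
  shows "slice_left w X = 0 \<or> slice_left w X = (THE R. False)"
proof (cases "\<exists>R. \<forall>p q. cinner p (R \<cdot> q) = w (vsr p q X)")
  case True
  then obtain R where R: "\<And>p q. cinner p (R \<cdot> q) = w (vsr p q X)" by blast
  have mem: "vsr p q X \<in> N" if "cinner p (R \<cdot> q) \<noteq> 0" for p q using that R w by metis
  have add: "vsr (p + p') q X = vsr p q X + vsr p' q X" "vsr p (q + q') X = vsr p q X + vsr p q' X" for p p' q q'
    by (simp_all add: vsl_flip[symmetric] vsl_add_vec1 vsl_add_vec2)
  have 0: "cinner a (R \<cdot> b) = 0" using mem ab by blast
  \<comment> \<open>Were this value nonzero, the slices at p and at a + p would both lie in N, and
    so would their difference, which is the excluded slice at a.\<close>
  have 1: "cinner p (R \<cdot> b) = 0" for p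
  proof (rule ccontr)
    assume n: "cinner p (R \<cdot> b) \<noteq> 0"
    then have "cinner (a + p) (R \<cdot> b) \<noteq> 0" using 0 by (simp add: cinner_simps)
    from N(1)[OF mem[OF this] mem[OF n]] ab show False by (simp add: add)
  qed
  have 2: "cinner a (R \<cdot> q) = 0" for q
  proof (rule ccontr)
    assume n: "cinner a (R \<cdot> q) \<noteq> 0"
    then have "cinner a (R \<cdot> (b + q)) \<noteq> 0" using 0 by (simp add: cinner_simps op_simps)
    from N(1)[OF mem[OF this] mem[OF n]] ab show False by (simp add: add)
  qed
  have "cinner p (R \<cdot> q) = 0" for p q
  proof (rule ccontr)
    assume n: "cinner p (R \<cdot> q) \<noteq> 0"
    have *: "cinner (a + p) (R \<cdot> (b + q)) \<noteq> 0" "cinner (a + p) (R \<cdot> q) \<noteq> 0" "cinner p (R \<cdot> (b + q)) \<noteq> 0"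
      using n 0 1 2 by (simp_all add: cinner_simps op_simps)
    have "vsr (a + p) (b + q) X - vsr (a + p) q X - (vsr p (b + q) X - vsr p q X) \<in> N" by (intro N(1) mem * n)
    then show False using ab by (simp add: add)
  qed
  then have "R = 0" by (intro op_eqI_cinner) simp
  moreover have "slice_left w X = R" unfolding slice_left_def by (rule the_equality) (auto simp: R[symmetric] intro: op_eqI_cinner)
  ultimately show ?thesis by simp
next
  case False
  \<comment> \<open>A description without a witness has the fixed default value
    \<open>THE R. False\<close>, the same for all functionals.\<close>
  then have "(\<lambda>R. \<forall>p q. cinner p (R \<cdot> q) = w (vsr p q X)) = (\<lambda>R. False)" by (simp add: fun_eq_iff)
  then show ?thesis unfolding slice_left_def by simp
qed

text \<open>The functional g \<otimes> h, written as g after a right slice. The representing vectors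
  of h have an auxiliary leg, which is accommodated by putting X on legs one and three.\<close>

lemma normal_tensor:
  fixes g :: "'i op => complex" and h :: "'j op => complex"
  assumes g: "nfun g" and h: "nfun h"
  shows "nfun (\<lambda>X. g (slice_right h X))"
proof -
  obtain u v :: "(nat \<times> 'i) ell2" where a: "\<And>T. g T = cinner v ((1 \<otimes> T) \<cdot> u)" using normal_unpack[OF g] by blast
  obtain u' v' :: "(nat \<times> 'j) ell2" where b: "\<And>T. h T = cinner v' ((1 \<otimes> T) \<cdot> u')" using normal_unpack[OF h] by blast
  have "vsr v' u' (leg13 X) = slice_right h X" for X :: "('i \<times> 'j) op"
  proof (rule op_eqI_cinner)
    fix p q
    have "cinner p (vsr v' u' (leg13 X) \<cdot> q) = cinner v' (vsl p q (leg13 X) \<cdot> u')" by (simp add: cinner_vsr cinner_vsl)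
    then show "cinner p (vsr v' u' (leg13 X) \<cdot> q) = cinner p (slice_right h X \<cdot> q)" by (simp add: vsl_leg13 cinner_slice_right[OF h] b)
  qed
  then have *: "g (slice_right h X) = cinner (assoc_vec (v \<odot> v')) ((1 \<otimes> leg13 X) \<cdot> assoc_vec (u \<odot> u'))" for X
    unfolding a cinner_leg_right by simp
  have "nfun (\<lambda>X :: ('i \<times> 'j) op. cinner (assoc_vec (v \<odot> v')) ((1 \<otimes> leg13 X) \<cdot> assoc_vec (u \<odot> u')))"
    unfolding leg13_def leg12_def assoc_op_def
    using normal_comp_left[OF relabel_normal[OF relabel_normal[OF normal_packed bij_swap23] bij_assoc], where A = 1 and B = 1] by simp
  then show ?thesis by (simp add: *)
qed

locale universal_pair = lcqg_pair G W for G :: "'i lcqg" and W +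
  fixes A :: "'j op set" and l :: "('i op => complex) => 'j op" and \<Delta>u :: "'j op => ('j \<times> 'j) op"
    and \<Lambda> :: "'j op => 'i op"
  assumes univ: "universal_C0 W A l" and univ_comult: "universal_comult W A l \<Delta>u"
    and red: "reducing_morphism G W A l \<Delta>u \<Lambda>"
begin

abbreviation "N \<equiv> dual_Linf W"
abbreviation "lam w \<equiv> slice_left w S"
abbreviation "B \<equiv> C0 W"
abbreviation "L1s \<equiv> dual_L1_star W"
abbreviation "slicesW \<equiv> {slice_left w W | w. nfun w}"

lemma cstar_A: "cstar_algebra A" and l_dense: "closure (l ` L1s) = A"
  and l_scaleC: "w \<in> L1s ==> l (\<lambda>x. c * w x) = c *C l w"
  and l_conv: "w \<in> L1s ==> p \<in> L1s ==> l (dual_conv W w p) = l w * l p"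
  and l_star: "dual_star W w p ==> l p = adj (l w)" using univ by (auto simp: universal_C0_def)

lemmas As = cstar_algebraD(1)[OF cstar_A] and Ac = cstar_algebraD(2)[OF cstar_A]

lemma l_mem: "w \<in> L1s ==> l w \<in> A" using l_dense closure_subset[of "l ` L1s"] by blast

lemma Lam_hom: "star_hom A \<Lambda>" and Lam_image: "\<Lambda> ` A = B" and Lam_l: "w \<in> L1s ==> \<Lambda> (l w) = dual_lambda W w"
  and comult_Lam: "a \<in> A ==> \<Delta> (\<Lambda> a) = strict_ext (A \<otimes>\<^sub>m A) (B \<otimes>\<^sub>m B) (cstar_tensor_hom A A \<Lambda> \<Lambda>) (\<Delta>u a)"
  using red by (auto simp: reducing_morphism_def)

lemma Bs: "star_subalgebra B" using star_hom_image[OF As Lam_hom] by (simp add: Lam_image)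
lemma Bc: "closed B" by (simp add: C0_def)

lemma vsr_W_mem: "vsr a b W \<in> B"
proof -
  have "slice_right (\<lambda>T. cinner a (T \<cdot> b)) W \<in> {slice_right w W | w. nfun w}" using normal_vec by blast
  then show ?thesis unfolding C0_def slice_right_vec by (rule closure_subset[THEN subsetD])
qed

text \<open>A nonzero complex space has more than two elements. This rules out the degenerate
  alternative in the dichotomies about slices.\<close>

lemma B_not_two: "\<not> B \<subseteq> {0, u}"
proof
  assume *: "B \<subseteq> {0, u}"
  have "x = 0" if "x \<in> B" for x
  proof (rule ccontr)
    assume "x \<noteq> 0"
    moreover have "2 *C x \<in> B" by (rule subalgD(5)[OF Bs that])
    moreover have "2 *C x \<noteq> 0" using \<open>x \<noteq> 0\<close> norm_scaleC_op[of 2 x] by auto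
    ultimately have "x = u" "2 *C x = u" using * that by auto
    then have "x + x = x" using scaleC_add_left[of 1 1 x] by (simp add: scaleC_one)
    then show False using \<open>x \<noteq> 0\<close> by simp
  qed
  then have "W = 0" using vsr_W_mem by (intro op_vsr_eqI) simp
  then show False using W_unitary by simp
qed

lemma slicesW_linear: "0 \<in> slicesW" "x \<in> slicesW ==> y \<in> slicesW ==> x + y \<in> slicesW" "x \<in> slicesW ==> c *C x \<in> slicesW"
proof -
  have "slice_left (\<lambda>x. 0) W = 0" by (rule slice_left_eqI[OF normal_zero]) simp
  then show "0 \<in> slicesW" using normal_zero by force
  show "x + y \<in> slicesW" if xy: "x \<in> slicesW" "y \<in> slicesW"
  proof -
    from xy obtain w p where "nfun w" "x = slice_left w W" "nfun p" "y = slice_left p W" by blast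
    then show ?thesis using slice_left_add_fun[of w p W] normal_add[of w p] by (intro CollectI exI[of _ "\<lambda>x. w x + p x"]) simp
  qed
  show "c *C x \<in> slicesW" if x: "x \<in> slicesW"
  proof -
    from x obtain w where "nfun w" "x = slice_left w W" by blast
    then show ?thesis using slice_left_scaleC_fun[of w c W] normal_scaleC[of w c] by (intro CollectI exI[of _ "\<lambda>x. c * w x"]) simp
  qed
qed

lemma N_linear: "0 \<in> N" "x \<in> N ==> y \<in> N ==> x + y \<in> N" "x \<in> N ==> c *C x \<in> N"
  unfolding dual_Linf_def by (rule swc_linear[OF slicesW_linear]; assumption)+

lemma N_diff: "x \<in> N ==> y \<in> N ==> x - y \<in> N" using N_linear(2)[of x "(-1) *C y"] N_linear(3)[of y "-1"] by simp

lemma closed_N: "closed N" by (simp add: dual_Linf_def closed_swc)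

text \<open>If one slice of X lies outside N, every slice by a functional of \<open>L1s\<close> is 0
  or the default value, and continuity carries this to all of A. As \<open>C0 W\<close> is too large
  for that, the slices of S and V are forced into N.\<close>

lemma l_junk:
  assumes X: "vsr a b X \<notin> N" and f: "\<And>w. w \<in> L1s ==> f (l w) = slice_left w X"
    and c: "continuous_on A f"
  shows "f ` A \<subseteq> {0, THE R. False}"
proof -
  have "f ` closure (l ` L1s) \<subseteq> {0, THE R. False}"
  proof (rule image_closure_subset)
    show "continuous_on (closure (l ` L1s)) f" using c l_dense by simp
    show "f ` l ` L1s \<subseteq> {0, THE R. False}"
    proof
      fix y assume "y \<in> f ` l ` L1s"
      then obtain w where w: "w \<in> L1s" "y = f (l w)" by blast
      have "w x = 0" if "x \<notin> N" for x using w(1) that by (auto simp: dual_L1_star_def dual_star_def dual_L1_def predual_def)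
      from slice_left_junk[OF N_diff N_linear(2) X this] show "y \<in> {0, THE R. False}" using w f by simp
    qed
  qed simp
  then show ?thesis by (simp add: l_dense)
qed

text \<open>N is generated by slices of W, whereas these are slices of adj W. They lie in N because
  the reducing morphism would otherwise take at most two values; this is what makes N closed under
  adjoints.\<close>

lemma vsr_S_mem: "vsr a b S \<in> N"
proof (rule ccontr)
  assume "vsr a b S \<notin> N"
  from l_junk[OF this _ star_hom_continuous[OF As Ac Lam_hom]] show False using B_not_two by (auto simp: Lam_l dual_lambda_def Lam_image)
qed

lemma vsr_S: "vsr a b S = vsl a b (adj W)" by (simp add: dual_unitary_def vsr_flip)

lemma slice_adjW_mem: "nfun w ==> slice_left w (adj W) \<in> N"
  by (rule slice_left_in_closed[OF _ closed_N]) (auto simp: N_linear vsr_S[symmetric] vsr_S_mem)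

text \<open>The pentagon equation writes a product of two vector slices as one slice by a normal
  functional; series of vector slices give the general case.\<close>

lemma mult_slices_mem: "nfun p ==> nfun q ==> slice_left p (adj W) * slice_left q (adj W) \<in> N"
proof -
  assume p: "nfun p" and q: "nfun q"
  have 1: "vsl c d (adj W) * vsl a b (adj W) \<in> N" for a b c d unfolding vsr_S[symmetric] pentagon_slice slice_right_flip
    using slice_adjW_mem[OF normal_comp_left[OF normal_vec]] by (simp add: dual_unitary_def)
  have "slice_left p (adj W) \<in> {x. x * vsl a b (adj W) \<in> N}" for a b
    by (rule slice_left_in_closed[OF p closed_vimage[OF linear_mult_op(2) closed_N]])
      (simp_all add: N_linear distrib_right 1)
  then have "slice_left q (adj W) \<in> {x. slice_left p (adj W) * x \<in> N}"
    by (intro slice_left_in_closed[OF q closed_vimage[OF linear_mult_op(1) closed_N]])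
      (simp_all add: N_linear distrib_left)
  then show ?thesis by simp
qed

lemma Ns: "star_subalgebra N"
proof -
  have conv: "\<exists>q. nfun q \<and> x = adj (slice_left q (adj W))" if "x \<in> slicesW" for x
  proof -
    from that obtain w where w: "nfun w" "x = slice_left w W" by blast
    have "adj (slice_left (\<lambda>x. cnj (w (adj x))) (adj W)) = x" using w by (simp add: slice_left_algebra(8)[OF normal_cnj])
    then show ?thesis using normal_cnj[OF w(1)] by metis
  qed
  have adjX: "adj x \<in> N" if "x \<in> slicesW" for x using conv[OF that] slice_adjW_mem by auto
  have adjN: "adj x \<in> N" if "x \<in> N" for x unfolding dual_Linf_def
  proof (rule swc_map[OF that[unfolded dual_Linf_def], of adj])
    fix w :: "'i op => complex" assume "nfun w"
    then show "\<exists>\<nu>. nfun \<nu> \<and> (\<forall>s. cmod (w (adj x) - w (adj s)) = cmod (\<nu> x - \<nu> s))"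
      using complex_mod_cnj[of "w (adj x) - w (adj _)"] by (intro exI[of _ "\<lambda>x. cnj (w (adj x))"]) (simp add: normal_cnj)
  qed (use adjX in \<open>simp add: dual_Linf_def\<close>)
  have mult: "x * y \<in> N" if x: "x \<in> slicesW" and y: "y \<in> slicesW" for x y
  proof -
    obtain p q where "nfun p" "x = adj (slice_left p (adj W))" "nfun q" "y = adj (slice_left q (adj W))" using conv[OF x] conv[OF y] by blast
    then show ?thesis using adjN[OF mult_slices_mem[of q p]] by (simp add: adj_mult)
  qed
  show ?thesis unfolding dual_Linf_def by (rule star_subalgebra_swc[OF slicesW_linear]) (simp_all only: dual_Linf_def[symmetric] mult adjX)
qed

text \<open>By the Fubini identity a normal functional that vanishes on the slices of adj W
  annihilates, after conjugation, the slices of W that generate N. Normal functionals on N are hence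
  compared on the slices of S alone.\<close>

lemma N_vanish:
  assumes \<nu>: "nfun \<nu>" and v: "\<And>a b. \<nu> (vsr a b S) = 0" and y: "y \<in> N"
  shows "\<nu> y = 0"
proof -
  let ?\<nu> = "\<lambda>x. cnj (\<nu> (adj x))"
  have n: "nfun ?\<nu>" by (rule normal_cnj[OF \<nu>])
  have "?\<nu> (vsl a b W) = 0" for a b using v[of b a] by (simp add: vsr_S adj_vsl)
  then have "slice_right ?\<nu> W = 0" by (intro op_eqI_cinner) (simp add: cinner_slice_right[OF n])
  then have "?\<nu> (slice_left w W) = 0" if "nfun w" for w using fubini_slices[OF that n, of W] normal_linear(4)[OF that] by simp
  then have "?\<nu> (adj y) = 0" using subalgD(4)[OF Ns y] normal_vanish_closure[OF _ n, of "adj y" slicesW] unfolding dual_Linf_def by blast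
  then show ?thesis by simp
qed

lemma N_eqI:
  "nfun \<mu> ==> nfun \<nu> ==> (\<And>a b. \<mu> (vsr a b S) = \<nu> (vsr a b S)) ==> y \<in> N ==> \<mu> y = \<nu> y"
  using N_vanish[OF normal_diff] by fastforce

text \<open>A vector y killed by N satisfies adj S (y \<otimes> a) = 0 for all a, and S is unitary.
  With this the density theorem identifies N with its bicommutant.\<close>

lemma N_kernel: assumes "\<And>x. x \<in> N ==> x \<cdot> y = 0" shows "y = 0"
proof -
  have "adj S \<cdot> (y \<odot> a) = 0" for a
  proof (rule tensor_cinner_eqI)
    fix p q
    have "cinner p (adj (vsr a q S) \<cdot> y) = 0" using assms[OF subalgD(4)[OF Ns vsr_S_mem]] by simp
    then show "cinner (p \<odot> q) (adj S \<cdot> (y \<odot> a)) = cinner (p \<odot> q) 0" by (simp add: adj_vsr cinner_vsr)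
  qed
  then have "S \<cdot> adj S \<cdot> (y \<odot> a) = 0" for a by simp
  then have "y \<odot> (a :: 'i ell2) = 0" for a by (simp add: op_apply_mult[symmetric] S_unitary del: op_apply_mult)
  from arg_cong[OF this[of "ket undefined"], of norm] show ?thesis by (simp add: norm_tensor)
qed

lemma N_bicommutant: "x \<in> commutant (commutant N) ==> x \<in> N"
  using bicommutant_density[OF Ns, of x] N_kernel swc_idem unfolding dual_Linf_def by force

lemma N_memI: "(\<And>y. y \<in> commutant N ==> x * y = y * x) ==> x \<in> N" by (intro N_bicommutant commutantI)

lemma N_one: "1 \<in> N" by (rule N_memI) simp

lemma left_leg_N: "(\<And>a b. vsr a b X \<in> N) ==> y \<in> commutant N ==> X * (y \<otimes> 1) = (y \<otimes> 1) * X"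
  using commutes_left_leg[of X y] commutantD[of y N] by metis

lemma S_left: "y \<in> commutant N ==> S * (y \<otimes> 1) = (y \<otimes> 1) * S" by (rule left_leg_N[OF vsr_S_mem])

end

section \<open>The predual *-algebra and its support\<close>

context universal_pair
begin

text \<open>The involution of the predual *-algebra, lifted to normal functionals on all operators;
  \<open>res\<close> cuts these back to functions that vanish off N. The lifted algebra
  \<open>Ln\<close> contains all normal functionals that vanish on N.\<close>

definition partner :: "('i op => complex) => ('i op => complex) => bool" where
  "partner p q \<longleftrightarrow> nfun p \<and> nfun q \<and> lam q = adj (lam p)"

definition Ln :: "('i op => complex) set" where "Ln = {p. \<exists>q. partner p q}"

abbreviation "res p \<equiv> (\<lambda>x. if x \<in> N then p x else 0)"
abbreviation "L p \<equiv> l (res p)"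
abbreviation "dcom x \<equiv> adj S * (1 \<otimes> x) * S"

definition conv :: "('i op => complex) => ('i op => complex) => 'i op => complex" where
  "conv p q x = p (slice_right q (dcom x))"

lemma partner_normal: "partner p q ==> nfun p" "partner p q ==> nfun q"
  and partner_sym: "partner p q ==> partner q p"
  and LnI: "partner p q ==> p \<in> Ln" by (auto simp: partner_def Ln_def)

lemma LnE: "p \<in> Ln ==> \<exists>q. partner p q" and Ln_normal: "p \<in> Ln ==> nfun p" by (auto simp: Ln_def partner_def)

lemma lam_res: "slice_left (res p) S = lam p" unfolding slice_left_def by (simp add: vsr_S_mem)

lemma partner_star: "partner p q ==> dual_star W (res p) (res q)"
  by (simp add: dual_star_def partner_def dual_L1_def predualI dual_lambda_def lam_res)

lemma L1s_res: "p \<in> Ln ==> res p \<in> L1s" using LnE partner_star unfolding dual_L1_star_def by blast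

lemma L1s_Ln: "w \<in> L1s ==> \<exists>p\<in>Ln. w = res p"
proof -
  assume "w \<in> L1s"
  then obtain u where u: "dual_star W w u" by (auto simp: dual_L1_star_def)
  then obtain p q where ab: "nfun p" "w = res p" "nfun q" "u = res q" unfolding dual_star_def dual_L1_def by (auto dest!: predualE)
  then have "partner p q" using u by (simp add: partner_def dual_star_def dual_lambda_def lam_res)
  then show ?thesis using LnI ab(2) by blast
qed

lemma L_dense: "closure (L ` Ln) = A"
proof -
  have "L ` Ln = l ` L1s"
  proof
    show "L ` Ln \<subseteq> l ` L1s" using L1s_res by blast
    show "l ` L1s \<subseteq> L ` Ln"
    proof
      fix x assume "x \<in> l ` L1s"
      then obtain w where "w \<in> L1s" "x = l w" by blast
      moreover from this obtain p where "p \<in> Ln" "w = res p" using L1s_Ln by blast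
      ultimately show "x \<in> L ` Ln" by simp
    qed
  qed
  then show ?thesis by (simp add: l_dense)
qed

lemma Lam_L: "p \<in> Ln ==> \<Lambda> (L p) = lam p" by (simp only: Lam_l[OF L1s_res] dual_lambda_def lam_res)

lemma L_mem: "p \<in> Ln ==> L p \<in> A" by (rule l_mem[OF L1s_res])

lemma L_star: "partner p q ==> L q = adj (L p)" by (rule l_star[OF partner_star])

lemma lam_mem: "p \<in> Ln ==> lam p \<in> B" using imageI[OF L_mem, of p \<Lambda>] by (simp only: Lam_L Lam_image)

lemma vsr_dcom_mem: "vsr a b (dcom x) \<in> N"
proof (rule N_memI)
  fix y assume y: "y \<in> commutant N"
  have "adj S * (y \<otimes> 1) = (y \<otimes> 1) * adj S"
    using arg_cong[OF S_left[OF commutant_adj[OF subalgD(4)[OF Ns] y]], of adj] by (simp add: adj_mult adj_tensor)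
  moreover have "dcom x * (y \<otimes> 1) = adj S * ((1 \<otimes> x) * (y \<otimes> 1)) * S" using S_left[OF y] by (simp only: mult.assoc)
  moreover have "(1 \<otimes> x) * (y \<otimes> 1) = (y \<otimes> 1) * (1 \<otimes> x)" by (simp add: tensor_op_mult)
  ultimately have "dcom x * (y \<otimes> 1) = (y \<otimes> 1) * dcom x" by (simp only: mult.assoc[symmetric])
  then show "vsr a b (dcom x) * y = y * vsr a b (dcom x)" using commutes_left_leg[of "dcom x" y] by blast
qed

lemma vsl_dcom_mem: assumes x: "x \<in> N" shows "vsl a b (dcom x) \<in> N"
proof (rule N_memI, rule op_eqI_cinner)
  fix y p q assume y: "y \<in> commutant N"
  have n: "nfun (\<lambda>x. cinner (a \<odot> p) (dcom x \<cdot> (b \<odot> q)))" for p q by (rule normal_comp[OF normal_vec])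
  have eq: "cinner (a \<odot> p) (dcom x \<cdot> (b \<odot> (y \<cdot> q))) = cinner (a \<odot> (adj y \<cdot> p)) (dcom x \<cdot> (b \<odot> q))"
  proof (rule N_eqI[OF n n _ x])
    fix c d
    have "cinner p ((vsl a b (dcom (vsr c d S)) * y) \<cdot> q) = cinner p ((y * vsl a b (dcom (vsr c d S))) \<cdot> q)"
      unfolding vsl_dual_comult using commutantD[OF y vsr_S_mem] by simp
    then show "cinner (a \<odot> p) (dcom (vsr c d S) \<cdot> (b \<odot> (y \<cdot> q))) = cinner (a \<odot> (adj y \<cdot> p)) (dcom (vsr c d S) \<cdot> (b \<odot> q))"
      by (simp only: cinner_vsl[symmetric] cinner_adj_left) (simp only: op_apply_mult)
  qed
  show "cinner p ((vsl a b (dcom x) * y) \<cdot> q) = cinner p ((y * vsl a b (dcom x)) \<cdot> q)"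
    using eq by (simp only: cinner_vsl[symmetric] cinner_adj_left) (simp only: op_apply_mult)
qed

lemma slice_left_mem_N: "nfun w ==> (\<And>a b. vsl a b T \<in> N) ==> slice_left w T \<in> N"
  by (rule slice_left_in_closed[OF _ closed_N]) (simp_all add: N_linear)

lemma slice_right_mem_N: "nfun w ==> (\<And>a b. vsr a b T \<in> N) ==> slice_right w T \<in> N"
  unfolding slice_right_flip by (rule slice_left_mem_N) (simp_all add: vsl_flip)

lemma conv_normal: "nfun p ==> nfun q ==> nfun (conv p q)" unfolding conv_def[abs_def] by (rule normal_comp[OF normal_tensor])

lemma lam_conv: "nfun p ==> nfun q ==> lam (conv p q) = lam p * lam q"
  by (rule slice_left_eqI[OF conv_normal]) (simp_all add: op_apply_mult cinner_slice_left conv_def dual_conv_slice)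

lemma conv_res:
  assumes "nfun p" "nfun q"
  shows "dual_conv W (res p) (res q) = res (conv p q)"
proof
  fix x
  have "slice_right (res q) (dcom x) = slice_right q (dcom x)" if "x \<in> N" unfolding slice_right_def by (simp add: vsl_dcom_mem[OF that])
  moreover have "dual_comult W x = dcom x" by (simp add: dual_comult_def dual_unitary_def flip_op_algebra flip_tensor)
  ultimately show "dual_conv W (res p) (res q) x = res (conv p q) x"
    using slice_right_mem_N[OF assms(2) vsr_dcom_mem] by (simp add: dual_conv_def conv_def)
qed

lemma L_conv: "p \<in> Ln ==> q \<in> Ln ==> L (conv p q) = L p * L q" using l_conv[OF L1s_res L1s_res, of p q] by (simp add: conv_res Ln_normal)

lemma partner_conv: "partner p p' ==> partner q q' ==> partner (conv p q) (conv q' p')" by (simp add: partner_def conv_normal lam_conv adj_mult)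

lemma dual_coproduct_form:
  assumes p: "nfun p"
  shows "p (vsr c d S * vsr a b S) = cinner (c \<odot> a) ((S * (lam p \<otimes> 1) * adj S) \<cdot> (d \<odot> b))"
  unfolding pentagon_slice by (rule fubini_slices[OF p normal_comp_left[OF normal_vec]])

text \<open>By the pentagon equation, multiplying a functional by a slice of S replaces its
  \<open>lam\<close> by a slice of S * (lam g \<otimes> 1) * adj S, and the adjoint of that slice
  exchanges its two vectors. The predual *-algebra is thus a bimodule over the slices of S.\<close>

lemma partner_module:
  assumes p: "partner g q"
  shows "partner (\<lambda>x. g (x * vsr a b S)) (\<lambda>x. q (x * vsr b a S))" "partner (\<lambda>x. g (vsr a b S * x)) (\<lambda>x. q (vsr b a S * x))"
proof -
  note n = partner_normal[OF p]
  have r: "lam (\<lambda>x. \<gamma> (x * vsr a b S)) = vsr a b (S * (lam \<gamma> \<otimes> 1) * adj S)"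
    and l: "lam (\<lambda>x. \<gamma> (vsr a b S * x)) = vsl a b (S * (lam \<gamma> \<otimes> 1) * adj S)" if \<gamma>: "nfun \<gamma>" for \<gamma> a b
    by (rule slice_left_eqI[OF normal_mult_right[OF \<gamma>]], simp only: dual_coproduct_form[OF \<gamma>] cinner_vsr)
      (rule slice_left_eqI[OF normal_mult_left[OF \<gamma>]], simp only: dual_coproduct_form[OF \<gamma>] cinner_vsl)
  show "partner (\<lambda>x. g (x * vsr a b S)) (\<lambda>x. q (x * vsr b a S))" "partner (\<lambda>x. g (vsr a b S * x)) (\<lambda>x. q (vsr b a S * x))"
    using p unfolding partner_def by (simp_all add: normal_mult_left normal_mult_right r l adj_vsr adj_vsl adj_mult adj_tensor mult.assoc)
qed

section \<open>Annihilator and support of the predual *-algebra\<close>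

definition annih :: "'i op set" where "annih = {x \<in> N. \<forall>p\<in>Ln. p x = 0}"

text \<open>The module property gives this for factors that are slices of S, and
  \<open>N_vanish\<close> extends it to all of N.\<close>

lemma annih_ideal: assumes x: "x \<in> annih" and y: "y \<in> N" shows "x * y \<in> annih" "y * x \<in> annih"
proof -
  have xN: "x \<in> N" and x0: "\<And>p. p \<in> Ln ==> p x = 0" using x by (auto simp: annih_def)
  have "p (x * y) = 0" if a: "p \<in> Ln" for p
  proof (rule N_vanish[OF normal_mult_left[OF Ln_normal[OF a]] _ y])
    obtain q where "partner p q" using LnE[OF a] by blast
    then show "p (x * vsr c d S) = 0" for c d using x0[OF LnI[OF partner_module(1)]] by simp
  qed
  moreover have "p (y * x) = 0" if a: "p \<in> Ln" for p
  proof (rule N_vanish[OF normal_mult_right[OF Ln_normal[OF a]] _ y])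
    obtain q where "partner p q" using LnE[OF a] by blast
    then show "p (vsr c d S * x) = 0" for c d using x0[OF LnI[OF partner_module(2)]] by simp
  qed
  ultimately show "x * y \<in> annih" "y * x \<in> annih" using subalgD(3)[OF Ns] xN y by (simp_all add: annih_def)
qed

text \<open>The ideal of elements annihilated by the predual *-algebra need not be closed under adjoints a priori,
  but it has the same kernel as its self-adjoint part.\<close>
lemma ex_support:
  "\<exists>r. r * r = r \<and> adj r = r \<and> r \<in> N \<and> r \<in> commutant N \<and> (\<forall>x\<in>annih. x * r = 0) \<and> (\<forall>p\<in>Ln. \<forall>n\<in>N. p (n * r) = p n)"
proof -
  \<comment> \<open>The common kernel of the annihilator, onto which r projects. It is invariant
    under N and under the commutant of N, so r is a central projection of N.\<close>
  let ?K = "{u. \<forall>x\<in>annih. x \<cdot> u = 0}"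
  have "csubspace ?K" by (simp add: csubspace_def op_simps)
  moreover have "closed ?K"
  proof -
    have "?K = (\<Inter>x\<in>annih. {u. x \<cdot> u = 0})" by auto
    moreover have "closed (\<Inter>x\<in>annih. {u. x \<cdot> u = 0})"
    proof (rule closed_INT, rule ballI)
      fix x show "closed {u. x \<cdot> u = 0}" using closed_vimage[OF linear_op_apply closed_singleton, of x 0] by simp
    qed
    ultimately show ?thesis by simp
  qed
  ultimately obtain r where r: "r * r = r" "adj r = r" "\<And>u. r \<cdot> u \<in> ?K" "\<And>u. u \<in> ?K ==> r \<cdot> u = u"
    using ex_projection[of ?K] by blast
  have comm: "r * y = y * r" if y: "\<And>u. u \<in> ?K ==> y \<cdot> u \<in> ?K" "\<And>u. u \<in> ?K ==> adj y \<cdot> u \<in> ?K" for y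
  proof -
    have 1: "r * (y * r) = y * r" by (rule op_eqI) (simp add: op_apply_mult r(4)[OF y(1)[OF r(3)]])
    have "r * (adj y * r) = adj y * r" by (rule op_eqI) (simp add: op_apply_mult r(4)[OF y(2)[OF r(3)]])
    from arg_cong[OF this, of adj] 1 show ?thesis by (simp add: adj_mult r(2) mult.assoc)
  qed
  have rN: "r \<in> N"
  proof (rule N_memI, rule comm)
    fix y u assume y: "y \<in> commutant N" and u: "u \<in> ?K"
    have "x \<cdot> z \<cdot> u = 0" if "x \<in> annih" "z \<in> commutant N" for x z
    proof -
      have "x * z = z * x" using commutantD[OF that(2)] that(1) by (simp add: annih_def)
      then have "x \<cdot> z \<cdot> u = z \<cdot> x \<cdot> u" by (metis op_apply_mult)
      then show ?thesis using u that(1) by simp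
    qed
    from this[OF _ y] this[OF _ commutant_adj[OF subalgD(4)[OF Ns] y]] show "y \<cdot> u \<in> ?K" "adj y \<cdot> u \<in> ?K" by simp_all
  qed
  have rN': "r \<in> commutant N"
  proof (rule commutantI, rule comm)
    fix n u assume n: "n \<in> N" and u: "u \<in> ?K"
    have "x \<cdot> z \<cdot> u = 0" if "x \<in> annih" "z \<in> N" for x z
    proof -
      have "(x * z) \<cdot> u = 0" using annih_ideal(1)[OF that] u by simp
      then show ?thesis by (simp only: op_apply_mult)
    qed
    from this[OF _ n] this[OF _ subalgD(4)[OF Ns n]] show "n \<cdot> u \<in> ?K" "adj n \<cdot> u \<in> ?K" by simp_all
  qed
  have xr: "x * r = 0" if "x \<in> annih" for x by (rule op_eqI) (use r(3) that in \<open>simp add: op_apply_mult\<close>)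
  define Y where "Y = {x \<in> annih. adj x \<in> annih}"
  have ann: "0 \<in> annih" "\<And>x y. x \<in> annih ==> y \<in> annih ==> x + y \<in> annih" "\<And>c x. x \<in> annih ==> c *C x \<in> annih"
    "\<And>x. x \<in> annih ==> x \<in> N"
  proof -
    show "x + y \<in> annih" if "x \<in> annih" "y \<in> annih" for x y
      using that by (simp add: annih_def N_linear) (metis Ln_normal normal_linear(1) add_0)
    show "c *C x \<in> annih" if "x \<in> annih" for c x
      using that by (simp add: annih_def N_linear) (metis Ln_normal normal_linear(2) mult_zero_right)
  qed (simp_all add: annih_def N_linear normal_linear(4)[OF Ln_normal])
  have Y: "star_subalgebra Y" by (simp add: star_subalgebra_def Y_def ann annih_ideal(1) adj_simps adj_mult)
  have kerY: "u \<in> ?K" if u: "\<And>y. y \<in> Y ==> y \<cdot> u = 0" for u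
  proof (intro CollectI ballI)
    fix x assume x: "x \<in> annih"
    then have "adj x * x \<in> Y" using annih_ideal(2)[OF x subalgD(4)[OF Ns ann(4)[OF x]]] by (simp add: Y_def adj_mult)
    then have "cinner u ((adj x * x) \<cdot> u) = 0" using u by simp
    then show "x \<cdot> u = 0" by (simp add: op_apply_mult cinner_adj_right cinner_norm)
  qed
  \<comment> \<open>By \<open>kerY\<close> the kernel of Y is again the range of r. The commutant of
    Y preserves it, so r, and with it 1 - r, lies in the bicommutant of Y.\<close>
  have T: "1 - r \<in> commutant (commutant Y)"
  proof (rule commutantI)
    fix z assume z: "z \<in> commutant Y"
    have adjY: "y \<in> Y ==> adj y \<in> Y" for y by (simp add: Y_def)
    have "w \<cdot> u \<in> ?K" if "w \<in> commutant Y" "u \<in> ?K" for w u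
    proof (rule kerY)
      fix y assume y: "y \<in> Y"
      then have "y \<cdot> u = 0" using that(2) by (simp add: Y_def)
      moreover have "y \<cdot> w \<cdot> u = w \<cdot> y \<cdot> u" using commutantD[OF that(1) y] by (metis op_apply_mult)
      ultimately show "y \<cdot> w \<cdot> u = 0" by simp
    qed
    from this[OF z] this[OF commutant_adj[OF adjY z]] have "r * z = z * r" by (intro comm) auto
    then show "(1 - r) * z = z * (1 - r)" by (simp add: left_diff_distrib right_diff_distrib)
  qed
  have "p (n * r) = p n" if a: "p \<in> Ln" and n: "n \<in> N" for p n
  proof -
    \<comment> \<open>The normal functional s |-> p (n * s) vanishes on Y, since n * s is again in
      the annihilator; the density theorem carries this to 1 - r.\<close>
    have "p (n * (1 - r)) = 0"
    proof (rule normal_vanish_bicommutant[OF Y T normal_mult_left[OF Ln_normal[OF a]]])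
      show "p (n * s) = 0" if "s \<in> Y" for s using annih_ideal(2)[OF _ n, of s] that a by (simp add: Y_def annih_def)
      show "(1 - r) \<cdot> u = 0" if "\<And>x. x \<in> Y ==> x \<cdot> u = 0" for u using r(4)[OF kerY[OF that]] by (simp add: op_simps)
    qed
    then show ?thesis by (simp add: right_diff_distrib normal_linear(3)[OF Ln_normal[OF a]])
  qed
  then show ?thesis using r(1,2) rN rN' xr by blast
qed

definition r :: "'i op" where
  "r = (SOME r. r * r = r \<and> adj r = r \<and> r \<in> N \<and> r \<in> commutant N \<and> (\<forall>x\<in>annih. x * r = 0) \<and> (\<forall>p\<in>Ln. \<forall>n\<in>N. p (n * r) = p n))"

lemma r: "r * r = r" "adj r = r" "r \<in> N" "r \<in> commutant N" "x \<in> annih ==> x * r = 0"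
  "p \<in> Ln ==> n \<in> N ==> p (n * r) = p n" using someI_ex[OF ex_support, folded r_def] by simp_all

lemma r_commute: "n \<in> N ==> n * r = r * n" using commutantD[OF r(4)] by simp

text \<open>Representatives living under r: replacing g in \<open>Ln\<close> by x |-> g (x * r)
  changes no value on N, hence neither \<open>L\<close> nor \<open>lam\<close>, but fixes the
  behaviour off N.\<close>

definition Lr :: "('i op => complex) set" where "Lr = {p \<in> Ln. \<forall>x. p (x * r) = p x}"

lemma LrD: "p \<in> Lr ==> p \<in> Ln" "p \<in> Lr ==> p (x * r) = p x" "p \<in> Lr ==> nfun p" by (auto simp: Lr_def Ln_normal)

lemma slice_cong_N:
  assumes "\<And>a b. vsr a b T \<in> N" "\<And>n. n \<in> N ==> p n = q n" shows "slice_left p T = slice_left q T"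
  unfolding slice_left_def by (simp add: assms)

lemma restrict_Lr:
  assumes p: "partner g q"
  shows "partner (\<lambda>x. g (x * r)) (\<lambda>x. q (x * r))" "(\<lambda>x. g (x * r)) \<in> Lr" "L (\<lambda>x. g (x * r)) = L g" "lam (\<lambda>x. g (x * r)) = lam g"
proof -
  have "lam (\<lambda>x. \<gamma> (x * r)) = lam \<gamma>" if "\<gamma> \<in> Ln" for \<gamma>
    by (rule slice_cong_N[OF vsr_S_mem]) (simp add: r(6) that)
  from this[OF LnI[OF p]] this[OF LnI[OF partner_sym[OF p]]]
  show *: "partner (\<lambda>x. g (x * r)) (\<lambda>x. q (x * r))" and "lam (\<lambda>x. g (x * r)) = lam g"
    using p by (simp_all add: partner_def normal_mult_right)
  then show "(\<lambda>x. g (x * r)) \<in> Lr" using LnI by (simp add: Lr_def mult.assoc r(1))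
  have "res (\<lambda>x. g (x * r)) = res g" by (simp add: fun_eq_iff r(6)[OF LnI[OF p]])
  then show "L (\<lambda>x. g (x * r)) = L g" by simp
qed

lemma L_Lr_dense: "closure (L ` Lr) = A"
proof -
  have "L ` Ln \<subseteq> L ` Lr"
  proof
    fix x assume "x \<in> L ` Ln"
    then obtain g where g: "x = L g" "g \<in> Ln" by blast
    then obtain q where p: "partner g q" using LnE by blast
    have "L (\<lambda>x. g (x * r)) \<in> L ` Lr" by (rule imageI[OF restrict_Lr(2)[OF p]])
    then show "x \<in> L ` Lr" by (simp only: restrict_Lr(3)[OF p] g)
  qed
  moreover have "L ` Lr \<subseteq> L ` Ln" by (rule image_mono) (simp add: Lr_def subset_iff)
  ultimately have "L ` Lr = L ` Ln" by (rule subset_antisym[rotated])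
  then show ?thesis by (simp only: L_dense)
qed

lemma lam_dense: "closure (lam ` Lr) = B"
proof
  show "closure (lam ` Lr) \<subseteq> B" by (rule closure_minimal[OF _ Bc]) (use lam_mem in \<open>auto simp: Lr_def\<close>)
  have "\<Lambda> ` closure (L ` Lr) \<subseteq> closure (lam ` Lr)"
  proof (rule image_closure_subset)
    show "continuous_on (closure (L ` Lr)) \<Lambda>" unfolding L_Lr_dense by (rule star_hom_continuous[OF As Ac Lam_hom])
    show "\<Lambda> ` L ` Lr \<subseteq> closure (lam ` Lr)"
    proof
      fix x assume "x \<in> \<Lambda> ` L ` Lr"
      then obtain p where "p \<in> Lr" "x = \<Lambda> (L p)" by blast
      then have "x \<in> lam ` Lr" using Lam_L[of p] by (simp add: Lr_def)
      then show "x \<in> closure (lam ` Lr)" by (rule closure_subset[THEN subsetD])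
    qed
  qed simp
  then show "B \<subseteq> closure (lam ` Lr)" by (simp add: L_Lr_dense Lam_image)
qed

lemma vanish_on_N_Ln:
  assumes "nfun \<gamma>" "\<And>n. n \<in> N ==> \<gamma> n = 0" shows "\<gamma> \<in> Ln"
proof -
  have "lam \<gamma> = 0" by (rule slice_left_eqI[OF assms(1)]) (simp add: assms(2) vsr_S_mem)
  then have "partner \<gamma> \<gamma>" using assms(1) by (simp add: partner_def)
  then show ?thesis by (rule LnI)
qed

text \<open>Since functionals vanishing on \<open>N\<close> belong to \<^term>\<open>Ln\<close>, no membership of \<open>x\<close> in \<open>N\<close> has to be assumed.\<close>
lemma Ln_separates: assumes "\<And>p. p \<in> Ln ==> p x = 0" shows "x \<in> annih"
proof -
  have "x \<in> N"
  proof (rule N_memI, rule op_eqI_cinner)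
    fix y a b assume y: "y \<in> commutant N"
    let ?\<gamma> = "\<lambda>x. cinner a (x \<cdot> (y \<cdot> b)) - cinner (adj y \<cdot> a) (x \<cdot> b)"
    have "?\<gamma> n = 0" if "n \<in> N" for n using commutantD[OF y that] by (simp only: cinner_adj_left op_apply_mult[symmetric]) simp
    then have "?\<gamma> x = 0" by (rule assms[OF vanish_on_N_Ln[OF normal_diff[OF normal_vec normal_vec]]])
    then show "cinner a ((x * y) \<cdot> b) = cinner a ((y * x) \<cdot> b)" by (simp add: cinner_adj_left op_apply_mult)
  qed
  then show ?thesis using assms by (simp add: annih_def)
qed

lemma Lr_separates: assumes "\<And>p. p \<in> Lr ==> p x = 0" shows "x * r = 0"
proof -
  have "p (x * r) = 0" if p: "p \<in> Ln" for p
  proof -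
    obtain q where "partner p q" using LnE[OF p] by blast
    from assms[OF restrict_Lr(2)[OF this]] show ?thesis .
  qed
  then have "x * r \<in> annih" by (rule Ln_separates)
  from r(5)[OF this] show ?thesis by (simp add: mult.assoc r(1))
qed

text \<open>Operator identities under r \<otimes> 1 are verified by slicing with functionals of
  \<open>Lr\<close>, for which the slices of S and V are known.\<close>

lemma Lr_slice_separates:
  assumes "\<And>p. p \<in> Lr ==> slice_left p X = 0" shows "X * (r \<otimes> 1) = 0"
proof (rule op_vsr_eqI)
  fix a b
  have "p (vsr a b X) = 0" if "p \<in> Lr" for p using cinner_slice_left[OF LrD(3)[OF that], of a X b] assms[OF that] by simp
  then show "vsr a b (X * (r \<otimes> 1)) = vsr a b 0" by (simp add: vsr_mult_out Lr_separates)
qed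

text \<open>Convolution products stay in \<open>Ln\<close> and vanish at e = 1 - r, so the dual
  comultiplication of e vanishes under r \<otimes> r; cancelling adj S leaves (1 \<otimes> e) S (r
  \<otimes> r) = 0. Slicing by g gives e * lam g * r = 0, and the partner of g gives the same for
  adj (lam g).\<close>

lemma r_commutes_B: assumes b: "b \<in> B" shows "b * r = r * b"
proof -
  define e where "e = 1 - r"
  have e: "e \<in> N" "e * r = 0" "r * e = 0" "adj e = e"
    using N_diff[OF N_one r(3)] by (simp_all add: e_def left_diff_distrib right_diff_distrib r adj_simps)
  have re: "g e = 0" if "g \<in> Ln" for g using r(6)[OF that N_one] by (simp add: e_def normal_linear(3)[OF Ln_normal[OF that]])
  have "g (slice_right q (dcom e)) = 0" if "g \<in> Ln" "q \<in> Ln" for g q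
  proof -
    have "conv g q \<in> Ln" using that LnE partner_conv LnI by blast
    from re[OF this] show ?thesis by (simp only: conv_def)
  qed
  then have sr: "slice_right q (dcom e) * r = 0" if "q \<in> Ln" for q using r(5)[OF Ln_separates] that by blast
  have "vsl a (r \<cdot> b) (dcom e) * r = 0" for a b
  proof (rule r(5)[OF Ln_separates])
    fix q assume q: "q \<in> Ln"
    have "cinner a ((slice_right q (dcom e) * r) \<cdot> b) = 0" by (simp add: sr[OF q])
    then show "q (vsl a (r \<cdot> b) (dcom e)) = 0" by (simp add: op_apply_mult cinner_slice_right[OF Ln_normal[OF q]])
  qed
  then have "dcom e * (r \<otimes> r) = 0"
  proof (intro op_vsl_eqI)
    fix a b assume *: "\<And>a b. vsl a (r \<cdot> b) (dcom e) * r = 0"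
    have "vsl a b (dcom e * (r \<otimes> r)) = vsl a b (dcom e * (r \<otimes> 1) * (1 \<otimes> r))" by (simp add: mult.assoc tensor_op_mult)
    also have "\<dots> = 0" by (simp only: vsl_mult_out vsl_mult_in *)
    finally show "vsl a b (dcom e * (r \<otimes> r)) = vsl a b 0" by simp
  qed
  then have "S * (dcom e * (r \<otimes> r)) = 0" by simp
  then have e0: "(1 \<otimes> e) * S * (r \<otimes> r) = 0" by (simp add: mult.assoc[symmetric] S_unitary)
  have er: "e * lam g * r = 0" if g: "g \<in> Lr" for g
  proof -
    have "lam g = slice_left (\<lambda>x. g (1 * x * r)) S" by (simp add: LrD(2)[OF g])
    also have "\<dots> = slice_left g (S * (r \<otimes> 1))" using slice_left_algebra(7)[OF LrD(3)[OF g], of 1 S r] by simp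
    finally have "e * lam g * r = slice_left g ((1 \<otimes> e) * (S * (r \<otimes> 1)) * (1 \<otimes> r))"
      by (simp add: slice_left_algebra[OF LrD(3)[OF g]])
    also have "(1 \<otimes> e) * (S * (r \<otimes> 1)) * (1 \<otimes> r) = 0" using e0 by (simp add: mult.assoc tensor_op_mult)
    finally show ?thesis using slice_left_algebra(2)[OF LrD(3)[OF g], of 0 0] by simp
  qed
  have "lam g * r = r * lam g" if g: "g \<in> Lr" for g
  proof -
    obtain q where p: "partner g q" using LnE[OF LrD(1)[OF g]] by blast
    then have "e * adj (lam g) * r = 0"
      using er[OF restrict_Lr(2)[OF partner_sym[OF p]]] restrict_Lr(4)[OF partner_sym[OF p]] by (simp add: partner_def)
    from arg_cong[OF this, of adj] er[OF g] show ?thesis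
      by (simp add: adj_mult e r(2) mult.assoc) (simp add: e_def left_diff_distrib right_diff_distrib mult.assoc)
  qed
  moreover have "closed {b. b * r = r * b}" by (rule closed_linear_eq) (rule linear_mult_op)+
  ultimately have "closure (lam ` Lr) \<subseteq> {b. b * r = r * b}" by (intro closure_minimal) auto
  then show ?thesis using b lam_dense by blast
qed

lemma r_nonzero: "r \<noteq> 0"
proof
  assume r0: "r = 0"
  have "lam p = 0" if "p \<in> Lr" for p
  proof (rule slice_left_eqI[OF LrD(3)[OF that]])
    fix a b
    have "p (vsr a b S) = p (vsr a b S * r)" by (simp only: LrD(2)[OF that])
    then show "cinner a (0 \<cdot> b) = p (vsr a b S)" using r0 by (simp add: normal_linear(4)[OF LrD(3)[OF that]])
  qed
  then have "closure (lam ` Lr) \<subseteq> {0}" by (intro closure_minimal) auto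
  then show False using B_not_two[of 0] lam_dense by simp
qed

end

section \<open>The universal corepresentation\<close>

lemma continuous_on_agree:
  fixes f :: "'a :: metric_space => 'b :: t2_space"
  assumes "continuous_on (closure S) f" "continuous_on (closure S) g" "\<And>y. y \<in> S ==> f y = g y" "x \<in> closure S"
  shows "f x = g x"
proof -
  obtain s where s: "\<And>n. s n \<in> S" "s \<longlonglongrightarrow> x" using assms(4) closure_sequential by blast
  have "\<forall>n. s n \<in> closure S" using s(1) closure_subset by blast
  then have sc: "\<forall>\<^sub>F n in sequentially. s n \<in> closure S" by simp
  have lim: "(\<lambda>n. h (s n)) \<longlonglongrightarrow> h x" if "continuous_on (closure S) h" for h :: "'a => 'b"
    by (rule continuous_on_tendsto_compose[OF that s(2) assms(4) sc])
  have "(\<lambda>n. f (s n)) = (\<lambda>n. g (s n))" by (simp add: s(1) assms(3))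
  then show ?thesis using LIMSEQ_unique[OF lim[OF assms(1)]] lim[OF assms(2)] by simp
qed

text \<open>A vector y orthogonal to all these vectors satisfies adj U (y \<otimes> a) = 0 for every
  a; applying U gives y \<otimes> a = 0.\<close>

lemma dense_slices:
  fixes U :: "('i \<times> 'j) op"
  assumes "U * adj U = 1" shows "closure (cspan {vsr a b U \<cdot> x | a b x. True}) = UNIV"
proof -
  define K where "K = closure (cspan {vsr a b U \<cdot> x | a b x. True})"
  have "csubspace K" "closed K" unfolding K_def by (rule csubspace_closure[OF csubspace_complex_span], simp)
  from ex_projection[OF this] obtain P where P: "P * P = P" "adj P = P" "\<And>x. P \<cdot> x \<in> K" "\<And>x. x \<in> K ==> P \<cdot> x = x"
    by blast
  have "P \<cdot> z = z" for z
  proof -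
    define y where "y = z - P \<cdot> z"
    have "P \<cdot> P \<cdot> z = P \<cdot> z" by (simp only: P(1) op_apply_mult[symmetric])
    then have y: "P \<cdot> y = 0" by (simp add: y_def op_simps)
    have "adj U \<cdot> (y \<odot> a) = 0" for a :: "'j ell2"
    proof (rule tensor_cinner_eqI)
      fix p q
      have "vsr a q U \<cdot> p \<in> K" unfolding K_def by (rule closure_subset[THEN subsetD], rule complex_spanI) blast
      then have "cinner y (vsr a q U \<cdot> p) = cinner (adj P \<cdot> y) (vsr a q U \<cdot> p)" by (simp add: cinner_adj_left P(4))
      then have "cinner (y \<odot> a) (U \<cdot> (p \<odot> q)) = 0" by (simp add: P(2) y cinner_vsr)
      then have "cinner (adj U \<cdot> (y \<odot> a)) (p \<odot> q) = 0" by (simp add: cinner_adj_left)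
      then show "cinner (p \<odot> q) (adj U \<cdot> (y \<odot> a)) = cinner (p \<odot> q) 0" by (subst cinner_commute) simp
    qed
    then have "(U * adj U) \<cdot> (y \<odot> a) = 0" for a :: "'j ell2" by (simp add: op_apply_mult)
    from arg_cong[OF this[of "ket undefined"], of norm] show ?thesis by (simp add: assms norm_tensor y_def)
  qed
  then have "z \<in> K" for z using P(3)[of z] by simp
  then show ?thesis unfolding K_def by auto
qed

lemma dense_slices_left:
  fixes U :: "('i \<times> 'j) op"
  assumes "U * adj U = 1" shows "closure (cspan {vsl a b U \<cdot> x | a b x. True}) = UNIV"
proof -
  have "flip_op U * adj (flip_op U) = 1" by (simp only: flip_op_algebra(3,7)[symmetric] assms flip_op_algebra(5))
  from dense_slices[OF this] show ?thesis by (simp only: vsr_flip)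
qed

lemma dense_actionI:
  assumes "closure (cspan {f a b \<cdot> x | a b x. True}) = UNIV" "\<And>a b. f a b \<in> D"
  shows "closure (cspan {k \<cdot> x | k x. k \<in> D}) = UNIV"
proof (rule closure_complex_span_UNIV_I[OF assms(1)])
  fix x assume "x \<in> {f a b \<cdot> x | a b x. True}"
  then show "x \<in> closure (cspan {k \<cdot> x | k x. k \<in> D})" using assms(2) by (intro closure_subset[THEN subsetD] complex_spanI) blast
qed

text \<open>By density the vector z may be taken of the form k x with k in D. Moving k and c into X
  as a factor k \<otimes> c turns the slice of X into a slice of an element of the tensor
  product.\<close>

lemma vsl_multiplier_mult:
  assumes A: "star_subalgebra A" "closed A" and D: "D \<noteq> {}" "closure (cspan {k \<cdot> x | k x. k \<in> D}) = UNIV"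
    and X: "\<And>k a. k \<in> D ==> a \<in> A ==> X * (k \<otimes> a) \<in> D' \<otimes>\<^sub>m A" and D': "D' \<noteq> {}" and c: "c \<in> A"
  shows "vsl t z X * c \<in> A"
proof -
  have l: "bounded_linear (\<lambda>z. vsl t z X * c)" by (rule bounded_linear_compose[OF linear_mult_op(2) bounded_linear_vsl_vec2])
  have "z \<in> closure (cspan {k \<cdot> x | k x. k \<in> D})" using D(2) by simp
  then show ?thesis
  proof (induction z rule: closure_cspan_induct)
    case closed show ?case by (rule closed_vimage[OF l A(2)])
  next
    case zero show ?case using linear_0[OF bounded_linear.linear[OF l]] A(1) by (simp add: subalgD(1))
  next
    case (add x y) then show ?case by (simp add: vsl_add_vec2 distrib_right subalgD(2)[OF A(1)])
  next
    case (base e x)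
    then obtain k z where k: "k \<in> D" "x = k \<cdot> z" by blast
    have "vsl t (k \<cdot> z) X * c = vsl t z (X * (k \<otimes> c))"
      by (simp add: vsl_mult_in(2)[symmetric] vsl_mult_out(2)[symmetric] mult.assoc tensor_op_mult)
    also have "\<dots> \<in> A" by (rule vsl_tensor_mem[OF A D' X[OF k(1) c]])
    finally show ?case by (simp add: k vsl_scaleC_vec2 scaleC_mult_left subalgD(5)[OF A(1)])
  qed
qed

lemma vsr_leg13_leg12: "vsr (a \<odot> q) (a' \<odot> q') (leg13 X * leg12 Y) = vsr q q' X * vsr a a' Y"
proof -
  have "vsr (a' \<odot> q') (a \<odot> q) (leg12 (adj Y) * leg13 (adj X)) = vsr a' a (adj Y) * vsr q' q (adj X)"
    by (rule op_eqI_cinner) (simp only: cinner_vsr cinner_leg12_leg13)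
  from arg_cong[OF this, of adj] show ?thesis by (simp add: adj_vsr adj_mult leg12_algebra leg13_algebra)
qed

context universal_pair
begin

lemma cstar_B: "cstar_algebra B" unfolding cstar_algebra_def using Bs Bc dense_actionI[OF dense_slices[OF W_unitary(2)] vsr_W_mem] by simp

lemma B_in_M: "B \<subseteq> M"
proof
  fix b assume "b \<in> B"
  then have b: "b \<in> closure (lam ` Lr)" by (simp add: lam_dense)
  show "b \<in> M"
  proof (rule memM)
    fix y assume y: "y \<in> commutant M"
    have "lam p * y = y * lam p" if "p \<in> Lr" for p
      using arg_cong[OF slice_S_commutant[OF y], of "slice_left p"] by (simp add: slice_left_algebra[OF LrD(3)[OF that]])
    moreover have "closed {b. b * y = y * b}" by (rule closed_linear_eq) (rule linear_mult_op)+
    ultimately have "closure (lam ` Lr) \<subseteq> {b. b * y = y * b}" by (intro closure_minimal) auto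
    then show "b * y = y * b" using b by blast
  qed
qed

section \<open>Strict extensions of the comultiplications and of the reducing morphism\<close>

lemma cstar_AA: "cstar_algebra (A \<otimes>\<^sub>m A)" and cstar_BB: "cstar_algebra (B \<otimes>\<^sub>m B)"
  by (simp_all add: cstar_algebra_tensor cstar_A cstar_B)

sublocale du: strict_hom A "A \<otimes>\<^sub>m A" \<Delta>u
  by unfold_locales (use cstar_A cstar_AA univ_comult in \<open>auto simp: universal_comult_def\<close>)

sublocale la: strict_hom A B \<Lambda>
proof unfold_locales
  have "closure (cspan {\<Lambda> a * b | a b. a \<in> A \<and> b \<in> B}) = B"
  proof
    have "cspan {\<Lambda> a * b | a b. a \<in> A \<and> b \<in> B} \<subseteq> B"
    proof
      fix x assume "x \<in> cspan {\<Lambda> a * b | a b. a \<in> A \<and> b \<in> B}"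
      then show "x \<in> B" by (induction x rule: complex_span_induct) (use Lam_image in \<open>auto intro!: subalgD[OF Bs]\<close>)
    qed
    then show "closure (cspan {\<Lambda> a * b | a b. a \<in> A \<and> b \<in> B}) \<subseteq> B" by (rule closure_minimal[OF _ Bc])
    have "{\<Lambda> a * b | a b. a \<in> A \<and> b \<in> B} = {x * y | x y. x \<in> B \<and> y \<in> B}" unfolding Lam_image[symmetric] by blast
    then show "B \<subseteq> closure (cspan {\<Lambda> a * b | a b. a \<in> A \<and> b \<in> B})" using cstar_mult_dense[OF Bs] by auto
  qed
  then show "nondegenerate_hom A B \<Lambda>" unfolding nondegenerate_hom_def using Lam_hom Lam_image multipliers_superset[OF Bs] by simp
qed (fact cstar_A cstar_B)+

abbreviation "LL \<equiv> cstar_tensor_hom A A \<Lambda> \<Lambda>"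

lemma LL_hom: "star_hom (A \<otimes>\<^sub>m A) LL" and LL_tensor: "a \<in> A ==> b \<in> A ==> LL (a \<otimes> b) = \<Lambda> a \<otimes> \<Lambda> b"
  using cstar_tensor_hom[OF As Ac Lam_hom As Ac Lam_hom] by blast+

lemmas AAs = cstar_algebraD(1)[OF cstar_AA] and AAc = cstar_algebraD(2)[OF cstar_AA]
lemmas BBs = cstar_algebraD(1)[OF cstar_BB] and BBc = cstar_algebraD(2)[OF cstar_BB]

lemma closure_complex_span_closed:
  assumes "x \<in> closure (cspan X)" "\<And>y. y \<in> X ==> y \<in> closure (cspan Y)"
  shows "x \<in> closure (cspan (Y :: 'c op set))" using assms(1)
proof (induction x rule: closure_cspan_induct)
  case zero show ?case using complex_span_zero closure_subset by blast
next
  case (add x y) then show ?case using closure_add[OF complex_span_add] by blast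
next
  case (base c x)
  show ?case by (rule closure_linear_image[OF bounded_linear_scaleC_op complex_span_scaleC assms(2)[OF base]])
qed simp

lemma closure_complex_span_subset:
  "star_subalgebra X ==> closed X ==> Y \<subseteq> X ==> closure (cspan Y) \<subseteq> X"
  by (rule closure_minimal) (auto elim!: complex_span_induct intro!: subalgD)

lemma LL_mem: "t \<in> A \<otimes>\<^sub>m A ==> LL t \<in> B \<otimes>\<^sub>m B"
proof -
  let ?E = "{a \<otimes> b | a b. a \<in> A \<and> b \<in> A}"
  have AAeq: "A \<otimes>\<^sub>m A = closure (cspan ?E)" by (simp add: cstar_tensor_def)
  have sub: "cspan ?E \<subseteq> A \<otimes>\<^sub>m A" unfolding AAeq by (rule closure_subset)
  have "LL ` closure (cspan ?E) \<subseteq> B \<otimes>\<^sub>m B"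
  proof (rule image_closure_subset)
    show "continuous_on (closure (cspan ?E)) LL" unfolding AAeq[symmetric] by (rule star_hom_continuous[OF AAs AAc LL_hom])
    show "LL ` cspan ?E \<subseteq> B \<otimes>\<^sub>m B"
    proof clarify
      fix x assume "x \<in> cspan ?E"
      then have "x \<in> A \<otimes>\<^sub>m A \<and> LL x \<in> B \<otimes>\<^sub>m B"
      proof (induction x rule: complex_span_induct)
        case zero show ?case using star_hom_zero[OF AAs LL_hom] subalgD(1)[OF AAs] subalgD(1)[OF BBs] by simp
      next
        case (add x y) then show ?case by (simp add: homD(1)[OF LL_hom] subalgD[OF AAs] subalgD[OF BBs])
      next
        case (base c x)
        then obtain a b where ab: "x = a \<otimes> b" "a \<in> A" "b \<in> A" by blast
        then have "\<Lambda> a \<in> B" "\<Lambda> b \<in> B" using Lam_image by blast+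
        then show ?case using ab by (simp add: homD(4)[OF LL_hom] LL_tensor tensor_memI tensor_scaleC_mem)
      qed
      then show "LL x \<in> B \<otimes>\<^sub>m B" by simp
    qed
  qed (fact BBc)
  then show "t \<in> A \<otimes>\<^sub>m A ==> LL t \<in> B \<otimes>\<^sub>m B" unfolding AAeq by blast
qed

sublocale ll: strict_hom "A \<otimes>\<^sub>m A" "B \<otimes>\<^sub>m B" LL
proof unfold_locales
  let ?C = "closure (cspan {LL t * s | t s. t \<in> A \<otimes>\<^sub>m A \<and> s \<in> B \<otimes>\<^sub>m B})"
  have C: "x * y \<in> ?C" if "x \<in> B \<otimes>\<^sub>m B" "y \<in> B \<otimes>\<^sub>m B" for x y using that(1)
  proof (induction x rule: tensor_mem_induct)
    case closed show ?case by (rule closed_vimage[OF linear_mult_op(2) closed_closure])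
  next
    case (add s t) then show ?case using closure_add[OF complex_span_add] by (simp add: distrib_right)
  next
    case (tensor a b c)
    then obtain a' b' where "a' \<in> A" "\<Lambda> a' = a" "b' \<in> A" "\<Lambda> b' = b" unfolding Lam_image[symmetric] by blast
    then have "c *C (a \<otimes> b) = LL (c *C (a' \<otimes> b'))" "c *C (a' \<otimes> b') \<in> A \<otimes>\<^sub>m A"
      by (simp_all add: homD(4)[OF LL_hom] LL_tensor tensor_memI tensor_scaleC_mem)
    then show ?case using that(2) by (intro closure_subset[THEN subsetD] complex_spanI) auto
  qed (use Bs star_subalgebra_ne in auto)
  have "?C = B \<otimes>\<^sub>m B"
  proof
    show "?C \<subseteq> B \<otimes>\<^sub>m B" by (rule closure_complex_span_subset[OF BBs BBc]) (auto intro!: subalgD(3)[OF BBs] LL_mem)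
    show "B \<otimes>\<^sub>m B \<subseteq> ?C" using closure_complex_span_closed[OF cstar_mult_dense[OF BBs]] C by blast
  qed
  then show "nondegenerate_hom (A \<otimes>\<^sub>m A) (B \<otimes>\<^sub>m B) LL"
    unfolding nondegenerate_hom_def using LL_hom LL_mem multipliers_superset[OF BBs] by auto
qed (fact cstar_AA cstar_BB)+

lemma comult_ll: "a \<in> A ==> \<Delta> (\<Lambda> a) = ll.ext (\<Delta>u a)" by (rule comult_Lam)

lemma D_hom_B: "star_hom B \<Delta>" using D_hom B_in_M unfolding star_hom_def by blast

text \<open>Non-degeneracy is inherited from that of \<Delta>u: LL(\<Delta>u a * u) * s =
  \<Delta>(\<Lambda> a) * (LL u * s), and by non-degeneracy of LL the products LL t * s span a dense
  subspace of the tensor square.\<close>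

sublocale de: strict_hom B "B \<otimes>\<^sub>m B" \<Delta>
proof unfold_locales
  let ?C = "closure (cspan {\<Delta> a * s | a s. a \<in> B \<and> s \<in> B \<otimes>\<^sub>m B})"
  let ?E = "{\<Delta>u a * t | a t. a \<in> A \<and> t \<in> A \<otimes>\<^sub>m A}"
  have DB: "\<Delta> a \<in> multipliers (B \<otimes>\<^sub>m B)" if "a \<in> B" for a
    using that ll.ext_mem[OF du.f_mem] comult_ll Lam_image by (metis imageE)
  have C: "LL t * s \<in> ?C" if "t \<in> A \<otimes>\<^sub>m A" "s \<in> B \<otimes>\<^sub>m B" for t s
  proof -
    have "(\<lambda>t. LL t * s) ` closure (cspan ?E) \<subseteq> ?C"
    proof (rule image_closure_subset)
      show "continuous_on (closure (cspan ?E)) (\<lambda>t. LL t * s)"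
        unfolding du.dense by (intro continuous_on_mult star_hom_continuous[OF AAs AAc LL_hom] continuous_on_const)
      show "(\<lambda>t. LL t * s) ` cspan ?E \<subseteq> ?C"
      proof clarify
        fix x assume "x \<in> cspan ?E"
        then have "x \<in> A \<otimes>\<^sub>m A \<and> LL x * s \<in> cspan {\<Delta> a * s | a s. a \<in> B \<and> s \<in> B \<otimes>\<^sub>m B}"
        proof (induction x rule: complex_span_induct)
          case zero show ?case using star_hom_zero[OF AAs LL_hom] subalgD(1)[OF AAs] complex_span_zero by simp
        next
          case (add x y) then show ?case by (simp add: homD(1)[OF LL_hom] subalgD[OF AAs] distrib_right complex_span_add)
        next
          case (base c x)
          then obtain a u where x: "x = \<Delta>u a * u" "a \<in> A" "u \<in> A \<otimes>\<^sub>m A" by blast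
          then have xA: "x \<in> A \<otimes>\<^sub>m A" using du.f_mem multipliersD(1) by blast
          have "LL x = \<Delta> (\<Lambda> a) * LL u" using x by (simp add: comult_ll ll.ext_apply du.f_mem)
          then have "LL x * s = \<Delta> (\<Lambda> a) * (LL u * s)" by (simp add: mult.assoc)
          moreover have "\<Lambda> a \<in> B" "LL u * s \<in> B \<otimes>\<^sub>m B" using x Lam_image that(2) by (auto intro!: subalgD(3)[OF BBs] LL_mem)
          ultimately have "LL x * s \<in> cspan {\<Delta> a * s | a s. a \<in> B \<and> s \<in> B \<otimes>\<^sub>m B}" by (intro complex_spanI) blast
          from complex_span_scaleC[OF this, of c] xA show ?case by (simp add: homD(4)[OF LL_hom] scaleC_mult_left tensor_scaleC_mem)
        qed
        then show "LL x * s \<in> ?C" using closure_subset by blast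
      qed
    qed simp
    then show ?thesis using that(1) unfolding du.dense by blast
  qed
  have "?C = B \<otimes>\<^sub>m B"
  proof
    show "?C \<subseteq> B \<otimes>\<^sub>m B" by (rule closure_complex_span_subset[OF BBs BBc]) (use DB multipliersD(1) in blast)
    show "B \<otimes>\<^sub>m B \<subseteq> ?C" using closure_complex_span_closed[of _ "{LL t * s | t s. t \<in> A \<otimes>\<^sub>m A \<and> s \<in> B \<otimes>\<^sub>m B}"] C
      unfolding ll.dense by blast
  qed
  then show "nondegenerate_hom B (B \<otimes>\<^sub>m B) \<Delta>" unfolding nondegenerate_hom_def using D_hom_B DB by auto
qed (fact cstar_B cstar_BB)+

end

lemma vsr_vec_linear: "vsr (a + a') b T = vsr a b T + vsr a' b T" "vsr (c *C a) b T = cnj c *C vsr a b T"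
  "vsr a (b + b') T = vsr a b T + vsr a b' T" "vsr a (c *C b) T = c *C vsr a b T"
  by (simp_all only: vsl_flip[symmetric] vsl_add_vec1 vsl_add_vec2 vsl_scaleC_vec1 vsl_scaleC_vec2)

context universal_pair
begin

section \<open>Slices of the universal corepresentation\<close>

definition V :: "('i \<times> 'j) op" where
  "V = (SOME V. unitary_op V \<and> V \<in> multipliers (dual_C0 W \<otimes>\<^sub>m A) \<and>
     (\<forall>w\<in>L1s. slice_left w V = l w \<and> \<Delta>u (l w) = slice_left w (leg13 V * leg12 V)))"

lemma V: "unitary_op V" "V \<in> multipliers (dual_C0 W \<otimes>\<^sub>m A)" "w \<in> L1s ==> slice_left w V = l w"
  "w \<in> L1s ==> \<Delta>u (l w) = slice_left w (leg13 V * leg12 V)"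
  using someI_ex[OF univ_comult[unfolded universal_comult_def, THEN conjunct2], folded V_def] by simp_all

lemma V_unitary: "adj V * V = 1" "V * adj V = 1" using V(1) by (simp_all add: unitary_op_def)

lemma vsr_V_mem: "vsr a b V \<in> N"
proof (rule ccontr)
  assume "vsr a b V \<notin> N"
  from l_junk[OF this _ continuous_on_id] have "A \<subseteq> {0, THE R. False}" by (simp add: V(3))
  then have "\<Lambda> ` A \<subseteq> {0, \<Lambda> (THE R. False)}" using star_hom_zero[OF As Lam_hom] by auto
  then show False using B_not_two by (simp add: Lam_image)
qed

lemma V_left: "y \<in> commutant N ==> V * (y \<otimes> 1) = (y \<otimes> 1) * V" by (rule left_leg_N[OF vsr_V_mem])

lemma adj_V_left: "y \<in> commutant N ==> adj V * (y \<otimes> 1) = (y \<otimes> 1) * adj V"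
  by (rule left_leg_N) (use subalgD(4)[OF Ns vsr_V_mem] in \<open>simp add: adj_vsr\<close>)

lemma slice_V: "p \<in> Ln ==> slice_left p V = L p" unfolding V(3)[OF L1s_res, symmetric] by (rule slice_cong_N[OF vsr_V_mem]) simp

lemma vsl_V_mult:
  assumes c: "c \<in> A" shows "vsl t z V * c \<in> A" "c * vsl t z V \<in> A"
proof -
  have W1: "vsl a b W \<in> dual_C0 W" for a b
  proof -
    have "slice_left (\<lambda>T. cinner a (T \<cdot> b)) W \<in> slicesW" using normal_vec by blast
    then show ?thesis unfolding dual_C0_def slice_left_vec by (rule closure_subset[THEN subsetD])
  qed
  then have ne: "dual_C0 W \<noteq> {}" by blast
  have V': "V * (k \<otimes> a) \<in> dual_C0 W \<otimes>\<^sub>m A" "(k \<otimes> a) * V \<in> dual_C0 W \<otimes>\<^sub>m A" if "k \<in> dual_C0 W" "a \<in> A" for k a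
    using multipliersD[OF V(2) tensor_memI[OF that]] by simp_all
  show "vsl t z V * c \<in> A" by (rule vsl_multiplier_mult[OF As Ac ne dense_actionI[OF dense_slices_left[OF W_unitary(2)] W1] V'(1) ne c])
  have l: "bounded_linear (\<lambda>t. c * vsl t z V)"
  proof -
    have "bounded_linear (\<lambda>t. c * adj (vsl z t (adj V)))"
      by (intro bounded_linear_compose[OF linear_mult_op(1)] bounded_linear_compose[OF bounded_linear_adj] bounded_linear_vsl_vec2)
    then show ?thesis by (simp add: adj_vsl)
  qed
  \<comment> \<open>For left multiplication by c the vector t, on the left of the form, has to be
    factored. It is taken in the span of slices of adj W, whose adjoints are slices of W and lie in
    \<open>dual_C0 W\<close>.\<close>
  have "adj W * adj (adj W) = 1" by (simp add: W_unitary)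
  then have "t \<in> closure (cspan {vsl a b (adj W) \<cdot> x | a b x. True})" using dense_slices_left by blast
  then show "c * vsl t z V \<in> A"
  proof (induction t rule: closure_cspan_induct)
    case closed show ?case by (rule closed_vimage[OF l Ac])
  next
    case zero show ?case using linear_0[OF bounded_linear.linear[OF l]] subalgD(1)[OF As] by simp
  next
    case (add x y) then show ?case by (simp add: vsl_add_vec1 distrib_left subalgD(2)[OF As])
  next
    case (base e x)
    then obtain a b t where x: "x = vsl a b (adj W) \<cdot> t" by blast
    have "c * vsl x z V = vsl t z ((vsl b a W \<otimes> c) * V)"
      unfolding x using vsl_mult_in(1)[of t z "vsl b a W" V] vsl_mult_out(1)[of t z c "(vsl b a W \<otimes> 1) * V"]
      by (simp add: adj_vsl mult.assoc[symmetric] tensor_op_mult)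
    also have "\<dots> \<in> A" by (rule vsl_tensor_mem[OF As Ac ne V'(2)[OF W1 c]])
    finally show ?case by (simp add: vsl_scaleC_vec1 scaleC_mult_right subalgD(5)[OF As])
  qed
qed

lemma slice_V_multiplier: assumes p: "nfun p" shows "slice_left p V \<in> multipliers A"
proof -
  have m: "star_subalgebra (multipliers A)" "closed (multipliers A)" using star_subalgebra_multipliers(1)[OF As] closed_multipliers[OF Ac] by auto
  have "vsl t z V \<in> multipliers A" for t z by (simp add: multipliers_def vsl_V_mult)
  then show ?thesis by (intro slice_left_in_closed[OF p m(2)]) (simp_all add: subalgD[OF m(1)])
qed

text \<open>Normal functionals under r, with no partner required. Twisting or multiplying a
  functional of \<open>Lr\<close> leads to functionals that are not known to lie in the *-algebra
  but stay in this class.\<close>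

definition rsup :: "('i op => complex) => bool" where
  "rsup p \<longleftrightarrow> nfun p \<and> (\<forall>x. p (x * r) = p x)"

lemma rsupD: "rsup p ==> nfun p" "rsup p ==> p (x * r) = p x"
  and Lr_rsup: "p \<in> Lr ==> rsup p" using LrD by (auto simp: rsup_def)

lemma rsup_vec: "rsup (\<lambda>x. cinner a (x \<cdot> (r \<cdot> b)))"
proof -
  have "r \<cdot> r \<cdot> b = r \<cdot> b" by (simp only: op_apply_mult[symmetric] r(1))
  then show ?thesis by (simp add: rsup_def normal_vec op_apply_mult)
qed

lemma rsup_ext: "rsup p ==> (\<And>q. q \<in> Lr ==> q x = 0) ==> p x = 0"
  using rsupD(2)[of p x] Lr_separates[of x] normal_linear(4)[OF rsupD(1), of p] by simp

text \<open>Both sides are normal functionals of \<open>p\<close>, so it suffices to check the identity on \<^term>\<open>Lr\<close>.\<close>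
lemma slice_transfer:
  fixes \<Phi> :: "'j op => 'm op" and R :: "('i \<times> 'm) op"
  assumes \<Phi>: "star_hom A \<Phi>" and \<Phi>L: "\<And>q. q \<in> Lr ==> \<Phi> (L q) = slice_left q R" and p: "rsup p" and b: "b \<in> A"
  shows "\<Phi> (slice_left p V * b) = slice_left p R * \<Phi> b"
proof (rule op_eqI_cinner)
  fix v w
  let ?f = "\<lambda>t z. cinner v (\<Phi> (vsl t z V * b) \<cdot> w)"
  note [simp] = vsl_V_mult[OF b]
  have "\<exists>x. \<forall>t z. cinner t (x \<cdot> z) = ?f t z"
  proof (rule ex_op_form)
    fix t z
    have "cmod (?f t z) \<le> norm (\<Phi> (vsl t z V * b)) * norm v * norm w" by (rule cmod_cinner_op_le)
    also have "\<dots> \<le> norm (vsl t z V * b) * norm v * norm w" by (intro mult_right_mono star_hom_contractive[OF As Ac \<Phi>]) simp_all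
    also have "\<dots> \<le> (norm t * norm z * norm V * norm b) * norm v * norm w"
      by (intro mult_right_mono order_trans[OF norm_mult_ineq] norm_vsl_le) simp_all
    finally show "cmod (?f t z) \<le> (norm V * norm b * norm v * norm w) * norm t * norm z" by (simp add: mult_ac)
  qed (simp_all add: vsl_add_vec1 vsl_add_vec2 vsl_scaleC_vec1 vsl_scaleC_vec2 distrib_right scaleC_mult_left
      homD[OF \<Phi>] op_simps cinner_simps)
  \<comment> \<open>x encodes the left-hand side for all functionals at once: its value under a
    normal q is the matrix element of \<Phi> (slice_left q V * b). The factor b brings the slice
    from the multipliers into A.\<close>
  then obtain x where x: "\<And>t z. cinner t (x \<cdot> z) = ?f t z" by blast
  define y where "y = x - vsr v (\<Phi> b \<cdot> w) R"
  have *: "q y = cinner v ((\<Phi> (slice_left q V * b) - slice_left q R * \<Phi> b) \<cdot> w)" if q: "nfun q" for q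
  proof -
    obtain u \<eta> where s: "(\<lambda>n. vsl (\<eta> n) (u n) V) sums slice_left q V"
      "\<And>T. (\<lambda>n. cinner (\<eta> n) (T \<cdot> u n)) sums q T" using slice_left_sums[OF q, of V] by blast
    let ?s = "\<lambda>n. \<Sum>k<n. vsl (\<eta> k) (u k) V * b"
    have sA: "?s n \<in> A" for n by (rule subalg_sum[OF As]) simp
    have lim: "?s \<longlonglongrightarrow> slice_left q V * b" using bounded_linear.sums[OF linear_mult_op(2) s(1)] by (simp add: sums_def)
    have \<Phi>s: "\<Phi> (?s n) = (\<Sum>k<n. \<Phi> (vsl (\<eta> k) (u k) V * b))" for n by (rule star_hom_sum[OF As \<Phi>]) simp
    have "(\<lambda>n. \<Phi> (?s n)) \<longlonglongrightarrow> \<Phi> (slice_left q V * b)"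
      by (rule continuous_on_tendsto_compose[OF star_hom_continuous[OF As Ac \<Phi>] lim])
        (simp_all add: sA multipliersD(1)[OF slice_V_multiplier[OF q] b])
    then have "(\<lambda>n. \<Phi> (vsl (\<eta> n) (u n) V * b)) sums \<Phi> (slice_left q V * b)" unfolding sums_def \<Phi>s .
    moreover have "bounded_linear (\<lambda>T. cinner v (T \<cdot> w))" by (rule normal_linear(5)[OF normal_vec])
    ultimately have "(\<lambda>n. ?f (\<eta> n) (u n)) sums cinner v (\<Phi> (slice_left q V * b) \<cdot> w)" by (rule bounded_linear.sums[rotated])
    then have "q x = cinner v (\<Phi> (slice_left q V * b) \<cdot> w)" using s(2)[of x] by (simp add: x sums_unique2)
    then show ?thesis by (simp add: y_def normal_linear(3)[OF q] cinner_slice_left[OF q, symmetric] op_simps cinner_simps)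
  qed
  have "q y = 0" if "q \<in> Lr" for q using that LrD[OF that] slice_V[of q] by (simp add: * homD(2)[OF \<Phi> L_mem b] \<Phi>L)
  then have "p y = 0" by (rule rsup_ext[OF p])
  then show "cinner v (\<Phi> (slice_left p V * b) \<cdot> w) = cinner v ((slice_left p R * \<Phi> b) \<cdot> w)"
    by (simp add: *[OF rsupD(1)[OF p]] op_simps cinner_simps)
qed

lemma Lam_slice: "rsup p ==> b \<in> A ==> \<Lambda> (slice_left p V * b) = lam p * \<Lambda> b"
  by (rule slice_transfer[OF Lam_hom]) (simp_all add: Lam_L LrD(1))

text \<open>On \<open>Lr\<close> this is multiplicativity of \<open>L\<close>. By the Fubini
  identity the defect is, in each argument separately, the value of the functional at a fixed
  operator, so it vanishes on \<open>rsup\<close> in one argument after the other.\<close>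

lemma slice_V_conv:
  assumes p: "rsup p" and q: "rsup q"
  shows "slice_left (conv p q) V = slice_left p V * slice_left q V"
proof (rule slice_left_eqI[OF conv_normal[OF rsupD(1)[OF p] rsupD(1)[OF q]]])
  fix v w
  let ?y = "dcom (vsr v w V)"
  define f where "f p q = p (slice_right q ?y) - cinner v ((slice_left p V * slice_left q V) \<cdot> w)" for p q
  have 1: "f p q = q (slice_left p ?y - vsr (adj (slice_left p V) \<cdot> v) w V)"
    if a: "nfun p" and b: "nfun q" for p q
    by (simp add: f_def normal_linear(3)[OF b] fubini_slices[OF a b] cinner_slice_left[OF b, symmetric] cinner_adj_left op_apply_mult)
  have 2: "f p q = p (slice_right q ?y - vsr v (slice_left q V \<cdot> w) V)"
    if a: "nfun p" for p q by (simp add: f_def normal_linear(3)[OF a] cinner_slice_left[OF a, symmetric] op_apply_mult)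
  have 0: "f p q = 0" if a: "p \<in> Lr" and b: "q \<in> Lr" for p q
  proof -
    have "conv p q \<in> Ln" using LnE[OF LrD(1)[OF a]] LnE[OF LrD(1)[OF b]] partner_conv LnI by blast
    then have "slice_left (conv p q) V = slice_left p V * slice_left q V" by (simp only: slice_V L_conv LrD(1)[OF a] LrD(1)[OF b])
    then show ?thesis using cinner_slice_left[OF conv_normal[OF LrD(3)[OF a] LrD(3)[OF b]], of v V w] by (simp add: f_def conv_def)
  qed
  have "f \<gamma> q = 0" if c: "\<gamma> \<in> Lr" for \<gamma> unfolding 1[OF LrD(3)[OF c] rsupD(1)[OF q]]
    by (rule rsup_ext[OF q]) (simp only: 1[OF LrD(3)[OF c] LrD(3), symmetric] 0[OF c])
  then have "f p q = 0" unfolding 2[OF rsupD(1)[OF p]] by (intro rsup_ext[OF p]) (simp only: 2[OF LrD(3), symmetric])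
  then show "cinner v ((slice_left p V * slice_left q V) \<cdot> w) = conv p q (vsr v w V)" by (simp add: f_def conv_def)
qed

text \<open>Multiplicativity of slicing V is the pentagon equation for S and V read through matrix
  elements; being known for functionals under r, it yields the equation on vectors under r \<otimes>
  r.\<close>

lemma pentagon_V:
  "leg12 S * leg13 V * (r \<otimes> r \<otimes> 1) = (1 \<otimes> V) * leg12 S * (1 \<otimes> adj V) * (r \<otimes> r \<otimes> 1)"
proof -
  let ?R = "r \<otimes> r \<otimes> (1 :: 'j op)"
  have 1: "(adj (leg12 S) * ((1 \<otimes> V) * leg12 S)) * ?R = (leg13 V * (1 \<otimes> V)) * ?R"
  proof (rule op_form3_eqI)
    fix p q a p' q' b
    let ?g = "\<lambda>x. cinner p (x \<cdot> (r \<cdot> p'))" and ?h = "\<lambda>x. cinner q (x \<cdot> (r \<cdot> q'))"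
    have "cinner (p \<odot> q \<odot> a) (((leg13 V * (1 \<otimes> V)) * ?R) \<cdot> (p' \<odot> q' \<odot> b)) =
        cinner (p \<odot> q \<odot> a) ((leg13 V * (1 \<otimes> V)) \<cdot> ((r \<cdot> p') \<odot> (r \<cdot> q') \<odot> b))"
      by (simp add: op_apply_mult)
    also have "\<dots> = cinner a ((vsl p (r \<cdot> p') V * vsl q (r \<cdot> q') V) \<cdot> b)" by (rule cinner_leg13_leg23)
    also have "\<dots> = cinner a ((slice_left ?g V * slice_left ?h V) \<cdot> b)" by (simp only: slice_left_vec)
    also have "\<dots> = cinner a (slice_left (conv ?g ?h) V \<cdot> b)" by (simp only: slice_V_conv[OF rsup_vec rsup_vec])
    also have "\<dots> = conv ?g ?h (vsr a b V)" by (rule cinner_slice_left[OF conv_normal[OF normal_vec normal_vec]])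
    also have "\<dots> = cinner (p \<odot> q) (dcom (vsr a b V) \<cdot> ((r \<cdot> p') \<odot> (r \<cdot> q')))"
      by (simp only: conv_def slice_right_vec cinner_vsr)
    also have "\<dots> = cinner (assoc_vec ((S \<cdot> (p \<odot> q)) \<odot> a)) ((1 \<otimes> V) \<cdot> assoc_vec ((S \<cdot> ((r \<cdot> p') \<odot> (r \<cdot> q'))) \<odot> b))"
      by (simp only: op_apply_mult cinner_adj_right cinner_leg_right)
    also have "\<dots> = cinner (p \<odot> q \<odot> a) (((adj (leg12 S) * ((1 \<otimes> V) * leg12 S)) * ?R) \<cdot> (p' \<odot> q' \<odot> b))"
      by (simp only: op_apply_mult cinner_adj_right leg12_tensor tensor_op_apply op_apply_one)
    finally show "cinner (p \<odot> q \<odot> a) (((adj (leg12 S) * ((1 \<otimes> V) * leg12 S)) * ?R) \<cdot> (p' \<odot> q' \<odot> b)) =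
       cinner (p \<odot> q \<odot> a) (((leg13 V * (1 \<otimes> V)) * ?R) \<cdot> (p' \<odot> q' \<odot> b))" by simp
  qed
  have S12: "leg12 S * adj (leg12 S) = 1" by (simp only: leg12_algebra(2)[symmetric] leg12_algebra(1)[symmetric] S_unitary leg12_algebra(3))
  have VR: "(1 \<otimes> adj V) * ?R = ?R * (1 \<otimes> adj V)" by (simp add: tensor_op_mult adj_V_left[OF r(4)])
  have "leg12 S * leg13 V * ?R = leg12 S * (leg13 V * ?R)" by (simp only: mult.assoc)
  also have "leg13 V * ?R = leg13 V * (1 \<otimes> V) * ?R * (1 \<otimes> adj V)"
    using VR[symmetric] V_unitary(2) by (simp add: mult.assoc) (simp add: mult.assoc[symmetric] tensor_op_mult)
  also have "leg12 S * \<dots> = (leg12 S * adj (leg12 S)) * ((1 \<otimes> V) * leg12 S * (?R * (1 \<otimes> adj V)))"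
    unfolding 1[symmetric] by (simp only: mult.assoc)
  finally show ?thesis unfolding S12 VR[symmetric] by (simp only: mult.assoc mult_1_left)
qed

lemma coproduct_V_form:
  assumes w: "rsup w"
  shows "w (vsr c (r \<cdot> d) S * vsr a b V) = cinner (c \<odot> a) ((V * (lam w \<otimes> 1) * adj V) \<cdot> ((r \<cdot> d) \<odot> b))"
proof -
  let ?\<nu> = "\<lambda>x. cinner (c \<odot> a) ((V * (x \<otimes> 1) * adj V) \<cdot> ((r \<cdot> d) \<odot> b))"
  have \<nu>: "nfun ?\<nu>" by (rule normal_comp_left[OF normal_vec])
  have "vsr c (r \<cdot> d) S * vsr a b V * r = slice_right ?\<nu> S * r"
  proof (rule op_eqI_cinner)
    fix p q
    have "cinner p ((vsr c (r \<cdot> d) S * vsr a b V * r) \<cdot> q) = cinner (p \<odot> c \<odot> a) ((leg12 S * leg13 V) \<cdot> ((r \<cdot> q) \<odot> (r \<cdot> d) \<odot> b))"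
      unfolding cinner_leg12_leg13 by (simp only: op_apply_mult)
    also have "\<dots> = cinner (p \<odot> c \<odot> a) ((leg12 S * leg13 V * (r \<otimes> r \<otimes> 1)) \<cdot> (q \<odot> d \<odot> b))"
      by (simp only: op_apply_mult tensor_op_apply op_apply_one)
    also have "\<dots> = cinner (p \<odot> c \<odot> a) (((1 \<otimes> V) * leg12 S * (1 \<otimes> adj V)) \<cdot> ((r \<cdot> q) \<odot> (r \<cdot> d) \<odot> b))"
      unfolding pentagon_V by (simp only: op_apply_mult tensor_op_apply op_apply_one)
    also have "\<dots> = ?\<nu> (vsl p (r \<cdot> q) S)"
      unfolding cinner_vsl[of "c \<odot> a" p "r \<cdot> q", symmetric] by (simp only: vsl_mult_out vsl_leg12)
    also have "\<dots> = cinner p ((slice_right ?\<nu> S * r) \<cdot> q)" by (simp only: op_apply_mult[of "slice_right ?\<nu> S" r] cinner_slice_right[OF \<nu>])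
    finally show "cinner p ((vsr c (r \<cdot> d) S * vsr a b V * r) \<cdot> q) = cinner p ((slice_right ?\<nu> S * r) \<cdot> q)" .
  qed
  from arg_cong[OF this, of w] have "w (vsr c (r \<cdot> d) S * vsr a b V) = w (slice_right ?\<nu> S)" by (simp only: rsupD(2)[OF w])
  also have "\<dots> = ?\<nu> (lam w)" by (rule fubini_slices[OF rsupD(1)[OF w] \<nu>])
  finally show ?thesis .
qed

lemma vsr_VV_mem: "vsr u v (leg13 V * leg12 V) \<in> N"
proof -
  have 1: "vsr (a \<odot> b) v (leg13 V * leg12 V) \<in> N" for a b
  proof (induction v rule: tensor_induct)
    case closed show ?case by (rule closed_vimage[OF bounded_linear_vsr_vec2 closed_N])
  next
    case (tensor a' b') show ?case unfolding vsr_leg13_leg12 by (intro subalgD(3)[OF Ns] vsr_V_mem)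
  qed (simp_all add: vsr_vec_linear N_linear)
  show ?thesis
  proof (induction u rule: tensor_induct)
    case closed
    have "bounded_linear (\<lambda>u. adj (vsr v u (adj (leg13 V * leg12 V))))"
      by (rule bounded_linear_compose[OF bounded_linear_adj bounded_linear_vsr_vec2])
    then have "bounded_linear (\<lambda>u. vsr u v (leg13 V * leg12 V))" by (simp add: adj_vsr)
    then show ?case by (rule closed_vimage[OF _ closed_N])
  qed (simp_all add: 1 vsr_vec_linear N_linear)
qed

lemma comult_L: "p \<in> Ln ==> \<Delta>u (L p) = slice_left p (leg13 V * leg12 V)"
  unfolding V(4)[OF L1s_res] by (rule slice_cong_N[OF vsr_VV_mem]) simp

lemma comult_slice: "rsup p ==> b \<in> A ==> \<Delta>u (slice_left p V * b) = slice_left p (leg13 V * leg12 V) * \<Delta>u b"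
  by (rule slice_transfer[OF du.hom]) (simp_all add: comult_L LrD(1))

lemma vsl_comult_mult: "x \<in> A ==> c \<in> A ==> vsl a b (\<Delta>u x) * c \<in> A"
proof -
  assume x: "x \<in> A" and c: "c \<in> A"
  have ne: "A \<noteq> {}" using x by blast
  have d: "closure (cspan {k \<cdot> x | k x. k \<in> A}) = UNIV" using cstar_A unfolding cstar_algebra_def by simp
  show ?thesis by (rule vsl_multiplier_mult[OF As Ac ne d multipliersD(1)[OF du.f_mem[OF x] tensor_memI] ne c])
qed

text \<open>Under r, the flip of (id \<otimes> \<Lambda>)(\<Delta>u x) is V * (\<Lambda> x \<otimes>
  1) * adj V. The statement is in terms of slices and contains c because a slice of \<Delta>u x is
  only a multiplier, whereas \<Lambda> is applied to elements of A.\<close>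

lemma comult_conjugation:
  assumes x: "x \<in> A" and c: "c \<in> A"
  shows "\<Lambda> (vsl a b (\<Delta>u x) * c) * r = vsr a b (V * (\<Lambda> x \<otimes> 1) * adj V) * r * \<Lambda> c"
proof (rule continuous_on_agree[where S = "L ` Lr" and f = "\<lambda>x. \<Lambda> (vsl a b (\<Delta>u x) * c) * r" and g = "\<lambda>x. vsr a b (V * (\<Lambda> x \<otimes> 1) * adj V) * r * \<Lambda> c"])
  show "x \<in> closure (L ` Lr)" by (simp add: L_Lr_dense x)
  have "bounded_linear (\<lambda>t. vsl a b t * c)" by (rule bounded_linear_compose[OF linear_mult_op(2) bounded_linear_vsl])
  then have "continuous_on A (\<lambda>x. vsl a b (\<Delta>u x) * c)"
    by (rule bounded_linear.continuous_on) (rule star_hom_continuous[OF As Ac du.hom])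
  then have "continuous_on A (\<lambda>x. \<Lambda> (vsl a b (\<Delta>u x) * c))"
    by (rule continuous_on_compose2[OF star_hom_continuous[OF As Ac Lam_hom]]) (use c vsl_comult_mult in auto)
  then show "continuous_on (closure (L ` Lr)) (\<lambda>x. \<Lambda> (vsl a b (\<Delta>u x) * c) * r)"
    unfolding L_Lr_dense by (rule bounded_linear.continuous_on[OF linear_mult_op(2)])
  have "bounded_linear (\<lambda>t. vsr a b (V * (t \<otimes> 1) * adj V) * r * \<Lambda> c)"
    by (intro bounded_linear_compose[OF linear_mult_op(2)] bounded_linear_compose[OF bounded_linear_vsr]
       bounded_linear_compose[OF linear_mult_op(1)] bounded_bilinear.bounded_linear_left[OF bilin_tensor])
  then show "continuous_on (closure (L ` Lr)) (\<lambda>x. vsr a b (V * (\<Lambda> x \<otimes> 1) * adj V) * r * \<Lambda> c)"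
    unfolding L_Lr_dense by (rule bounded_linear.continuous_on) (rule star_hom_continuous[OF As Ac Lam_hom])
  fix y assume "y \<in> L ` Lr"
  then obtain w where w: "w \<in> Lr" "y = L w" by blast
  \<comment> \<open>Slicing the first leg of \<Delta>u (L w) amounts to multiplying the argument of
    w by a slice of V on the right; the result is a functional under r that is not known to lie in
    \<open>Lr\<close>.\<close>
  define w' where "w' x = w (x * vsr a b V)" for x
  have w': "rsup w'" unfolding rsup_def w'_def[abs_def] using LrD(2)[OF w(1)]
    by (auto simp: normal_mult_right LrD(3)[OF w(1)] mult.assoc r_commute[OF vsr_V_mem, symmetric]) (simp add: mult.assoc[symmetric])
  have "vsl a b (\<Delta>u y) = slice_left w' V"
  proof (rule slice_left_eqI[OF rsupD(1)[OF w'], symmetric])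
    fix q q'
    show "cinner q (vsl a b (\<Delta>u y) \<cdot> q') = w' (vsr q q' V)"
      by (simp only: cinner_vsl w comult_L[OF LrD(1)[OF w(1)]] cinner_slice_left[OF LrD(3)[OF w(1)]] vsr_leg13_leg12 w'_def)
  qed
  moreover have "lam w' * r = vsr a b (V * (lam w \<otimes> 1) * adj V) * r" by (rule op_eqI_cinner)
      (simp only: op_apply_mult[of _ r] cinner_slice_left[OF rsupD(1)[OF w']] w'_def coproduct_V_form[OF Lr_rsup[OF w(1)]] cinner_vsr)
  moreover have "\<Lambda> c * r = r * \<Lambda> c" by (rule r_commutes_B) (use c Lam_image in blast)
  ultimately show "\<Lambda> (vsl a b (\<Delta>u y) * c) * r = vsr a b (V * (\<Lambda> y \<otimes> 1) * adj V) * r * \<Lambda> c"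
    using Lam_slice[OF w' c] Lam_L[OF LrD(1)[OF w(1)]] by (simp add: w mult.assoc) (simp add: mult.assoc[symmetric])
qed

end

section \<open>Matrices over multiplier algebras\<close>

abbreviation delta :: "nat => nat => 'i op" where "delta i j \<equiv> (if i = j then 1 else 0)"

lemma sum_delta_op: "j < n ==> (\<Sum>k<n. delta k j * f k) = (f j :: 'i op)" "j < n ==> (\<Sum>k<n. delta j k * f k) = f j"
  "j < n ==> (\<Sum>k<n. f k * delta k j) = f j" "j < n ==> (\<Sum>k<n. f k * delta j k) = f j"
  by (simp_all add: if_distrib[of "\<lambda>x. x * _"] if_distrib[of "\<lambda>x. _ * x"] cong: if_cong)

text \<open>A matrix over the multipliers is encoded as one operator with an extra leg over nat, so
  that spectral permanence for multipliers applies. The encoding is not unital; adding the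
  complementary projection q makes the encoded matrices invertible.\<close>

lemma matrix_inverse_multipliers:
  fixes A :: "'j op set" and T X :: "nat => nat => 'j op"
  assumes A: "star_subalgebra A" "closed A" and T: "\<And>i j. i < n ==> j < n ==> T i j \<in> multipliers A"
    and TX: "\<And>i j. i < n ==> j < n ==> (\<Sum>k<n. T i k * X k j) = delta i j"
    and XT: "\<And>i j. i < n ==> j < n ==> (\<Sum>k<n. X i k * T k j) = delta i j"
    and ij: "i < n" "j < n"
  shows "X i j \<in> multipliers A"
proof -
  define mat :: "(nat => nat => 'j op) => ('j \<times> nat) op" where "mat a = (\<Sum>i<n. \<Sum>j<n. a i j \<otimes> matrix_unit i j)" for a
  define p :: "nat op" where "p = coord_proj {..<n}"
  have e: "vsr (ket i) (ket j) (a \<otimes> matrix_unit k l) = (if k = i \<and> l = j then a else 0)" for a :: "'j op" and i j k l :: nat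
    by (simp add: vsr_tensor coord_ket cinner_simps)
  have vmat: "vsr (ket i) (ket j) (mat a) = (if i < n \<and> j < n then a i j else 0)" for i j a
  proof -
    have "vsr (ket i) (ket j) (mat a) = (\<Sum>k<n. \<Sum>l<n. if k = i \<and> l = j then a k l else 0)" by (simp add: mat_def vsr_sum e)
    also have "\<dots> = (\<Sum>k<n. if k = i then (\<Sum>l<n. if l = j then a k l else 0) else 0)" by (intro sum.cong refl) auto
    finally show ?thesis by simp
  qed
  have matm: "mat a * mat b = mat (\<lambda>i j. \<Sum>k<n. a i k * b k j)" for a b
  proof -
    have x: "(a i k \<otimes> matrix_unit i k) * mat b = (\<Sum>j<n. (a i k * b k j) \<otimes> matrix_unit i j)" if "k < n" for i k
    proof -
      have "(a i k \<otimes> matrix_unit i k) * mat b = (\<Sum>k'<n. if k = k' then (\<Sum>j<n. (a i k * b k j) \<otimes> matrix_unit i j) else 0)"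
        unfolding mat_def sum_distrib_left tensor_op_mult matrix_unit_mult by (intro sum.cong refl) simp
      then show ?thesis using that by simp
    qed
    have "mat a * mat b = (\<Sum>i<n. \<Sum>k<n. (a i k \<otimes> matrix_unit i k) * mat b)" unfolding mat_def[of a] sum_distrib_right ..
    also have "\<dots> = (\<Sum>i<n. \<Sum>k<n. \<Sum>j<n. (a i k * b k j) \<otimes> matrix_unit i j)" by (intro sum.cong refl) (simp add: x)
    also have "\<dots> = (\<Sum>i<n. \<Sum>j<n. \<Sum>k<n. (a i k * b k j) \<otimes> matrix_unit i j)" by (intro sum.cong refl sum.swap)
    finally show ?thesis by (simp add: mat_def tensor_op_sum_left)
  qed
  have matadj: "adj (mat a) = mat (\<lambda>i j. adj (a j i))" for a
    unfolding mat_def by (simp add: adj_sum adj_tensor adj_matrix_unit) (rule sum.swap)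
  have matadd: "mat a + mat b = mat (\<lambda>i j. a i j + b i j)" and matsc: "c *C mat a = mat (\<lambda>i j. c *C a i j)" for a b c
    by (simp_all add: mat_def tensor_op_add_left sum.distrib scaleC_sum_right tensor_op_scaleC_left)
  have mat1: "mat delta = 1 \<otimes> p"
    by (simp add: mat_def p_def coord_proj_def if_distrib[of "\<lambda>x. x \<otimes> _"] tensor_op_sum_right cong: if_cong)
  define q :: "('j \<times> nat) op" where "q = 1 \<otimes> (1 - p)"
  have matdelta: "mat delta * mat a = mat a" "mat a * mat delta = mat a" for a unfolding matm unfolding mat_def by (simp_all add: sum_delta_op)
  have pq: "1 \<otimes> p + q = 1" by (simp add: q_def tensor_op_add_right[symmetric])
  then have qd: "q = 1 - mat delta" unfolding mat1 by (metis add_diff_cancel_left')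
  have qm: "q * mat a = 0" "mat a * q = 0" "q * q = q" for a
    using matdelta[of a] matdelta(1)[of delta] by (simp_all add: qd left_diff_distrib right_diff_distrib)
  define C where "C = {mat a | a. \<forall>i j. a i j \<in> A}"
  have cong: "mat a = mat b" if "\<And>i j. i < n ==> j < n ==> a i j = b i j" for a b unfolding mat_def by (intro sum.cong refl) (simp add: that)
  have memC: "mat a \<in> C" if "\<And>i j. i < n ==> j < n ==> a i j \<in> A" for a
  proof -
    have "mat a = mat (\<lambda>i j. if i < n \<and> j < n then a i j else 0)" by (rule cong) simp
    then show ?thesis unfolding C_def using that subalgD(1)[OF A(1)] by (intro CollectI exI) auto
  qed
  have Cs: "star_subalgebra C"
  proof -
    have "mat (\<lambda>i j. 0) \<in> C" unfolding C_def using subalgD(1)[OF A(1)] by blast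
    moreover have "mat (\<lambda>i j. 0) = 0" by (simp add: mat_def)
    moreover have "x + y \<in> C \<and> x * y \<in> C" if xy: "x \<in> C" "y \<in> C" for x y
    proof -
      obtain a b where "x = mat a" "\<forall>i j. a i j \<in> A" "y = mat b" "\<forall>i j. b i j \<in> A" using xy unfolding C_def by blast
      then show ?thesis by (simp add: matadd matm memC subalg_sum[OF A(1)] subalgD(2,3)[OF A(1)])
    qed
    moreover have "adj x \<in> C \<and> (\<forall>c. c *C x \<in> C)" if x: "x \<in> C" for x
    proof -
      obtain a where "x = mat a" "\<forall>i j. a i j \<in> A" using x unfolding C_def by blast
      then show ?thesis by (simp add: matadj matsc memC subalgD(4,5)[OF A(1)])
    qed
    ultimately show ?thesis unfolding star_subalgebra_def by simp
  qed
  \<comment> \<open>C consists of the operators with entries in A that are fixed by the bounded map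
    which reassembles an operator from its first n-by-n entries.\<close>
  have Cc: "closed C"
  proof -
    let ?m = "\<lambda>t. mat (\<lambda>i j. vsr (ket i) (ket j) t)"
    have m: "bounded_linear ?m" unfolding mat_def
      by (intro bounded_linear_sum bounded_linear_compose[OF bounded_bilinear.bounded_linear_left[OF bilin_tensor]] bounded_linear_vsr)
    have mm: "?m (mat a) = mat a" for a unfolding mat_def[of "\<lambda>i j. vsr (ket i) (ket j) (mat a)"] vmat by (simp add: mat_def)
    have "C = {t. ?m t = t} \<inter> (\<Inter>i. \<Inter>j. {t. vsr (ket i) (ket j) t \<in> A})"
    proof
      show "C \<subseteq> {t. ?m t = t} \<inter> (\<Inter>i. \<Inter>j. {t. vsr (ket i) (ket j) t \<in> A})"
        using mm subalgD(1)[OF A(1)] by (auto simp: C_def vmat)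
      show "{t. ?m t = t} \<inter> (\<Inter>i. \<Inter>j. {t. vsr (ket i) (ket j) t \<in> A}) \<subseteq> C"
      proof
        fix t assume "t \<in> {t. ?m t = t} \<inter> (\<Inter>i. \<Inter>j. {t. vsr (ket i) (ket j) t \<in> A})"
        then have "t = ?m t" "\<forall>i j. vsr (ket i) (ket j) t \<in> A" by auto
        then show "t \<in> C" unfolding C_def by blast
      qed
    qed
    moreover have "closed {t. ?m t = t}" by (rule closed_linear_eq[OF m bounded_linear_ident])
    ultimately show ?thesis by (simp add: closed_Int closed_INT closed_vimage[OF bounded_linear_vsr A(2)])
  qed
  have "mat X + q \<in> multipliers C"
  proof (rule multipliers_inverse[OF Cs Cc])
    show "mat T + q \<in> multipliers C" unfolding multipliers_def
    proof (intro CollectI ballI)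
      fix t assume "t \<in> C"
      then obtain a where a: "t = mat a" "\<forall>i j. a i j \<in> A" unfolding C_def by blast
      show "(mat T + q) * t \<in> C \<and> t * (mat T + q) \<in> C" unfolding a(1) distrib_left distrib_right qm matm add_0_right
        by (intro conjI memC subalg_sum[OF A(1)] multipliersD T) (use a(2) in auto)
    qed
    have "mat (\<lambda>i j. \<Sum>k<n. T i k * X k j) = mat delta" "mat (\<lambda>i j. \<Sum>k<n. X i k * T k j) = mat delta"
      by (rule cong, simp add: TX XT)+
    then show "(mat T + q) * (mat X + q) = 1" "(mat X + q) * (mat T + q) = 1" by (simp_all add: distrib_left distrib_right matm qm mat1 pq)
  qed
  note m = multipliersD[OF this]
  show ?thesis unfolding multipliers_def
  proof (intro CollectI ballI conjI)
    fix a assume a: "a \<in> A"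
    \<comment> \<open>The diagonal matrix with entry a: multiplying the matrix X by it multiplies
      every entry by a.\<close>
    define d where "d i' k = (if i' = k then a else 0)" for i' k :: nat
    have d: "mat d \<in> C" by (rule memC) (simp add: d_def a subalgD(1)[OF A(1)])
    have CA: "vsr (ket i) (ket j) t \<in> A" if "t \<in> C" for t using that subalgD(1)[OF A(1)] by (auto simp: C_def vmat)
    show "X i j * a \<in> A" using CA[OF m(1)[OF d]] ij
      by (simp add: distrib_right qm matm vmat d_def if_distrib[of "\<lambda>x. _ * x"] cong: if_cong)
    show "a * X i j \<in> A" using CA[OF m(2)[OF d]] ij
      by (simp add: distrib_left qm matm vmat d_def if_distrib[of "\<lambda>x. x * _"] cong: if_cong)
  qed
qed

text \<open>The relation \<open>R (U\<^sub>i\<^sub>j \<otimes> 1) = \<Sum>\<^sub>k (U\<^sub>k\<^sub>j \<otimes> T\<^sub>i\<^sub>k) R\<close>, solved for \<open>T\<close>.\<close>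
lemma matrix_slide:
  fixes R :: "('i \<times> 'k) op"
  assumes R: "\<And>j. j < n ==> R * (U i j \<otimes> 1) = (\<Sum>k<n. U k j \<otimes> T i k) * R"
    and Z: "\<And>k. k < n ==> (\<Sum>j<n. Z m j * U k j) = delta m k" and m: "m < n"
  shows "(\<Sum>j<n. (Z m j \<otimes> 1) * (R * (U i j \<otimes> 1))) = (1 \<otimes> T i m) * R"
proof -
  have "(\<Sum>j<n. (Z m j \<otimes> 1) * (R * (U i j \<otimes> 1))) = (\<Sum>j<n. \<Sum>k<n. ((Z m j * U k j) \<otimes> T i k) * R)"
    by (intro sum.cong refl)
      (simp add: R sum_distrib_left sum_distrib_right mult.assoc[symmetric] tensor_op_mult)
  also have "\<dots> = (\<Sum>k<n. ((\<Sum>j<n. Z m j * U k j) \<otimes> T i k) * R)"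
    by (subst sum.swap) (simp add: tensor_op_sum_left sum_distrib_right)
  also have "\<dots> = (\<Sum>k<n. if m = k then (1 \<otimes> T i k) * R else 0)" by (intro sum.cong refl) (simp add: Z)
  finally show ?thesis using m by simp
qed

lemma slice_left_twist:
  assumes "nfun w"
  shows "nfun (\<lambda>x. w (\<Sum>j\<in>J. P j * x * Q j))"
    "slice_left (\<lambda>x. w (\<Sum>j\<in>J. P j * x * Q j)) X = slice_left w (\<Sum>j\<in>J. (P j \<otimes> 1) * (X * (Q j \<otimes> 1)))"
proof -
  have "nfun (\<lambda>x. \<Sum>j\<in>J. w (P j * x * Q j))" by (rule normal_sum) (rule normal_mult[OF assms])
  then show n: "nfun (\<lambda>x. w (\<Sum>j\<in>J. P j * x * Q j))" by (simp add: normal_linear(6)[OF assms])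
  show "slice_left (\<lambda>x. w (\<Sum>j\<in>J. P j * x * Q j)) X = slice_left w (\<Sum>j\<in>J. (P j \<otimes> 1) * (X * (Q j \<otimes> 1)))"
    by (rule slice_left_eqI[OF n]) (simp add: cinner_slice_left[OF assms] vsr_sum vsr_mult_out mult.assoc)
qed

lemma leg_sum: "leg12 (sum f F) = (\<Sum>k\<in>F. leg12 (f k))" "leg13 (sum g F) = (\<Sum>k\<in>F. leg13 (g k))"
proof -
  have z: "leg12 0 = 0" and a: "leg12 (x + y) = leg12 x + leg12 y" for x y unfolding leg12_def assoc_op_def
    by (simp_all add: relabel_algebra[OF bij_assoc] tensor_op_add_left)
  show "leg12 (sum f F) = (\<Sum>k\<in>F. leg12 (f k))" by (induction F rule: infinite_finite_induct) (simp_all add: z a)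
  show "leg13 (sum g F) = (\<Sum>k\<in>F. leg13 (g k))"
  proof (induction F rule: infinite_finite_induct)
    case (insert k F) then show ?case by (simp add: leg13_def a relabel_algebra[OF bij_swap23])
  qed (simp_all add: leg13_def z relabel_algebra[OF bij_swap23])
qed

section \<open>Lifting corepresentations\<close>

context universal_pair
begin

abbreviation "MA \<equiv> multipliers A"
abbreviation "MB \<equiv> multipliers B"
abbreviation "Vr \<equiv> V * (r \<otimes> 1)"

lemma MB_commute:
  assumes m: "m \<in> MB" and y: "\<And>b. b \<in> B ==> b * y = y * b" shows "m * y = y * m"
proof (rule cstar_cancel_right[OF cstar_B])
  fix b assume b: "b \<in> B"
  have "m * y * b = (m * b) * y" using y[OF b] by (simp add: mult.assoc)
  also have "\<dots> = y * m * b" using y[OF multipliersD(1)[OF m b]] by (simp add: mult.assoc)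
  finally show "m * y * b = y * m * b" .
qed

lemma MB_M: "m \<in> MB ==> m \<in> M"
proof (rule memM)
  fix y assume m: "m \<in> MB" and y: "y \<in> commutant M"
  show "m * y = y * m" by (rule MB_commute[OF m]) (use commutantD[OF y] B_in_M in auto)
qed

lemma MB_r: "m \<in> MB ==> m * r = r * m" by (rule MB_commute[OF _ r_commutes_B])

lemma MB_r_tensor: "m \<in> MB ==> (m \<otimes> x) * (r \<otimes> 1) = (r \<otimes> 1) * (m \<otimes> x)" by (simp add: tensor_op_mult MB_r)

lemma V_r: "(r \<otimes> 1) * V = Vr" by (simp add: V_left[OF r(4)])

lemma Vr_r: "Vr * (r \<otimes> 1) = Vr" "(r \<otimes> 1) * Vr = Vr"
proof -
  show 1: "Vr * (r \<otimes> 1) = Vr" by (simp add: mult.assoc tensor_op_mult r(1))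
  have "(r \<otimes> 1) * Vr = Vr * (r \<otimes> 1)" by (simp only: mult.assoc[symmetric] V_r)
  then show "(r \<otimes> 1) * Vr = Vr" by (simp only: 1)
qed

text \<open>Multipliers of \<open>C0 W\<close> lie in M, where \<Delta> is multiplicative, so
  \<Delta> m solves the equation that determines the strict extension.\<close>

lemma comult_MB: "m \<in> MB ==> multiplier_comult B \<Delta> m = \<Delta> m" unfolding multiplier_comult_def
  by (rule de.ext_eqI) (use B_in_M in \<open>auto simp: homD(2)[OF D_hom MB_M]\<close>)

lemma B_cancel: assumes "\<And>w. w \<in> Lr ==> X * lam w = X' * lam w" shows "X = X'"
proof (rule cstar_cancel_right[OF cstar_B])
  fix b assume "b \<in> B"
  have "closed {b. X * b = X' * b}" by (rule closed_linear_eq) (rule linear_mult_op)+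
  then have "closure (lam ` Lr) \<subseteq> {b. X * b = X' * b}" using assms by (intro closure_minimal) auto
  then show "X * b = X' * b" using \<open>b \<in> B\<close> lam_dense by blast
qed

lemma A_cancel: assumes "\<And>w. w \<in> Lr ==> X * L w = X' * L w" shows "X = X'"
proof (rule cstar_cancel_right[OF cstar_A])
  fix a assume "a \<in> A"
  have "closed {a. X * a = X' * a}" by (rule closed_linear_eq) (rule linear_mult_op)+
  then have "closure (L ` Lr) \<subseteq> {a. X * a = X' * a}" using assms by (intro closure_minimal) auto
  then show "X * a = X' * a" using \<open>a \<in> A\<close> L_Lr_dense by blast
qed

text \<open>X * L w is at first only a multiplier, so X is tested on products of two elements of A,
  which span a dense subspace.\<close>

lemma left_multiplierI:
  assumes X: "\<And>w. w \<in> Lr ==> X * L w \<in> MA" and a: "a \<in> A" shows "X * a \<in> A"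
proof -
  have *: "X * x * y \<in> A" if "x \<in> A" "y \<in> A" for x y
  proof -
    have "bounded_linear (\<lambda>x. X * x * y)" by (intro bounded_linear_compose[OF linear_mult_op(2)] linear_mult_op(1))
    then have "closed {x. X * x * y \<in> A}" by (rule closed_vimage[OF _ Ac])
    then have "closure (L ` Lr) \<subseteq> {x. X * x * y \<in> A}" using multipliersD(1)[OF X that(2)] by (intro closure_minimal) auto
    then show ?thesis using that(1) L_Lr_dense by blast
  qed
  have "a \<in> closure (cspan {x * y | x y. x \<in> A \<and> y \<in> A})" by (rule cstar_mult_dense[OF As a])
  then show ?thesis
  proof (induction a rule: closure_cspan_induct)
    case closed show ?case by (rule closed_vimage[OF linear_mult_op(1) Ac])
  next
    case (base c x)
    then obtain y z where "x = y * z" "y \<in> A" "z \<in> A" by blast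
    then show ?case using *[of y z] by (simp add: scaleC_mult_right subalgD(5)[OF As] mult.assoc)
  qed (simp_all add: subalgD[OF As] distrib_left)
qed

lemma slice_left_r: "rsup w ==> slice_left w (X * (r \<otimes> 1)) = slice_left w X"
  by (rule slice_left_eqI) (simp_all add: rsupD cinner_slice_left vsr_mult_out)

text \<open>For Z inverse to the transpose of U and any T related to U by R, the slice of R by this
  functional is T_im times the slice by w. The definition does not involve T, which is how T is
  found.\<close>

definition twist :: "nat => (nat => nat => 'i op) => (nat => nat => 'i op) => nat => nat => ('i op => complex) => 'i op => complex" where
  "twist n Z U i m w x = w (\<Sum>j<n. Z m j * x * U i j)"

lemma twist_rsup:
  assumes "rsup w" "\<And>j. j < n ==> U i j \<in> MB" shows "rsup (twist n Z U i m w)"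
proof -
  have "(\<Sum>j<n. Z m j * (x * r) * U i j) = (\<Sum>j<n. Z m j * x * U i j) * r" for x by (simp add: sum_distrib_right mult.assoc MB_r assms(2))
  then show ?thesis
    using slice_left_twist(1)[OF rsupD(1)[OF assms(1)], of "Z m" "U i" "{..<n}"] by (simp add: rsup_def twist_def[abs_def] rsupD(2)[OF assms(1)])
qed

lemma slice_twist:
  "rsup w ==> slice_left (twist n Z U i m w) X = slice_left w (\<Sum>j<n. (Z m j \<otimes> 1) * (X * (U i j \<otimes> 1)))"
  unfolding twist_def[abs_def] by (rule slice_left_twist(2)[OF rsupD(1)])

text \<open>R is left open: the relation is used for S with T = U, for V under r, and for leg13 V *
  leg12 V under r, whose slices give the comultiplication.\<close>

definition intertwines :: "nat => (nat => nat => 'i op) => (nat => nat => 'm op) => ('i \<times> 'm) op => bool" where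
  "intertwines n U T R \<longleftrightarrow> (\<forall>i<n. \<forall>j<n. R * (U i j \<otimes> 1) = (\<Sum>k<n. U k j \<otimes> T i k) * R)"

lemma slice_twist_intertwines:
  assumes w: "rsup w" and F: "intertwines n U T R" and im: "i < n" "m < n"
    and Z: "\<And>k. k < n ==> (\<Sum>j<n. Z m j * U k j) = delta m k"
  shows "slice_left (twist n Z U i m w) R = T i m * slice_left w R" unfolding slice_twist[OF w] using matrix_slide[of n R U i T Z m] F im Z
  by (simp add: intertwines_def slice_left_algebra(5)[OF rsupD(1)[OF w]])

text \<open>Conjugation by S implements the flipped comultiplication, so the first relation is the
  corepresentation identity for U, and its adjoint is the second.\<close>

lemma intertwines_S:
  assumes U: "\<And>i j. i < n ==> j < n ==> U i j \<in> MB"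
    and D: "\<And>i j. i < n ==> j < n ==> \<Delta> (U i j) = (\<Sum>k<n. U i k \<otimes> U k j)"
  shows "intertwines n U U S" "intertwines n (\<lambda>i j. adj (U i j)) (\<lambda>i j. adj (U i j)) S"
proof -
  have *: "S * (U i j \<otimes> 1) * adj S = (\<Sum>k<n. U k j \<otimes> U i k)" if "i < n" "j < n" for i j
  proof -
    have "flip_op (\<Sum>k<n. U i k \<otimes> U k j) = (\<Sum>k<n. U k j \<otimes> U i k)"
      by (simp add: linear_sum[OF bounded_linear.linear[OF bounded_linear_flip]] flip_tensor)
    then show ?thesis using D_S[OF MB_M[OF U[OF that]]] by (simp only: D[OF that])
  qed
  have "S * (U i j \<otimes> 1) * adj S * S = (\<Sum>k<n. U k j \<otimes> U i k) * S" if "i < n" "j < n" for i j using *[OF that] by simp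
  then show "intertwines n U U S" by (simp add: intertwines_def mult.assoc S_unitary)
  have "S * (adj (U i j) \<otimes> 1) * adj S = (\<Sum>k<n. adj (U k j) \<otimes> adj (U i k))" if "i < n" "j < n" for i j
    using arg_cong[OF *[OF that], of adj] by (simp add: adj_mult adj_tensor adj_sum mult.assoc)
  then have "S * (adj (U i j) \<otimes> 1) * adj S * S = (\<Sum>k<n. adj (U k j) \<otimes> adj (U i k)) * S" if "i < n" "j < n" for i j using that by simp
  then show "intertwines n (\<lambda>i j. adj (U i j)) (\<lambda>i j. adj (U i j)) S" by (simp add: intertwines_def mult.assoc S_unitary)
qed

lemma Lr_partner: "w \<in> Lr ==> \<exists>w'\<in>Lr. partner w w'"
proof -
  assume w: "w \<in> Lr"
  then obtain w' where p: "partner w w'" using LnE[OF LrD(1)] by blast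
  have "(\<lambda>x. w (x * r)) = w" using LrD(2)[OF w] by auto
  then have "partner w (\<lambda>x. w' (x * r))" using restrict_Lr(1)[OF p] by simp
  then show ?thesis using restrict_Lr(2)[OF partner_sym[OF p]] by blast
qed

text \<open>For the matrix T to be found this says adj(L b) (T_im L w) = adj(adj T_im L b) L w,
  before T is available. The twisted functionals have no known partners, but their convolutions with
  partners of b and w have adjoint \<open>lam\<close>, hence are partners of each other, and
  \<open>L\<close> respects the involution.\<close>

lemma lift_adjoint:
  assumes U: "\<And>i j. i < n ==> j < n ==> U i j \<in> MB"
    and D: "\<And>i j. i < n ==> j < n ==> \<Delta> (U i j) = (\<Sum>k<n. U i k \<otimes> U k j)"
    and Z: "\<And>m k. m < n ==> k < n ==> (\<Sum>j<n. Z m j * U k j) = delta m k"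
    and Y: "\<And>i j. i < n ==> j < n ==> (\<Sum>k<n. U i k * Y k j) = delta i j"
    and im: "i < n" "m < n" and b: "b \<in> Lr" and w: "w \<in> Lr"
  shows "adj (L b) * slice_left (twist n Z U i m w) V =
    adj (slice_left (twist n (\<lambda>m j. adj (Y j m)) (\<lambda>i j. adj (U i j)) i m b) V) * L w"
proof -
  let ?U = "\<lambda>i j. adj (U i j)" and ?Z = "\<lambda>m j. adj (Y j m)"
  let ?w = "twist n Z U i m w" and ?b = "twist n ?Z ?U i m b"
  obtain p where p: "p \<in> Lr" "partner b p" using Lr_partner[OF b] by blast
  obtain v where v: "v \<in> Lr" "partner w v" using Lr_partner[OF w] by blast
  have rw: "rsup ?w" and rb: "rsup ?b" by (rule twist_rsup[OF Lr_rsup]; use w b U im subalgD(4)[OF la.MB(1)] in simp)+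
  have Zs: "(\<Sum>j<n. ?Z m j * ?U k j) = delta m k" if "k < n" for k using arg_cong[OF Y[OF that im(2)], of adj] by (simp add: adj_sum adj_mult)
  have lw: "lam ?w = U i m * lam w" by (rule slice_twist_intertwines[OF Lr_rsup[OF w] intertwines_S(1)[OF U D] im]) (simp_all add: Z im)
  have lb: "lam ?b = adj (U i m) * lam b" by (rule slice_twist_intertwines[OF Lr_rsup[OF b] intertwines_S(2)[OF U D] im]) (simp_all add: Zs)
  have "partner (conv p ?w) (conv v ?b)" using p v partner_sym[OF p(2)] unfolding partner_def
    by (simp add: conv_normal rsupD(1)[OF rw] rsupD(1)[OF rb] lam_conv lw lb adj_mult mult.assoc)
  from L_star[OF this] LnI[OF this] LnI[OF partner_sym[OF this]]
  have "slice_left (conv v ?b) V = adj (slice_left (conv p ?w) V)" by (simp only: slice_V)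
  then have "L v * slice_left ?b V = adj (L p * slice_left ?w V)"
    by (simp only: slice_V_conv[OF Lr_rsup[OF v(1)] rb] slice_V_conv[OF Lr_rsup[OF p(1)] rw] slice_V[OF LrD(1)] v(1) p(1))
  moreover have "L v = adj (L w)" "L p = adj (L b)" by (rule L_star[OF v(2)], rule L_star[OF p(2)])
  ultimately have "adj (adj (L w) * slice_left ?b V) = adj (adj (adj (L b) * slice_left ?w V))" by simp
  then show ?thesis by (simp add: adj_mult)
qed

lemma ex_r_vector: obtains u where "r \<cdot> u = u" "cinner u u \<noteq> 0"
proof -
  obtain y where "r \<cdot> y \<noteq> 0" using r_nonzero op_eqI[of r 0] by force
  then show ?thesis by (intro that[of "r \<cdot> y"]) (simp_all add: op_apply_mult[symmetric] r(1) cinner_norm del: op_apply_mult)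
qed

lemma lift_entry:
  assumes U: "\<And>i j. i < n ==> j < n ==> U i j \<in> MB"
    and D: "\<And>i j. i < n ==> j < n ==> \<Delta> (U i j) = (\<Sum>k<n. U i k \<otimes> U k j)"
    and Z: "\<And>m k. m < n ==> k < n ==> (\<Sum>j<n. Z m j * U k j) = delta m k"
    and Y: "\<And>i j. i < n ==> j < n ==> (\<Sum>k<n. U i k * Y k j) = delta i j"
    and im: "i < n" "m < n"
  shows "\<exists>z\<in>MA. (\<Sum>j<n. (Z m j \<otimes> 1) * (V * (U i j \<otimes> 1))) * (r \<otimes> 1) = (1 \<otimes> z) * Vr"
proof -
  define E where "E = (\<Sum>j<n. (Z m j \<otimes> 1) * (V * (U i j \<otimes> 1)))"
  \<comment> \<open>Multiplication by adj V turns the equation to be solved into G = r \<otimes> z.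
    That G has this form is seen after multiplying by 1 \<otimes> adj (L b), where
    \<open>lift_adjoint\<close> applies.\<close>
  define G where "G = E * (r \<otimes> 1) * adj V"
  define h where "h b = slice_left (twist n (\<lambda>m j. adj (Y j m)) (\<lambda>i j. adj (U i j)) i m b) V" for b
  have sE: "slice_left w E = slice_left (twist n Z U i m w) V" if "w \<in> Lr" for w
    unfolding E_def by (rule slice_twist[OF Lr_rsup[OF that], symmetric])
  have bE: "(1 \<otimes> adj (L b)) * G = r \<otimes> adj (h b)" if b: "b \<in> Lr" for b
  proof -
    have "((1 \<otimes> adj (L b)) * E - (1 \<otimes> adj (h b)) * V) * (r \<otimes> 1) = 0"
    proof (rule Lr_slice_separates)
      fix w assume w: "w \<in> Lr"
      show "slice_left w ((1 \<otimes> adj (L b)) * E - (1 \<otimes> adj (h b)) * V) = 0" using lift_adjoint[OF U D Z Y im b w]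
        by (simp only: slice_left_algebra[OF LrD(3)[OF w]] sE[OF w] slice_V[OF LrD(1)[OF w]] h_def) simp
    qed
    then have "(1 \<otimes> adj (L b)) * E * (r \<otimes> 1) * adj V = (1 \<otimes> adj (h b)) * V * (r \<otimes> 1) * adj V"
      by (simp add: left_diff_distrib)
    also have "\<dots> = (1 \<otimes> adj (h b)) * ((r \<otimes> 1) * (V * adj V))" using V_r by (simp add: mult.assoc[symmetric])
    also have "\<dots> = r \<otimes> adj (h b)" by (simp add: V_unitary tensor_op_mult)
    finally show ?thesis by (simp add: G_def mult.assoc)
  qed
  obtain u where u0: "r \<cdot> u = u" "cinner u u \<noteq> 0" by (rule ex_r_vector)
  define c where "c = cinner u u"
  note u = u0[folded c_def]
  \<comment> \<open>Slicing by a vector u in the range of r, divided by its squared length c, sends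
    r \<otimes> z to z.\<close>
  define z where "z = (1 / c) *C vsl u u G"
  have bz: "adj (L b) * z = adj (h b)" if "b \<in> Lr" for b
  proof -
    have "adj (L b) * vsl u u G = vsl u u ((1 \<otimes> adj (L b)) * G)" by (simp add: vsl_mult_out)
    also have "\<dots> = c *C adj (h b)" by (simp add: bE[OF that] vsl_tensor u c_def)
    finally show ?thesis using u(2) by (simp add: z_def scaleC_mult_right scaleC_scaleC scaleC_one)
  qed
  have Gz: "G = r \<otimes> z"
  proof (rule op_vsl_eqI)
    fix p q
    have "adj (vsl p q G) = adj (vsl p q (r \<otimes> z))"
    proof (rule A_cancel)
      fix b assume b: "b \<in> Lr"
      have "adj (L b) * vsl p q G = vsl p q ((1 \<otimes> adj (L b)) * G)" by (simp add: vsl_mult_out)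
      also have "\<dots> = adj (L b) * vsl p q (r \<otimes> z)" by (simp add: bE[OF b] vsl_tensor bz[OF b] scaleC_mult_right)
      finally have "adj (adj (L b) * vsl p q G) = adj (adj (L b) * vsl p q (r \<otimes> z))" by (simp only:)
      then show "adj (vsl p q G) * L b = adj (vsl p q (r \<otimes> z)) * L b" by (simp only: adj_mult adj_adj)
    qed
    from arg_cong[OF this, of adj] show "vsl p q G = vsl p q (r \<otimes> z)" by simp
  qed
  have "G * V = (1 \<otimes> z) * ((r \<otimes> 1) * V)" by (simp add: Gz mult.assoc[symmetric] tensor_op_mult)
  then have Ez: "E * (r \<otimes> 1) = (1 \<otimes> z) * Vr" by (simp add: V_r G_def mult.assoc V_unitary)
  have "z * a \<in> A" if a: "a \<in> A" for a
  proof (rule left_multiplierI[OF _ a])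
    fix w assume w: "w \<in> Lr"
    have "z * L w = slice_left w ((1 \<otimes> z) * Vr)"
      by (simp add: slice_left_algebra(5)[OF LrD(3)[OF w]] slice_left_r[OF Lr_rsup[OF w]] slice_V[OF LrD(1)[OF w]])
    also have "\<dots> = slice_left (twist n Z U i m w) V" unfolding Ez[symmetric] by (simp add: slice_left_r[OF Lr_rsup[OF w]] sE[OF w])
    finally have "z * L w = slice_left (twist n Z U i m w) V" .
    moreover have "rsup (twist n Z U i m w)" by (rule twist_rsup[OF Lr_rsup[OF w]]) (simp add: U im)
    ultimately show "z * L w \<in> MA" using slice_V_multiplier[OF rsupD(1)] by simp
  qed
  \<comment> \<open>The adjoint goes through the twist of the adjoint matrix, whose coefficients
    come from the inverse Y of U, as z itself went through the twist by Z.\<close>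
  moreover have "adj z * a \<in> A" if a: "a \<in> A" for a
  proof (rule left_multiplierI[OF _ a])
    fix b assume b: "b \<in> Lr"
    have "rsup (twist n (\<lambda>m j. adj (Y j m)) (\<lambda>i j. adj (U i j)) i m b)"
      by (rule twist_rsup[OF Lr_rsup[OF b]]) (simp add: subalgD(4)[OF la.MB(1)] U im)
    moreover have "adj z * L b = h b" using arg_cong[OF bz[OF b], of adj] by (simp add: adj_mult)
    ultimately show "adj z * L b \<in> MA" using slice_V_multiplier[OF rsupD(1)] by (simp add: h_def)
  qed
  then have "a * z \<in> A" if "a \<in> A" for a using subalgD(4)[OF As, of "adj z * adj a"] subalgD(4)[OF As that] by (simp add: adj_mult)
  ultimately have "z \<in> MA" by (simp add: multipliers_def)
  then show ?thesis using Ez unfolding E_def by blast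
qed

text \<open>The entries solve the relation after multiplication by Z; multiplying back uses that Z
  inverts the transpose on the other side too.\<close>

lemma ex_lift:
  assumes U: "\<And>i j. i < n ==> j < n ==> U i j \<in> MB"
    and D: "\<And>i j. i < n ==> j < n ==> \<Delta> (U i j) = (\<Sum>k<n. U i k \<otimes> U k j)"
    and Z: "\<And>m k. m < n ==> k < n ==> (\<Sum>j<n. Z m j * U k j) = delta m k"
    and Z': "\<And>i j. i < n ==> j < n ==> (\<Sum>m<n. U m i * Z m j) = delta i j"
    and Y: "\<And>i j. i < n ==> j < n ==> (\<Sum>k<n. U i k * Y k j) = delta i j"
  shows "\<exists>T. (\<forall>i<n. \<forall>m<n. T i m \<in> MA) \<and> intertwines n U T Vr"
proof -
  define P where "P i m z \<longleftrightarrow> z \<in> MA \<and> (\<Sum>j<n. (Z m j \<otimes> 1) * (V * (U i j \<otimes> 1))) * (r \<otimes> 1) = (1 \<otimes> z) * Vr" for i m z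
  define T where "T i m = (SOME z. P i m z)" for i m
  have PT: "P i m (T i m)" if im: "i < n" "m < n" for i m
  proof -
    obtain z where "P i m z" using lift_entry[OF U D Z Y im] unfolding P_def by blast
    then show ?thesis unfolding T_def by (rule someI)
  qed
  then have T: "\<And>i m. i < n ==> m < n ==> T i m \<in> MA"
    "\<And>i m. i < n ==> m < n ==> (\<Sum>j<n. (Z m j \<otimes> 1) * (V * (U i j \<otimes> 1))) * (r \<otimes> 1) = (1 \<otimes> T i m) * Vr"
    by (simp_all add: P_def)
  have "Vr * (U i j \<otimes> 1) = (\<Sum>m<n. U m j \<otimes> T i m) * Vr" if ij: "i < n" "j < n" for i j
  proof -
    define X where "X j = V * (U i j \<otimes> 1) * (r \<otimes> 1)" for j
    have "(\<Sum>m<n. U m j \<otimes> T i m) * Vr = (\<Sum>m<n. (U m j \<otimes> 1) * ((1 \<otimes> T i m) * Vr))"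
      by (simp add: sum_distrib_right mult.assoc[symmetric] tensor_op_mult)
    also have "\<dots> = (\<Sum>m<n. \<Sum>k<n. ((U m j * Z m k) \<otimes> 1) * X k)"
    proof (rule sum.cong[OF refl])
      fix m assume "m \<in> {..<n}"
      then have "m < n" by simp
      show "(U m j \<otimes> 1) * ((1 \<otimes> T i m) * Vr) = (\<Sum>k<n. ((U m j * Z m k) \<otimes> 1) * X k)"
        unfolding T(2)[OF ij(1) \<open>m < n\<close>, symmetric]
        by (simp add: sum_distrib_left sum_distrib_right X_def mult.assoc[symmetric] tensor_op_mult)
    qed
    also have "\<dots> = (\<Sum>k<n. ((\<Sum>m<n. U m j * Z m k) \<otimes> 1) * X k)"
      by (subst sum.swap) (simp add: tensor_op_sum_left sum_distrib_right)
    also have "\<dots> = (\<Sum>k<n. if j = k then X k else 0)" using ij by (intro sum.cong refl) (simp add: Z')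
    also have "\<dots> = X j" using ij by simp
    also have "\<dots> = Vr * (U i j \<otimes> 1)" by (simp add: X_def mult.assoc MB_r_tensor U ij)
    finally show ?thesis by simp
  qed
  then show ?thesis using T(1) unfolding intertwines_def by blast
qed

end

section \<open>Invertibility and comultiplication of the lift\<close>

lemma invertible_matrixD:
  "invertible_matrix B n T ==> \<exists>S. (\<forall>i j. i < n --> j < n --> T i j \<in> B \<and> S i j \<in> B) \<and>
    (\<forall>i j. i < n --> j < n --> (\<Sum>k<n. T i k * S k j) = delta i j \<and> (\<Sum>k<n. S i k * T k j) = delta i j)"
  by (auto simp: invertible_matrix_def)

lemma invertible_matrix_adj:
  assumes B: "star_subalgebra B" and T: "invertible_matrix B n T"
  shows "invertible_matrix B n (\<lambda>i j. adj (T j i))"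
proof -
  obtain S where S: "\<And>i j. i < n ==> j < n ==> T i j \<in> B \<and> S i j \<in> B"
    "\<And>i j. i < n ==> j < n ==> (\<Sum>k<n. T i k * S k j) = delta i j \<and> (\<Sum>k<n. S i k * T k j) = delta i j"
    using invertible_matrixD[OF T] by blast
  have "(\<Sum>k<n. adj (T k i) * adj (S j k)) = delta i j \<and> (\<Sum>k<n. adj (S k i) * adj (T j k)) = delta i j" if "i < n" "j < n" for i j
    using arg_cong[OF S(2)[OF that(2,1), THEN conjunct1], of adj] arg_cong[OF S(2)[OF that(2,1), THEN conjunct2], of adj]
    by (auto simp: adj_sum adj_mult)
  then show ?thesis unfolding invertible_matrix_def using S(1) subalgD(4)[OF B] by (intro conjI exI[of _ "\<lambda>i j. adj (S j i)"]) auto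
qed

text \<open>If \<open>b = t a\<close> for matrices with \<open>a\<close> and \<open>b\<close> invertible, then \<open>a b\<^sup>-\<^sup>1\<close> is an inverse of \<open>t\<close>; everything
  holds under the projection \<open>\<rho>\<close>.\<close>
lemma block_inverse:
  fixes t a a' b b' :: "nat => nat => 'a op"
  assumes a: "\<And>i j. i < n ==> j < n ==> (\<Sum>k<n. a i k * a' k j) = delta i j"
    and b: "\<And>i j. i < n ==> j < n ==> (\<Sum>k<n. b i k * b' k j) = delta i j"
      "\<And>i j. i < n ==> j < n ==> (\<Sum>k<n. b' i k * b k j) = delta i j"
    and \<rho>: "\<And>i j. i < n ==> j < n ==> a' i j * \<rho> = \<rho> * a' i j" "\<And>i j. i < n ==> j < n ==> b' i j * \<rho> = \<rho> * b' i j"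
    and rel: "\<And>i j. i < n ==> j < n ==> b i j * \<rho> = (\<Sum>k<n. t i k * a k j) * \<rho>" and ik: "i < n" "k < n"
  shows "(\<Sum>m<n. t i m * (\<Sum>j<n. a m j * b' j k)) * \<rho> = delta i k * \<rho>" "(\<Sum>m<n. (\<Sum>j<n. a i j * b' j m) * t m k) * \<rho> = delta i k * \<rho>"
proof -
  have swap: "(\<Sum>m<n. x m * (\<Sum>j<n. y m j * z j)) = (\<Sum>j<n. (\<Sum>m<n. x m * y m j) * z j)" for x z and y :: "nat => nat => 'a op"
    unfolding sum_distrib_left sum_distrib_right mult.assoc by (rule sum.swap)
  have move: "x * z * \<rho> = y * z * \<rho>" if "x * \<rho> = y * \<rho>" "z * \<rho> = \<rho> * z" for x y z
  proof -
    have "x * z * \<rho> = x * \<rho> * z" "y * \<rho> * z = y * z * \<rho>" by (simp_all only: mult.assoc that(2))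
    then show ?thesis by (simp only: that(1))
  qed
  have "(\<Sum>m<n. t i m * (\<Sum>j<n. a m j * b' j k)) * \<rho> = (\<Sum>j<n. b i j * b' j k) * \<rho>"
    unfolding swap sum_distrib_right[of "\<lambda>j. _ j * b' j k"] using ik by (intro sum.cong refl move) (simp_all only: rel \<rho> lessThan_iff)
  then show "(\<Sum>m<n. t i m * (\<Sum>j<n. a m j * b' j k)) * \<rho> = delta i k * \<rho>" by (simp only: b(1)[OF ik])
  have t: "(\<Sum>l<n. b m l * a' l k) * \<rho> = t m k * \<rho>" if "m < n" for m
  proof -
    have "(\<Sum>l<n. b m l * a' l k) * \<rho> = (\<Sum>l<n. (\<Sum>p<n. t m p * a p l) * a' l k) * \<rho>"
      unfolding sum_distrib_right[of "\<lambda>l. _ l * a' l k"] using ik that by (intro sum.cong refl move) (simp_all only: rel \<rho> lessThan_iff)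
    then show ?thesis unfolding swap[symmetric] using that ik by (simp add: a sum_delta_op)
  qed
  have "(\<Sum>m<n. (\<Sum>j<n. a i j * b' j m) * t m k) * \<rho> = (\<Sum>m<n. (\<Sum>j<n. a i j * b' j m) * (\<Sum>l<n. b m l * a' l k)) * \<rho>"
    unfolding sum_distrib_right[of _ _ \<rho>] by (intro sum.cong refl) (simp add: mult.assoc t)
  also have "\<dots> = (\<Sum>j<n. a i j * (\<Sum>m<n. b' j m * (\<Sum>l<n. b m l * a' l k))) * \<rho>" unfolding swap ..
  also have "\<dots> = (\<Sum>j<n. a i j * a' j k) * \<rho>"
  proof -
    have "(\<Sum>m<n. b' j m * (\<Sum>l<n. b m l * a' l k)) = a' j k" if "j < n" for j unfolding swap using that by (simp add: b sum_delta_op)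
    then show ?thesis by simp
  qed
  finally show "(\<Sum>m<n. (\<Sum>j<n. a i j * b' j m) * t m k) * \<rho> = delta i k * \<rho>" by (simp add: a ik)
qed

lemma leg13_commute: "leg13 X * (1 \<otimes> T \<otimes> 1) = (1 \<otimes> T \<otimes> 1) * leg13 X"
  by (rule op_vsl_eqI) (simp add: vsl_mult_out vsl_leg13 tensor_op_mult)

context universal_pair
begin

text \<open>V is unitary and commutes with r \<otimes> 1, so it can be moved to the other side. In
  conjugated form the relation is easy to take adjoints of and to invert.\<close>

lemma intertwines_Vr:
  assumes U: "\<And>i j. i < n ==> j < n ==> U i j \<in> MB"
  shows "intertwines n U T Vr \<longleftrightarrow>
    (\<forall>i<n. \<forall>j<n. V * (U i j \<otimes> 1) * adj V * (r \<otimes> 1) = (\<Sum>k<n. U k j \<otimes> T i k) * (r \<otimes> 1))"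
proof -
  have "Vr * (U i j \<otimes> 1) = Y * Vr \<longleftrightarrow> V * (U i j \<otimes> 1) * adj V * (r \<otimes> 1) = Y * (r \<otimes> 1)" if "i < n" "j < n" for i j Y
  proof -
    have 1: "Vr * (U i j \<otimes> 1) = V * (U i j \<otimes> 1) * adj V * (r \<otimes> 1) * V"
    proof -
      have "V * (U i j \<otimes> 1) * adj V * (r \<otimes> 1) * V = V * (U i j \<otimes> 1) * (adj V * V) * (r \<otimes> 1)"
        by (simp only: mult.assoc V_r)
      also have "\<dots> = V * ((U i j \<otimes> 1) * (r \<otimes> 1))" by (simp only: V_unitary mult_1_right mult.assoc)
      finally show ?thesis unfolding MB_r_tensor[OF U[OF that]] by (simp only: mult.assoc)
    qed
    have 2: "Y * Vr = Y * (r \<otimes> 1) * V" by (simp add: mult.assoc V_r)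
    have "P * V = Q * V \<longleftrightarrow> P = Q" for P Q by (metis V_unitary(2) mult.assoc mult_1_right)
    then show ?thesis unfolding 1 2 .
  qed
  then show ?thesis by (simp add: intertwines_def)
qed

lemma intertwines_adj:
  assumes U: "\<And>i j. i < n ==> j < n ==> U i j \<in> MB" and F: "intertwines n U T Vr"
  shows "intertwines n (\<lambda>i j. adj (U i j)) (\<lambda>i j. adj (T i j)) Vr"
proof -
  have U': "adj (U i j) \<in> MB" if "i < n" "j < n" for i j using subalgD(4)[OF la.MB(1) U[OF that]] .
  have rV: "(r \<otimes> 1) * adj V = adj V * (r \<otimes> 1)" by (simp only: adj_V_left[OF r(4)])
  have "V * (adj (U i j) \<otimes> 1) * adj V * (r \<otimes> 1) = (\<Sum>k<n. adj (U k j) \<otimes> adj (T i k)) * (r \<otimes> 1)" if ij: "i < n" "j < n" for i j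
  proof -
    have "V * (adj (U i j) \<otimes> 1) * adj V * (r \<otimes> 1) = V * ((adj (U i j) \<otimes> 1) * (r \<otimes> 1)) * adj V" by (simp only: mult.assoc rV)
    also have "\<dots> = (r \<otimes> 1) * V * (adj (U i j) \<otimes> 1) * adj V" unfolding MB_r_tensor[OF U'[OF ij]] by (simp only: mult.assoc[symmetric] V_r)
    also have "\<dots> = adj (V * (U i j \<otimes> 1) * adj V * (r \<otimes> 1))" by (simp add: adj_mult adj_tensor r(2) mult.assoc)
    also have "\<dots> = adj ((\<Sum>k<n. U k j \<otimes> T i k) * (r \<otimes> 1))" using F ij by (simp only: intertwines_Vr[OF U])
    also have "\<dots> = (\<Sum>k<n. (r \<otimes> 1) * (adj (U k j) \<otimes> adj (T i k)))" by (simp add: adj_mult adj_sum adj_tensor r(2) sum_distrib_left)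
    also have "\<dots> = (\<Sum>k<n. adj (U k j) \<otimes> adj (T i k)) * (r \<otimes> 1)"
      unfolding sum_distrib_right using ij by (intro sum.cong refl) (simp only: MB_r_tensor[OF U'] lessThan_iff)
    finally show ?thesis .
  qed
  then show ?thesis using intertwines_Vr[of n "\<lambda>i j. adj (U i j)"] U' by simp
qed

text \<open>\<open>comult_conjugation\<close> speaks of elements of A, so it is applied to T_ij d
  with d in A; the corepresentation identity splits off the factors T, and \<Lambda> c and \<Lambda>
  d are cancelled by non-degeneracy.\<close>

lemma intertwines_corep:
  assumes T: "\<And>i j. i < n ==> j < n ==> T i j \<in> MA"
    and D: "\<And>i j. i < n ==> j < n ==> du.ext (T i j) = (\<Sum>k<n. T i k \<otimes> T k j)"
  shows "intertwines n (\<lambda>i j. la.ext (T i j)) T Vr" unfolding intertwines_def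
proof (intro allI impI)
  fix i j assume ij: "i < n" "j < n"
  let ?U = "\<lambda>i j. la.ext (T i j)"
  let ?Y = "\<Sum>k<n. ?U k j \<otimes> T i k"
  have U: "?U i j \<in> MB" by (rule la.ext_mem[OF T[OF ij]])
  have "vsr p q (Vr * (?U i j \<otimes> 1)) = vsr p q (?Y * Vr)" for p q
  proof (rule la.f_cancel)
    fix d assume d: "d \<in> A"
    let ?X = "V * (\<Lambda> d \<otimes> 1) * adj V"
    have \<Lambda>d: "\<Lambda> d \<in> B" using d Lam_image by blast
    have x: "T i j * d \<in> A" by (rule multipliersD(1)[OF T[OF ij] d])
    have "V * ((?U i j * \<Lambda> d) \<otimes> 1) * adj V * (r \<otimes> 1) = ?Y * ?X * (r \<otimes> 1)"
    proof (rule op_vsr_eqI)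
      fix a b
      have "vsr a b (V * ((?U i j * \<Lambda> d) \<otimes> 1) * adj V) * r = vsr a b (?Y * ?X) * r"
      proof (rule la.f_cancel)
        fix c assume c: "c \<in> A"
        define y where "y k = vsl (adj (T i k) \<cdot> a) b (\<Delta>u d) * c" for k
        have yA: "y k \<in> A" for k unfolding y_def by (rule vsl_comult_mult[OF d c])
        have "vsl a b (\<Delta>u (T i j * d)) * c = (\<Sum>k<n. T k j * y k)"
        proof -
          have "\<Delta>u (T i j * d) = (\<Sum>k<n. (1 \<otimes> T k j) * ((T i k \<otimes> 1) * \<Delta>u d))"
            by (simp add: du.ext_apply[OF T[OF ij] d, symmetric] D ij sum_distrib_right mult.assoc[symmetric] tensor_op_mult)
          then show ?thesis by (simp add: vsl_sum vsl_mult_out vsl_mult_in sum_distrib_right y_def mult.assoc)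
        qed
        then have "\<Lambda> (vsl a b (\<Delta>u (T i j * d)) * c) * r = (\<Sum>k<n. \<Lambda> (T k j * y k)) * r"
          using star_hom_sum[OF As Lam_hom, of "{..<n}" "\<lambda>k. T k j * y k"] multipliersD(1)[OF T yA] ij by simp
        also have "\<dots> = (\<Sum>k<n. ?U k j * (\<Lambda> (y k) * r))"
          unfolding sum_distrib_right using ij by (intro sum.cong refl) (simp add: la.ext_apply[OF T yA, symmetric] mult.assoc)
        also have "\<dots> = (\<Sum>k<n. vsr a b ((?U k j \<otimes> 1) * ((1 \<otimes> T i k) * ?X)) * r * \<Lambda> c)"
          by (intro sum.cong refl) (simp only: y_def comult_conjugation[OF d c] vsr_mult_out vsr_mult_in mult.assoc)
        also have "\<dots> = vsr a b (?Y * ?X) * r * \<Lambda> c" by (simp add: vsr_sum sum_distrib_right mult.assoc[symmetric] tensor_op_mult)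
        finally show "vsr a b (V * ((?U i j * \<Lambda> d) \<otimes> 1) * adj V) * r * \<Lambda> c = vsr a b (?Y * ?X) * r * \<Lambda> c"
          unfolding comult_conjugation[OF x c] la.ext_apply[OF T[OF ij] d] by simp
      qed
      then show "vsr a b (V * ((?U i j * \<Lambda> d) \<otimes> 1) * adj V * (r \<otimes> 1)) = vsr a b (?Y * ?X * (r \<otimes> 1))"
        by (simp only: vsr_mult_out)
    qed
    then have *: "V * ((?U i j * \<Lambda> d) \<otimes> 1) * adj V * ((r \<otimes> 1) * V) = ?Y * V * (\<Lambda> d \<otimes> 1) * adj V * ((r \<otimes> 1) * V)"
      by (simp add: mult.assoc[symmetric])
    have e: "X * (m \<otimes> 1) * adj V * ((r \<otimes> 1) * V) = X * (r \<otimes> 1) * (m \<otimes> 1)" if "m \<in> MB" for m and X :: "('i \<times> 'j) op"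
      unfolding V_r by (simp add: mult.assoc MB_r_tensor[OF that, symmetric]) (simp add: mult.assoc[symmetric] V_unitary)
    have "Vr * ((?U i j * \<Lambda> d) \<otimes> 1) = ?Y * Vr * (\<Lambda> d \<otimes> 1)"
      using * e[of "?U i j * \<Lambda> d" V] e[of "\<Lambda> d" "?Y * V"] multipliers_superset[OF Bs] \<Lambda>d U
      by (simp add: subalgD(3)[OF la.MB(1)] subset_iff mult.assoc)
    then have "Vr * (?U i j \<otimes> 1) * (\<Lambda> d \<otimes> 1) = ?Y * Vr * (\<Lambda> d \<otimes> 1)" by (simp add: mult.assoc tensor_op_mult)
    from arg_cong[OF this, of "vsr p q"] show "vsr p q (Vr * (?U i j \<otimes> 1)) * \<Lambda> d = vsr p q (?Y * Vr) * \<Lambda> d"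
      by (simp only: vsr_mult_out)
  qed
  then show "Vr * (?U i j \<otimes> 1) = ?Y * Vr" by (rule op_vsr_eqI)
qed

text \<open>In conjugated form the relation factors the matrix of the c(U_ij), under r \<otimes> 1,
  as (1 \<otimes> T)(U \<otimes> 1). As c(U) and U are invertible, so is 1 \<otimes> T there;
  slicing away the first leg gives an inverse of T, and spectral permanence puts its entries into
  the multipliers.\<close>

lemma invertible_lift:
  assumes U: "invertible_matrix MB n U" and T: "\<And>i j. i < n ==> j < n ==> T i j \<in> MA" and F: "intertwines n U T Vr"
  shows "invertible_matrix MA n T"
proof -
  obtain Y where Y: "\<And>i j. i < n ==> j < n ==> U i j \<in> MB \<and> Y i j \<in> MB"
    "\<And>i j. i < n ==> j < n ==> (\<Sum>k<n. U i k * Y k j) = delta i j \<and> (\<Sum>k<n. Y i k * U k j) = delta i j"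
    using invertible_matrixD[OF U] by blast
  let ?\<rho> = "r \<otimes> (1 :: 'j op)"
  define c where "c X = V * (X \<otimes> 1) * adj V" for X
  have cm: "c X * c X' = c (X * X')" for X X'
  proof -
    have "c X * c X' = V * (X \<otimes> 1) * (adj V * V) * (X' \<otimes> 1) * adj V" by (simp only: c_def mult.assoc)
    then show ?thesis by (simp add: V_unitary c_def mult.assoc) (simp add: mult.assoc[symmetric] tensor_op_mult)
  qed
  have cs: "c (sum f {..<n}) = (\<Sum>k<n. c (f k))" for f by (simp add: c_def tensor_op_sum_left sum_distrib_left sum_distrib_right)
  have cd: "c (delta i j) = delta i j" for i j by (simp add: c_def V_unitary)
  have c\<rho>: "c X * ?\<rho> = ?\<rho> * c X" if "X \<in> MB" for X
  proof -
    have "c X * ?\<rho> = V * ((X \<otimes> 1) * ?\<rho>) * adj V" by (simp only: c_def mult.assoc adj_V_left[OF r(4)])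
    also have "\<dots> = ?\<rho> * c X" unfolding MB_r_tensor[OF that] c_def by (simp only: mult.assoc[symmetric] V_r)
    finally show ?thesis .
  qed
  let ?w = "\<lambda>m k. \<Sum>j<n. (U m j \<otimes> 1) * c (Y j k)"
  have rel: "c (U i j) * ?\<rho> = (\<Sum>k<n. (1 \<otimes> T i k) * (U k j \<otimes> 1)) * ?\<rho>" if "i < n" "j < n" for i j
    using F that Y(1) by (simp add: intertwines_Vr c_def tensor_op_mult)
  have w: "(\<Sum>m<n. (1 \<otimes> T i m) * ?w m k) * ?\<rho> = delta i k * ?\<rho>" "(\<Sum>m<n. ?w i m * (1 \<otimes> T m k)) * ?\<rho> = delta i k * ?\<rho>" if ik: "i < n" "k < n" for i k
  proof -
    have 1: "(\<Sum>k<n. (U i k \<otimes> 1) * (Y k j \<otimes> 1)) = delta i j" if "i < n" "j < n" for i j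
      using Y(2)[OF that] by (simp add: tensor_op_mult tensor_op_sum_left[symmetric])
    have 2: "(\<Sum>k<n. c (U i k) * c (Y k j)) = delta i j" "(\<Sum>k<n. c (Y i k) * c (U k j)) = delta i j" if "i < n" "j < n" for i j
      using Y(2)[OF that] by (simp_all only: cm cs[symmetric] cd)
    have 3: "(Y i j \<otimes> 1) * ?\<rho> = ?\<rho> * (Y i j \<otimes> 1)" "c (Y i j) * ?\<rho> = ?\<rho> * c (Y i j)" if "i < n" "j < n" for i j
      using Y(1)[OF that] by (simp_all only: MB_r_tensor c\<rho>)
    note bi = block_inverse[where a = "\<lambda>i j. U i j \<otimes> 1" and b = "\<lambda>i j. c (U i j)" and a' = "\<lambda>i j. Y i j \<otimes> 1" and b' = "\<lambda>i j. c (Y i j)"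
        and t = "\<lambda>i j. 1 \<otimes> T i j" and \<rho> = ?\<rho>, OF 1 2 3 rel ik]
    show "(\<Sum>m<n. (1 \<otimes> T i m) * ?w m k) * ?\<rho> = delta i k * ?\<rho>" by (rule bi(1))
    show "(\<Sum>m<n. ?w i m * (1 \<otimes> T m k)) * ?\<rho> = delta i k * ?\<rho>" by (rule bi(2))
  qed
  obtain u where u0: "r \<cdot> u = u" "cinner u u \<noteq> 0" by (rule ex_r_vector)
  define e where "e = cinner u u"
  note u = u0[folded e_def]
  \<comment> \<open>Slicing by a normalized vector in the range of r absorbs the factor r \<otimes>
    1 and pulls factors 1 \<otimes> T out on either side.\<close>
  define s where "s X = (1 / e) *C vsl u u X" for X :: "('i \<times> 'j) op"
  have s\<rho>: "s (X * ?\<rho>) = s X" for X by (simp add: s_def vsl_mult_in u)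
  have s1: "s (delta i k) = delta i k" for i k
    using u(2) vsl_tensor[of u u "1 :: 'i op" "1 :: 'j op"] by (simp add: s_def e_def scaleC_scaleC scaleC_one)
  have ss: "s (\<Sum>m<n. (1 \<otimes> T i m) * f m) = (\<Sum>m<n. T i m * s (f m))" "s (\<Sum>m<n. f m * (1 \<otimes> T m i)) = (\<Sum>m<n. s (f m) * T m i)" for f i
    by (simp_all add: s_def vsl_sum vsl_mult_out scaleC_sum_right scaleC_mult_right scaleC_mult_left)
  have TX: "(\<Sum>m<n. T i m * s (?w m k)) = delta i k" "(\<Sum>m<n. s (?w i m) * T m k) = delta i k" if ik: "i < n" "k < n" for i k
    using arg_cong[OF w(1)[OF ik], of s] arg_cong[OF w(2)[OF ik], of s] by (simp_all only: s\<rho> s1 ss)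
  have "s (?w i j) \<in> MA" if ij: "i < n" "j < n" for i j by (rule matrix_inverse_multipliers[OF As Ac T TX ij])
  then show ?thesis unfolding invertible_matrix_def using T TX by (intro conjI exI[of _ "\<lambda>i j. s (?w i j)"]) simp_all
qed

text \<open>U is passed through leg12 and then through leg13. The entry of T from the first passage
  sits on the middle leg and commutes with leg13; the second passage supplies the entry on the third
  leg.\<close>

lemma intertwines_VV:
  assumes F: "intertwines n U T Vr"
  shows "intertwines n U (\<lambda>i k. \<Sum>m<n. T i m \<otimes> T m k) (leg13 V * leg12 V * (r \<otimes> 1))"
proof -
  have l: "leg12 (m \<otimes> 1) = m \<otimes> 1" "leg13 (m \<otimes> 1) = m \<otimes> 1" for m :: "'i op" by (simp_all add: leg12_tensor_op leg13_tensor_op)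
  have VV: "leg13 V * leg12 V * (r \<otimes> 1) = leg13 Vr * leg12 Vr"
  proof -
    have "leg13 V * leg12 V * (r \<otimes> 1) = leg13 V * leg12 ((r \<otimes> 1) * Vr)" unfolding Vr_r(2) by (simp only: leg12_algebra l mult.assoc)
    also have "\<dots> = leg13 Vr * leg12 Vr" by (simp only: leg12_algebra(1)[of "r \<otimes> 1" Vr] leg13_algebra l mult.assoc)
    finally show ?thesis .
  qed
  have F': "Vr * (U i j \<otimes> 1) = (\<Sum>k<n. U k j \<otimes> T i k) * Vr" if "i < n" "j < n" for i j using F that by (simp add: intertwines_def)
  have "leg13 Vr * leg12 Vr * (U i j \<otimes> 1) = (\<Sum>k<n. U k j \<otimes> (\<Sum>m<n. T i m \<otimes> T m k)) * (leg13 Vr * leg12 Vr)" if ij: "i < n" "j < n" for i j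
  proof -
    have s: "leg12 (Vr * (m \<otimes> 1)) = leg12 Vr * (m \<otimes> 1)" "leg13 (Vr * (m \<otimes> 1)) = leg13 Vr * (m \<otimes> 1)" for m
      by (simp_all only: leg12_algebra(1)[of Vr] leg13_algebra(1)[of Vr] l)
    have "leg13 Vr * leg12 Vr * (U i j \<otimes> 1) = leg13 Vr * leg12 (Vr * (U i j \<otimes> 1))" unfolding s by (simp only: mult.assoc)
    also have "\<dots> = (\<Sum>m<n. leg13 Vr * (1 \<otimes> T i m \<otimes> 1) * (U m j \<otimes> 1) * leg12 Vr)"
      unfolding F'[OF ij] leg12_algebra(1)[of _ Vr] leg_sum leg12_tensor_op sum_distrib_left sum_distrib_right
      by (simp add: mult.assoc[symmetric] tensor_op_mult) (simp add: mult.assoc tensor_op_mult)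
    also have "\<dots> = (\<Sum>m<n. (1 \<otimes> T i m \<otimes> 1) * leg13 (Vr * (U m j \<otimes> 1)) * leg12 Vr)"
      unfolding s leg13_commute by (simp only: mult.assoc)
    also have "\<dots> = (\<Sum>m<n. \<Sum>k<n. (U k j \<otimes> T i m \<otimes> T m k) * (leg13 Vr * leg12 Vr))"
    proof (intro sum.cong refl)
      fix m assume "m \<in> {..<n}"
      then have m: "m < n" by simp
      show "(1 \<otimes> T i m \<otimes> 1) * leg13 (Vr * (U m j \<otimes> 1)) * leg12 Vr = (\<Sum>k<n. (U k j \<otimes> T i m \<otimes> T m k) * (leg13 Vr * leg12 Vr))"
        unfolding F'[OF m ij(2)] leg13_algebra(1)[of _ Vr] leg_sum leg13_tensor_op
        by (simp add: sum_distrib_left sum_distrib_right mult.assoc[symmetric] tensor_op_mult)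
    qed
    also have "\<dots> = (\<Sum>k<n. U k j \<otimes> (\<Sum>m<n. T i m \<otimes> T m k)) * (leg13 Vr * leg12 Vr)"
      by (subst sum.swap) (simp add: sum_distrib_right tensor_op_sum_right)
    finally show ?thesis .
  qed
  then show ?thesis unfolding VV by (simp add: intertwines_def)
qed

context
  fixes n U T Z
  assumes U: "\<And>i j. i < n ==> j < n ==> U i j \<in> MB" and F: "intertwines n U T Vr"
    and Z: "\<And>m k. m < n ==> k < n ==> (\<Sum>j<n. Z m j * U k j) = delta m k"
begin

lemma twist_lift: "w \<in> Lr ==> i < n ==> rsup (twist n Z U i m w)" by (rule twist_rsup[OF Lr_rsup]) (simp_all add: U)

lemma lift_L: "w \<in> Lr ==> i < n ==> m < n ==> slice_left (twist n Z U i m w) V = T i m * L w"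
  using slice_twist_intertwines[OF Lr_rsup F, of w i m Z] Z[of m]
  by (simp add: slice_left_r[OF twist_lift] slice_left_r[OF Lr_rsup] slice_V[OF LrD(1)])

text \<open>The twisted functional does not involve T. Its slice of V is T_im L w, its slice of S is
  U_im lam w, and \<open>Lam_slice\<close> relates the two.\<close>

lemma lift_Lam:
  assumes S: "intertwines n U U S" and im: "i < n" "m < n" and T: "T i m \<in> MA"
  shows "la.ext (T i m) = U i m"
proof (rule B_cancel, rule la.f_cancel)
  fix w c assume w: "w \<in> Lr" and c: "c \<in> A"
  have "la.ext (T i m) * lam w * \<Lambda> c = la.ext (T i m) * \<Lambda> (L w * c)"
    using w c by (simp add: homD(2)[OF Lam_hom] L_mem LrD(1) Lam_L mult.assoc)
  also have "\<dots> = \<Lambda> (slice_left (twist n Z U i m w) V * c)"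
    using w c by (simp add: la.ext_apply[OF T] subalgD(3)[OF As] L_mem LrD(1) lift_L im mult.assoc)
  also have "\<dots> = lam (twist n Z U i m w) * \<Lambda> c" by (rule Lam_slice[OF twist_lift[OF w im(1)] c])
  also have "lam (twist n Z U i m w) = U i m * lam w" by (rule slice_twist_intertwines[OF Lr_rsup[OF w] S im]) (simp add: Z im)
  finally show "la.ext (T i m) * lam w * \<Lambda> c = U i m * lam w * \<Lambda> c" .
qed

text \<open>The twisted functional is used against leg13 V * leg12 V, whose slices are \<Delta>u of
  the slices of V and which satisfies the relation with the product matrix.\<close>

lemma lift_comult:
  assumes im: "i < n" "m < n" and T: "T i m \<in> MA"
  shows "du.ext (T i m) = (\<Sum>k<n. T i k \<otimes> T k m)" (is "_ = ?X")
proof (rule du.f_cancel)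
  fix a assume a: "a \<in> A"
  have c: "continuous_on A (\<lambda>a. X * \<Delta>u a)" for X
    by (rule bounded_linear.continuous_on[OF linear_mult_op(1) star_hom_continuous[OF As Ac du.hom]])
  show "du.ext (T i m) * \<Delta>u a = ?X * \<Delta>u a"
  proof (rule continuous_on_agree[where S = "L ` Lr" and f = "\<lambda>a. du.ext (T i m) * \<Delta>u a"])
    fix y assume "y \<in> L ` Lr"
    then obtain w where w: "w \<in> Lr" "y = L w" by blast
    show "du.ext (T i m) * \<Delta>u y = ?X * \<Delta>u y"
    proof (rule du.f_cancel)
      fix b assume b: "b \<in> A"
      let ?R = "leg13 V * leg12 V * (r \<otimes> 1)"
      have "du.ext (T i m) * \<Delta>u y * \<Delta>u b = du.ext (T i m) * \<Delta>u (L w * b)"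
        using w b by (simp add: homD(2)[OF du.hom] L_mem LrD(1) mult.assoc)
      also have "\<dots> = \<Delta>u (slice_left (twist n Z U i m w) V * b)"
        using w b by (simp add: du.ext_apply[OF T] subalgD(3)[OF As] L_mem LrD(1) lift_L im mult.assoc)
      also have "\<dots> = slice_left (twist n Z U i m w) ?R * \<Delta>u b"
        by (simp only: comult_slice[OF twist_lift[OF w(1) im(1)] b] slice_left_r[OF twist_lift[OF w(1) im(1)]])
      also have "slice_left (twist n Z U i m w) ?R = ?X * slice_left w ?R"
        by (rule slice_twist_intertwines[OF Lr_rsup[OF w(1)] intertwines_VV[OF F] im]) (simp add: Z im)
      also have "slice_left w ?R = \<Delta>u y" by (simp only: slice_left_r[OF Lr_rsup[OF w(1)]] w comult_L[OF LrD(1)[OF w(1)]])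
      finally show "du.ext (T i m) * \<Delta>u y * \<Delta>u b = ?X * \<Delta>u y * \<Delta>u b" .
    qed
  qed (simp_all add: L_Lr_dense c a)
qed

text \<open>An element of the kernel annihilates all \<^term>\<open>L w\<close>, because functionals on \<open>N\<close> are determined by \<^term>\<open>lam\<close>.\<close>
lemma lift_injective:
  assumes S: "intertwines n U U S" and 0: "(\<Sum>i<n. \<Sum>j<n. c i j *C U i j) = 0"
  shows "(\<Sum>i<n. \<Sum>j<n. c i j *C T i j) = 0"
proof (rule A_cancel)
  fix w assume w: "w \<in> Lr"
  define g where "g x = (\<Sum>i<n. \<Sum>j<n. c i j * twist n Z U i j w x)" for x
  have n: "nfun (twist n Z U i j w)" if "i < n" for i j using rsupD(1)[OF twist_lift[OF w that]] .
  have g: "nfun g" unfolding g_def[abs_def] by (intro normal_sum normal_scaleC n) simp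
  have sl: "slice_left g X = (\<Sum>i<n. \<Sum>j<n. c i j *C slice_left (twist n Z U i j w) X)" for X :: "('i \<times> 'q) op"
    by (rule slice_left_eqI[OF g]) (simp add: g_def op_apply_sum_left cinner_sum_right op_simps cinner_simps cinner_slice_left n)
  have tw: "lam (twist n Z U i j w) = U i j * lam w" if "i < n" "j < n" for i j
    by (rule slice_twist_intertwines[OF Lr_rsup[OF w] S that]) (simp add: Z that)
  have "lam g = (\<Sum>i<n. \<Sum>j<n. c i j *C U i j) * lam w" by (simp add: sl tw sum_distrib_right scaleC_mult_left)
  then have "lam g = 0" by (simp add: 0)
  then have "g (vsr a b S) = 0" for a b using cinner_slice_left[OF g, of a S b] by simp
  then have "g y = 0" if "y \<in> N" for y using N_vanish[OF g _ that] by blast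
  then have "slice_left g V = 0" by (intro slice_left_eqI[OF g]) (simp add: vsr_V_mem)
  then show "(\<Sum>i<n. \<Sum>j<n. c i j *C T i j) * L w = 0 * L w" by (simp add: sl lift_L[OF w] sum_distrib_right scaleC_mult_left)
qed

end

end

section \<open>Almost periodic elements\<close>

text \<open>f is linear and injective on P only. Slicing the right leg produces sums in P, where
  injectivity removes the first f; slicing the left leg then removes the second.\<close>

lemma tensor_sum_injective:
  fixes f :: "'j op => 'i op" and x y :: "'a => 'j op" and x' y' :: "'b => 'j op"
  assumes P: "\<And>a b. a \<in> P ==> b \<in> P ==> a + b \<in> P" "\<And>a c. a \<in> P ==> c *C a \<in> P" "0 \<in> P"
    and f: "\<And>a b. a \<in> P ==> b \<in> P ==> f (a + b) = f a + f b" "\<And>a c. a \<in> P ==> f (c *C a) = c *C f a" "f 0 = 0" "inj_on f P"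
    and mem: "\<And>k. k \<in> F ==> x k \<in> P \<and> y k \<in> P" "\<And>k. k \<in> G ==> x' k \<in> P \<and> y' k \<in> P"
    and eq: "(\<Sum>k\<in>F. f (x k) \<otimes> f (y k)) = (\<Sum>k\<in>G. f (x' k) \<otimes> f (y' k))"
  shows "(\<Sum>k\<in>F. x k \<otimes> y k) = (\<Sum>k\<in>G. x' k \<otimes> y' k)"
proof -
  have sumP: "(\<Sum>k\<in>K. c k *C z k) \<in> P \<and> f (\<Sum>k\<in>K. c k *C z k) = (\<Sum>k\<in>K. c k *C f (z k))" if "\<And>k. k \<in> K ==> z k \<in> P" for K c and z :: "'k => 'j op"
    using that by (induction K rule: infinite_finite_induct) (simp_all add: P f)
  note inj = inj_onD[OF f(4)]
  have 1: "(\<Sum>k\<in>F. cinner a (f (y k) \<cdot> b) *C x k) = (\<Sum>k\<in>G. cinner a (f (y' k) \<cdot> b) *C x' k)" for a b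
    using arg_cong[OF eq, of "vsr a b"] mem by (intro inj) (simp_all add: sumP vsr_sum vsr_tensor)
  have 2: "(\<Sum>k\<in>F. cinner p (x k \<cdot> q) *C f (y k)) = (\<Sum>k\<in>G. cinner p (x' k \<cdot> q) *C f (y' k))" for p q
  proof (rule op_eqI_cinner)
    fix a b
    show "cinner a ((\<Sum>k\<in>F. cinner p (x k \<cdot> q) *C f (y k)) \<cdot> b) = cinner a ((\<Sum>k\<in>G. cinner p (x' k \<cdot> q) *C f (y' k)) \<cdot> b)"
      using arg_cong[OF 1[of a b], of "\<lambda>T. cinner p (T \<cdot> q)"]
      by (simp add: op_apply_sum_left cinner_sum_right op_simps cinner_simps mult.commute)
  qed
  show ?thesis
  proof (rule op_vsl_eqI)
    fix p q
    have "(\<Sum>k\<in>F. cinner p (x k \<cdot> q) *C y k) = (\<Sum>k\<in>G. cinner p (x' k \<cdot> q) *C y' k)"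
      using 2[of p q] mem by (intro inj) (simp_all add: sumP)
    then show "vsl p q (\<Sum>k\<in>F. x k \<otimes> y k) = vsl p q (\<Sum>k\<in>G. x' k \<otimes> y' k)" by (simp add: vsl_sum vsl_tensor)
  qed
qed

text \<open>Entries need not commute, so the inverse of the product matrix has its factors in
  reversed order, and the inner sum collapses first.\<close>

lemma invertible_matrix_product:
  fixes T S T' S' :: "nat => nat => 'a op"
  assumes TS: "\<And>i j. i < n ==> j < n ==> (\<Sum>k<n. T i k * S k j) = delta i j \<and> (\<Sum>k<n. S i k * T k j) = delta i j"
    "\<And>i j. i < m ==> j < m ==> (\<Sum>k<m. T' i k * S' k j) = delta i j \<and> (\<Sum>k<m. S' i k * T' k j) = delta i j"
    and ij: "i < n" "j < n" "k < m" "l < m"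
  shows "(\<Sum>p\<in>{..<n} \<times> {..<m}. (T i (fst p) * T' k (snd p)) * (S' (snd p) l * S (fst p) j)) = (if i = j \<and> k = l then 1 else 0)"
    "(\<Sum>p\<in>{..<n} \<times> {..<m}. (S' k (snd p) * S i (fst p)) * (T (fst p) j * T' (snd p) l)) = (if i = j \<and> k = l then 1 else 0)"
proof -
  have "(\<Sum>p\<in>{..<n} \<times> {..<m}. (T i (fst p) * T' k (snd p)) * (S' (snd p) l * S (fst p) j)) = (\<Sum>p<n. T i p * (\<Sum>q<m. T' k q * S' q l) * S p j)"
    by (simp add: sum.cartesian_product[symmetric] sum.cartesian_product' sum_distrib_left sum_distrib_right mult.assoc)
  then show "(\<Sum>p\<in>{..<n} \<times> {..<m}. (T i (fst p) * T' k (snd p)) * (S' (snd p) l * S (fst p) j)) = (if i = j \<and> k = l then 1 else 0)"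
    using TS ij by simp
  have "(\<Sum>p\<in>{..<n} \<times> {..<m}. (S' k (snd p) * S i (fst p)) * (T (fst p) j * T' (snd p) l)) = (\<Sum>q<m. \<Sum>p<n. S' k q * (S i p * T p j) * T' q l)"
    by (subst sum.swap) (simp add: sum.cartesian_product' mult.assoc)
  also have "\<dots> = (\<Sum>q<m. S' k q * (\<Sum>p<n. S i p * T p j) * T' q l)" by (simp add: sum_distrib_left sum_distrib_right)
  finally show "(\<Sum>p\<in>{..<n} \<times> {..<m}. (S' k (snd p) * S i (fst p)) * (T (fst p) j * T' (snd p) l)) = (if i = j \<and> k = l then 1 else 0)"
    using TS ij by simp
qed

lemma (in strict_hom) ext_lincomb:
  assumes "\<And>i j. i < n ==> j < n ==> T i j \<in> multipliers A"
  shows "ext (\<Sum>i<n. \<Sum>j<n. c i j *C T i j) = (\<Sum>i<n. \<Sum>j<n. c i j *C ext (T i j))"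
proof -
  have m: "c i j *C T i j \<in> multipliers A" if "i < n" "j < n" for i j using subalgD(5)[OF MA(1) assms[OF that]] .
  have "ext (\<Sum>i<n. \<Sum>j<n. c i j *C T i j) = (\<Sum>i<n. ext (\<Sum>j<n. c i j *C T i j))"
    by (rule ext_sum, rule subalg_sum[OF MA(1)]) (simp add: m)
  also have "\<dots> = (\<Sum>i<n. \<Sum>j<n. ext (c i j *C T i j))" by (intro sum.cong refl ext_sum) (simp add: m)
  also have "\<dots> = (\<Sum>i<n. \<Sum>j<n. c i j *C ext (T i j))" by (intro sum.cong refl ext_scaleC assms) simp_all
  finally show ?thesis .
qed

context universal_pair
begin

section \<open>The *-algebra of matrix elements\<close>

abbreviation "PA \<equiv> AP A \<Delta>u"
abbreviation "PB \<equiv> AP B \<Delta>"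
abbreviation "\<Phi> \<equiv> la.ext"

lemma APE: "x \<in> AP A' \<Delta>' ==> \<exists>n T c. admissible_corep A' \<Delta>' n T \<and> x = (\<Sum>i<n. \<Sum>j<n. c i j *C T i j)"
  and API: "admissible_corep A' \<Delta>' n T ==> (\<Sum>i<n. \<Sum>j<n. c i j *C T i j) \<in> AP A' \<Delta>'" unfolding AP_def by blast+

lemma admissible_iff:
  "admissible_corep A' \<Delta>' n T \<longleftrightarrow> invertible_matrix (multipliers A') n T \<and> invertible_matrix (multipliers A') n (\<lambda>i j. T j i) \<and>
    (\<forall>i<n. \<forall>j<n. strict_ext A' (A' \<otimes>\<^sub>m A') \<Delta>' (T i j) = (\<Sum>k<n. T i k \<otimes> T k j))"
  by (auto simp: admissible_corep_def invertible_corep_def multiplier_comult_def)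

lemma admissibleD:
  assumes "admissible_corep A' \<Delta>' n T" "i < n" "j < n"
  shows "T i j \<in> multipliers A'" "strict_ext A' (A' \<otimes>\<^sub>m A') \<Delta>' (T i j) = (\<Sum>k<n. T i k \<otimes> T k j)"
  using assms by (simp_all add: admissible_iff invertible_matrix_def)

lemma AP_indexI:
  fixes I :: "'x set" and T S R :: "'x => 'x => 'j op"
  assumes I: "finite I" and T: "\<And>i j. i \<in> I ==> j \<in> I ==> T i j \<in> MA \<and> S i j \<in> MA \<and> R i j \<in> MA"
    and D: "\<And>i j. i \<in> I ==> j \<in> I ==> du.ext (T i j) = (\<Sum>k\<in>I. T i k \<otimes> T k j)"
    and S: "\<And>i j. i \<in> I ==> j \<in> I ==> (\<Sum>k\<in>I. T i k * S k j) = (if i = j then 1 else 0) \<and> (\<Sum>k\<in>I. S i k * T k j) = (if i = j then 1 else 0)"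
    and R: "\<And>i j. i \<in> I ==> j \<in> I ==> (\<Sum>k\<in>I. T k i * R k j) = (if i = j then 1 else 0) \<and> (\<Sum>k\<in>I. R i k * T j k) = (if i = j then 1 else 0)"
  shows "(\<Sum>i\<in>I. \<Sum>j\<in>I. c i j *C T i j) \<in> PA"
proof -
  obtain e where e: "bij_betw e {..<card I} I" using ex_bij_betw_nat_finite[OF I] by (auto simp: atLeast0LessThan)
  note re = sum.reindex_bij_betw[OF e]
  have eI: "e i \<in> I" if "i < card I" for i using bij_betwE[OF e] that by simp
  have ee: "e i = e j \<longleftrightarrow> i = j" if "i < card I" "j < card I" for i j
    using bij_betw_imp_inj_on[OF e] that by (auto simp: inj_on_eq_iff)
  have inv: "invertible_matrix MA (card I) (\<lambda>i j. X (e i) (e j))"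
    if X: "\<And>i j. i \<in> I ==> j \<in> I ==> X i j \<in> MA \<and> Y i j \<in> MA"
      "\<And>i j. i \<in> I ==> j \<in> I ==> (\<Sum>k\<in>I. X i k * Y k j) = (if i = j then 1 else 0) \<and> (\<Sum>k\<in>I. Y i k * X k j) = (if i = j then 1 else 0)" for X Y
    unfolding invertible_matrix_def
  proof (intro conjI allI impI exI[of _ "\<lambda>i j. Y (e i) (e j)"])
    fix i j assume ij: "i < card I" "j < card I"
    show "(\<Sum>k<card I. X (e i) (e k) * Y (e k) (e j)) = delta i j" "(\<Sum>k<card I. Y (e i) (e k) * X (e k) (e j)) = delta i j"
      using X(2)[OF eI[OF ij(1)] eI[OF ij(2)]] re[of "\<lambda>k. X (e i) k * Y k (e j)"] re[of "\<lambda>k. Y (e i) k * X k (e j)"] by (simp_all add: ee ij)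
  qed (simp_all add: X eI)
  have "du.ext (T (e i) (e j)) = (\<Sum>k<card I. T (e i) (e k) \<otimes> T (e k) (e j))" if "i < card I" "j < card I" for i j
    using D[OF eI[OF that(1)] eI[OF that(2)]] re[of "\<lambda>k. T (e i) k \<otimes> T k (e j)"] by simp
  then have "admissible_corep A \<Delta>u (card I) (\<lambda>i j. T (e i) (e j))"
    using inv[of T S] inv[of "\<lambda>i j. T j i" R] T S R by (simp add: admissible_iff)
  from API[OF this, of "\<lambda>i j. c (e i) (e j)"] show ?thesis
    using re[of "\<lambda>i. \<Sum>j<card I. c i (e j) *C T i (e j)"] re[of "\<lambda>j. c i j *C T i j" for i] by simp
qed

definition "adm A' \<Delta>' n T Q R \<longleftrightarrow> (\<forall>i<n. \<forall>j<n. (T i j \<in> multipliers A' \<and> Q i j \<in> multipliers A' \<and> R i j \<in> multipliers A') \<and>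
  strict_ext A' (A' \<otimes>\<^sub>m A') \<Delta>' (T i j) = (\<Sum>k<n. T i k \<otimes> T k j) \<and>
  ((\<Sum>k<n. T i k * Q k j) = delta i j \<and> (\<Sum>k<n. Q i k * T k j) = delta i j) \<and>
  (\<Sum>k<n. T k i * R k j) = delta i j \<and> (\<Sum>k<n. R i k * T j k) = delta i j)"

lemma admD:
  assumes "adm A' \<Delta>' n T Q R" "i < n" "j < n"
  shows "T i j \<in> multipliers A' \<and> Q i j \<in> multipliers A' \<and> R i j \<in> multipliers A'"
    "strict_ext A' (A' \<otimes>\<^sub>m A') \<Delta>' (T i j) = (\<Sum>k<n. T i k \<otimes> T k j)"
    "(\<Sum>k<n. T i k * Q k j) = delta i j \<and> (\<Sum>k<n. Q i k * T k j) = delta i j"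
    "(\<Sum>k<n. T k i * R k j) = delta i j \<and> (\<Sum>k<n. R i k * T j k) = delta i j" using assms unfolding adm_def by blast+

lemma admissibleE:
  assumes "admissible_corep A' \<Delta>' n T" obtains Q R where "adm A' \<Delta>' n T Q R"
proof -
  have a: "invertible_matrix (multipliers A') n T" "invertible_matrix (multipliers A') n (\<lambda>i j. T j i)"
    "\<forall>i<n. \<forall>j<n. strict_ext A' (A' \<otimes>\<^sub>m A') \<Delta>' (T i j) = (\<Sum>k<n. T i k \<otimes> T k j)"
    using assms by (auto simp: admissible_iff)
  let ?F = "\<lambda>T S. (\<forall>i j. i < n --> j < n --> T i j \<in> multipliers A' \<and> S i j \<in> multipliers A') \<and>
    (\<forall>i j. i < n --> j < n --> (\<Sum>k<n. T i k * S k j) = delta i j \<and> (\<Sum>k<n. S i k * T k j) = delta i j)"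
  obtain Q where Q: "?F T Q" using invertible_matrixD[OF a(1)] by blast
  obtain R where R: "?F (\<lambda>i j. T j i) R" using invertible_matrixD[OF a(2)] by blast
  show thesis by (rule that[of Q R]) (use Q R a(3) in \<open>simp add: adm_def\<close>)
qed

lemma PAE:
  assumes "x \<in> PA" obtains n T Q R c where "adm A \<Delta>u n T Q R" "x = (\<Sum>i<n. \<Sum>j<n. c i j *C T i j)"
proof -
  obtain n T c where T: "admissible_corep A \<Delta>u n T" "x = (\<Sum>i<n. \<Sum>j<n. c i j *C T i j)" using APE[OF assms] by blast
  obtain Q R where "adm A \<Delta>u n T Q R" using T(1) by (rule admissibleE)
  then show thesis using T(2) by (rule that)
qed

lemma PA_add: assumes "x \<in> PA" "y \<in> PA" shows "x + y \<in> PA"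
proof -
  obtain n T S R c where T: "adm A \<Delta>u n T S R" "x = (\<Sum>i<n. \<Sum>j<n. c i j *C T i j)" using assms(1) by (rule PAE)
  obtain m T' S' R' c' where T': "adm A \<Delta>u m T' S' R'" "y = (\<Sum>i<m. \<Sum>j<m. c' i j *C T' i j)" using assms(2) by (rule PAE)
  note SR = admD[OF T(1)] and SR' = admD[OF T'(1)]
  \<comment> \<open>Block diagonal matrices: the direct sum of two corepresentations, with inverses
    formed block by block.\<close>
  define d where "d f g i j = (case i of Inl i => (case j of Inl j => f i j | Inr j => 0) | Inr i => (case j of Inl j => 0 | Inr j => g i j))"
    for f g :: "nat => nat => 'j op" and i j
  have d: "d f g (Inl i) (Inl j) = f i j" "d f g (Inl i) (Inr j) = 0" "d f g (Inr i) (Inl j) = 0" "d f g (Inr i) (Inr j) = g i j" for f g i j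
    by (simp_all add: d_def)
  let ?I = "{..<n} <+> {..<m}" and ?c = "\<lambda>i j. case i of Inl i => c i (projl j) | Inr i => c' i (projr j)"
  note z = subalgD(1)[OF du.MA(1)]
  have 0: "0 \<otimes> X = 0" "X \<otimes> 0 = 0" for X :: "'j op" by simp_all
  have "(\<Sum>i\<in>?I. \<Sum>j\<in>?I. ?c i j *C d T T' i j) \<in> PA" by (rule AP_indexI[where S = "d S S'" and R = "d R R'"])
      (auto simp: d SR SR' z du.ext_zero sum.Plus 0)
  then show ?thesis by (simp add: d sum.Plus T T')
qed

lemma PA_scaleC: "x \<in> PA ==> c *C x \<in> PA"
  using API[of A \<Delta>u _ _ "\<lambda>i j. c * _ i j"] by (auto dest!: APE simp: scaleC_sum_right scaleC_scaleC)

lemma PA_one: "1 \<in> PA" using AP_indexI[of "{0 :: nat}" "\<lambda>i j. 1" "\<lambda>i j. 1" "\<lambda>i j. 1" "\<lambda>i j. 1"]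
  by (simp add: du.MA du.ext_one scaleC_one)

lemma PA_zero: "0 \<in> PA" using PA_scaleC[OF PA_one, of 0] by simp

lemma PA_mult: assumes "x \<in> PA" "y \<in> PA" shows "x * y \<in> PA"
proof -
  obtain n T S R c where T: "adm A \<Delta>u n T S R" "x = (\<Sum>i<n. \<Sum>j<n. c i j *C T i j)" using assms(1) by (rule PAE)
  obtain m T' S' R' c' where T': "adm A \<Delta>u m T' S' R'" "y = (\<Sum>i<m. \<Sum>j<m. c' i j *C T' i j)" using assms(2) by (rule PAE)
  note SR = admD[OF T(1)] and SR' = admD[OF T'(1)]
  let ?I = "{..<n} \<times> {..<m}"
  let ?T = "\<lambda>a b. T (fst a) (fst b) * T' (snd a) (snd b)"
  let ?S = "\<lambda>a b. S' (snd a) (snd b) * S (fst a) (fst b)"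
  let ?R = "\<lambda>a b. R' (snd a) (snd b) * R (fst a) (fst b)"
  have "(\<Sum>a\<in>?I. \<Sum>b\<in>?I. (c (fst a) (fst b) * c' (snd a) (snd b)) *C ?T a b) \<in> PA"
  proof (rule AP_indexI[where S = ?S and R = ?R])
    fix a b assume "a \<in> ?I" "b \<in> ?I"
    then obtain i k j l where ab: "a = (i, k)" "b = (j, l)" "i < n" "k < m" "j < n" "l < m" by auto
    show "?T a b \<in> MA \<and> ?S a b \<in> MA \<and> ?R a b \<in> MA" using SR(1) SR'(1) ab by (simp add: subalgD(3)[OF du.MA(1)])
    show "du.ext (?T a b) = (\<Sum>p\<in>?I. ?T a p \<otimes> ?T p b)"
      using SR(1,2) SR'(1,2) ab by (simp add: du.ext_mult sum_product tensor_op_mult sum.cartesian_product split_def)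
    show "(\<Sum>p\<in>?I. ?T a p * ?S p b) = (if a = b then 1 else 0) \<and> (\<Sum>p\<in>?I. ?S a p * ?T p b) = (if a = b then 1 else 0)"
      unfolding ab using invertible_matrix_product[of n T S m T' S' i j k l, OF SR(3) SR'(3) ab(3,5,4,6)] by simp
    show "(\<Sum>p\<in>?I. ?T p a * ?R p b) = (if a = b then 1 else 0) \<and> (\<Sum>p\<in>?I. ?R a p * ?T b p) = (if a = b then 1 else 0)"
      unfolding ab using invertible_matrix_product[of n "\<lambda>i j. T j i" R m "\<lambda>i j. T' j i" R' i j k l, OF SR(4) SR'(4) ab(3,5,4,6)] by simp
  qed simp
  also have "(\<Sum>a\<in>?I. \<Sum>b\<in>?I. (c (fst a) (fst b) * c' (snd a) (snd b)) *C ?T a b) = x * y" unfolding T T' sum_product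
    by (simp add: sum.cartesian_product' sum_product scaleC_mult_left scaleC_mult_right scaleC_scaleC mult.commute)
  finally show ?thesis .
qed

text \<open>Taking adjoints of the entries turns an inverse of the transpose into an inverse of the
  conjugate matrix and conversely, so the two conditions of admissibility change places.\<close>

lemma admissible_adj: "admissible_corep A \<Delta>u n T ==> admissible_corep A \<Delta>u n (\<lambda>i j. adj (T i j))"
  using invertible_matrix_adj[OF du.MA(1), of n "\<lambda>i j. T j i"] invertible_matrix_adj[OF du.MA(1), of n T]
  using admissibleD(1)[of A \<Delta>u n T] by (simp add: admissible_iff du.ext_adj adj_sum adj_tensor)

lemma PA_adj: "x \<in> PA ==> adj x \<in> PA"
  using API[OF admissible_adj, of _ _ "\<lambda>i j. cnj (_ i j)"] by (auto dest!: APE simp: adj_sum adj_simps)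

lemma PA_MA: "x \<in> PA ==> x \<in> MA" by (auto dest!: APE intro!: subalg_sum[OF du.MA(1)] subalgD(5)[OF du.MA(1)] elim: admissibleD(1))

section \<open>The bijection between matrix elements\<close>

lemma ll_ext_tensor:
  assumes "x \<in> MA" "y \<in> MA" shows "ll.ext (x \<otimes> y) = \<Phi> x \<otimes> \<Phi> y" "x \<otimes> y \<in> multipliers (A \<otimes>\<^sub>m A)"
proof -
  show m: "x \<otimes> y \<in> multipliers (A \<otimes>\<^sub>m A)" by (rule tensor_multiplier[OF As As assms])
  have "continuous_on (A \<otimes>\<^sub>m A) (\<lambda>t. LL ((x \<otimes> y) * t))"
  proof (rule continuous_on_compose2[OF star_hom_continuous[OF AAs AAc LL_hom]])
    show "continuous_on (A \<otimes>\<^sub>m A) (\<lambda>t. (x \<otimes> y) * t)" by (intro continuous_intros)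
  qed (use multipliersD(1)[OF m] in auto)
  moreover have "continuous_on (A \<otimes>\<^sub>m A) (\<lambda>t. (\<Phi> x \<otimes> \<Phi> y) * LL t)"
    by (intro continuous_on_mult continuous_on_const star_hom_continuous[OF AAs AAc LL_hom])
  ultimately have c: "continuous_on (closure (cspan {a \<otimes> b | a b. a \<in> A \<and> b \<in> A})) (\<lambda>t. (\<Phi> x \<otimes> \<Phi> y) * LL t)"
    "continuous_on (closure (cspan {a \<otimes> b | a b. a \<in> A \<and> b \<in> A})) (\<lambda>t. LL ((x \<otimes> y) * t))"
    by (simp_all add: cstar_tensor_def)
  have "(\<Phi> x \<otimes> \<Phi> y) * LL t = LL ((x \<otimes> y) * t)" if t: "t \<in> A \<otimes>\<^sub>m A" for t
  proof (rule continuous_on_agree[OF c _ t[unfolded cstar_tensor_def]])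
    fix s assume "s \<in> cspan {a \<otimes> b | a b. a \<in> A \<and> b \<in> A}"
    then have "s \<in> A \<otimes>\<^sub>m A \<and> (\<Phi> x \<otimes> \<Phi> y) * LL s = LL ((x \<otimes> y) * s)"
    proof (induction s rule: complex_span_induct)
      case zero show ?case using star_hom_zero[OF AAs LL_hom] subalgD(1)[OF AAs] by simp
    next
      case (add s t) then show ?case by (simp add: homD(1)[OF LL_hom] subalgD(2)[OF AAs] distrib_left multipliersD(1)[OF m])
    next
      case (base c s)
      then obtain a b where ab: "s = a \<otimes> b" "a \<in> A" "b \<in> A" by blast
      have "LL ((x * a) \<otimes> (y * b)) = (\<Phi> x * \<Lambda> a) \<otimes> (\<Phi> y * \<Lambda> b)"
        by (simp add: LL_tensor multipliersD(1) assms ab la.ext_apply)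
      then show ?case using ab multipliersD(1)[OF assms(1) ab(2)] multipliersD(1)[OF assms(2) ab(3)]
        by (simp add: homD(4)[OF LL_hom] tensor_memI tensor_scaleC_mem scaleC_mult_right tensor_op_mult LL_tensor)
    qed
    then show "(\<Phi> x \<otimes> \<Phi> y) * LL s = LL ((x \<otimes> y) * s)" by simp
  qed
  then show "ll.ext (x \<otimes> y) = \<Phi> x \<otimes> \<Phi> y" by (intro ll.ext_eqI[OF m])
qed

lemma comult_ext: assumes m: "m \<in> MA" shows "de.ext (\<Phi> m) = ll.ext (du.ext m)"
proof (rule de.ext_eqI[OF la.ext_mem[OF m]])
  fix b assume "b \<in> B"
  then obtain a where a: "a \<in> A" "b = \<Lambda> a" unfolding Lam_image[symmetric] by blast
  have ma: "m * a \<in> A" by (rule multipliersD(1)[OF m a(1)])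
  have "ll.ext (du.ext m) * \<Delta> b = ll.ext (du.ext m * \<Delta>u a)"
    unfolding a comult_ll[OF a(1)] by (rule ll.ext_mult[OF du.ext_mem[OF m] du.f_mem[OF a(1)], symmetric])
  also have "\<dots> = \<Delta> (\<Lambda> (m * a))" by (simp only: du.ext_apply[OF m a(1)] comult_ll[OF ma])
  also have "\<dots> = \<Delta> (\<Phi> m * b)" by (simp only: a la.ext_apply[OF m a(1)])
  finally show "ll.ext (du.ext m) * \<Delta> b = \<Delta> (\<Phi> m * b)" .
qed

lemma comult_ext_sum:
  assumes "m \<in> MA" "du.ext m = (\<Sum>k\<in>K. x k \<otimes> y k)" "\<And>k. k \<in> K ==> x k \<in> MA \<and> y k \<in> MA"
  shows "de.ext (\<Phi> m) = (\<Sum>k\<in>K. \<Phi> (x k) \<otimes> \<Phi> (y k))" using assms by (simp add: comult_ext ll.ext_sum ll_ext_tensor)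

lemma invertible_ext: "invertible_matrix MA n T ==> invertible_matrix MB n (\<lambda>i j. \<Phi> (T i j))"
proof -
  assume T: "invertible_matrix MA n T"
  obtain S where S: "\<forall>i j. i < n --> j < n --> T i j \<in> MA \<and> S i j \<in> MA"
    "\<forall>i j. i < n --> j < n --> (\<Sum>k<n. T i k * S k j) = delta i j \<and> (\<Sum>k<n. S i k * T k j) = delta i j"
    using invertible_matrixD[OF T] by blast
  have "(\<Sum>k<n. \<Phi> (P i k) * \<Phi> (Q k j)) = delta i j"
    if "\<And>i j. i < n ==> j < n ==> P i j \<in> MA \<and> Q i j \<in> MA" "(\<Sum>k<n. P i k * Q k j) = delta i j" "i < n" "j < n" for P Q i j
  proof -
    have "\<Phi> (\<Sum>k<n. P i k * Q k j) = (\<Sum>k<n. \<Phi> (P i k * Q k j))"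
      by (rule la.ext_sum) (use that in \<open>simp add: subalgD(3)[OF la.MA(1)]\<close>)
    also have "\<dots> = (\<Sum>k<n. \<Phi> (P i k) * \<Phi> (Q k j))" by (intro sum.cong refl la.ext_mult) (use that in simp_all)
    finally have "\<Phi> (delta i j) = (\<Sum>k<n. \<Phi> (P i k) * \<Phi> (Q k j))" unfolding that(2) .
    then show ?thesis by (cases "i = j") (simp_all add: la.ext_one la.ext_zero)
  qed
  then show ?thesis unfolding invertible_matrix_def using S la.ext_mem by (intro conjI exI[of _ "\<lambda>i j. \<Phi> (S i j)"]) simp_all
qed

lemma admissible_ext: "admissible_corep A \<Delta>u n T ==> admissible_corep B \<Delta> n (\<lambda>i j. \<Phi> (T i j))"
proof -
  assume T: "admissible_corep A \<Delta>u n T"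
  have "de.ext (\<Phi> (T i j)) = (\<Sum>k<n. \<Phi> (T i k) \<otimes> \<Phi> (T k j))" if "i < n" "j < n" for i j
    by (rule comult_ext_sum[OF admissibleD[OF T that]]) (use admissibleD(1)[OF T] that in simp)
  then show ?thesis using T invertible_ext[of n T] invertible_ext[of n "\<lambda>i j. T j i"] by (simp add: admissible_iff)
qed

lemma ext_lin: "admissible_corep A \<Delta>u n T ==> \<Phi> (\<Sum>i<n. \<Sum>j<n. c i j *C T i j) = (\<Sum>i<n. \<Sum>j<n. c i j *C \<Phi> (T i j))"
  by (rule la.ext_lincomb) (rule admissibleD(1))

lemma admissible_comult:
  assumes "admissible_corep B \<Delta> n U" "i < n" "j < n" shows "\<Delta> (U i j) = (\<Sum>k<n. U i k \<otimes> U k j)"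
  using admissibleD(2)[OF assms] comult_MB[OF admissibleD(1)[OF assms]] by (simp add: multiplier_comult_def)

text \<open>T itself satisfies the relation for its image under \<Phi>, so linear relations between
  the entries of the image pass back to T.\<close>

lemma ext_injective: assumes "x \<in> PA" "\<Phi> x = 0" shows "x = 0"
proof -
  obtain n T c where T: "admissible_corep A \<Delta>u n T" "x = (\<Sum>i<n. \<Sum>j<n. c i j *C T i j)" using APE[OF assms(1)] by blast
  have U: "admissible_corep B \<Delta> n (\<lambda>i j. \<Phi> (T i j))" by (rule admissible_ext[OF T(1)])
  obtain Q R where "adm B \<Delta> n (\<lambda>i j. \<Phi> (T i j)) Q R" using U by (rule admissibleE)
  note M = admD(1)[OF this] and R = admD(4)[OF this]
  note UM = M[THEN conjunct1]
  show ?thesis unfolding T(2)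
  proof (rule lift_injective[where U = "\<lambda>i j. \<Phi> (T i j)" and Z = R])
    show "intertwines n (\<lambda>i j. \<Phi> (T i j)) T Vr" by (rule intertwines_corep) (simp_all add: admissibleD[OF T(1)])
    show "intertwines n (\<lambda>i j. \<Phi> (T i j)) (\<lambda>i j. \<Phi> (T i j)) S"
      by (rule intertwines_S(1)) (simp_all add: UM admissible_comult[OF U])
    show "(\<Sum>i<n. \<Sum>j<n. c i j *C \<Phi> (T i j)) = 0" using assms(2) by (simp only: T(2) ext_lin[OF T(1)])
  qed (simp_all add: R UM)
qed

lemma ex_admissible_lift:
  assumes U: "admissible_corep B \<Delta> n U"
  shows "\<exists>T. admissible_corep A \<Delta>u n T \<and> (\<forall>i<n. \<forall>j<n. \<Phi> (T i j) = U i j)"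
proof -
  obtain Y Z where "adm B \<Delta> n U Y Z" using U by (rule admissibleE)
  note Z = admD(1)[OF this] and Z' = admD(3,4)[OF this]
  note UM = Z(1)[THEN conjunct1] and D = admissible_comult[OF U]
  have S: "intertwines n U U S" by (rule intertwines_S(1)[OF UM D])
  obtain T where T: "\<And>i j. i < n ==> j < n ==> T i j \<in> MA" "intertwines n U T Vr"
  proof -
    have "\<exists>T. (\<forall>i<n. \<forall>m<n. T i m \<in> MA) \<and> intertwines n U T Vr" by (rule ex_lift[of n U Z Y]) (simp_all add: UM D Z')
    then show thesis using that by blast
  qed
  have inv: "invertible_matrix MB n U" "invertible_matrix MB n (\<lambda>i j. U j i)" using U by (simp_all add: admissible_iff)
  have "invertible_matrix MA n T" by (rule invertible_lift[OF inv(1) T])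
  \<comment> \<open>The transpose of T is reached through adjoints: the matrix of the adj U_ij is
    invertible because the transpose of U is, and the adj T_ij are its lift. Taking adjoints once
    more transposes.\<close>
  moreover have "invertible_matrix MA n (\<lambda>i j. adj (T i j))"
    by (rule invertible_lift[OF invertible_matrix_adj[OF la.MB(1) inv(2)] _ intertwines_adj[OF UM T(2)]])
      (simp_all add: T(1) subalgD(4)[OF la.MA(1)])
  from invertible_matrix_adj[OF la.MA(1) this] have "invertible_matrix MA n (\<lambda>i j. T j i)" by simp
  moreover have "du.ext (T i j) = (\<Sum>k<n. T i k \<otimes> T k j)" if "i < n" "j < n" for i j
    by (rule lift_comult[OF UM T(2) _ that T(1)[OF that], of Z]) (simp_all add: Z')
  ultimately have "admissible_corep A \<Delta>u n T" by (simp add: admissible_iff)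
  moreover have "\<Phi> (T i j) = U i j" if "i < n" "j < n" for i j by (rule lift_Lam[OF UM T(2) _ S that T(1)[OF that], of Z]) (simp_all add: Z')
  ultimately show ?thesis by blast
qed

lemma ext_bij: "bij_betw \<Phi> PA PB" unfolding bij_betw_def
proof
  show "inj_on \<Phi> PA"
  proof (rule inj_onI)
    fix x y assume xy: "x \<in> PA" "y \<in> PA" "\<Phi> x = \<Phi> y"
    have m: "(-1) *C y \<in> PA" by (rule PA_scaleC[OF xy(2)])
    have "\<Phi> (x + (-1) *C y) = \<Phi> x + (-1) *C \<Phi> y"
      by (simp only: la.ext_add[OF PA_MA[OF xy(1)] PA_MA[OF m]] la.ext_scaleC[OF PA_MA[OF xy(2)]])
    then have "x + (-1) *C y = 0" using ext_injective[OF PA_add[OF xy(1) m]] xy(3) by simp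
    then show "x = y" by simp
  qed
  show "\<Phi> ` PA = PB"
  proof
    show "\<Phi> ` PA \<subseteq> PB" using API[OF admissible_ext] by (auto dest!: APE simp: ext_lin)
    show "PB \<subseteq> \<Phi> ` PA"
    proof
      fix x assume "x \<in> PB"
      then obtain n U c where U: "admissible_corep B \<Delta> n U" "x = (\<Sum>i<n. \<Sum>j<n. c i j *C U i j)" using APE by blast
      obtain T where T: "admissible_corep A \<Delta>u n T" "\<And>i j. i < n ==> j < n ==> \<Phi> (T i j) = U i j" using ex_admissible_lift[OF U(1)] by blast
      have "\<Phi> (\<Sum>i<n. \<Sum>j<n. c i j *C T i j) = x" by (simp add: ext_lin[OF T(1)] U(2) T(2))
      then show "x \<in> \<Phi> ` PA" using API[OF T(1)] by blast
    qed
  qed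
qed

section \<open>Transport of the Haar state and of the reduced version\<close>

abbreviation "\<Psi> \<equiv> inv_into PA \<Phi>"

lemma Psi: "a \<in> PB ==> \<Psi> a \<in> PA" "a \<in> PB ==> \<Phi> (\<Psi> a) = a" "x \<in> PA ==> \<Psi> (\<Phi> x) = x" "x \<in> PA ==> \<Phi> x \<in> PB"
  using ext_bij bij_betw_inv_into_left[OF ext_bij] bij_betw_inv_into_right[OF ext_bij] bij_betwE[OF bij_betw_inv_into[OF ext_bij]] bij_betwE[OF ext_bij]
  by auto

lemma Psi_eqI: "x \<in> PA ==> \<Phi> x = a ==> \<Psi> a = x" using Psi(3) by blast

lemma Psi_hom:
  assumes a: "a \<in> PB" "b \<in> PB"
  shows "\<Psi> (a + b) = \<Psi> a + \<Psi> b" "\<Psi> (a * b) = \<Psi> a * \<Psi> b" "\<Psi> (adj a) = adj (\<Psi> a)" "\<Psi> (c *C a) = c *C \<Psi> a"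
  by (rule Psi_eqI, simp_all add: PA_add PA_mult PA_adj PA_scaleC Psi a la.ext_add la.ext_mult la.ext_adj la.ext_scaleC PA_MA)+

text \<open>The given decomposition is compared with one of the comultiplication of \<Psi> a read
  off from matrix elements. Their images under \<Phi> \<otimes> \<Phi> coincide, and \<Phi> is
  injective on PA, so the given one pulls back term by term.\<close>

lemma decomp_Psi:
  assumes a: "a \<in> PB" and d: "comult_decomp PB (multiplier_comult B \<Delta>) a n b c"
  shows "comult_decomp PA (multiplier_comult A \<Delta>u) (\<Psi> a) n (\<lambda>k. \<Psi> (b k)) (\<lambda>k. \<Psi> (c k))"
proof -
  have bc: "\<And>k. k < n ==> b k \<in> PB \<and> c k \<in> PB" and eq: "de.ext a = (\<Sum>k<n. b k \<otimes> c k)"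
    using d by (auto simp: comult_decomp_def multiplier_comult_def)
  obtain m T e where T: "admissible_corep A \<Delta>u m T" "\<Psi> a = (\<Sum>i<m. \<Sum>j<m. e i j *C T i j)" using APE[OF Psi(1)[OF a]] by blast
  have TM: "T i j \<in> MA" and TD: "du.ext (T i j) = (\<Sum>k<m. T i k \<otimes> T k j)" if "i < m" "j < m" for i j
    by (simp_all add: admissibleD[OF T(1)] that)
  \<comment> \<open>The comultiplication of sum e_ij T_ij is the sum over pairs (i, k) of T_ik
    \<otimes> (sum_j e_ij T_kj); ?x and ?y are these factors.\<close>
  let ?G = "{..<m} \<times> {..<m}" and ?y = "\<lambda>p. \<Sum>j<m. e (fst p) j *C T (snd p) j" and ?x = "\<lambda>p. T (fst p) (snd p)"
  have TP: "T i j \<in> PA" if "i < m" "j < m" for i j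
  proof -
    \<comment> \<open>Indicator coefficients exhibit a single entry of T as a matrix
      element.\<close>
    let ?d = "\<lambda>i' j'. if i' = i then (if j' = j then 1 else 0) else 0"
    have "(\<Sum>i'<m. \<Sum>j'<m. ?d i' j' *C T i' j') = (\<Sum>i'<m. if i' = i then T i j else 0)"
      using that by (intro sum.cong refl) (auto simp: scaleC_one if_distrib[of "\<lambda>x. x *C _"] cong: if_cong)
    then show ?thesis using API[OF T(1), of ?d] that by simp
  qed
  have sumP: "sum f F \<in> PA" if "\<And>k. k \<in> F ==> f k \<in> PA" for f and F :: "nat set"
    using that by (induction F rule: infinite_finite_induct) (auto simp: PA_zero PA_add)
  have du: "du.ext (\<Psi> a) = (\<Sum>p\<in>?G. ?x p \<otimes> ?y p)"
  proof -
    have "du.ext (\<Psi> a) = (\<Sum>i<m. \<Sum>j<m. \<Sum>k<m. e i j *C (T i k \<otimes> T k j))"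
      using du.ext_lincomb[of m T e, OF TM] unfolding T(2) by (simp add: TD scaleC_sum_right)
    also have "\<dots> = (\<Sum>i<m. \<Sum>k<m. \<Sum>j<m. e i j *C (T i k \<otimes> T k j))" by (intro sum.cong refl sum.swap)
    finally show ?thesis by (simp add: tensor_op_sum_right tensor_op_scaleC_right sum.cartesian_product')
  qed
  have xy: "?x p \<in> PA \<and> ?y p \<in> PA" if "p \<in> ?G" for p using that by (auto intro!: TP sumP PA_scaleC)
  have "(\<Sum>k<n. \<Psi> (b k) \<otimes> \<Psi> (c k)) = (\<Sum>p\<in>?G. ?x p \<otimes> ?y p)"
  proof (rule tensor_sum_injective[where f = \<Phi> and P = PA])
    have "(\<Sum>k<n. \<Phi> (\<Psi> (b k)) \<otimes> \<Phi> (\<Psi> (c k))) = de.ext (\<Phi> (\<Psi> a))" using bc by (simp add: Psi a eq)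
    also have "\<dots> = (\<Sum>p\<in>?G. \<Phi> (?x p) \<otimes> \<Phi> (?y p))"
      by (rule comult_ext_sum[OF PA_MA[OF Psi(1)[OF a]] du]) (use xy PA_MA in blast)
    finally show "(\<Sum>k<n. \<Phi> (\<Psi> (b k)) \<otimes> \<Phi> (\<Psi> (c k))) = (\<Sum>p\<in>?G. \<Phi> (?x p) \<otimes> \<Phi> (?y p))" .
    show "inj_on \<Phi> PA" using ext_bij by (simp add: bij_betw_def)
  qed (use bc xy in \<open>simp_all add: PA_add PA_scaleC PA_zero la.ext_add la.ext_scaleC la.ext_zero PA_MA Psi\<close>)
  then show ?thesis using bc by (simp add: comult_decomp_def multiplier_comult_def Psi du)
qed

text \<open>Haar state and representation are composed with \<Psi>. The cyclic vector, the
  completion and its comultiplication stay the same, since \<Psi> maps PB onto PA and respects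
  products, adjoints and decompositions.\<close>

lemma reduced_version_transfer:
  fixes \<pi> :: "'j op => 'k op"
  assumes rv: "reduced_version (AP_closure A \<Delta>u) (multiplier_comult A \<Delta>u) PA \<pi> C \<Delta>C"
  shows "reduced_version (AP_closure B \<Delta>) (multiplier_comult B \<Delta>) PB (\<pi> \<circ> \<Psi>) C \<Delta>C"
proof -
  obtain h y where h: "haar_state PA (multiplier_comult A \<Delta>u) h" "star_hom PA \<pi>" "\<forall>a\<in>PA. cinner y (\<pi> a \<cdot> y) = h a"
    "closure {\<pi> a \<cdot> y | a. a \<in> PA} = UNIV"
    and C: "C = closure (\<pi> ` PA)" "star_hom C \<Delta>C" "\<Delta>C ` C \<subseteq> C \<otimes>\<^sub>m C"
    "\<And>a n b c. a \<in> PA ==> comult_decomp PA (multiplier_comult A \<Delta>u) a n b c ==> \<Delta>C (\<pi> a) = (\<Sum>k<n. \<pi> (b k) \<otimes> \<pi> (c k))"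
    using rv unfolding reduced_version_def by auto
  have im: "\<Psi> ` PB = PA" using bij_betw_imp_surj_on[OF bij_betw_inv_into[OF ext_bij]] .
  have PB: "a * b \<in> PB" "adj a \<in> PB" if "a \<in> PB" "b \<in> PB" for a b
  proof -
    have "\<Phi> (\<Psi> a * \<Psi> b) \<in> PB" "\<Phi> (adj (\<Psi> a)) \<in> PB" by (intro Psi(4) PA_mult PA_adj Psi(1) that)+
    then show "a * b \<in> PB" "adj a \<in> PB" using that by (simp_all add: la.ext_mult la.ext_adj PA_MA Psi)
  qed
  have haar: "haar_state PB (multiplier_comult B \<Delta>) (\<lambda>a. h (\<Psi> a))" unfolding haar_state_def
  proof (intro conjI ballI allI impI)
    have "\<Psi> 1 = 1" by (rule Psi_eqI[OF PA_one la.ext_one])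
    then show "h (\<Psi> 1) = 1" using h(1) by (simp add: haar_state_def)
    fix a assume a: "a \<in> PB"
    show "h (\<Psi> (a + b)) = h (\<Psi> a) + h (\<Psi> b)" if "b \<in> PB" for b using h(1) a that by (simp add: haar_state_def Psi_hom Psi(1))
    show "h (\<Psi> (c *C a)) = c * h (\<Psi> a)" for c using h(1) a by (simp add: haar_state_def Psi_hom(4)[OF a a] Psi(1))
    have "\<Psi> (adj a * a) = adj (\<Psi> a) * \<Psi> a" using a PB[OF a a] by (simp add: Psi_hom(2) Psi_hom(3)[OF a a])
    then show "Im (h (\<Psi> (adj a * a))) = 0" "0 \<le> Re (h (\<Psi> (adj a * a)))" using h(1) Psi(1)[OF a] by (simp_all add: haar_state_def)
    fix n b c assume d: "comult_decomp PB (multiplier_comult B \<Delta>) a n b c"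
    then have bc: "b k \<in> PB" "c k \<in> PB" if "k < n" for k using that by (auto simp: comult_decomp_def)
    have e: "(\<Sum>k<n. h (\<Psi> (b k)) *C \<Psi> (c k)) = h (\<Psi> a) *C 1" "(\<Sum>k<n. h (\<Psi> (c k)) *C \<Psi> (b k)) = h (\<Psi> a) *C 1"
      using h(1)[unfolded haar_state_def, THEN conjunct2, THEN conjunct2, THEN conjunct2, THEN conjunct2, rule_format, OF Psi(1)[OF a] decomp_Psi[OF a d]]
      by simp_all
    show "(\<Sum>k<n. h (\<Psi> (b k)) *C c k) = h (\<Psi> a) *C 1" "(\<Sum>k<n. h (\<Psi> (c k)) *C b k) = h (\<Psi> a) *C 1"
    proof -
      \<comment> \<open>The invariance identities \<open>e\<close> are equations in PA; applying
        \<Phi> carries them to PB.\<close>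
      have s: "\<Phi> (\<Sum>k<n. f k *C \<Psi> (g k)) = (\<Sum>k<n. f k *C g k)" if "\<And>k. k < n ==> g k \<in> PB" for f g
      proof -
        have "\<Phi> (\<Sum>k<n. f k *C \<Psi> (g k)) = (\<Sum>k<n. \<Phi> (f k *C \<Psi> (g k)))"
          by (rule la.ext_sum) (simp add: PA_MA PA_scaleC Psi(1) that)
        then show ?thesis by (simp add: la.ext_scaleC PA_MA Psi that)
      qed
      show "(\<Sum>k<n. h (\<Psi> (b k)) *C c k) = h (\<Psi> a) *C 1" "(\<Sum>k<n. h (\<Psi> (c k)) *C b k) = h (\<Psi> a) *C 1"
        using arg_cong[OF e(1), of \<Phi>] arg_cong[OF e(2), of \<Phi>] bc by (simp_all add: s la.ext_scaleC la.ext_one la.MA(2))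
    qed
  qed
  have "star_hom PB (\<pi> \<circ> \<Psi>)" using h(2) unfolding star_hom_def by (simp add: Psi Psi_hom)
  moreover have "(\<pi> \<circ> \<Psi>) ` PB = \<pi> ` PA" by (simp only: image_comp[symmetric] im)
  moreover have "{(\<pi> \<circ> \<Psi>) a \<cdot> y | a. a \<in> PB} = {\<pi> a \<cdot> y | a. a \<in> PA}"
  proof -
    have "{(\<pi> \<circ> \<Psi>) a \<cdot> y | a. a \<in> PB} = (\<lambda>x. \<pi> x \<cdot> y) ` (\<Psi> ` PB)" by auto
    then show ?thesis unfolding im by auto
  qed
  moreover have "\<Delta>C (\<pi> (\<Psi> a)) = (\<Sum>k<n. \<pi> (\<Psi> (b k)) \<otimes> \<pi> (\<Psi> (c k)))"
    if "a \<in> PB" "comult_decomp PB (multiplier_comult B \<Delta>) a n b c" for a n b c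
    using C(4)[OF Psi(1)[OF that(1)] decomp_Psi[OF that]] by simp
  ultimately show ?thesis unfolding reduced_version_def AP_closure_def
    using haar h(3,4) C(1-3) by (auto simp: Psi(1) intro!: exI[of _ "\<lambda>a. h (\<Psi> a)"] exI[of _ y])
qed

end

theorem proposition3p9:
  fixes G :: "'i lcqg"
    and W :: "('i \<times> 'i) op"
    and A\<^sub>u :: "'j op set"
    and l :: "('i op \<Rightarrow> complex) \<Rightarrow> 'j op"
    and \<Delta>\<^sub>u :: "'j op \<Rightarrow> ('j \<times> 'j) op"
    and \<Lambda> :: "'j op \<Rightarrow> 'i op"
  assumes "locally_compact_quantum_group G"
    and "multiplicative_unitary G W"
    and "universal_C0 W A\<^sub>u l"
    and "universal_comult W A\<^sub>u l \<Delta>\<^sub>u"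
    and "reducing_morphism G W A\<^sub>u l \<Delta>\<^sub>u \<Lambda>"
  shows "bij_betw (strict_ext A\<^sub>u (C0 W) \<Lambda>) (AP A\<^sub>u \<Delta>\<^sub>u) (AP (C0 W) (comult G)) \<and>
    (\<forall>(\<pi> :: 'j op \<Rightarrow> 'k op) C \<Delta>\<^sub>C.
       reduced_version (AP_closure A\<^sub>u \<Delta>\<^sub>u) (multiplier_comult A\<^sub>u \<Delta>\<^sub>u) (AP A\<^sub>u \<Delta>\<^sub>u) \<pi> C \<Delta>\<^sub>C \<longrightarrow>
       reduced_version (AP_closure (C0 W) (comult G)) (multiplier_comult (C0 W) (comult G))
         (AP (C0 W) (comult G))
         (\<pi> \<circ> inv_into (AP A\<^sub>u \<Delta>\<^sub>u) (strict_ext A\<^sub>u (C0 W) \<Lambda>)) C \<Delta>\<^sub>C)"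
proof -
  interpret universal_pair G W A\<^sub>u l \<Delta>\<^sub>u \<Lambda> by unfold_locales (rule assms)+
  show ?thesis by (intro conjI allI impI ext_bij reduced_version_transfer)
qed

end
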